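(* Let $m,M\ge 0$ be constants. For any $\psi_0 \in H^{-\frac12}(\mathbb{R})$ ($\mathbb{C}^2$-valued), any real-valued $(\phi_0,\phi_1)\in H^{\frac12}(\mathbb{R})\times H^{-\frac12}(\mathbb{R})$, and any $\varepsilon>0$, there exist a solution $(\psi_\varepsilon,\phi_\varepsilon)$ to the Dirac-Klein-Gordon system $$ \begin{cases} (i\gamma_0\partial_t+\gamma_1\partial_x)\psi+m\psi=\phi\,\psi,\\ (\partial_t^2-\partial_x^2+M^2)\phi=\psi^{*}\gamma_0\psi, \end{cases} $$ and a time $t_\varepsilon\in(0,\varepsilon)$ such that $$ \|\psi_\varepsilon(0)-\psi_0\|_{H^{-\frac12}}+\|\phi_\varepsilon(0)-\phi_0\|_{H^{\frac12}}+\|\partial_t\phi_\varepsilon(0)-\phi_1\|_{H^{-\frac12}}<\varepsilon $$ and $$ \|\phi_\varepsilon(t_\varepsilon)\|_{H^{\frac12}}>\varepsilon^{-1}. $$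
   Context: The unknowns are $\psi=\begin{pmatrix}\psi_1\\ \psi_2\end{pmatrix}$, a $\mathbb{C}^2$-valued function of $(t,x)\in\mathbb{R}^{1+1}$, and $\phi$, a real-valued function of $(t,x)$. Here $\psi^{*}$ is the conjugate transpose of $\psi$ and $$\gamma_0=\begin{pmatrix}1&0\\0&-1\end{pmatrix},\qquad \gamma_1=\begin{pmatrix}0&-i\\ i&0\end{pmatrix}.$$ For $s\in\mathbb{R}$, $\|f\|_{H^s}=\left(\int_{\mathbb{R}}\langle\xi\rangle^{2s}|\hat f(\xi)|^2\,d\xi\right)^{1/2}$ with $\langle\xi\rangle=(1+|\xi|^2)^{1/2}$ and $\hat f(\xi)=\int_{\mathbb{R}}e^{-ix\xi}f(x)\,dx$. A solution is considered on a time interval containing $[0,t_\varepsilon]$, with $(\psi,\phi,\partial_t\phi)(t)\in H^{-\frac12}(\mathbb{R})\times H^{\frac12}(\mathbb{R})\times H^{-\frac12}(\mathbb{R})$; the equations are understood in the usual Duhamel (integral equation) sense, and the solution's initial data are its own values $(\psi_\varepsilon,\phi_\varepsilon,\partial_t\phi_\varepsilon)$ at $t=0$. *)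

theory Defs
  imports "HOL-Analysis.Analysis"
begin

section \<open>Schwartz functions and tempered distributions on the real line\<close>

definition vderiv :: "(real \<Rightarrow> complex) \<Rightarrow> real \<Rightarrow> complex" where
  "vderiv f = (\<lambda>x. vector_derivative f (at x))"

definition schwartz :: "(real \<Rightarrow> complex) \<Rightarrow> bool" where
  "schwartz f \<longleftrightarrow>
     (\<forall>n x. ((vderiv ^^ n) f) differentiable (at x)) \<and>
     (\<forall>k n. bounded (range (\<lambda>x. x ^ k *\<^sub>R (vderiv ^^ n) f x)))"

definition schwartz_seminorm :: "nat \<Rightarrow> nat \<Rightarrow> (real \<Rightarrow> complex) \<Rightarrow> real" where
  "schwartz_seminorm k n f = (SUP x. norm (x ^ k *\<^sub>R (vderiv ^^ n) f x))"

text \<open>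
  A distribution is a functional on test functions. Its values off the Schwartz space carry
  no information: everything below evaluates distributions at Schwartz functions only.
  The pairing is bilinear (no complex conjugate).
\<close>

type_synonym dist = "(real \<Rightarrow> complex) \<Rightarrow> complex"

definition tempered :: "dist \<Rightarrow> bool" where
  "tempered T \<longleftrightarrow>
     (\<forall>f g a b. schwartz f \<longrightarrow> schwartz g \<longrightarrow>
        T (\<lambda>x. a * f x + b * g x) = a * T f + b * T g) \<and>
     (\<exists>C N. \<forall>f. schwartz f \<longrightarrow>
        norm (T f) \<le> C * (\<Sum>k\<le>N. \<Sum>n\<le>N. schwartz_seminorm k n f))"

definition real_valued :: "dist \<Rightarrow> bool" where
  "real_valued T \<longleftrightarrow> (\<forall>f. schwartz f \<longrightarrow> (\<forall>x. f x \<in> \<real>) \<longrightarrow> T f \<in> \<real>)"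

definition dist_diff :: "dist \<Rightarrow> dist \<Rightarrow> dist" where
  "dist_diff S T = (\<lambda>f. S f - T f)"

definition dist_scale :: "complex \<Rightarrow> dist \<Rightarrow> dist" where
  "dist_scale c T = (\<lambda>f. c * T f)"

definition tempered_fun :: "(real \<Rightarrow> complex) \<Rightarrow> bool" where
  "tempered_fun u \<longleftrightarrow> u \<in> borel_measurable lborel \<and>
     (\<forall>f. schwartz f \<longrightarrow> integrable lborel (\<lambda>x. u x * f x))"

definition dist_of :: "(real \<Rightarrow> complex) \<Rightarrow> dist" where
  "dist_of u = (\<lambda>f. LINT x|lborel. u x * f x)"

definition fourier :: "(real \<Rightarrow> complex) \<Rightarrow> real \<Rightarrow> complex" where
  "fourier f \<xi> = (LINT x|lborel. exp (- \<i> * of_real (x * \<xi>)) * f x)"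

definition dist_fourier :: "dist \<Rightarrow> dist" where
  "dist_fourier T = (\<lambda>f. T (fourier f))"


section \<open>Sobolev spaces\<close>

definition japanese :: "real \<Rightarrow> real" where
  "japanese \<xi> = sqrt (1 + \<bar>\<xi>\<bar>\<^sup>2)"

text \<open>\<open>g\<close> is the Fourier transform of \<open>T\<close>, and is square integrable with weight
  \<open>japanese \<xi> powr (2 * s)\<close>. Such a \<open>g\<close> is unique up to null sets, so the choice in \<open>Hs_norm\<close>
  is immaterial.\<close>

definition Hs_transform :: "real \<Rightarrow> dist \<Rightarrow> (real \<Rightarrow> complex) \<Rightarrow> bool" where
  "Hs_transform s T g \<longleftrightarrow>
     g \<in> borel_measurable lborel \<and>
     integrable lborel (\<lambda>\<xi>. japanese \<xi> powr (2 * s) * (norm (g \<xi>))\<^sup>2) \<and>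
     (\<forall>f. schwartz f \<longrightarrow> dist_fourier T f = dist_of g f)"

definition in_Hs :: "real \<Rightarrow> dist \<Rightarrow> bool" where
  "in_Hs s T \<longleftrightarrow> tempered T \<and> (\<exists>g. Hs_transform s T g)"

definition Hs_norm :: "real \<Rightarrow> dist \<Rightarrow> real" where
  "Hs_norm s T =
     sqrt (LINT \<xi>|lborel. japanese \<xi> powr (2 * s) * (norm ((SOME g. Hs_transform s T g) \<xi>))\<^sup>2)"

definition in_Hs2 :: "real \<Rightarrow> dist ^ 2 \<Rightarrow> bool" where
  "in_Hs2 s T \<longleftrightarrow> (\<forall>j. in_Hs s (T $ j))"

definition Hs_norm2 :: "real \<Rightarrow> dist ^ 2 \<Rightarrow> real" where
  "Hs_norm2 s T = sqrt (\<Sum>j\<in>UNIV. (Hs_norm s (T $ j))\<^sup>2)"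

definition dist_of2 :: "(real \<Rightarrow> complex ^ 2) \<Rightarrow> dist ^ 2" where
  "dist_of2 u = (\<chi> j. dist_of (\<lambda>x. u x $ j))"

definition dist_diff2 :: "dist ^ 2 \<Rightarrow> dist ^ 2 \<Rightarrow> dist ^ 2" where
  "dist_diff2 S T = (\<chi> j. dist_diff (S $ j) (T $ j))"


section \<open>The free propagators\<close>

definition gamma0 :: "complex ^ 2 ^ 2" where
  "gamma0 = vector [vector [1, 0], vector [0, -1]]"

definition gamma1 :: "complex ^ 2 ^ 2" where
  "gamma1 = vector [vector [0, -\<i>], vector [\<i>, 0]]"

definition omega :: "real \<Rightarrow> real \<Rightarrow> real" where
  "omega M \<xi> = sqrt (M\<^sup>2 + \<xi>\<^sup>2)"

definition kg_cos :: "real \<Rightarrow> real \<Rightarrow> real \<Rightarrow> real" where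
  "kg_cos M t \<xi> = cos (t * omega M \<xi>)"

text \<open>\<open>sin (t * omega M \<xi>) / omega M \<xi>\<close>, extended continuously to \<open>omega M \<xi> = 0\<close>.\<close>

definition kg_sin :: "real \<Rightarrow> real \<Rightarrow> real \<Rightarrow> real" where
  "kg_sin M t \<xi> =
     (if omega M \<xi> = 0 then t else sin (t * omega M \<xi>) / omega M \<xi>)"

text \<open>
  Since \<open>gamma0 ** gamma0 = mat 1\<close>, the Dirac equation
  \<open>(\<i> gamma0 \<partial>\<^sub>t + gamma1 \<partial>\<^sub>x) \<psi> + m \<psi> = F\<close> reads
  \<open>\<i> \<partial>\<^sub>t \<psi> = H \<psi> + gamma0 F\<close> with \<open>H = - gamma0 (gamma1 \<partial>\<^sub>x + m)\<close>.
  The Fourier symbol of \<open>H\<close> is \<open>dirac_symbol\<close>; its square is \<open>(m\<^sup>2 + \<xi>\<^sup>2) mat 1\<close>, so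
  \<open>exp (- \<i> t H)\<close> has the closed form \<open>dirac_prop\<close>.
\<close>

definition dirac_symbol :: "real \<Rightarrow> real \<Rightarrow> complex ^ 2 ^ 2" where
  "dirac_symbol m \<xi> =
     (\<chi> j k. - (\<i> * of_real \<xi> * (gamma0 ** gamma1) $ j $ k + of_real m * gamma0 $ j $ k))"

definition dirac_prop :: "real \<Rightarrow> real \<Rightarrow> real \<Rightarrow> complex ^ 2 ^ 2" where
  "dirac_prop m t \<xi> =
     (\<chi> j k. of_real (kg_cos m t \<xi>) * mat 1 $ j $ k
            - \<i> * of_real (kg_sin m t \<xi>) * dirac_symbol m \<xi> $ j $ k)"

lemma kg_cos_0: "kg_cos M 0 \<xi> = 1" and kg_sin_0: "kg_sin M 0 \<xi> = 0"
  by (auto simp: kg_cos_def kg_sin_def)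

lemma kg_sin_deriv:
  "((\<lambda>t. kg_sin M t \<xi>) has_real_derivative kg_cos M t \<xi>) (at t)"
  by (cases "omega M \<xi> = 0")
     (auto simp: kg_sin_def kg_cos_def intro!: derivative_eq_intros)

lemma kg_cos_deriv:
  "((\<lambda>t. kg_cos M t \<xi>) has_real_derivative - (M\<^sup>2 + \<xi>\<^sup>2) * kg_sin M t \<xi>) (at t)"
proof -
  have "M\<^sup>2 + \<xi>\<^sup>2 = omega M \<xi> * omega M \<xi>"
    by (simp add: omega_def)
  hence "- (M\<^sup>2 + \<xi>\<^sup>2) * kg_sin M t \<xi> = - (sin (t * omega M \<xi>) * omega M \<xi>)"
    by (simp only: kg_sin_def) simp
  moreover have
    "((\<lambda>t. kg_cos M t \<xi>) has_real_derivative - (sin (t * omega M \<xi>) * omega M \<xi>)) (at t)"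
    unfolding kg_cos_def by (auto intro!: derivative_eq_intros)
  ultimately show ?thesis by simp
qed

lemma dirac_prop_0: "dirac_prop m 0 \<xi> = mat 1"
  by (simp add: dirac_prop_def kg_cos_0 kg_sin_0 vec_eq_iff)

lemma dirac_symbol_square:
  "(dirac_symbol m \<xi> ** dirac_symbol m \<xi>) $ j $ k = of_real (m\<^sup>2 + \<xi>\<^sup>2) * mat 1 $ j $ k"
  using exhaust_2[of j] exhaust_2[of k]
  by (auto simp: dirac_symbol_def gamma0_def gamma1_def matrix_matrix_mult_def mat_def
      sum_2 vector_2 power2_eq_square algebra_simps)

lemma dirac_prop_deriv:
  "((\<lambda>t. dirac_prop m t \<xi> $ j $ k) has_vector_derivative
      - \<i> * (dirac_symbol m \<xi> ** dirac_prop m t \<xi>) $ j $ k) (at t)"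
proof -
  let ?H = "dirac_symbol m \<xi>"
  have c: "((\<lambda>t. of_real (kg_cos m t \<xi>) :: complex) has_vector_derivative
      of_real (- (m\<^sup>2 + \<xi>\<^sup>2) * kg_sin m t \<xi>)) (at t)"
    using kg_cos_deriv by (rule has_vector_derivative_of_real)
  have s: "((\<lambda>t. of_real (kg_sin m t \<xi>) :: complex) has_vector_derivative
      of_real (kg_cos m t \<xi>)) (at t)"
    using kg_sin_deriv by (rule has_vector_derivative_of_real)
  have "(?H ** dirac_prop m t \<xi>) $ j $ k =
      of_real (kg_cos m t \<xi>) * (?H ** mat 1) $ j $ k
      - \<i> * of_real (kg_sin m t \<xi>) * (?H ** ?H) $ j $ k"
    by (simp add: dirac_prop_def matrix_matrix_mult_def sum_2 algebra_simps)
  hence e: "(?H ** dirac_prop m t \<xi>) $ j $ k =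
      of_real (kg_cos m t \<xi>) * ?H $ j $ k
      - \<i> * of_real (kg_sin m t \<xi>) * (of_real (m\<^sup>2 + \<xi>\<^sup>2) * mat 1 $ j $ k)"
    by (simp only: dirac_symbol_square matrix_mul_rid)
  have "((\<lambda>t. of_real (kg_cos m t \<xi>) * mat 1 $ j $ k
        - \<i> * of_real (kg_sin m t \<xi>) * ?H $ j $ k) has_vector_derivative
      (of_real (- (m\<^sup>2 + \<xi>\<^sup>2) * kg_sin m t \<xi>) * mat 1 $ j $ k
        - \<i> * of_real (kg_cos m t \<xi>) * ?H $ j $ k)) (at t)"
    by (intro has_vector_derivative_diff has_vector_derivative_mult_left
        has_vector_derivative_mult_right c s)
  moreover have "of_real (- (m\<^sup>2 + \<xi>\<^sup>2) * kg_sin m t \<xi>) * mat 1 $ j $ k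
        - \<i> * of_real (kg_cos m t \<xi>) * ?H $ j $ k
      = - \<i> * (?H ** dirac_prop m t \<xi>) $ j $ k"
    unfolding e by (simp add: algebra_simps)
  ultimately show ?thesis by (simp add: dirac_prop_def)
qed


section \<open>Solutions of the Dirac-Klein-Gordon system\<close>

definition dirac_source :: "(real \<Rightarrow> real) \<Rightarrow> (real \<Rightarrow> complex ^ 2) \<Rightarrow> real \<Rightarrow> complex ^ 2" where
  "dirac_source \<phi> \<psi> x = of_real (\<phi> x) *s \<psi> x"

definition kg_source :: "(real \<Rightarrow> complex ^ 2) \<Rightarrow> real \<Rightarrow> complex" where
  "kg_source \<psi> x = (\<Sum>j\<in>UNIV. cnj (\<psi> x $ j) * (gamma0 *v \<psi> x) $ j)"

text \<open>
  The Duhamel formulas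
    \<open>\<psi>(t) = S(t) \<psi>(0) - \<i> \<integral>\<^sub>0\<^sup>t S(t - s) gamma0 (\<phi> \<psi>)(s) ds\<close>,
    \<open>\<phi>(t) = cos(t \<omega>) \<phi>(0) + (sin(t \<omega>) / \<omega>) \<partial>\<^sub>t\<phi>(0) + \<integral>\<^sub>0\<^sup>t (sin((t - s) \<omega>) / \<omega>) (\<psi>\<^sup>* gamma0 \<psi>)(s) ds\<close>
  are identities between tempered distributions: their Fourier transforms are compared on every
  Schwartz function. A Fourier multiplier \<open>a\<close> acts on a Fourier transform by
  multiplication, that is, by replacing the test function \<open>f\<close> by \<open>\<lambda>\<xi>. a \<xi> * f \<xi>\<close>.
\<close>

definition dirac_integrand ::
  "real \<Rightarrow> (real \<Rightarrow> real \<Rightarrow> complex ^ 2) \<Rightarrow> (real \<Rightarrow> real \<Rightarrow> real) \<Rightarrow>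
   real \<Rightarrow> 2 \<Rightarrow> (real \<Rightarrow> complex) \<Rightarrow> real \<Rightarrow> complex" where
  "dirac_integrand m \<psi> \<phi> t j f s =
     (\<Sum>k\<in>UNIV. dist_fourier (dist_of (\<lambda>x. (gamma0 *v dirac_source (\<phi> s) (\<psi> s) x) $ k))
                 (\<lambda>\<xi>. dirac_prop m (t - s) \<xi> $ j $ k * f \<xi>))"

definition dirac_duhamel ::
  "real \<Rightarrow> real \<Rightarrow> (real \<Rightarrow> real \<Rightarrow> complex ^ 2) \<Rightarrow> (real \<Rightarrow> real \<Rightarrow> real) \<Rightarrow> bool" where
  "dirac_duhamel m T \<psi> \<phi> \<longleftrightarrow>
     (\<forall>t\<in>{0..T}. \<forall>j f. schwartz f \<longrightarrow>
        set_integrable lborel {0..t} (dirac_integrand m \<psi> \<phi> t j f) \<and>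
        dist_fourier (dist_of2 (\<psi> t) $ j) f =
          (\<Sum>k\<in>UNIV. dist_fourier (dist_of2 (\<psi> 0) $ k) (\<lambda>\<xi>. dirac_prop m t \<xi> $ j $ k * f \<xi>))
          - \<i> * (LINT s:{0..t}|lborel. dirac_integrand m \<psi> \<phi> t j f s))"

definition kg_integrand ::
  "real \<Rightarrow> (real \<Rightarrow> real \<Rightarrow> complex ^ 2) \<Rightarrow> real \<Rightarrow> (real \<Rightarrow> complex) \<Rightarrow> real \<Rightarrow> complex" where
  "kg_integrand M \<psi> t f s =
     dist_fourier (dist_of (kg_source (\<psi> s))) (\<lambda>\<xi>. of_real (kg_sin M (t - s) \<xi>) * f \<xi>)"

definition kg_duhamel ::
  "real \<Rightarrow> real \<Rightarrow> (real \<Rightarrow> real \<Rightarrow> complex ^ 2) \<Rightarrow> (real \<Rightarrow> real \<Rightarrow> real) \<Rightarrow> (real \<Rightarrow> dist) \<Rightarrow> bool" where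
  "kg_duhamel M T \<psi> \<phi> \<phi>t \<longleftrightarrow>
     (\<forall>t\<in>{0..T}. \<forall>f. schwartz f \<longrightarrow>
        set_integrable lborel {0..t} (kg_integrand M \<psi> t f) \<and>
        dist_fourier (dist_of (\<lambda>x. of_real (\<phi> t x))) f =
          dist_fourier (dist_of (\<lambda>x. of_real (\<phi> 0 x))) (\<lambda>\<xi>. of_real (kg_cos M t \<xi>) * f \<xi>)
          + dist_fourier (\<phi>t 0) (\<lambda>\<xi>. of_real (kg_sin M t \<xi>) * f \<xi>)
          + (LINT s:{0..t}|lborel. kg_integrand M \<psi> t f s))"

text \<open>
  A solution on \<open>[0, T]\<close>. The unknowns are functions of \<open>(t, x)\<close> for which, at every time, the
  undifferentiated terms of the system (\<open>\<psi>\<close>, \<open>\<phi>\<close>, \<open>\<phi> \<psi>\<close> and \<open>\<bar>\<psi>\<bar>\<^sup>2\<close>, hence \<open>\<psi>\<^sup>* gamma0 \<psi>\<close>) are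
  functions defining distributions, so that both nonlinearities are pointwise products. This
  requirement is needed because \<open>\<psi>\<^sup>* gamma0 \<psi>\<close> has no meaning for general \<open>\<psi>\<close> in
  \<open>H\<^sup>s\<close> with \<open>s = - 1/2\<close>. The time derivative \<open>\<phi>t\<close> of \<open>\<phi>\<close> is a distribution at each time
  and is the limit of the difference quotients of \<open>\<phi>\<close> in that \<open>H\<^sup>s\<close>.
\<close>

definition dkg_solution ::
  "real \<Rightarrow> real \<Rightarrow> real \<Rightarrow>
   (real \<Rightarrow> real \<Rightarrow> complex ^ 2) \<Rightarrow> (real \<Rightarrow> real \<Rightarrow> real) \<Rightarrow> (real \<Rightarrow> dist) \<Rightarrow> bool" where
  "dkg_solution m M T \<psi> \<phi> \<phi>t \<longleftrightarrow>
     (\<forall>t\<in>{0..T}.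
        tempered_fun (\<lambda>x. of_real (\<phi> t x)) \<and>
        (\<forall>j. tempered_fun (\<lambda>x. \<psi> t x $ j)) \<and>
        (\<forall>j. tempered_fun (\<lambda>x. dirac_source (\<phi> t) (\<psi> t) x $ j)) \<and>
        tempered_fun (\<lambda>x. of_real ((norm (\<psi> t x))\<^sup>2)) \<and>
        in_Hs2 (- 1/2) (dist_of2 (\<psi> t)) \<and>
        in_Hs (1/2) (dist_of (\<lambda>x. of_real (\<phi> t x))) \<and>
        in_Hs (- 1/2) (\<phi>t t)) \<and>
     (\<forall>t\<^sub>0\<in>{0..T}.
        ((\<lambda>t. Hs_norm2 (- 1/2) (dist_diff2 (dist_of2 (\<psi> t)) (dist_of2 (\<psi> t\<^sub>0))))
           \<longlongrightarrow> 0) (at t\<^sub>0 within {0..T}) \<and>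
        ((\<lambda>t. Hs_norm (1/2) (dist_diff (dist_of (\<lambda>x. of_real (\<phi> t x)))
                                       (dist_of (\<lambda>x. of_real (\<phi> t\<^sub>0 x)))))
           \<longlongrightarrow> 0) (at t\<^sub>0 within {0..T}) \<and>
        ((\<lambda>t. Hs_norm (- 1/2) (dist_diff (\<phi>t t) (\<phi>t t\<^sub>0)))
           \<longlongrightarrow> 0) (at t\<^sub>0 within {0..T}) \<and>
        ((\<lambda>t. Hs_norm (- 1/2)
            (dist_diff
              (dist_scale (of_real (1 / (t - t\<^sub>0)))
                 (dist_diff (dist_of (\<lambda>x. of_real (\<phi> t x))) (dist_of (\<lambda>x. of_real (\<phi> t\<^sub>0 x)))))
              (\<phi>t t\<^sub>0)))
           \<longlongrightarrow> 0) (at t\<^sub>0 within {0..T})) \<and>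
     dirac_duhamel m T \<psi> \<phi> \<and>
     kg_duhamel M T \<psi> \<phi> \<phi>t"

end

theory Submission
  imports Defs "HOL-Probability.Probability" "HOL-Real_Asymp.Real_Asymp"
begin

text \<open>
  On the Fourier side, let the data live at frequencies of size \<open>l\<close> and follow the solution up to the
  time \<open>T = 1 / l\<close>. Functions bounded by the weight \<open>wt l\<close> form an algebra under convolution up to a
  factor \<open>l\<close>, which each time integration regains; hence for data of size \<open>A0 * wt l\<close> with fixed \<open>A0\<close>
  the Duhamel map is a contraction as soon as \<open>l\<close> is large, and the solution is a free massless
  wave up to errors smaller by a factor \<open>1 / l\<close>.

  To a truncation of the given data add the left-moving profile \<open>a * (sin y)\<^sup>2\<close> on \<open>1 \<le> y \<le> R\<close> and the
  right-moving profile \<open>b\<close> on \<open>N0 \<le> y \<le> 2 * N0\<close>, where \<open>y = \<xi> / l\<close>. Both have squared norms in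
  \<open>H\<^sup>s\<close>, \<open>s = - 1/2\<close>, bounded independently of \<open>l\<close>, by \<open>a\<^sup>2 * \<mu>\<close> and \<open>b\<^sup>2\<close>, with \<open>\<mu>\<close> the integral of
  \<open>(sin y) ^ 4 / y\<close> over \<open>{1..R}\<close>. Their product in \<open>\<psi>\<^sup>* gamma0 \<psi>\<close> drives \<open>\<phi>\<close> at frequencies near
  \<open>- l * N0\<close>, and by time \<open>T\<close> the oscillating integral has the factor \<open>(sin y)\<^sup>2 / y\<close>, so that the
  contributions of all \<open>y\<close> add up and the \<open>H\<^sup>s\<close> norm of \<open>\<phi>(T)\<close>, \<open>s = 1/2\<close>, is at least a constant times
  \<open>a * b * \<mu>\<close>. Since \<open>\<mu>\<close> is unbounded in \<open>R\<close>, taking \<open>a = e / sqrt \<mu>\<close> and \<open>b = e\<close> keeps the data small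
  while \<open>a * b * \<mu> = e\<^sup>2 * sqrt \<mu>\<close> becomes as large as desired.
\<close>

section \<open>Parseval's identity\<close>

text \<open>The gain is a logarithm at the critical exponent. On left-moving profiles measured with
  the weight 1 / y, the resonant kernel (sin y)^2 / y is a functional whose squared norm over {1..R}
  is the integral \<open>\<mu>\<close> of (sin y)^4 / y. The profile (sin y)^2 is its extremiser:
  the same integral measures the data, under a square root, and the interaction, without one. The
  density psi^* gamma0 psi has no meaning for general spinors in the data space. The given data are
  therefore replaced by bounded Fourier transforms of compact support, the equations are solved in a
  weighted supremum norm on the Fourier side, and Sobolev norms only measure the finished solution.
  The constants of this norm are bad in \<open>R\<close> and \<open>N0\<close>, but the truncation,
  \<open>R\<close>, \<open>a\<close>, \<open>b\<close> and \<open>N0\<close> are fixed before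
  \<open>l\<close>, and every error is smaller than the main term by a factor 1 / l. The main term
  itself is independent of \<open>l\<close> by scaling. The high frequency \<open>N0\<close> serves
  to make the other half of the oscillating time integral, of relative size R / N0, small against
  \<open>\<mu>\<close>, and to keep the two profiles and the window of observation apart.\<close>

lemma norm_integral_le:
  fixes f :: "'a \<Rightarrow> 'b::{banach, second_countable_topology}"
  assumes g: "integrable M g" and le: "\<And>x. norm (f x) \<le> g x"
  shows "norm (integral\<^sup>L M f) \<le> integral\<^sup>L M g"
proof (cases "integrable M f")
  case True
  then show ?thesis
    by (intro order_trans[OF integral_norm_bound] integral_mono) (auto intro: g le)
next
  \<comment> \<open>A function that is not integrable has integral 0 by convention, so only the sign
    of \<open>g\<close> matters. The bound can thus be applied before integrability of
    \<open>f\<close> is known.\<close>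
  case False
  then show ?thesis
    using order_trans[OF norm_ge_zero le] by (simp add: not_integrable_integral_eq integral_nonneg)
qed

text \<open>A majorant of product form makes the iterated integrals of the norm finite, which yields
  the exchange and the integrability of both inner integrals at once.\<close>

lemma Fubini_dominated:
  fixes f :: "real \<Rightarrow> real \<Rightarrow> 'b::{banach, second_countable_topology}"
  assumes [measurable]: "case_prod f \<in> borel_measurable (lborel \<Otimes>\<^sub>M lborel)"
    and a: "integrable lborel a" and b: "integrable lborel b"
    and bd: "\<And>x y. norm (f x y) \<le> a x * b y"
  shows "integrable (lborel \<Otimes>\<^sub>M lborel) (case_prod f)"
    and "(LINT x|lborel. LINT y|lborel. f x y) = (LINT y|lborel. LINT x|lborel. f x y)"
    and "integrable lborel (\<lambda>x. LINT y|lborel. f x y)"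
    and "integrable lborel (\<lambda>y. LINT x|lborel. f x y)"
proof -
  have [measurable]: "a \<in> borel_measurable lborel" "b \<in> borel_measurable lborel" using a b by auto
  have f1: "integrable lborel (\<lambda>y. norm (f x y))" for x
    by (rule Bochner_Integration.integrable_bound[OF integrable_mult_right[OF b, of "a x"]], measurable)
      (intro AE_I2, subst real_norm_def, subst abs_of_nonneg[OF norm_ge_zero], rule order_trans[OF bd], simp)
  have le: "(LINT y|lborel. norm (f x y)) \<le> a x * (LINT y|lborel. b y)" for x
    by (subst integral_mult_right_zero[symmetric], rule integral_mono) (use f1 b bd in auto)
  have "integrable lborel (\<lambda>x. LINT y|lborel. norm (f x y))"
    by (rule Bochner_Integration.integrable_bound[OF integrable_mult_left[OF a, of "LINT y|lborel. b y"]])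
      (use le in \<open>auto intro!: AE_I2 intro: order_trans[OF _ abs_ge_self]\<close>)
  then show i: "integrable (lborel \<Otimes>\<^sub>M lborel) (case_prod f)"
    by (intro lborel_pair.Fubini_integrable) (use f1 in \<open>auto intro!: AE_I2 simp: integrable_norm_iff\<close>)
  show "(LINT x|lborel. LINT y|lborel. f x y) = (LINT y|lborel. LINT x|lborel. f x y)"
    using lborel_pair.Fubini_integral[OF i] by simp
  show "integrable lborel (\<lambda>x. LINT y|lborel. f x y)" "integrable lborel (\<lambda>y. LINT x|lborel. f x y)"
    using lborel_pair.integrable_fst[OF i] lborel_pair.integrable_snd[OF i] by auto
qed

text \<open>The class in which Parseval's identity is proved: integrability defines the transforms,
  and together with boundedness it makes the function, hence also its transform, square
  integrable.\<close>

definition bounded_integrable :: "(real \<Rightarrow> complex) \<Rightarrow> bool" where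
  "bounded_integrable h \<longleftrightarrow> integrable lborel h \<and> (\<exists>B. \<forall>x. norm (h x) \<le> B)"

text \<open>The inverse transform belonging to the unnormalised \<open>fourier\<close>. With this
  factor a convolution becomes 2 pi times a product, the origin of the divisions by 2 pi in all
  later nonlinear terms.\<close>

definition ift :: "(real \<Rightarrow> complex) \<Rightarrow> real \<Rightarrow> complex" where
  "ift h x = (LINT \<xi>|lborel. exp (\<i> * of_real (x * \<xi>)) * h \<xi>) / (2 * of_real pi)"

text \<open>The normal density of standard deviation 1 / n, an approximate identity as
  \<open>n\<close> grows.\<close>

definition gauss_kernel :: "real \<Rightarrow> real \<Rightarrow> real" where
  "gauss_kernel n z = n * std_normal_density (n * z)"

lemma gauss_kernel_measurable[measurable]: "gauss_kernel n \<in> borel_measurable borel"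
  unfolding gauss_kernel_def by measurable

lemma gauss_kernel_nonneg: "n > 0 \<Longrightarrow> 0 \<le> gauss_kernel n z"
  by (simp add: gauss_kernel_def)

lemma gauss_kernel_sym: "gauss_kernel n (x - y) = gauss_kernel n (y - x)"
  by (simp add: gauss_kernel_def std_normal_density_def power2_commute[of "n * x" "n * y"] right_diff_distrib)

lemma integrable_exp_square:
  assumes "n > (0::real)"
  shows "integrable lborel (\<lambda>x. exp (- x\<^sup>2 / (2 * n\<^sup>2)))"
proof -
  have "integrable lborel (\<lambda>x. sqrt (2 * pi * n\<^sup>2) * normal_density 0 n x)" using assms by auto
  moreover have "sqrt (2 * pi * n\<^sup>2) * normal_density 0 n x = exp (- x\<^sup>2 / (2 * n\<^sup>2))" for x
    using assms by (simp add: normal_density_def)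
  ultimately show ?thesis by simp
qed

text \<open>The characteristic function of the standard normal distribution, after the substitution
  x = n y.\<close>

lemma gauss_kernel_fourier:
  assumes n: "n > (0::real)"
  shows "(LINT x|lborel. exp (\<i> * of_real (x * z)) * of_real (exp (- x\<^sup>2 / (2 * n\<^sup>2)))) = 2 * of_real pi * of_real (gauss_kernel n z)"
proof -
  have "char std_normal_distribution (n * z) = (LINT y|lborel. of_real (std_normal_density y) * exp (\<i> * of_real (n * z * y)))"
    unfolding char_def by (subst integral_density) (auto simp: scaleR_conv_of_real)
  then have c: "of_real (exp (- (n*z)\<^sup>2/2)) = (LINT y|lborel. of_real (std_normal_density y) * exp (\<i> * of_real (n * z * y)))"
    by (simp add: char_std_normal_distribution)
  have "(LINT x|lborel. exp (\<i> * of_real (x * z)) * of_real (exp (- x\<^sup>2 / (2 * n\<^sup>2))))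
      = \<bar>n\<bar> *\<^sub>R (LINT y|lborel. exp (\<i> * of_real ((0 + n * y) * z)) * of_real (exp (- (0 + n * y)\<^sup>2 / (2 * n\<^sup>2))))"
    by (rule lborel_integral_real_affine) (use n in auto)
  also have "\<dots> = n *\<^sub>R (LINT y|lborel. of_real (sqrt (2 * pi)) * (of_real (std_normal_density y) * exp (\<i> * of_real (n * z * y))))"
  proof (intro arg_cong2[where f=scaleR] Bochner_Integration.integral_cong refl)
    fix y
    have a: "(0 + n * y) * z = n * z * y" "(0 + n * y)\<^sup>2 / (2 * n\<^sup>2) = y\<^sup>2 / 2"
      using n by (auto simp: power_mult_distrib)
    have b: "exp (- (y\<^sup>2 / 2)) = sqrt (2 * pi) * std_normal_density y"
      by (simp add: std_normal_density_def)
    show "exp (\<i> * of_real ((0 + n * y) * z)) * of_real (exp (- (0 + n * y)\<^sup>2 / (2 * n\<^sup>2)))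
      = of_real (sqrt (2 * pi)) * (of_real (std_normal_density y) * exp (\<i> * of_real (n * z * y)))"
      unfolding minus_divide_left[symmetric] a b of_real_mult by (simp only: mult_ac)
  qed (use n in auto)
  also have "\<dots> = of_real (n * sqrt (2 * pi) * exp (- (n*z)\<^sup>2/2))"
    by (subst integral_mult_right_zero, subst c[symmetric]) (simp add: scaleR_conv_of_real)
  also have "\<dots> = of_real (2 * pi * gauss_kernel n z)"
    by (intro arg_cong[where f=of_real]) (simp add: gauss_kernel_def std_normal_density_def field_simps)
  finally show ?thesis by simp
qed

text \<open>The substitution moves \<open>n\<close> from the kernel into the argument of
  \<open>F\<close>; the remaining weight is fixed, which is the form needed for dominated
  convergence.\<close>

lemma gauss_kernel_conv_affine:
  fixes F :: "real \<Rightarrow> complex"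
  assumes n: "n > (0::real)"
  shows "(LINT \<eta>|lborel. of_real (gauss_kernel n (\<eta> - \<xi>)) * F \<eta>)
    = (LINT y|lborel. of_real (std_normal_density y) * F (\<xi> + y / n))"
proof -
  have "(LINT \<eta>|lborel. of_real (gauss_kernel n (\<eta> - \<xi>)) * F \<eta>)
     = \<bar>1/n\<bar> *\<^sub>R (LINT y|lborel. of_real (gauss_kernel n ((\<xi> + 1/n * y) - \<xi>)) * F (\<xi> + 1/n * y))"
    by (rule lborel_integral_real_affine) (use n in auto)
  also have "\<dots> = (LINT y|lborel. (1/n) *\<^sub>R (of_real (gauss_kernel n ((\<xi> + 1/n * y) - \<xi>)) * F (\<xi> + 1/n * y)))"
    using n by (subst integral_scaleR_right) auto
  also have "\<dots> = (LINT y|lborel. of_real (std_normal_density y) * F (\<xi> + y / n))"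
    using n by (intro Bochner_Integration.integral_cong) (auto simp: gauss_kernel_def scaleR_conv_of_real)
  finally show ?thesis .
qed

lemma gauss_kernel_conv_bound:
  fixes F :: "real \<Rightarrow> complex"
  assumes n: "n > 0" and [measurable]: "F \<in> borel_measurable borel" and B: "\<And>x. norm (F x) \<le> B"
  shows "norm (LINT \<eta>|lborel. of_real (gauss_kernel n (\<eta> - \<xi>)) * F \<eta>) \<le> B"
proof -
  have "norm (LINT y|lborel. of_real (std_normal_density y) * F (\<xi> + y / n)) \<le> (LINT y|lborel. B * std_normal_density y)"
    by (rule norm_integral_le) (auto simp: norm_mult mult.commute[of B] intro!: mult_left_mono B)
  then show ?thesis unfolding gauss_kernel_conv_affine[OF n] by simp
qed

text \<open>Continuity is asked at the single point \<open>\<xi>\<close>, so that the lemma also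
  applies to the indicator of an interval away from its endpoints.\<close>

lemma gauss_kernel_conv_tendsto:
  fixes F :: "real \<Rightarrow> complex"
  assumes [measurable]: "F \<in> borel_measurable borel" and B: "\<And>x. norm (F x) \<le> B" and c: "isCont F \<xi>"
  shows "(\<lambda>n. LINT \<eta>|lborel. of_real (gauss_kernel (real (Suc n)) (\<eta> - \<xi>)) * F \<eta>) \<longlonglongrightarrow> F \<xi>"
proof -
  have "(\<lambda>n. LINT y|lborel. of_real (std_normal_density y) * F (\<xi> + y / real (Suc n))) \<longlonglongrightarrow>
     (LINT y|lborel. of_real (std_normal_density y) * F \<xi>)"
  proof (rule integral_dominated_convergence[where w="\<lambda>y. B * std_normal_density y"])
    show "AE x in lborel. (\<lambda>n. of_real (std_normal_density x) * F (\<xi> + x / real (Suc n))) \<longlonglongrightarrow> of_real (std_normal_density x) * F \<xi>"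
    proof (intro AE_I2 tendsto_mult tendsto_const)
      fix x
      have "(\<lambda>n. \<xi> + x / real (Suc n)) \<longlonglongrightarrow> \<xi> + 0"
        by (intro tendsto_add tendsto_const) real_asymp
      then show "(\<lambda>n. F (\<xi> + x / real (Suc n))) \<longlonglongrightarrow> F \<xi>"
        using isCont_tendsto_compose[OF c] by auto
    qed
  qed (auto simp: norm_mult mult.commute[of B] intro!: mult_left_mono B)
  then show ?thesis by (subst gauss_kernel_conv_affine) auto
qed

lemma bounded_integrable_measurable: "bounded_integrable h \<Longrightarrow> h \<in> borel_measurable borel"
  by (auto simp: bounded_integrable_def)

lemma norm_exp_imaginary[simp]: "norm (exp (\<i> * of_real x)) = 1" "norm (exp (- (\<i> * of_real x))) = 1"
   "norm (exp (\<i> * (of_real x * of_real y))) = 1" "norm (exp (- (\<i> * (of_real x * of_real y)))) = 1"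
  using norm_exp_i_times[of x] norm_exp_i_times[of "-x"] norm_exp_i_times[of "x*y"] norm_exp_i_times[of "-(x*y)"] by auto

lemma fourier_measurable[measurable]:
  assumes [measurable]: "h \<in> borel_measurable borel"
  shows "fourier h \<in> borel_measurable borel" "ift h \<in> borel_measurable borel"
  unfolding fourier_def[abs_def] ift_def[abs_def] by measurable

lemma fourier_bound:
  assumes "integrable lborel h"
  shows "norm (fourier h x) \<le> (LINT \<xi>|lborel. norm (h \<xi>))"
  unfolding fourier_def by (rule order_trans[OF integral_norm_bound]) (simp add: norm_mult)

lemma ift_bound:
  assumes "integrable lborel h"
  shows "norm (ift h x) \<le> (LINT \<xi>|lborel. norm (h \<xi>))"
proof -
  have "norm (ift h x) \<le> (LINT \<xi>|lborel. norm (h \<xi>)) / (2 * pi)"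
    unfolding ift_def norm_divide
    by (rule order_trans[OF divide_right_mono[OF integral_norm_bound]]) (simp_all add: norm_mult)
  also have "\<dots> \<le> (LINT \<xi>|lborel. norm (h \<xi>)) / 1"
    using pi_gt3 by (intro divide_left_mono) auto
  finally show ?thesis by simp
qed

text \<open>Parseval's identity with a Gaussian damping in \<open>x\<close>. The damping makes the
  triple integral absolutely convergent, so Fubini applies twice, and the innermost integral over
  \<open>x\<close> is the transform of a Gaussian, that is, the approximate identity on the
  right.\<close>

lemma Gauss_Parseval:
  assumes h: "integrable lborel h" and F: "integrable lborel F" and n: "n > (0::real)"
  shows "(LINT x|lborel. of_real (exp (- x\<^sup>2 / (2 * n\<^sup>2))) * (ift h x * fourier F x))
     = (LINT \<xi>|lborel. h \<xi> * (LINT \<eta>|lborel. of_real (gauss_kernel n (\<eta> - \<xi>)) * F \<eta>))"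
proof -
  have [measurable]: "h \<in> borel_measurable borel" "F \<in> borel_measurable borel" using h F by auto
  let ?E = "\<lambda>x::real. exp (- x\<^sup>2 / (2 * n\<^sup>2))"
  have E: "integrable lborel ?E" by (rule integrable_exp_square[OF n])
  define B where "B = (LINT \<xi>|lborel. norm (F \<xi>))"
  have B: "norm (fourier F x) \<le> B" for x unfolding B_def by (rule fourier_bound[OF F])
  have "(LINT x|lborel. of_real (?E x) * (ift h x * fourier F x)) =
     (LINT x|lborel. LINT \<xi>|lborel. of_real (?E x) * (exp (\<i> * of_real (x * \<xi>)) * h \<xi> * fourier F x) / (2 * of_real pi))"
    unfolding ift_def by simp
  also have "\<dots> = (LINT \<xi>|lborel. LINT x|lborel. of_real (?E x) * (exp (\<i> * of_real (x * \<xi>)) * h \<xi> * fourier F x) / (2 * of_real pi))"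
  proof (rule Fubini_dominated(2))
    show "integrable lborel (\<lambda>x. ?E x * (B / (2*pi)))" using E by simp
    show "integrable lborel (\<lambda>\<xi>. norm (h \<xi>))" using h by simp
    fix x y show "norm (of_real (?E x) * (exp (\<i> * of_real (x * y)) * h y * fourier F x) / (2 * of_real pi)) \<le> ?E x * (B / (2*pi)) * norm (h y)"
      using mult_right_mono[OF B[of x], of "norm (h y) * ?E x"] by (simp add: norm_mult norm_divide divide_simps mult_ac)
  qed measurable
  also have "\<dots> = (LINT \<xi>|lborel. h \<xi> * (LINT x|lborel. of_real (?E x) * (exp (\<i> * of_real (x * \<xi>)) * fourier F x) / (2 * of_real pi)))"
    by (intro Bochner_Integration.integral_cong refl, subst integral_mult_right_zero[symmetric]) (intro Bochner_Integration.integral_cong refl, simp)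
  also have "\<dots> = (LINT \<xi>|lborel. h \<xi> * (LINT x|lborel. LINT \<eta>|lborel. of_real (?E x) * (exp (\<i> * of_real (x * \<xi>)) * (exp (-\<i> * of_real (\<eta> * x)) * F \<eta>)) / (2 * of_real pi)))"
    unfolding fourier_def by simp
  also have "\<dots> = (LINT \<xi>|lborel. h \<xi> * (LINT \<eta>|lborel. LINT x|lborel. of_real (?E x) * (exp (\<i> * of_real (x * \<xi>)) * (exp (-\<i> * of_real (\<eta> * x)) * F \<eta>)) / (2 * of_real pi)))"
  proof (rule Bochner_Integration.integral_cong[OF refl], rule arg_cong2[where f="(*)", OF refl],
      rule Fubini_dominated(2)[where a="\<lambda>x. ?E x / (2*pi)" and b="\<lambda>\<xi>. norm (F \<xi>)"])
  qed (use E F in \<open>auto simp: norm_mult norm_divide\<close>)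
  also have "\<dots> = (LINT \<xi>|lborel. h \<xi> * (LINT \<eta>|lborel. of_real (gauss_kernel n (\<eta> - \<xi>)) * F \<eta>))"
  proof (intro Bochner_Integration.integral_cong refl arg_cong2[where f="(*)"])
    fix \<xi> \<eta> :: real
    have "(LINT x|lborel. of_real (?E x) * (exp (\<i> * of_real (x * \<xi>)) * (exp (-\<i> * of_real (\<eta> * x)) * F \<eta>)) / (2 * of_real pi))
      = (LINT x|lborel. (exp (\<i> * of_real (x * (\<xi> - \<eta>))) * of_real (?E x)) * (F \<eta> / (2 * of_real pi)))"
    proof (intro Bochner_Integration.integral_cong refl)
      fix x
      have "exp (\<i> * of_real (x * (\<xi> - \<eta>))) = exp (\<i> * of_real (x * \<xi>)) * exp (-\<i> * of_real (\<eta> * x))"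
        by (subst exp_add[symmetric], rule arg_cong[of _ _ exp]) (simp add: algebra_simps)
      then show "of_real (?E x) * (exp (\<i> * of_real (x * \<xi>)) * (exp (-\<i> * of_real (\<eta> * x)) * F \<eta>)) / (2 * of_real pi)
        = (exp (\<i> * of_real (x * (\<xi> - \<eta>))) * of_real (?E x)) * (F \<eta> / (2 * of_real pi))"
        by simp
    qed
    also have "\<dots> = of_real (gauss_kernel n (\<eta> - \<xi>)) * F \<eta>"
      by (subst integral_mult_left_zero, subst gauss_kernel_fourier[OF n]) (simp add: gauss_kernel_sym)
    finally show "(LINT x|lborel. of_real (?E x) * (exp (\<i> * of_real (x * \<xi>)) * (exp (-\<i> * of_real (\<eta> * x)) * F \<eta>)) / (2 * of_real pi)) = of_real (gauss_kernel n (\<eta> - \<xi>)) * F \<eta>" .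
  qed
  finally show ?thesis .
qed

lemma bounded_integrable_cnj: "bounded_integrable h \<Longrightarrow> bounded_integrable (\<lambda>x. cnj (h x))"
  by (auto simp: bounded_integrable_def)

lemma bounded_integrable_reflect: "bounded_integrable h \<Longrightarrow> bounded_integrable (\<lambda>x. h (- x))"
  using lborel_integrable_real_affine[of h "-1" 0] by (auto simp: bounded_integrable_def)

lemma cnj_fourier: "cnj (fourier h x) = 2 * of_real pi * ift (\<lambda>x. cnj (h x)) x"
  unfolding fourier_def ift_def by (simp add: exp_cnj mult.commute flip: Bochner_Integration.integral_cnj)

lemma ift_fourier: "ift h x = fourier (\<lambda>x. h (- x)) x / (2 * of_real pi)"
  unfolding ift_def fourier_def
  by (subst lborel_integral_real_affine[where c="-1" and t=0]) (auto simp: mult.commute)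

lemma exp_square_tendsto: "(\<lambda>n. exp (- x\<^sup>2 / (2 * (real (Suc n))\<^sup>2))) \<longlonglongrightarrow> 1"
proof -
  have "(\<lambda>n. - x\<^sup>2 / (2 * (real n)\<^sup>2)) \<longlonglongrightarrow> 0" by real_asymp
  then have "(\<lambda>n. exp (- x\<^sup>2 / (2 * (real n)\<^sup>2))) \<longlonglongrightarrow> exp 0" by (rule tendsto_exp)
  from LIMSEQ_Suc[OF this] show ?thesis by simp
qed

text \<open>The damped identity with \<open>h\<close> the conjugate of \<open>F\<close> bounds the
  damped integrals of the squared modulus uniformly in \<open>n\<close>; Fatou's lemma removes the
  damping.\<close>

lemma fourier_square_integrable:
  assumes "bounded_integrable F"
  shows "integrable lborel (\<lambda>x. (norm (fourier F x))\<^sup>2)"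
proof -
  have F: "integrable lborel F" using assms by (auto simp: bounded_integrable_def)
  then have [measurable]: "F \<in> borel_measurable borel" by auto
  obtain B where B: "\<And>x. norm (F x) \<le> B" using assms by (auto simp: bounded_integrable_def)
  let ?E = "\<lambda>n x::real. exp (- x\<^sup>2 / (2 * (real (Suc n))\<^sup>2))"
  let ?f = "\<lambda>n x. ?E n x * (norm (fourier F x))\<^sup>2"
  let ?C = "2 * pi * (LINT x|lborel. norm (F x) * B)"
  have fi: "integrable lborel (?f n)" for n
  proof (rule Bochner_Integration.integrable_bound[OF integrable_mult_left[OF integrable_exp_square[of "real (Suc n)"], of "(LINT \<xi>|lborel. norm (F \<xi>))\<^sup>2"]])
    show "AE x in lborel. norm (?f n x) \<le> norm (?E n x * (LINT \<xi>|lborel. norm (F \<xi>))\<^sup>2)"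
      using power_mono[OF fourier_bound[OF F] norm_ge_zero] by (intro AE_I2) (simp add: abs_mult)
    show "(\<lambda>x. ?f n x) \<in> borel_measurable lborel" by measurable
  qed simp
  have fl: "(LINT x|lborel. ?f n x) \<le> ?C" for n
  proof -
    have i: "integrable lborel (\<lambda>x. cnj (F x))" using F by simp
    have "complex_of_real (LINT x|lborel. ?f n x) = (LINT x|lborel. of_real (?f n x))"
      by (rule integral_complex_of_real[symmetric])
    also have "\<dots> = (LINT x|lborel. 2 * of_real pi * (of_real (?E n x) * (ift (\<lambda>x. cnj (F x)) x * fourier F x)))"
    proof (intro Bochner_Integration.integral_cong refl)
      fix x
      have "of_real ((norm (fourier F x))\<^sup>2) = fourier F x * (2 * of_real pi * ift (\<lambda>x. cnj (F x)) x)"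
        by (simp only: complex_norm_square cnj_fourier)
      then show "of_real (?f n x) = 2 * of_real pi * (of_real (?E n x) * (ift (\<lambda>x. cnj (F x)) x * fourier F x))"
        by (simp only: of_real_mult mult_ac)
    qed
    also have "\<dots> = 2 * of_real pi * (LINT \<xi>|lborel. cnj (F \<xi>) * (LINT \<eta>|lborel. of_real (gauss_kernel (real (Suc n)) (\<eta> - \<xi>)) * F \<eta>))"
      by (subst integral_mult_right_zero, subst Gauss_Parseval[OF i F]) auto
    finally have "norm (complex_of_real (LINT x|lborel. ?f n x)) = norm (2 * of_real pi * (LINT \<xi>|lborel. cnj (F \<xi>) * (LINT \<eta>|lborel. of_real (gauss_kernel (real (Suc n)) (\<eta> - \<xi>)) * F \<eta>)))"
      by (rule arg_cong)
    then have "\<bar>LINT x|lborel. ?f n x\<bar> = norm (2 * of_real pi * (LINT \<xi>|lborel. cnj (F \<xi>) * (LINT \<eta>|lborel. of_real (gauss_kernel (real (Suc n)) (\<eta> - \<xi>)) * F \<eta>)))"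
      by (simp only: norm_of_real)
    also have "\<dots> \<le> ?C"
    proof -
      have "norm (LINT \<xi>|lborel. cnj (F \<xi>) * (LINT \<eta>|lborel. of_real (gauss_kernel (real (Suc n)) (\<eta> - \<xi>)) * F \<eta>)) \<le> (LINT x|lborel. norm (F x) * B)"
        by (rule norm_integral_le) (use F in \<open>auto simp: norm_mult intro!: mult_left_mono gauss_kernel_conv_bound B\<close>)
      then show ?thesis by (simp add: norm_mult)
    qed
    finally show ?thesis by simp
  qed
  show ?thesis
  proof (rule integrableI_bounded)
    have "(\<integral>\<^sup>+ x. ennreal (norm ((norm (fourier F x))\<^sup>2)) \<partial>lborel) = (\<integral>\<^sup>+ x. liminf (\<lambda>n. ennreal (?f n x)) \<partial>lborel)"
    proof (intro nn_integral_cong)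
      fix x
      have "(\<lambda>n. ennreal (?f n x)) \<longlonglongrightarrow> ennreal (1 * (norm (fourier F x))\<^sup>2)"
        by (intro tendsto_ennrealI tendsto_mult tendsto_const exp_square_tendsto)
      from lim_imp_Liminf[OF trivial_limit_sequentially this]
      show "ennreal (norm ((norm (fourier F x))\<^sup>2)) = liminf (\<lambda>n. ennreal (?f n x))" by simp
    qed
    also have "\<dots> \<le> liminf (\<lambda>n. \<integral>\<^sup>+ x. ennreal (?f n x) \<partial>lborel)"
      by (rule nn_integral_liminf) measurable
    also have "\<dots> \<le> ennreal ?C"
    proof (rule Liminf_le[OF trivial_limit_sequentially always_eventually], rule allI)
      fix n
      have "(\<integral>\<^sup>+ x. ennreal (?f n x) \<partial>lborel) = ennreal (LINT x|lborel. ?f n x)"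
        by (rule nn_integral_eq_integral[OF fi]) simp
      then show "(\<integral>\<^sup>+ x. ennreal (?f n x) \<partial>lborel) \<le> ennreal ?C"
        using ennreal_leI[OF fl[of n]] by simp
    qed
    also have "ennreal ?C < \<infinity>" by simp
    finally show "(\<integral>\<^sup>+ x. ennreal (norm ((norm (fourier F x))\<^sup>2)) \<partial>lborel) < \<infinity>" .
  qed measurable
qed

text \<open>The damping is removed on both sides of \<open>Gauss_Parseval\<close>: on the left by
  dominated convergence, as a product of two square integrable functions is integrable, and on the
  right because the Gaussian averages of \<open>F\<close> converge at every point of
  continuity.\<close>

lemma Parseval:
  assumes h: "bounded_integrable h" and F: "bounded_integrable F" and c: "\<And>x. isCont F x"
  shows "integrable lborel (\<lambda>x. ift h x * fourier F x)"
    and "(LINT x|lborel. ift h x * fourier F x) = (LINT \<xi>|lborel. h \<xi> * F \<xi>)"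
proof -
  have hi: "integrable lborel h" and Fi: "integrable lborel F" using h F by (auto simp: bounded_integrable_def)
  then have [measurable]: "h \<in> borel_measurable borel" "F \<in> borel_measurable borel" by auto
  obtain B where B: "\<And>x. norm (F x) \<le> B" using F by (auto simp: bounded_integrable_def)
  have s1: "integrable lborel (\<lambda>x. (norm (ift h x))\<^sup>2)"
    using fourier_square_integrable[OF bounded_integrable_reflect[OF h]]
    by (simp add: ift_fourier norm_divide power_divide)
  have s2: "integrable lborel (\<lambda>x. (norm (fourier F x))\<^sup>2)"
    by (rule fourier_square_integrable[OF F])
  show i: "integrable lborel (\<lambda>x. ift h x * fourier F x)"
  proof (rule Bochner_Integration.integrable_bound[OF Bochner_Integration.integrable_add[OF s1 s2]])
    have "a * b \<le> a\<^sup>2 + b\<^sup>2" if "a \<ge> 0" "b \<ge> 0" for a b :: real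
      using sum_squares_bound[of a b] mult_nonneg_nonneg[OF that] by linarith
    then show "AE x in lborel. norm (ift h x * fourier F x) \<le> norm ((norm (ift h x))\<^sup>2 + (norm (fourier F x))\<^sup>2)"
      by (intro AE_I2) (simp add: norm_mult)
  qed measurable
  let ?E = "\<lambda>n x::real. exp (- x\<^sup>2 / (2 * (real (Suc n))\<^sup>2))"
  have "(\<lambda>n. LINT x|lborel. of_real (?E n x) * (ift h x * fourier F x)) \<longlonglongrightarrow> (LINT x|lborel. ift h x * fourier F x)"
  proof (rule integral_dominated_convergence[where w="\<lambda>x. norm (ift h x * fourier F x)"])
    show "AE x in lborel. (\<lambda>n. of_real (?E n x) * (ift h x * fourier F x)) \<longlonglongrightarrow> ift h x * fourier F x"
    proof (intro AE_I2)
      fix x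
      have "(\<lambda>n. of_real (?E n x) * (ift h x * fourier F x)) \<longlonglongrightarrow> of_real 1 * (ift h x * fourier F x)"
        by (intro tendsto_mult tendsto_const tendsto_of_real exp_square_tendsto)
      then show "(\<lambda>n. of_real (?E n x) * (ift h x * fourier F x)) \<longlonglongrightarrow> ift h x * fourier F x" by simp
    qed
    show "integrable lborel (\<lambda>x. norm (ift h x * fourier F x))" using i by (rule integrable_norm)
  qed (auto simp: norm_mult mult_left_le_one_le)
  moreover have "(\<lambda>n. LINT \<xi>|lborel. h \<xi> * (LINT \<eta>|lborel. of_real (gauss_kernel (real (Suc n)) (\<eta> - \<xi>)) * F \<eta>)) \<longlonglongrightarrow> (LINT \<xi>|lborel. h \<xi> * F \<xi>)"
  proof (rule integral_dominated_convergence[where w="\<lambda>x. norm (h x) * B"])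
    show "AE \<xi> in lborel. (\<lambda>n. h \<xi> * (LINT \<eta>|lborel. of_real (gauss_kernel (real (Suc n)) (\<eta> - \<xi>)) * F \<eta>)) \<longlonglongrightarrow> h \<xi> * F \<xi>"
      by (intro AE_I2 tendsto_mult tendsto_const gauss_kernel_conv_tendsto[OF _ B c]) auto
    show "AE x in lborel. norm (h x * (LINT \<eta>|lborel. of_real (gauss_kernel (real (Suc n)) (\<eta> - x)) * F \<eta>)) \<le> norm (h x) * B" for n
      unfolding norm_mult by (intro AE_I2 mult_left_mono gauss_kernel_conv_bound B) auto
  qed (use hi in auto)
  moreover have "(LINT x|lborel. of_real (?E n x) * (ift h x * fourier F x)) = (LINT \<xi>|lborel. h \<xi> * (LINT \<eta>|lborel. of_real (gauss_kernel (real (Suc n)) (\<eta> - \<xi>)) * F \<eta>))" for n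
    by (rule Gauss_Parseval[OF hi Fi]) auto
  ultimately show "(LINT x|lborel. ift h x * fourier F x) = (LINT \<xi>|lborel. h \<xi> * F \<xi>)"
    using LIMSEQ_unique by auto
qed

lemma integrable_inverse_1_plus_square': "integrable lborel (\<lambda>x::real. 1 / (1 + x\<^sup>2))"
  using integrable_inverse_1_plus_square by (simp add: set_integrable_def inverse_eq_divide)

section \<open>Gaussian test functions\<close>

text \<open>The power is at most a factorial times \<open>exp \<bar>x\<bar>\<close>; after that a
  linear term minus \<open>c * x\<^sup>2\<close> is bounded by completing the square.\<close>

lemma power_exp_bound:
  fixes a c :: real
  assumes c: "c > 0"
  shows "\<exists>B. \<forall>x::real. \<bar>x\<bar> ^ i * exp (a * x - c * x\<^sup>2) \<le> B"
proof (intro exI allI)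
  fix x :: real
  have s: "summable (\<lambda>n. \<bar>x\<bar> ^ n /\<^sub>R fact n)" by (rule summable_exp_generic)
  have "\<bar>x\<bar> ^ i /\<^sub>R fact i \<le> exp \<bar>x\<bar>"
    unfolding exp_def using sum_le_suminf[OF s, of "{i}"] by simp
  then have p: "\<bar>x\<bar> ^ i \<le> fact i * exp \<bar>x\<bar>"
    by (simp add: divide_simps mult.commute)
  define k where "k = 1 + \<bar>a\<bar>"
  have "0 \<le> (2 * c * \<bar>x\<bar> - k)\<^sup>2" by simp
  then have "4 * c * (k * \<bar>x\<bar> - c * x\<^sup>2) \<le> k\<^sup>2"
    by (simp add: power2_eq_square algebra_simps flip: abs_mult)
  then have q: "k * \<bar>x\<bar> - c * x\<^sup>2 \<le> k\<^sup>2 / (4 * c)"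
    using c by (simp add: field_simps)
  have "a * x \<le> \<bar>a\<bar> * \<bar>x\<bar>" by (metis abs_ge_self abs_mult)
  then have "\<bar>x\<bar> + (a * x - c * x\<^sup>2) \<le> k\<^sup>2 / (4 * c)" using q by (simp add: k_def algebra_simps)
  then have "exp \<bar>x\<bar> * exp (a * x - c * x\<^sup>2) \<le> exp (k\<^sup>2 / (4 * c))" by (simp flip: exp_add)
  moreover have "\<bar>x\<bar> ^ i * exp (a * x - c * x\<^sup>2) \<le> (fact i * exp \<bar>x\<bar>) * exp (a * x - c * x\<^sup>2)"
    by (intro mult_right_mono p) simp
  ultimately show "\<bar>x\<bar> ^ i * exp (a * x - c * x\<^sup>2) \<le> fact i * exp ((1 + \<bar>a\<bar>)\<^sup>2 / (4 * c))"
  proof -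
    assume 1: "exp \<bar>x\<bar> * exp (a * x - c * x\<^sup>2) \<le> exp (k\<^sup>2 / (4 * c))"
      and 2: "\<bar>x\<bar> ^ i * exp (a * x - c * x\<^sup>2) \<le> (fact i * exp \<bar>x\<bar>) * exp (a * x - c * x\<^sup>2)"
    note 2
    also have "(fact i * exp \<bar>x\<bar>) * exp (a * x - c * x\<^sup>2) = fact i * (exp \<bar>x\<bar> * exp (a * x - c * x\<^sup>2))"
      by (rule mult.assoc)
    also have "\<dots> \<le> fact i * exp (k\<^sup>2 / (4 * c))" by (intro mult_left_mono 1) simp
    finally show ?thesis unfolding k_def .
  qed
qed

text \<open>A class closed under differentiation, so that the Schwartz property is checked once for
  all derivatives. It contains the Gaussian test functions (real \<open>\<alpha>\<close>) as well as
  their Fourier transforms (imaginary \<open>\<alpha>\<close>).\<close>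

definition poly_gauss :: "complex poly \<Rightarrow> complex \<Rightarrow> real \<Rightarrow> real \<Rightarrow> complex" where
  "poly_gauss p \<alpha> c x = poly p (of_real x) * exp (\<alpha> * of_real x - of_real c * (of_real x)\<^sup>2)"

lemma poly_gauss_deriv:
  "(poly_gauss p \<alpha> c has_vector_derivative poly_gauss (pderiv p + p * [:\<alpha>, - 2 * of_real c:]) \<alpha> c x) (at x)"
proof -
  have "((\<lambda>z. poly p z * exp (\<alpha> * z - of_real c * z\<^sup>2)) has_field_derivative
     poly (pderiv p + p * [:\<alpha>, - 2 * of_real c:]) (of_real x) * exp (\<alpha> * of_real x - of_real c * (of_real x)\<^sup>2)) (at (of_real x))"
    by (auto intro!: derivative_eq_intros poly_DERIV simp: algebra_simps)
  from has_vector_derivative_real_field[OF this] show ?thesis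
    unfolding poly_gauss_def[abs_def] by simp
qed

lemma vderiv_poly_gauss: "vderiv (poly_gauss p \<alpha> c) = poly_gauss (pderiv p + p * [:\<alpha>, - 2 * of_real c:]) \<alpha> c"
  unfolding vderiv_def using vector_derivative_at[OF poly_gauss_deriv] by auto

lemma vderiv_iter_poly_gauss: "\<exists>q. (vderiv ^^ n) (poly_gauss p \<alpha> c) = poly_gauss q \<alpha> c"
proof (induction n)
  case (Suc n)
  then obtain q where "(vderiv ^^ n) (poly_gauss p \<alpha> c) = poly_gauss q \<alpha> c" by auto
  then show ?case using vderiv_poly_gauss[of q \<alpha> c] by auto
qed auto

lemma poly_gauss_bounded:
  assumes c: "c > 0"
  shows "bounded (range (\<lambda>x. x ^ k *\<^sub>R poly_gauss p \<alpha> c x))"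
proof -
  have nE: "norm (exp (\<alpha> * of_real x - of_real c * (of_real x)\<^sup>2)) = exp (Re \<alpha> * x - c * x\<^sup>2)" for x :: real
    by (simp add: norm_exp_eq_Re power2_eq_square)
  have "\<forall>i. \<exists>B. \<forall>x. \<bar>x\<bar> ^ i * exp (Re \<alpha> * x - c * x\<^sup>2) \<le> B" using power_exp_bound[OF c] by blast
  then obtain B where B: "\<And>i x. \<bar>x\<bar> ^ i * exp (Re \<alpha> * x - c * x\<^sup>2) \<le> B i" by metis
  have "norm (x ^ k *\<^sub>R poly_gauss p \<alpha> c x) \<le> (\<Sum>i\<le>degree p. norm (coeff p i) * B (k + i))" for x
  proof -
    have "norm (x ^ k *\<^sub>R poly_gauss p \<alpha> c x) = \<bar>x\<bar> ^ k * norm (\<Sum>i\<le>degree p. coeff p i * of_real x ^ i) * exp (Re \<alpha> * x - c * x\<^sup>2)"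
      by (simp add: poly_gauss_def poly_altdef norm_mult nE power_abs)
    also have "\<dots> \<le> \<bar>x\<bar> ^ k * (\<Sum>i\<le>degree p. norm (coeff p i) * \<bar>x\<bar> ^ i) * exp (Re \<alpha> * x - c * x\<^sup>2)"
      by (intro mult_right_mono mult_left_mono order_trans[OF norm_sum] sum_mono) (auto simp: norm_mult norm_power)
    also have "\<dots> = (\<Sum>i\<le>degree p. norm (coeff p i) * (\<bar>x\<bar> ^ (k + i) * exp (Re \<alpha> * x - c * x\<^sup>2)))"
      by (simp add: sum_distrib_left sum_distrib_right power_add mult_ac)
    also have "\<dots> \<le> (\<Sum>i\<le>degree p. norm (coeff p i) * B (k + i))"
      by (intro sum_mono mult_left_mono B) auto
    finally show ?thesis .
  qed
  then show ?thesis unfolding bounded_iff by blast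
qed

lemma schwartz_poly_gauss:
  assumes "c > 0"
  shows "schwartz (poly_gauss p \<alpha> c)"
  unfolding schwartz_def
proof (intro conjI allI)
  fix n k x
  obtain q where q: "(vderiv ^^ n) (poly_gauss p \<alpha> c) = poly_gauss q \<alpha> c" using vderiv_iter_poly_gauss by blast
  show "(vderiv ^^ n) (poly_gauss p \<alpha> c) differentiable at x"
    unfolding q using poly_gauss_deriv[of q \<alpha> c x] by (auto simp: differentiable_def has_vector_derivative_def)
  show "bounded (range (\<lambda>x. x ^ k *\<^sub>R (vderiv ^^ n) (poly_gauss p \<alpha> c) x))"
    unfolding q by (rule poly_gauss_bounded[OF assms])
qed

text \<open>Integrating \<open>D\<close> against \<open>test_gauss n a\<close> convolves \<open>D \<xi> * exp (- \<xi>\<^sup>2)\<close> with an approximate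
  identity; the extra factor makes this function integrable.\<close>

definition test_gauss :: "real \<Rightarrow> real \<Rightarrow> real \<Rightarrow> complex" where
  "test_gauss n a \<xi> = of_real (gauss_kernel n (a - \<xi>) * exp (- \<xi>\<^sup>2))"

lemma poly_gauss_real: "poly_gauss [:of_real C:] (of_real a) c x = of_real (C * exp (a * x - c * x\<^sup>2))"
proof -
  have "exp (of_real a * of_real x - of_real c * (of_real x)\<^sup>2) = complex_of_real (exp (a * x - c * x\<^sup>2))"
    by (simp only: exp_of_real[symmetric] of_real_diff of_real_mult of_real_power)
  then show ?thesis by (simp add: poly_gauss_def)
qed

lemma test_gauss_eq: "test_gauss n a = poly_gauss [:of_real (n / sqrt (2 * pi) * exp (- (n\<^sup>2 * a\<^sup>2 / 2))):] (of_real (n\<^sup>2 * a)) (n\<^sup>2 / 2 + 1)"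
proof
  fix \<xi> :: real
  have "exp (- (n * (a - \<xi>))\<^sup>2 / 2) * exp (- \<xi>\<^sup>2) = exp (- (n\<^sup>2 * a\<^sup>2 / 2)) * exp (n\<^sup>2 * a * \<xi> - (n\<^sup>2 / 2 + 1) * \<xi>\<^sup>2)"
    unfolding exp_add[symmetric] by (simp add: power2_eq_square field_simps)
  then have "gauss_kernel n (a - \<xi>) * exp (- \<xi>\<^sup>2) = n / sqrt (2 * pi) * exp (- (n\<^sup>2 * a\<^sup>2 / 2)) * exp (n\<^sup>2 * a * \<xi> - (n\<^sup>2 / 2 + 1) * \<xi>\<^sup>2)"
    unfolding gauss_kernel_def std_normal_density_def by (simp add: mult.assoc)
  then show "test_gauss n a \<xi> = poly_gauss [:of_real (n / sqrt (2 * pi) * exp (- (n\<^sup>2 * a\<^sup>2 / 2))):] (of_real (n\<^sup>2 * a)) (n\<^sup>2 / 2 + 1) \<xi>"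
    unfolding test_gauss_def poly_gauss_real by simp
qed

lemma schwartz_test_gauss: "schwartz (test_gauss n a)"
  unfolding test_gauss_eq by (rule schwartz_poly_gauss) (simp add: add_nonneg_pos)

text \<open>Completing the square exhibits the test function as a Gaussian with centre
  \<open>b\<close> and width \<open>N\<close>; shifting by \<open>b\<close> leaves the transform of
  a centred Gaussian times a phase. The explicit form shows that the transform is again a Schwartz
  function, as the argument about real-valued distributions requires.\<close>

lemma fourier_test_gauss:
  fixes n a :: real
  shows "\<exists>C b k. k > 0 \<and> fourier (test_gauss n a) = poly_gauss [:C:] (\<i> * of_real b) k"
proof -
  define c where "c = n\<^sup>2 / 2 + 1"
  define b where "b = n\<^sup>2 * a / (2 * c)"
  define K where "K = n / sqrt (2 * pi) * exp (- (n\<^sup>2 * a\<^sup>2 / 2)) * exp (c * b\<^sup>2)"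
  define N where "N = 1 / sqrt (2 * c)"
  have c: "c > 0" by (simp add: c_def add_nonneg_pos)
  then have N: "N > 0" by (simp add: N_def)
  have N2: "2 * N\<^sup>2 = 1 / c" using c by (simp add: N_def power_divide)
  have t: "test_gauss n a (b + 1 * y) = of_real K * of_real (exp (- y\<^sup>2 / (2 * N\<^sup>2)))" for y
  proof -
    have e: "n\<^sup>2 * a = 2 * c * b" using c by (simp add: b_def)
    have "exp (n\<^sup>2 * a * (b + y) - c * (b + y)\<^sup>2) = exp (c * b\<^sup>2) * exp (- y\<^sup>2 / (2 * N\<^sup>2))"
      unfolding exp_add[symmetric] e N2 by (simp add: power2_eq_square algebra_simps)
    then have "of_real (n / sqrt (2 * pi) * exp (- (n\<^sup>2 * a\<^sup>2 / 2))) * complex_of_real (exp (n\<^sup>2 * a * (b + y) - c * (b + y)\<^sup>2))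
       = of_real K * of_real (exp (- y\<^sup>2 / (2 * N\<^sup>2)))"
      unfolding K_def by (simp only: of_real_mult mult.assoc)
    then show ?thesis
      unfolding test_gauss_eq poly_gauss_real c_def[symmetric] by simp
  qed
  have "fourier (test_gauss n a) x = poly_gauss [:of_real (K * N * sqrt (2 * pi)):] (\<i> * of_real (- b)) (N\<^sup>2 / 2) x" for x
  proof -
    have "fourier (test_gauss n a) x = \<bar>1\<bar> *\<^sub>R (LINT y|lborel. exp (- \<i> * of_real ((b + 1 * y) * x)) * test_gauss n a (b + 1 * y))"
      unfolding fourier_def by (rule lborel_integral_real_affine) simp
    also have "\<dots> = (LINT y|lborel. (of_real K * exp (- \<i> * of_real (b * x))) * (exp (\<i> * of_real (y * (- x))) * of_real (exp (- y\<^sup>2 / (2 * N\<^sup>2)))))"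
    proof -
      have "exp (- \<i> * of_real ((b + 1 * y) * x)) = exp (- \<i> * of_real (b * x)) * exp (\<i> * of_real (y * (- x)))" for y
        unfolding exp_add[symmetric] by (simp add: algebra_simps)
      then show ?thesis unfolding t by (simp add: mult_ac)
    qed
    also have "\<dots> = (of_real K * exp (- \<i> * of_real (b * x))) * (2 * of_real pi * of_real (gauss_kernel N (- x)))"
      by (subst integral_mult_right_zero, subst gauss_kernel_fourier[OF N]) simp
    also have "\<dots> = of_real (K * (2 * pi * gauss_kernel N (-x))) * exp (- \<i> * of_real (b * x))" by simp
    also have "2 * pi * gauss_kernel N (-x) = N * sqrt (2 * pi) * exp (- (N\<^sup>2 / 2 * x\<^sup>2))"
      unfolding gauss_kernel_def std_normal_density_def by (simp add: field_simps)
    also have "of_real (K * (N * sqrt (2 * pi) * exp (- (N\<^sup>2 / 2 * x\<^sup>2)))) * exp (- \<i> * of_real (b * x))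
       = of_real (K * N * sqrt (2 * pi)) * (exp (- \<i> * of_real (b * x)) * exp (of_real (- (N\<^sup>2 / 2 * x\<^sup>2))))"
      by (simp only: exp_of_real of_real_mult mult_ac)
    also have "exp (- \<i> * of_real (b * x)) * exp (of_real (- (N\<^sup>2 / 2 * x\<^sup>2))) = exp (\<i> * of_real (- b) * of_real x - of_real (N\<^sup>2 / 2) * (of_real x)\<^sup>2)"
      unfolding exp_add[symmetric] by (simp add: mult.assoc)
    finally show ?thesis by (simp add: poly_gauss_def)
  qed
  then show ?thesis using N by (intro exI[of _ "of_real (K * N * sqrt (2 * pi))"] exI[of _ "- b"] exI[of _ "N\<^sup>2 / 2"]) auto
qed

lemma schwartz_fourier_test_gauss: "schwartz (fourier (test_gauss n a))"
  using fourier_test_gauss[of n a] schwartz_poly_gauss by metis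

lemma schwartz_cnj_fourier_test_gauss: "schwartz (\<lambda>x. cnj (fourier (test_gauss n a) x))"
proof -
  obtain C b k where k: "k > 0" and f: "fourier (test_gauss n a) = poly_gauss [:C:] (\<i> * of_real b) k"
    using fourier_test_gauss by blast
  have "(\<lambda>x. cnj (fourier (test_gauss n a) x)) = poly_gauss [:cnj C:] (\<i> * of_real (- b)) k"
    unfolding f poly_gauss_def by (simp add: exp_cnj)
  then show ?thesis using schwartz_poly_gauss[OF k] by simp
qed

section \<open>Decay of Schwartz functions, Sobolev weights and uniqueness of transforms\<close>

lemma schwartz_isCont: "schwartz f \<Longrightarrow> isCont f x"
  unfolding schwartz_def by (metis (no_types, lifting) differentiable_imp_continuous_within funpow_0)

lemma schwartz_measurable: "schwartz f \<Longrightarrow> f \<in> borel_measurable borel"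
  by (intro borel_measurable_continuous_onI continuous_at_imp_continuous_on ballI schwartz_isCont)

lemma schwartz_seminorm_upper:
  assumes "schwartz f"
  shows "norm (x ^ k *\<^sub>R (vderiv ^^ n) f x) \<le> schwartz_seminorm k n f"
proof -
  have "bounded (range (\<lambda>x. x ^ k *\<^sub>R (vderiv ^^ n) f x))" using assms by (auto simp: schwartz_def)
  then have "bdd_above (range (\<lambda>x. norm (x ^ k *\<^sub>R (vderiv ^^ n) f x)))"
    by (auto simp: bounded_iff bdd_above_def)
  then show ?thesis unfolding schwartz_seminorm_def by (rule cSUP_upper[OF UNIV_I])
qed

lemma schwartz_seminorm_nonneg: "schwartz f \<Longrightarrow> 0 \<le> schwartz_seminorm k n f"
  using schwartz_seminorm_upper norm_ge_zero by (rule order_trans[rotated])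

text \<open>The function 1 / (1 + x^2) serves as the common majorant in all that follows; two
  seminorms control it.\<close>

lemma schwartz_decay:
  assumes "schwartz f"
  shows "norm (f x) \<le> (schwartz_seminorm 0 0 f + schwartz_seminorm 2 0 f) * (1 / (1 + x\<^sup>2))"
proof -
  have "norm (f x) * (1 + x\<^sup>2) \<le> schwartz_seminorm 0 0 f + schwartz_seminorm 2 0 f"
    using schwartz_seminorm_upper[OF assms, of x 0 0] schwartz_seminorm_upper[OF assms, of x 2 0]
    by (simp add: algebra_simps)
  then show ?thesis by (simp add: field_simps add_pos_nonneg)
qed

lemma integrable_of_decay:
  assumes [measurable]: "f \<in> borel_measurable borel" and f: "\<And>x. norm (f x :: complex) \<le> C * (1 / (1 + x\<^sup>2))"
  shows "integrable lborel f"
  by (rule Bochner_Integration.integrable_bound[OF integrable_mult_right[OF integrable_inverse_1_plus_square', of C]])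
    (use f in \<open>auto intro!: AE_I2 order_trans[OF f abs_ge_self] simp del: times_divide_eq_right mult_1_right\<close>)

lemma decay_bound:
  assumes f: "\<And>x::real. norm (f x :: complex) \<le> C * (1 / (1 + x\<^sup>2))"
  shows "norm (f x) \<le> C" "C \<ge> 0"
proof -
  show C: "C \<ge> 0" using order_trans[OF norm_ge_zero f[of 0]] by simp
  have "C * (1 / (1 + x\<^sup>2)) \<le> C * 1" by (intro mult_left_mono C) (simp add: divide_le_eq add_pos_nonneg)
  then show "norm (f x) \<le> C" using f[of x] by simp
qed

lemma bounded_integrable_of_decay:
  assumes [measurable]: "f \<in> borel_measurable borel" and f: "\<And>x. norm (f x :: complex) \<le> C * (1 / (1 + x\<^sup>2))"
  shows "bounded_integrable f"
  unfolding bounded_integrable_def using integrable_of_decay[OF assms] decay_bound[OF f] by blast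

lemma schwartz_bounded_integrable: "schwartz f \<Longrightarrow> bounded_integrable f"
  using bounded_integrable_of_decay schwartz_measurable schwartz_decay by blast

lemma japanese_ge_1: "japanese \<xi> \<ge> 1"
  by (simp add: japanese_def)

text \<open>For exponents of modulus at most 1/2, the weight and its inverse are both dominated by 1
  + x^2. This is the reason for the restriction on \<open>s\<close> below, which covers the two
  exponents of the problem.\<close>

lemma japanese_powr_le:
  assumes "\<bar>s\<bar> \<le> 1/2"
  shows "japanese \<xi> powr (2 * s) \<le> 1 + \<xi>\<^sup>2"
proof -
  have "japanese \<xi> powr (2 * s) \<le> japanese \<xi> powr 1" using assms japanese_ge_1 by (intro powr_mono) auto
  also have "\<dots> \<le> japanese \<xi> * japanese \<xi>" using mult_left_mono[OF japanese_ge_1[of \<xi>], of "japanese \<xi>"] japanese_ge_1[of \<xi>] by simp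
  also have "\<dots> = 1 + \<xi>\<^sup>2" by (simp add: japanese_def add_nonneg_nonneg)
  finally show ?thesis .
qed

lemma japanese_measurable[measurable]: "japanese \<in> borel_measurable borel"
  unfolding japanese_def[abs_def] by measurable

lemma japanese_powr_pos[simp]: "japanese \<xi> powr a > 0"
  using japanese_ge_1[of \<xi>] by (simp add: powr_gt_zero)

text \<open>Young's inequality splits the product between the weight \<open>J\<close> and its
  inverse: 2 |g f| is at most J |g|^2 + |f|^2 / J, and 1 / J is the weight of exponent - s.\<close>

lemma weighted_integrable:
  assumes s: "\<bar>s\<bar> \<le> 1/2" and [measurable]: "g \<in> borel_measurable borel" "f \<in> borel_measurable borel"
    and g: "integrable lborel (\<lambda>\<xi>. japanese \<xi> powr (2 * s) * (norm (g \<xi> :: complex))\<^sup>2)"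
    and f: "\<And>x. norm (f x :: complex) \<le> C * (1 / (1 + x\<^sup>2))"
  shows "integrable lborel (\<lambda>x. g x * f x)"
proof (rule Bochner_Integration.integrable_bound)
  show "integrable lborel (\<lambda>\<xi>. japanese \<xi> powr (2 * s) * (norm (g \<xi>))\<^sup>2 + C\<^sup>2 * (1 / (1 + \<xi>\<^sup>2)))"
    by (intro Bochner_Integration.integrable_add g integrable_mult_right integrable_inverse_1_plus_square')
  show "AE x in lborel. norm (g x * f x) \<le> norm (japanese x powr (2 * s) * (norm (g x))\<^sup>2 + C\<^sup>2 * (1 / (1 + x\<^sup>2)))"
  proof (intro AE_I2)
    fix x :: real
    define J where "J = japanese x powr (2 * s)"
    have J: "J > 0" unfolding J_def by (rule japanese_powr_pos)
    have "japanese x \<noteq> 0" using japanese_ge_1[of x] by linarith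
    then have "1 / J = japanese x powr (2 * (- s))" by (simp add: J_def powr_minus_divide)
    also have "\<dots> \<le> 1 + x\<^sup>2" using s by (intro japanese_powr_le) auto
    finally have J1: "1 / J \<le> 1 + x\<^sup>2" .
    have "(norm (f x))\<^sup>2 \<le> (C * (1 / (1 + x\<^sup>2)))\<^sup>2" by (intro power_mono f) auto
    then have "1 / J * (norm (f x))\<^sup>2 \<le> (1 + x\<^sup>2) * (C * (1 / (1 + x\<^sup>2)))\<^sup>2"
      by (intro mult_mono J1) (use J in auto)
    also have "\<dots> = C\<^sup>2 * (1 / (1 + x\<^sup>2))"
      using add_pos_nonneg[of 1 "x\<^sup>2"] by (simp add: power_mult_distrib power_divide power2_eq_square[of "1 + x\<^sup>2"])
    finally have 2: "1 / J * (norm (f x))\<^sup>2 \<le> C\<^sup>2 * (1 / (1 + x\<^sup>2))" .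
    have "0 \<le> (J * norm (g x) - norm (f x))\<^sup>2 / J" using J by simp
    also have "\<dots> = J * (norm (g x))\<^sup>2 - 2 * (norm (g x) * norm (f x)) + 1 / J * (norm (f x))\<^sup>2"
      using J by (simp add: power2_eq_square field_simps)
    finally have "norm (g x) * norm (f x) \<le> J * (norm (g x))\<^sup>2 + C\<^sup>2 * (1 / (1 + x\<^sup>2))"
      using 2 mult_nonneg_nonneg[OF norm_ge_zero[of "g x"] norm_ge_zero[of "f x"]] by linarith
    then show "norm (g x * f x) \<le> norm (japanese x powr (2 * s) * (norm (g x))\<^sup>2 + C\<^sup>2 * (1 / (1 + x\<^sup>2)))"
      unfolding J_def norm_mult real_norm_def by (rule order_trans) (rule abs_ge_self)
  qed
qed measurable

text \<open>The sets over which \<open>D\<close> integrates to zero contain the compact intervals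
  and are closed under countable disjoint unions. Closure under complements needs the integral over
  the whole line, which vanishes by exhaustion with growing intervals.\<close>

lemma set_integral_intervals_zero:
  fixes D :: "real \<Rightarrow> complex"
  assumes D: "integrable lborel D" and I: "\<And>a b. a \<le> b \<Longrightarrow> (LINT x:{a..b}|lborel. D x) = 0"
  shows "AE x in lborel. D x = 0"
proof (rule sigma_finite_measure.density_zero[OF lborel.sigma_finite_measure_axioms D])
  have si: "A \<in> sets borel \<Longrightarrow> set_integrable lborel A D" for A
    unfolding set_integrable_def using D by (intro integrable_mult_indicator) auto
  have "(\<lambda>n. LINT x:{- real n..real n}|lborel. D x) \<longlonglongrightarrow> (LINT x:(\<Union>n::nat. {- real n..real n})|lborel. D x)"
    by (intro set_integral_cont_up si) (auto simp: incseq_def)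
  moreover have "(\<Union>n::nat. {- real n..real n}) = UNIV"
  proof -
    have "\<exists>n. x \<in> {- real n..real n}" for x
    proof -
      obtain n where "\<bar>x\<bar> \<le> real n" using real_arch_simple by blast
      then have "x \<in> {- real n..real n}" by (simp add: abs_le_iff minus_le_iff)
      then show ?thesis by blast
    qed
    then show ?thesis by blast
  qed
  ultimately have tot: "(LINT x|lborel. D x) = 0"
    using I by (simp add: set_lebesgue_integral_def LIMSEQ_const_iff)
  fix A :: "real set" assume "A \<in> sets lborel"
  then have "A \<in> sets borel" by simp
  then show "(LINT x:A|lborel. D x) = 0"
  proof (induction rule: borel_set_induct)
    case (compl A)
    have "(LINT x:(A \<union> -A)|lborel. D x) = (LINT x:A|lborel. D x) + (LINT x:-A|lborel. D x)"
      using compl by (intro set_integral_Un si) auto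
    then show ?case using compl tot by (simp add: set_lebesgue_integral_def)
  next
    case (union f)
    then show ?case
      by (subst lebesgue_integral_countable_add) (auto simp: disjoint_family_on_def intro!: si)
  next
    case empty
    show ?case by (simp add: set_lebesgue_integral_def)
  next
    case (interval a b)
    then show ?case by (rule I)
  qed
qed

lemma gauss_kernel_le: assumes "n > 0" shows "gauss_kernel n z \<le> n"
proof -
  have "std_normal_density (n * z) \<le> 1 * 1"
    unfolding std_normal_density_def using pi_gt3 by (intro mult_mono) (auto simp: real_le_rsqrt)
  then show ?thesis using assms by (simp add: gauss_kernel_def)
qed

text \<open>Integrating the hypothesis over \<open>a\<close> in an interval and exchanging the
  integrals gives the indicator of the interval, smeared by an approximate identity and tested
  against \<open>E\<close>. In the limit \<open>E\<close> integrates to zero over every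
  interval.\<close>

lemma gauss_unique:
  assumes s: "\<bar>s\<bar> \<le> 1/2" and D[measurable]: "D \<in> borel_measurable borel"
    and Di: "integrable lborel (\<lambda>\<xi>. japanese \<xi> powr (2 * s) * (norm (D \<xi> :: complex))\<^sup>2)"
    and z: "\<And>n a. (LINT \<xi>|lborel. D \<xi> * test_gauss n a \<xi>) = 0"
  shows "AE x in lborel. D x = 0"
proof -
  define E where "E x = D x * of_real (exp (- x\<^sup>2))" for x
  have "norm (complex_of_real (exp (- x\<^sup>2))) \<le> 1 * (1 / (1 + x\<^sup>2))" for x :: real
  proof -
    have "exp (- x\<^sup>2) \<le> 1 / (1 + x\<^sup>2)"
      using exp_ge_add_one_self[of "x\<^sup>2"] by (simp add: exp_minus divide_inverse le_imp_inverse_le add_pos_nonneg)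
    then show ?thesis by (simp only: norm_of_real abs_exp_cancel mult_1)
  qed
  then have Ei: "integrable lborel E" unfolding E_def[abs_def]
    by (intro weighted_integrable[OF s D _ Di]) auto
  then have [measurable]: "E \<in> borel_measurable borel" by auto
  have "(LINT x:{a..b}|lborel. E x) = 0" if ab: "a \<le> b" for a b
  proof -
    define F :: "real \<Rightarrow> complex" where "F = indicator {a..b}"
    have Fm[measurable]: "F \<in> borel_measurable borel" unfolding F_def by measurable
    have FB: "norm (F x) \<le> 1" for x by (auto simp: F_def indicator_def)
    have Fi: "integrable lborel (\<lambda>x. norm (F x))"
    proof -
      have "(\<lambda>x. norm (F x)) = indicator {a..b}" by (auto simp: F_def indicator_def fun_eq_iff)
      moreover have "integrable lborel (indicat_real {a..b})" by (rule integrable_real_indicator) (use ab in auto)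
      ultimately show ?thesis by simp
    qed
    have 0: "(LINT \<xi>|lborel. E \<xi> * (LINT \<eta>|lborel. of_real (gauss_kernel (real (Suc n)) (\<eta> - \<xi>)) * F \<eta>)) = 0" for n
    proof -
      have "(LINT \<xi>|lborel. E \<xi> * (LINT \<eta>|lborel. of_real (gauss_kernel (real (Suc n)) (\<eta> - \<xi>)) * F \<eta>))
         = (LINT \<xi>|lborel. (LINT \<eta>|lborel. E \<xi> * (of_real (gauss_kernel (real (Suc n)) (\<eta> - \<xi>)) * F \<eta>)))"
        by simp
      also have "\<dots> = (LINT \<eta>|lborel. (LINT \<xi>|lborel. E \<xi> * (of_real (gauss_kernel (real (Suc n)) (\<eta> - \<xi>)) * F \<eta>)))"
      proof (rule Fubini_dominated(2))
        show "integrable lborel (\<lambda>\<xi>. norm (E \<xi>) * real (Suc n))" using Ei by simp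
        show "integrable lborel (\<lambda>x. norm (F x))" by (rule Fi)
        fix x y
        have "gauss_kernel (real (Suc n)) (y - x) \<le> real (Suc n)" "gauss_kernel (real (Suc n)) (y - x) \<ge> 0"
          by (rule gauss_kernel_le, simp, rule gauss_kernel_nonneg, simp)
        then show "norm (E x * (of_real (gauss_kernel (real (Suc n)) (y - x)) * F y)) \<le> norm (E x) * real (Suc n) * norm (F y)"
          unfolding norm_mult norm_of_real mult.assoc
          by (intro mult_left_mono mult_right_mono) auto
      qed measurable
      also have "\<dots> = (LINT \<eta>|lborel. F \<eta> * (LINT \<xi>|lborel. D \<xi> * test_gauss (real (Suc n)) \<eta> \<xi>))"
        by (subst integral_mult_right_zero[symmetric]) (simp add: E_def test_gauss_def mult_ac)
      finally show ?thesis by (simp add: z)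
    qed
    have "(\<lambda>n. LINT \<xi>|lborel. E \<xi> * (LINT \<eta>|lborel. of_real (gauss_kernel (real (Suc n)) (\<eta> - \<xi>)) * F \<eta>)) \<longlonglongrightarrow> (LINT \<xi>|lborel. E \<xi> * F \<xi>)"
    proof (rule integral_dominated_convergence[where w="\<lambda>x. norm (E x) * 1"])
      \<comment> \<open>The smeared indicator converges except possibly at the two endpoints, a null
        set.\<close>
      have "AE \<xi> in lborel. \<xi> \<noteq> a \<and> \<xi> \<noteq> b"
        using AE_lborel_singleton[of a] AE_lborel_singleton[of b] by eventually_elim auto
      then show "AE \<xi> in lborel. (\<lambda>n. E \<xi> * (LINT \<eta>|lborel. of_real (gauss_kernel (real (Suc n)) (\<eta> - \<xi>)) * F \<eta>)) \<longlonglongrightarrow> E \<xi> * F \<xi>"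
      proof eventually_elim
        fix \<xi> assume x: "\<xi> \<noteq> a \<and> \<xi> \<noteq> b"
        have "\<xi> \<notin> frontier {a..b}" using x ab by (auto simp: frontier_def)
        then have "isCont F \<xi>"
        proof -
          consider "\<xi> \<in> {a<..<b}" | "\<xi> \<in> - {a..b}" using x by fastforce
          then show ?thesis
          proof cases
            case 1
            then have "eventually (\<lambda>y. y \<in> {a<..<b}) (nhds \<xi>)" by (intro eventually_nhds_in_open) auto
            then have "eventually (\<lambda>y. F y = 1) (nhds \<xi>)" by eventually_elim (auto simp: F_def)
            then show ?thesis using isCont_cong[of F "\<lambda>_. 1" \<xi>] by simp
          next
            case 2
            then have "eventually (\<lambda>y. y \<in> - {a..b}) (nhds \<xi>)" by (intro eventually_nhds_in_open) auto
            then have "eventually (\<lambda>y. F y = 0) (nhds \<xi>)" by eventually_elim (auto simp: F_def)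
            then show ?thesis using isCont_cong[of F "\<lambda>_. 0" \<xi>] by simp
          qed
        qed
        then show "(\<lambda>n. E \<xi> * (LINT \<eta>|lborel. of_real (gauss_kernel (real (Suc n)) (\<eta> - \<xi>)) * F \<eta>)) \<longlonglongrightarrow> E \<xi> * F \<xi>"
          by (intro tendsto_mult tendsto_const gauss_kernel_conv_tendsto[OF Fm FB])
      qed
      show "AE x in lborel. norm (E x * (LINT \<eta>|lborel. of_real (gauss_kernel (real (Suc n)) (\<eta> - x)) * F \<eta>)) \<le> norm (E x) * 1" for n
        unfolding norm_mult by (intro AE_I2 mult_left_mono gauss_kernel_conv_bound[OF _ Fm FB]) auto
      show "integrable lborel (\<lambda>x. norm (E x) * 1)" using Ei by simp
    qed measurable
    then have "(LINT \<xi>|lborel. E \<xi> * F \<xi>) = 0" unfolding 0 by (simp add: LIMSEQ_const_iff)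
    moreover have "E x * F x = indicat_real {a..b} x *\<^sub>R E x" for x by (auto simp: F_def indicator_def)
    ultimately show ?thesis unfolding set_lebesgue_integral_def by simp
  qed
  then have "AE x in lborel. E x = 0" by (intro set_integral_intervals_zero Ei)
  then show ?thesis by eventually_elim (simp add: E_def)
qed

section \<open>Sobolev norms on the Fourier side\<close>

lemma Hs_transform_schwartz_integrable:
  assumes "\<bar>s\<bar> \<le> 1/2" "Hs_transform s T g" "schwartz f"
  shows "integrable lborel (\<lambda>x. g x * f x)"
  using assms schwartz_measurable[OF assms(3)] schwartz_decay[OF assms(3)]
  by (intro weighted_integrable[OF assms(1)]) (auto simp: Hs_transform_def)

lemma weighted_diff_integrable:
  fixes g g' :: "real \<Rightarrow> complex"
  assumes [measurable]: "g \<in> borel_measurable lborel" "g' \<in> borel_measurable lborel"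
    and "integrable lborel (\<lambda>\<xi>. japanese \<xi> powr (2 * s) * (norm (g \<xi>))\<^sup>2)"
    and "integrable lborel (\<lambda>\<xi>. japanese \<xi> powr (2 * s) * (norm (g' \<xi>))\<^sup>2)"
  shows "integrable lborel (\<lambda>\<xi>. japanese \<xi> powr (2 * s) * (norm (g \<xi> - g' \<xi>))\<^sup>2)"
proof (rule Bochner_Integration.integrable_bound)
  show "integrable lborel (\<lambda>\<xi>. 2 * (japanese \<xi> powr (2 * s) * (norm (g \<xi>))\<^sup>2) + 2 * (japanese \<xi> powr (2 * s) * (norm (g' \<xi>))\<^sup>2))"
    by (intro Bochner_Integration.integrable_add integrable_mult_right assms)
  show "AE \<xi> in lborel. norm (japanese \<xi> powr (2 * s) * (norm (g \<xi> - g' \<xi>))\<^sup>2) \<le>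
    norm (2 * (japanese \<xi> powr (2 * s) * (norm (g \<xi>))\<^sup>2) + 2 * (japanese \<xi> powr (2 * s) * (norm (g' \<xi>))\<^sup>2))"
  proof (intro AE_I2)
    fix \<xi>
    have "(norm (g \<xi> - g' \<xi>))\<^sup>2 \<le> (norm (g \<xi>) + norm (g' \<xi>))\<^sup>2" by (intro power_mono norm_triangle_ineq4) auto
    also have "\<dots> \<le> 2 * (norm (g \<xi>))\<^sup>2 + 2 * (norm (g' \<xi>))\<^sup>2"
      using sum_squares_bound[of "norm (g \<xi>)" "norm (g' \<xi>)"] by (simp add: power2_sum)
    finally have "japanese \<xi> powr (2 * s) * (norm (g \<xi> - g' \<xi>))\<^sup>2 \<le> japanese \<xi> powr (2 * s) * (2 * (norm (g \<xi>))\<^sup>2 + 2 * (norm (g' \<xi>))\<^sup>2)"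
      by (intro mult_left_mono) auto
    also have "\<dots> = 2 * (japanese \<xi> powr (2 * s) * (norm (g \<xi>))\<^sup>2) + 2 * (japanese \<xi> powr (2 * s) * (norm (g' \<xi>))\<^sup>2)"
      by (simp add: algebra_simps)
    finally show "norm (japanese \<xi> powr (2 * s) * (norm (g \<xi> - g' \<xi>))\<^sup>2) \<le>
    norm (2 * (japanese \<xi> powr (2 * s) * (norm (g \<xi>))\<^sup>2) + 2 * (japanese \<xi> powr (2 * s) * (norm (g' \<xi>))\<^sup>2))"
      by simp
  qed
qed measurable

lemma Hs_transform_diff:
  assumes s: "\<bar>s\<bar> \<le> 1/2" and 1: "Hs_transform s S g" and 2: "Hs_transform s T g'"
  shows "Hs_transform s (dist_diff S T) (\<lambda>\<xi>. g \<xi> - g' \<xi>)"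
  unfolding Hs_transform_def
proof (intro conjI allI impI)
  show "(\<lambda>\<xi>. g \<xi> - g' \<xi>) \<in> borel_measurable lborel" using 1 2 by (auto simp: Hs_transform_def)
  show "integrable lborel (\<lambda>\<xi>. japanese \<xi> powr (2 * s) * (cmod (g \<xi> - g' \<xi>))\<^sup>2)"
    using 1 2 by (intro weighted_diff_integrable) (auto simp: Hs_transform_def)
  fix f assume f: "schwartz f"
  have "dist_fourier (dist_diff S T) f = dist_of g f - dist_of g' f"
    using 1 2 f by (simp add: Hs_transform_def dist_fourier_def dist_diff_def)
  also have "\<dots> = dist_of (\<lambda>\<xi>. g \<xi> - g' \<xi>) f"
    unfolding dist_of_def left_diff_distrib
    by (rule Bochner_Integration.integral_diff[symmetric])
      (use Hs_transform_schwartz_integrable[OF s 1 f] Hs_transform_schwartz_integrable[OF s 2 f] in auto)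
  finally show "dist_fourier (dist_diff S T) f = dist_of (\<lambda>\<xi>. g \<xi> - g' \<xi>) f" .
qed

lemma Hs_transform_scale:
  assumes 1: "Hs_transform s S g"
  shows "Hs_transform s (dist_scale c S) (\<lambda>\<xi>. c * g \<xi>)"
  unfolding Hs_transform_def
proof (intro conjI allI impI)
  have [measurable]: "g \<in> borel_measurable lborel" using 1 by (simp add: Hs_transform_def)
  show "(\<lambda>\<xi>. c * g \<xi>) \<in> borel_measurable lborel" by measurable
  have "integrable lborel (\<lambda>\<xi>. (norm c)\<^sup>2 * (japanese \<xi> powr (2 * s) * (norm (g \<xi>))\<^sup>2))"
    using 1 by (intro integrable_mult_right) (simp add: Hs_transform_def)
  moreover have "(norm c)\<^sup>2 * (japanese \<xi> powr (2 * s) * (norm (g \<xi>))\<^sup>2) = japanese \<xi> powr (2 * s) * (norm (c * g \<xi>))\<^sup>2" for \<xi>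
    unfolding norm_mult power_mult_distrib by (rule mult.left_commute)
  ultimately show "integrable lborel (\<lambda>\<xi>. japanese \<xi> powr (2 * s) * (norm (c * g \<xi>))\<^sup>2)" by simp
  fix f assume "schwartz f"
  then have "dist_fourier S f = dist_of g f" using 1 by (simp add: Hs_transform_def)
  then show "dist_fourier (dist_scale c S) f = dist_of (\<lambda>\<xi>. c * g \<xi>) f"
    unfolding dist_fourier_def dist_scale_def dist_of_def mult.assoc integral_mult_right_zero by simp
qed

text \<open>Two transforms of \<open>T\<close> agree on all Gaussian test functions, and these
  determine a function with finite weighted norm.\<close>

lemma Hs_transform_unique:
  assumes s: "\<bar>s\<bar> \<le> 1/2" and 1: "Hs_transform s T g" and 2: "Hs_transform s T g'"
  shows "AE x in lborel. g x = g' x"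
proof -
  have d: "Hs_transform s (dist_diff T T) (\<lambda>\<xi>. g \<xi> - g' \<xi>)" by (rule Hs_transform_diff[OF s 1 2])
  have "AE x in lborel. g x - g' x = 0"
  proof (rule gauss_unique[OF s])
    show "(LINT \<xi>|lborel. (g \<xi> - g' \<xi>) * test_gauss n a \<xi>) = 0" for n a
      using d schwartz_test_gauss[of n a] by (simp add: Hs_transform_def dist_fourier_def dist_diff_def dist_of_def)
  qed (use d in \<open>auto simp: Hs_transform_def\<close>)
  then show ?thesis by simp
qed

lemma Hs_transform_measurable: "Hs_transform s T g \<Longrightarrow> g \<in> borel_measurable lborel"
  by (simp add: Hs_transform_def)

text \<open>Uniqueness makes the choice in \<open>Hs_norm\<close> immaterial; every later norm is
  computed from an explicit transform through this lemma.\<close>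

lemma Hs_norm_eq:
  assumes s: "\<bar>s\<bar> \<le> 1/2" and 1: "Hs_transform s T g"
  shows "Hs_norm s T = sqrt (LINT \<xi>|lborel. japanese \<xi> powr (2 * s) * (norm (g \<xi>))\<^sup>2)"
proof -
  have 2: "Hs_transform s T (SOME g. Hs_transform s T g)" by (rule someI[of "Hs_transform s T", OF 1])
  have "(LINT \<xi>|lborel. japanese \<xi> powr (2 * s) * (norm ((SOME g. Hs_transform s T g) \<xi>))\<^sup>2)
     = (LINT \<xi>|lborel. japanese \<xi> powr (2 * s) * (norm (g \<xi>))\<^sup>2)"
  proof (rule Bochner_Integration.integral_cong_AE)
    show "AE \<xi> in lborel. japanese \<xi> powr (2 * s) * (norm ((SOME g. Hs_transform s T g) \<xi>))\<^sup>2 = japanese \<xi> powr (2 * s) * (norm (g \<xi>))\<^sup>2"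
      using Hs_transform_unique[OF s 1 2] by eventually_elim simp
    have [measurable]: "g \<in> borel_measurable lborel" "(SOME g. Hs_transform s T g) \<in> borel_measurable lborel"
      using Hs_transform_measurable[OF 1] Hs_transform_measurable[OF 2] .
    show "(\<lambda>\<xi>. japanese \<xi> powr (2 * s) * (norm (g \<xi>))\<^sup>2) \<in> borel_measurable lborel"
      "(\<lambda>\<xi>. japanese \<xi> powr (2 * s) * (norm ((SOME g. Hs_transform s T g) \<xi>))\<^sup>2) \<in> borel_measurable lborel"
      by measurable
  qed
  then show ?thesis by (simp add: Hs_norm_def)
qed

definition decay_mass :: real where "decay_mass = sqrt (LINT \<xi>|lborel. 1 / (1 + \<xi>\<^sup>2))"

lemma weighted_decay:
  assumes s: "\<bar>s\<bar> \<le> 1/2" and g[measurable]: "g \<in> borel_measurable borel" and d: "\<And>\<xi>. norm (g \<xi> :: complex) \<le> K * (1 / (1 + \<xi>\<^sup>2))"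
  shows "integrable lborel (\<lambda>\<xi>. japanese \<xi> powr (2 * s) * (norm (g \<xi>))\<^sup>2)"
    and "sqrt (LINT \<xi>|lborel. japanese \<xi> powr (2 * s) * (norm (g \<xi>))\<^sup>2) \<le> K * decay_mass"
proof -
  have K: "K \<ge> 0" using decay_bound(2)[OF d] .
  have b: "japanese \<xi> powr (2 * s) * (norm (g \<xi>))\<^sup>2 \<le> K\<^sup>2 * (1 / (1 + \<xi>\<^sup>2))" for \<xi>
  proof -
    have "japanese \<xi> powr (2 * s) * (norm (g \<xi>))\<^sup>2 \<le> (1 + \<xi>\<^sup>2) * (K * (1 / (1 + \<xi>\<^sup>2)))\<^sup>2"
      by (intro mult_mono japanese_powr_le s power_mono d) (auto simp: add_nonneg_nonneg)
    also have "\<dots> = K\<^sup>2 * (1 / (1 + \<xi>\<^sup>2))"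
      using add_pos_nonneg[of 1 "\<xi>\<^sup>2"] by (simp add: power_mult_distrib power_divide power2_eq_square[of "1 + \<xi>\<^sup>2"])
    finally show ?thesis .
  qed
  have i2: "integrable lborel (\<lambda>\<xi>::real. K\<^sup>2 * (1 / (1 + \<xi>\<^sup>2)))" using integrable_inverse_1_plus_square' by (rule integrable_mult_right)
  show i: "integrable lborel (\<lambda>\<xi>. japanese \<xi> powr (2 * s) * (norm (g \<xi>))\<^sup>2)"
    by (rule Bochner_Integration.integrable_bound[OF i2], measurable)
      (intro AE_I2, unfold real_norm_def, rule order_trans[OF _ abs_ge_self], subst abs_of_nonneg, simp, rule b)
  have "sqrt (LINT \<xi>|lborel. japanese \<xi> powr (2 * s) * (norm (g \<xi>))\<^sup>2) \<le> sqrt (LINT \<xi>|lborel. K\<^sup>2 * (1 / (1 + \<xi>\<^sup>2)))"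
    by (intro real_sqrt_le_mono integral_mono i i2 b)
  also have "\<dots> = K * decay_mass"
    unfolding integral_mult_right_zero decay_mass_def real_sqrt_mult using K by simp
  finally show "sqrt (LINT \<xi>|lborel. japanese \<xi> powr (2 * s) * (norm (g \<xi>))\<^sup>2) \<le> K * decay_mass" .
qed

lemma Hs_norm_decay:
  assumes s: "\<bar>s\<bar> \<le> 1/2" and 1: "Hs_transform s T g" and d: "\<And>\<xi>. norm (g \<xi>) \<le> K * (1 / (1 + \<xi>\<^sup>2))"
  shows "Hs_norm s T \<le> K * decay_mass"
  unfolding Hs_norm_eq[OF s 1] using 1 by (intro weighted_decay[OF s] d) (auto simp: Hs_transform_def)

lemma Hs_norm_nonneg: "0 \<le> Hs_norm s T"
  unfolding Hs_norm_def by (intro real_sqrt_ge_zero integral_nonneg_AE AE_I2 mult_nonneg_nonneg) (auto intro: less_imp_le)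

lemma bounded_times_integrable:
  fixes u :: "real \<Rightarrow> complex"
  assumes [measurable]: "u \<in> borel_measurable borel" and B: "\<And>x. norm (u x) \<le> B" and f: "integrable lborel f"
  shows "integrable lborel (\<lambda>x. u x * f x)"
proof (rule Bochner_Integration.integrable_bound)
  show "integrable lborel (\<lambda>x. B * norm (f x))" using f by auto
  have "B \<ge> 0" using order_trans[OF norm_ge_zero B] .
  then show "AE x in lborel. norm (u x * f x) \<le> norm (B * norm (f x))"
    by (intro AE_I2) (auto simp: norm_mult intro!: mult_right_mono B)
  show "(\<lambda>x. u x * f x) \<in> borel_measurable lborel" using f by measurable
qed

lemma tempered_fun_bounded:
  assumes [measurable]: "u \<in> borel_measurable borel" and B: "\<And>x. norm (u x) \<le> B"
  shows "tempered_fun u"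
  unfolding tempered_fun_def using bounded_times_integrable[OF assms] schwartz_bounded_integrable by (simp add: bounded_integrable_def)

lemma tempered_bounded:
  assumes u: "u \<in> borel_measurable borel" and B: "\<And>x. norm (u x) \<le> B"
  shows "tempered (dist_of u)"
  unfolding tempered_def
proof (intro conjI allI impI exI)
  fix f g a b assume "schwartz f" "schwartz g"
  then have "integrable lborel (\<lambda>x. u x * f x)" "integrable lborel (\<lambda>x. u x * g x)"
    using bounded_times_integrable[OF assms] schwartz_bounded_integrable by (auto simp: bounded_integrable_def)
  then show "dist_of u (\<lambda>x. a * f x + b * g x) = a * dist_of u f + b * dist_of u g"
    by (simp add: dist_of_def distrib_left mult.left_commute[of "u _"])
next
  fix f assume f: "schwartz f"
  have B_nonneg: "B \<ge> 0" using order_trans[OF norm_ge_zero B] .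
  define S where "S = schwartz_seminorm 0 0 f + schwartz_seminorm 2 0 f"
  have "norm (dist_of u f) \<le> (LINT x|lborel. (B * S) * (1 / (1 + x\<^sup>2)))"
    unfolding dist_of_def
  proof (rule norm_integral_le)
    show "norm (u x * f x) \<le> (B * S) * (1 / (1 + x\<^sup>2))" for x
      using mult_mono[OF B schwartz_decay[OF f] B_nonneg norm_ge_zero] unfolding norm_mult S_def mult.assoc .
  qed (rule integrable_mult_right[OF integrable_inverse_1_plus_square'])
  also have "\<dots> = B * (LINT x|lborel. 1 / (1 + x\<^sup>2)) * S"
    by (subst integral_mult_right_zero) (simp add: mult_ac)
  also have "S \<le> (\<Sum>k\<le>2. \<Sum>n\<le>2. schwartz_seminorm k n f)"
  proof -
    have 1: "schwartz_seminorm k 0 f \<le> (\<Sum>n\<le>2. schwartz_seminorm k n f)" for k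
      using schwartz_seminorm_nonneg[OF f] by (intro member_le_sum) auto
    have 2: "(\<Sum>n\<le>2. schwartz_seminorm 0 n f) + (\<Sum>n\<le>2. schwartz_seminorm 2 n f) \<le> (\<Sum>k\<in>{..2}. \<Sum>n\<le>2. schwartz_seminorm k n f)"
    proof -
      have "(\<Sum>k\<in>{0,2::nat}. \<Sum>n\<le>2. schwartz_seminorm k n f) \<le> (\<Sum>k\<in>{..2}. \<Sum>n\<le>2. schwartz_seminorm k n f)"
        by (rule sum_mono2) (simp_all add: sum_nonneg schwartz_seminorm_nonneg[OF f])
      then show ?thesis by simp
    qed
    show ?thesis unfolding S_def using 1[of 0] 1[of 2] 2 by linarith
  qed
  then have "B * (LINT x|lborel. 1 / (1 + x\<^sup>2)) * S \<le> B * (LINT x|lborel. 1 / (1 + x\<^sup>2)) * (\<Sum>k\<le>2. \<Sum>n\<le>2. schwartz_seminorm k n f)"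
    by (intro mult_left_mono mult_nonneg_nonneg B_nonneg integral_nonneg_AE AE_I2) (simp_all add: add_nonneg_nonneg)
  finally show "norm (dist_of u f) \<le> B * (LINT x|lborel. 1 / (1 + x\<^sup>2)) * (\<Sum>k\<le>2. \<Sum>n\<le>2. schwartz_seminorm k n f)" .
qed

lemma ift_bounded: "bounded_integrable h \<Longrightarrow> \<exists>B. \<forall>x. norm (ift h x) \<le> B"
  using ift_bound by (auto simp: bounded_integrable_def)

lemma dist_fourier_ift:
  assumes "bounded_integrable h" "bounded_integrable F" "\<And>x. isCont F x"
  shows "dist_fourier (dist_of (ift h)) F = (LINT \<xi>|lborel. h \<xi> * F \<xi>)"
  unfolding dist_fourier_def dist_of_def by (rule Parseval(2)[OF assms])

text \<open>The bridge from the Fourier side: a transform with the standard decay defines a bounded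
  function, and Parseval's identity confirms that \<open>h\<close> is its transform in the sense of
  distributions. All functions of the solution are produced in this way.\<close>

lemma Hs_transform_ift:
  assumes s: "\<bar>s\<bar> \<le> 1/2" and [measurable]: "h \<in> borel_measurable borel" and d: "\<And>\<xi>. norm (h \<xi>) \<le> K * (1 / (1 + \<xi>\<^sup>2))"
  shows "Hs_transform s (dist_of (ift h)) h" "in_Hs s (dist_of (ift h))" "tempered_fun (ift h)"
proof -
  have b: "bounded_integrable h" by (rule bounded_integrable_of_decay[OF _ d]) measurable
  obtain B where B: "\<And>x. norm (ift h x) \<le> B" using ift_bounded[OF b] by auto
  show 1: "Hs_transform s (dist_of (ift h)) h"
    unfolding Hs_transform_def
    using weighted_decay(1)[OF s _ d] dist_fourier_ift[OF b schwartz_bounded_integrable schwartz_isCont]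
    by (auto simp: dist_of_def[of h])
  show "in_Hs s (dist_of (ift h))"
    unfolding in_Hs_def using 1 tempered_bounded[OF _ B] by auto
  show "tempered_fun (ift h)" by (rule tempered_fun_bounded[OF _ B]) measurable
qed

lemma borel_measurable_cnj[measurable (raw)]:
  "f \<in> borel_measurable M \<Longrightarrow> (\<lambda>x. cnj (f x)) \<in> borel_measurable M"
  by (rule borel_measurable_continuous_on[OF continuous_on_cnj[OF continuous_on_id]])

lemma schwartz_lincomb:
  assumes f: "schwartz f" and g: "schwartz g"
  shows "schwartz (\<lambda>x. a * f x + b * g x)"
proof -
  have it: "(vderiv ^^ n) (\<lambda>x. a * f x + b * g x) = (\<lambda>x. a * (vderiv ^^ n) f x + b * (vderiv ^^ n) g x)" for n
  proof (induction n)
    case (Suc n)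
    have "((\<lambda>x. a * (vderiv ^^ n) f x + b * (vderiv ^^ n) g x) has_vector_derivative
       a * vderiv ((vderiv ^^ n) f) x + b * vderiv ((vderiv ^^ n) g) x) (at x)" for x
      using f g unfolding schwartz_def vderiv_def
      by (intro has_vector_derivative_add has_vector_derivative_mult_right)
        (simp_all add: vector_derivative_works[symmetric])
    from vector_derivative_at[OF this] have "vderiv (\<lambda>x. a * (vderiv ^^ n) f x + b * (vderiv ^^ n) g x) = (\<lambda>x. a * vderiv ((vderiv ^^ n) f) x + b * vderiv ((vderiv ^^ n) g) x)"
      by (intro ext) (simp add: vderiv_def[of "\<lambda>x. a * (vderiv ^^ n) f x + b * (vderiv ^^ n) g x"])
    then show ?case using Suc by simp
  qed simp
  show ?thesis unfolding schwartz_def it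
  proof (intro conjI allI)
    fix n x k
    show "(\<lambda>x. a * (vderiv ^^ n) f x + b * (vderiv ^^ n) g x) differentiable at x"
      using f g by (auto simp: schwartz_def)
    have "bounded (range (\<lambda>x. a * (x ^ k *\<^sub>R (vderiv ^^ n) f x) + b * (x ^ k *\<^sub>R (vderiv ^^ n) g x)))"
    proof -
      have "bounded (range (\<lambda>x. x ^ k *\<^sub>R (vderiv ^^ n) f x))" "bounded (range (\<lambda>x. x ^ k *\<^sub>R (vderiv ^^ n) g x))"
        using f g by (simp_all add: schwartz_def)
      then obtain B C where "\<And>x. norm (x ^ k *\<^sub>R (vderiv ^^ n) f x) \<le> B" "\<And>x. norm (x ^ k *\<^sub>R (vderiv ^^ n) g x) \<le> C"
        unfolding bounded_iff by blast
      then have "norm (a * (x ^ k *\<^sub>R (vderiv ^^ n) f x) + b * (x ^ k *\<^sub>R (vderiv ^^ n) g x)) \<le> norm a * B + norm b * C" for x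
        by (intro norm_triangle_mono) (auto simp only: norm_mult intro!: mult_left_mono norm_ge_zero)
      then show ?thesis unfolding bounded_iff by blast
    qed
    then show "bounded (range (\<lambda>x. x ^ k *\<^sub>R (a * (vderiv ^^ n) f x + b * (vderiv ^^ n) g x)))"
      by (simp add: scaleR_add_right)
  qed
qed

text \<open>\<open>T\<close> is real on the real part \<open>p\<close> and the imaginary part
  \<open>q\<close> of \<open>h\<close>; both are Schwartz functions because \<open>h\<close> and its
  conjugate are.\<close>

lemma real_valued_cnj:
  assumes T: "tempered T" and r: "real_valued T" and h: "schwartz h" and h': "schwartz (\<lambda>x. cnj (h x))"
  shows "T (\<lambda>x. cnj (h x)) = cnj (T h)"
proof -
  define p where "p x = 1/2 * h x + 1/2 * cnj (h x)" for x
  define q where "q x = (-\<i>/2) * h x + (\<i>/2) * cnj (h x)" for x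
  have pS: "schwartz p" and qS: "schwartz q"
    unfolding p_def[abs_def] q_def[abs_def] by (intro schwartz_lincomb h h')+
  have "p x \<in> \<real>" "q x \<in> \<real>" for x
    by (auto simp: p_def q_def complex_is_Real_iff)
  then have "T p \<in> \<real>" "T q \<in> \<real>" using r pS qS by (auto simp: real_valued_def)
  then have c: "cnj (T p) = T p" "cnj (T q) = T q" by (auto simp: Reals_cnj_iff)
  have "h = (\<lambda>x. 1 * p x + \<i> * q x)" "(\<lambda>x. cnj (h x)) = (\<lambda>x. 1 * p x + (-\<i>) * q x)"
    by (auto simp: p_def q_def fun_eq_iff algebra_simps)
  moreover have "T (\<lambda>x. 1 * p x + \<i> * q x) = 1 * T p + \<i> * T q" "T (\<lambda>x. 1 * p x + (-\<i>) * q x) = 1 * T p + (-\<i>) * T q"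
    using T pS qS unfolding tempered_def by blast+
  ultimately show ?thesis using c by simp
qed

lemma integral_reflect: "(LINT x|lborel. f (- x)) = (LINT x|lborel. (f x :: complex))" for f :: "real \<Rightarrow> complex"
  using lborel_integral_real_affine[of "-1" f 0] by simp

text \<open>The conjugate reflection \<open>g'\<close> is tested against the same Gaussians as
  \<open>g\<close>. Reflecting such a test function replaces \<open>a\<close> by \<open>- a\<close>
  and conjugates its Fourier transform, so reality of \<open>T\<close> makes both integrals equal,
  and uniqueness gives \<open>g = g'\<close> almost everywhere.\<close>

lemma Hs_transform_real:
  assumes s: "\<bar>s\<bar> \<le> 1/2" and T: "tempered T" and r: "real_valued T" and 1: "Hs_transform s T g"
  shows "AE x in lborel. g (- x) = cnj (g x)"
proof -
  define g' where "g' x = cnj (g (- x))" for x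
  have gm[measurable]: "g \<in> borel_measurable borel" using 1 by (simp add: Hs_transform_def)
  have gi: "integrable lborel (\<lambda>\<xi>. japanese \<xi> powr (2 * s) * (norm (g \<xi>))\<^sup>2)" using 1 by (simp add: Hs_transform_def)
  have g'm[measurable]: "g' \<in> borel_measurable borel" unfolding g'_def[abs_def] by measurable
  have jm: "japanese (- x) = japanese x" for x by (simp add: japanese_def)
  have g'i: "integrable lborel (\<lambda>\<xi>. japanese \<xi> powr (2 * s) * (norm (g' \<xi>))\<^sup>2)"
    using lborel_integrable_real_affine[OF gi, of "-1" 0] by (simp add: g'_def jm)
  have tg: "test_gauss n a (- x) = test_gauss n (- a) x" "cnj (test_gauss n a x) = test_gauss n a x" for n a x
    using gauss_kernel_sym[of n "a" "- x"] by (auto simp: test_gauss_def minus_diff_commute[of x a])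
  have i1: "integrable lborel (\<lambda>x. g x * test_gauss n a x)" for n a
    by (rule Hs_transform_schwartz_integrable[OF s 1 schwartz_test_gauss])
  have i2: "integrable lborel (\<lambda>x. g' x * test_gauss n a x)" for n a
    using weighted_integrable[OF s g'm schwartz_measurable[OF schwartz_test_gauss] g'i schwartz_decay[OF schwartz_test_gauss]] .
  have "AE x in lborel. g x - g' x = 0"
  proof (rule gauss_unique[OF s])
    show "integrable lborel (\<lambda>\<xi>. japanese \<xi> powr (2 * s) * (norm (g \<xi> - g' \<xi>))\<^sup>2)"
      by (intro weighted_diff_integrable gi g'i) auto
    fix n a
    have F: "fourier (test_gauss n (- a)) x = cnj (fourier (test_gauss n a) x)" for x
    proof -
      have "cnj (fourier (test_gauss n a) x) = (LINT y|lborel. exp (\<i> * of_real (y * x)) * test_gauss n a y)"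
        unfolding fourier_def Bochner_Integration.integral_cnj[symmetric] by (simp add: exp_cnj tg)
      also have "\<dots> = (LINT y|lborel. exp (\<i> * of_real (- y * x)) * test_gauss n a (- y))"
        by (rule integral_reflect[symmetric])
      finally show ?thesis by (simp add: fourier_def tg)
    qed
    have "(LINT x|lborel. g' x * test_gauss n a x) = (LINT x|lborel. g' (- x) * test_gauss n a (- x))"
      by (rule integral_reflect[symmetric])
    also have "\<dots> = cnj (LINT x|lborel. g x * test_gauss n (- a) x)"
      unfolding Bochner_Integration.integral_cnj[symmetric] by (simp add: g'_def tg)
    also have "\<dots> = cnj (T (fourier (test_gauss n (- a))))"
      using 1 schwartz_test_gauss[of n "- a"] by (simp add: Hs_transform_def dist_fourier_def dist_of_def)
    also have "\<dots> = T (\<lambda>x. cnj (fourier (test_gauss n (- a)) x))"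
      by (rule real_valued_cnj[OF T r schwartz_fourier_test_gauss schwartz_cnj_fourier_test_gauss, symmetric])
    also have "\<dots> = T (fourier (test_gauss n a))" by (simp add: F)
    also have "\<dots> = (LINT x|lborel. g x * test_gauss n a x)"
      using 1 schwartz_test_gauss[of n a] by (simp add: Hs_transform_def dist_fourier_def dist_of_def)
    finally show "(LINT \<xi>|lborel. (g \<xi> - g' \<xi>) * test_gauss n a \<xi>) = 0"
      using i1 i2 by (simp add: left_diff_distrib)
  qed measurable
  then show ?thesis by eventually_elim (simp add: g'_def)
qed

section \<open>Weights and convolutions\<close>

text \<open>The decay is of fourth order so that a factor 1 + x^2, the price of two derivatives, may
  be lost and the integrable majorant 1 / (1 + x^2) still remains.\<close>

definition wt :: "real \<Rightarrow> real \<Rightarrow> real" where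
  "wt l \<xi> = 1 / (1 + (\<xi> / l)\<^sup>2)\<^sup>2"

definition wmass :: real where "wmass = (LINT \<xi>|lborel. wt 1 \<xi>)"

lemma wt_measurable[measurable]: "wt l \<in> borel_measurable borel"
  unfolding wt_def[abs_def] by measurable

lemma one_plus_sq_pos: "0 < 1 + (x::real)\<^sup>2"
  by (simp add: add_pos_nonneg)

lemma wt_pos: "0 < wt l \<xi>"
  unfolding wt_def using one_plus_sq_pos[of "\<xi> / l"] by simp

lemma wt_nonneg: "0 \<le> wt l \<xi>"
  using wt_pos[of l \<xi>] by simp

lemma wt_even: "wt l (- \<xi>) = wt l \<xi>"
  by (simp add: wt_def)

lemma wt_le_1: "wt l \<xi> \<le> 1"
proof -
  have 1: "1 \<le> (1 + (\<xi> / l)\<^sup>2)\<^sup>2" by (rule one_le_power) simp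
  then have "0 < (1 + (\<xi> / l)\<^sup>2)\<^sup>2" by linarith
  then show ?thesis unfolding wt_def using 1 by (subst divide_le_eq_1_pos)
qed

lemma sq_add_bound:
  fixes b c :: real
  shows "(1 + (b + c)\<^sup>2)\<^sup>2 \<le> 8 * ((1 + b\<^sup>2)\<^sup>2 + (1 + c\<^sup>2)\<^sup>2)"
proof -
  define B C where "B = 1 + b\<^sup>2" and "C = 1 + c\<^sup>2"
  have "(b + c)\<^sup>2 \<le> 2 * b\<^sup>2 + 2 * c\<^sup>2" using sum_squares_bound[of b c] by (simp add: power2_sum)
  then have "1 + (b + c)\<^sup>2 \<le> 2 * (B + C)" unfolding B_def C_def by simp
  then have "(1 + (b + c)\<^sup>2)\<^sup>2 \<le> (2 * (B + C))\<^sup>2" by (intro power_mono) (auto simp: add_nonneg_nonneg)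
  also have "\<dots> \<le> 8 * (B\<^sup>2 + C\<^sup>2)" using sum_squares_bound[of B C] by (simp add: power2_sum power_mult_distrib)
  finally show ?thesis unfolding B_def C_def .
qed

text \<open>Clearing denominators turns this into \<open>sq_add_bound\<close>. In substance, one of
  the two frequencies is at least of the size of \<open>x / 2\<close>; its weight supplies
  \<open>wt l x\<close>, and the other weight is left for integration.\<close>

lemma wt_prod: "wt l (x - y) * wt l y \<le> 8 * wt l x * (wt l y + wt l (x - y))"
proof -
  define X B C where "X = (1 + (x / l)\<^sup>2)\<^sup>2" and "B = (1 + ((x - y) / l)\<^sup>2)\<^sup>2" and "C = (1 + (y / l)\<^sup>2)\<^sup>2"
  have pos: "X > 0" "B > 0" "C > 0" unfolding X_def B_def C_def by (intro zero_less_power one_plus_sq_pos)+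
  have "(x - y) / l + y / l = x / l" by (simp add: diff_divide_distrib)
  then have "X \<le> 8 * (B + C)" using sq_add_bound[of "(x - y) / l" "y / l"] unfolding X_def B_def C_def by simp
  then have "1 / B * (1 / C) \<le> 8 * (1 / X) * (1 / C + 1 / B)"
    using pos by (simp add: field_simps)
  then show ?thesis unfolding wt_def X_def B_def C_def .
qed

text \<open>An inequality of Peetre type: a shift by \<open>y\<close> costs a factor depending on
  \<open>y\<close> alone, uniformly in \<open>l \<ge> 1\<close>. It allows convolution with a fixed
  low-frequency function without loss in \<open>l\<close>.\<close>

lemma wt_shift:
  assumes l: "l \<ge> 1"
  shows "wt l (x - y) \<le> 16 * wt l x * (1 + y\<^sup>2)\<^sup>2"
proof -
  define X B C where "X = (1 + (x / l)\<^sup>2)\<^sup>2" and "B = (1 + ((x - y) / l)\<^sup>2)\<^sup>2" and "C = (1 + (y / l)\<^sup>2)\<^sup>2"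
  have pos: "X > 0" "B \<ge> 1" "C \<ge> 1" unfolding X_def B_def C_def using one_plus_sq_pos[of "x / l"] by auto
  have "(x - y) / l + y / l = x / l" by (simp add: diff_divide_distrib)
  then have X: "X \<le> 8 * (B + C)" using sq_add_bound[of "(x - y) / l" "y / l"] unfolding X_def B_def C_def by simp
  have "B + C \<le> 2 * (B * C)"
  proof -
    have "0 \<le> (B - 1) * (C - 1)" using pos by simp
    moreover have "1 * 1 \<le> B * C" using pos by (intro mult_mono) auto
    ultimately show ?thesis by (simp add: algebra_simps)
  qed
  then have "8 * (B + C) \<le> 8 * (2 * (B * C))" by (intro mult_left_mono) auto
  with X have "X \<le> 16 * (B * C)" by simp
  then have "X \<le> 16 * C * B" by (simp add: mult_ac)
  then have "1 / B \<le> 16 * (1 / X) * C" using pos by (simp add: field_simps)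
  also have "\<dots> \<le> 16 * (1 / X) * (1 + y\<^sup>2)\<^sup>2"
  proof -
    have "y\<^sup>2 \<le> y\<^sup>2 * l\<^sup>2" using l mult_left_mono[of 1 "l\<^sup>2" "y\<^sup>2"] by simp
    then have "(y / l)\<^sup>2 \<le> y\<^sup>2" using l by (simp add: power_divide divide_le_eq)
    then have "C \<le> (1 + y\<^sup>2)\<^sup>2" unfolding C_def by (intro power_mono) auto
    then show ?thesis using pos by (intro mult_left_mono) auto
  qed
  finally show ?thesis unfolding wt_def X_def B_def .
qed

lemma wt_1_decay: "wt 1 \<xi> \<le> 1 * (1 / (1 + \<xi>\<^sup>2))"
proof -
  have "1 * (1 + \<xi>\<^sup>2) \<le> (1 + \<xi>\<^sup>2)\<^sup>2"
    unfolding power2_eq_square[of "1 + \<xi>\<^sup>2"] by (intro mult_right_mono) auto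
  then show ?thesis unfolding wt_def using one_plus_sq_pos[of \<xi>] by (simp add: frac_le)
qed

lemma wt_1_integrable: "integrable lborel (wt 1)"
  by (rule Bochner_Integration.integrable_bound[OF integrable_inverse_1_plus_square'], measurable)
     (intro AE_I2, use wt_1_decay wt_nonneg in simp)

lemma wt_scale: "l > 0 \<Longrightarrow> wt l (0 + l * x) = wt 1 x"
  by (simp add: wt_def)

lemma wt_integrable:
  assumes l: "l > 0"
  shows "integrable lborel (wt l)" "(LINT \<xi>|lborel. wt l \<xi>) = l * wmass"
proof -
  have "integrable lborel (\<lambda>x. wt l (0 + l * x))"
    unfolding wt_scale[OF l] by (rule wt_1_integrable)
  then show "integrable lborel (wt l)" using l by (subst (asm) lborel_integrable_real_affine_iff) auto
  show "(LINT \<xi>|lborel. wt l \<xi>) = l * wmass"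
    by (subst lborel_integral_real_affine[of l _ 0]) (use l wt_scale[OF l] in \<open>auto simp: wmass_def\<close>)
qed

lemma wmass_nonneg: "0 \<le> wmass"
  unfolding wmass_def by (intro integral_nonneg_AE AE_I2 wt_nonneg)

lemma wt_shift_integrable:
  assumes l: "l > 0"
  shows "integrable lborel (\<lambda>y. wt l (x - y))" "(LINT y|lborel. wt l (x - y)) = l * wmass"
proof -
  show "integrable lborel (\<lambda>y. wt l (x - y))"
    using lborel_integrable_real_affine[OF wt_integrable(1)[OF l], of "-1" x] by simp
  have "(LINT y|lborel. wt l y) = \<bar>-1\<bar> *\<^sub>R (LINT y|lborel. wt l (x + (-1) * y))"
    by (rule lborel_integral_real_affine) simp
  then show "(LINT y|lborel. wt l (x - y)) = l * wmass" using wt_integrable(2)[OF l] by simp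
qed

lemma wt_decay:
  assumes l: "l \<ge> 1"
  shows "(1 + \<xi>\<^sup>2) * wt l \<xi> \<le> l ^ 4 * (1 / (1 + \<xi>\<^sup>2))"
proof -
  have "1 + \<xi>\<^sup>2 \<le> l\<^sup>2 * (1 + (\<xi> / l)\<^sup>2)" using l one_le_power[OF l, of 2] by (simp add: distrib_left power_divide)
  then have "(1 + \<xi>\<^sup>2)\<^sup>2 \<le> (l\<^sup>2 * (1 + (\<xi> / l)\<^sup>2))\<^sup>2" by (intro power_mono) auto
  also have "\<dots> = l ^ 4 * (1 + (\<xi> / l)\<^sup>2)\<^sup>2" by (simp add: power_mult_distrib)
  finally have "(1 + \<xi>\<^sup>2) * (1 + \<xi>\<^sup>2) \<le> l ^ 4 * (1 + (\<xi> / l)\<^sup>2)\<^sup>2" by (simp add: power2_eq_square)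
  moreover have "0 < 1 + \<xi>\<^sup>2" "0 < (1 + (\<xi> / l)\<^sup>2)\<^sup>2" using one_plus_sq_pos by (blast intro: zero_less_power)+
  ultimately show ?thesis unfolding wt_def by (simp add: field_simps)
qed

lemma wt_decay':
  assumes l: "l \<ge> 1"
  shows "wt l \<xi> \<le> l ^ 4 * (1 / (1 + \<xi>\<^sup>2))"
proof -
  have "1 * wt l \<xi> \<le> (1 + \<xi>\<^sup>2) * wt l \<xi>" by (intro mult_right_mono wt_nonneg) auto
  then show ?thesis using wt_decay[OF l, of \<xi>] by simp
qed

definition conv :: "(real \<Rightarrow> complex) \<Rightarrow> (real \<Rightarrow> complex) \<Rightarrow> real \<Rightarrow> complex" where
  "conv h k \<xi> = (LINT \<eta>|lborel. h (\<xi> - \<eta>) * k \<eta>)"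

lemma bound_integrable:
  fixes f :: "real \<Rightarrow> complex"
  assumes [measurable]: "f \<in> borel_measurable borel" and g: "integrable lborel g" and b: "\<And>x. norm (f x) \<le> g x"
  shows "integrable lborel f"
  by (rule Bochner_Integration.integrable_bound[OF g], measurable)
     (intro AE_I2, unfold real_norm_def, rule order_trans[OF b abs_ge_self])

text \<open>The factor \<open>l\<close> is the integral of the weight, \<open>l * wmass\<close>, and
  16 is the 8 of \<open>wt_prod\<close> for each of its two summands. This loss of \<open>l\<close>
  is what the short time interval has to repay.\<close>

lemma conv_bound:
  assumes l: "l > 0" and m[measurable]: "h \<in> borel_measurable borel" "k \<in> borel_measurable borel"
    and h: "\<And>x. norm (h x) \<le> a * wt l x" and k: "\<And>x. norm (k x) \<le> b * wt l x"
  shows "integrable lborel (\<lambda>\<eta>. h (\<xi> - \<eta>) * k \<eta>)"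
    and "norm (conv h k \<xi>) \<le> 16 * wmass * l * a * b * wt l \<xi>"
proof -
  have ab: "a \<ge> 0" "b \<ge> 0"
    using order_trans[OF norm_ge_zero h[of 0]] order_trans[OF norm_ge_zero k[of 0]] wt_pos[of l 0]
    by (simp_all add: zero_le_mult_iff)
  let ?g = "\<lambda>\<eta>. 8 * a * b * wt l \<xi> * (wt l \<eta> + wt l (\<xi> - \<eta>))"
  have gi: "integrable lborel ?g"
    by (intro integrable_mult_right Bochner_Integration.integrable_add wt_integrable[OF l] wt_shift_integrable[OF l])
  have bd: "norm (h (\<xi> - \<eta>) * k \<eta>) \<le> ?g \<eta>" for \<eta>
  proof -
    have "norm (h (\<xi> - \<eta>) * k \<eta>) \<le> (a * wt l (\<xi> - \<eta>)) * (b * wt l \<eta>)"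
      unfolding norm_mult by (intro mult_mono h k norm_ge_zero mult_nonneg_nonneg ab wt_nonneg)
    also have "\<dots> = a * b * (wt l (\<xi> - \<eta>) * wt l \<eta>)" by (simp add: mult_ac)
    also have "\<dots> \<le> a * b * (8 * wt l \<xi> * (wt l \<eta> + wt l (\<xi> - \<eta>)))"
      by (intro mult_left_mono wt_prod mult_nonneg_nonneg ab)
    finally show ?thesis by (simp add: mult_ac)
  qed
  show "integrable lborel (\<lambda>\<eta>. h (\<xi> - \<eta>) * k \<eta>)"
    by (rule bound_integrable[OF _ gi bd]) measurable
  have "norm (conv h k \<xi>) \<le> integral\<^sup>L lborel ?g"
    unfolding conv_def by (rule norm_integral_le[OF gi bd])
  also have "\<dots> = 8 * a * b * wt l \<xi> * (l * wmass + l * wmass)"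
    unfolding integral_mult_right_zero
    by (subst Bochner_Integration.integral_add) (auto intro: wt_integrable[OF l] wt_shift_integrable[OF l] simp: wt_integrable(2)[OF l] wt_shift_integrable(2)[OF l])
  finally show "norm (conv h k \<xi>) \<le> 16 * wmass * l * a * b * wt l \<xi>" by (simp add: mult_ac)
qed

text \<open>Here the second factor has an integrable majorant against the weight of
  \<open>wt_shift\<close>, which does not change with \<open>l\<close>; no factor \<open>l\<close>
  is lost.\<close>

lemma conv_bound_low:
  assumes l: "l \<ge> 1" and m[measurable]: "h \<in> borel_measurable borel" "k \<in> borel_measurable borel"
    and h: "\<And>x. norm (h x) \<le> a * wt l x" and k: "\<And>x. norm (k x) \<le> b x"
    and b: "integrable lborel (\<lambda>\<eta>. b \<eta> * (1 + \<eta>\<^sup>2)\<^sup>2)"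
  shows "integrable lborel (\<lambda>\<eta>. h (\<xi> - \<eta>) * k \<eta>)"
    and "norm (conv h k \<xi>) \<le> 16 * a * (LINT \<eta>|lborel. b \<eta> * (1 + \<eta>\<^sup>2)\<^sup>2) * wt l \<xi>"
proof -
  have a: "a \<ge> 0"
    using order_trans[OF norm_ge_zero h[of 0]] wt_pos[of l 0] by (simp add: zero_le_mult_iff)
  let ?g = "\<lambda>\<eta>. 16 * a * wt l \<xi> * (b \<eta> * (1 + \<eta>\<^sup>2)\<^sup>2)"
  have gi: "integrable lborel ?g" by (intro integrable_mult_right b)
  have bd: "norm (h (\<xi> - \<eta>) * k \<eta>) \<le> ?g \<eta>" for \<eta>
  proof -
    have b0: "b \<eta> \<ge> 0" using order_trans[OF norm_ge_zero k] .
    have "norm (h (\<xi> - \<eta>) * k \<eta>) \<le> (a * wt l (\<xi> - \<eta>)) * b \<eta>"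
      unfolding norm_mult by (intro mult_mono h k norm_ge_zero mult_nonneg_nonneg a wt_nonneg)
    also have "\<dots> \<le> (a * (16 * wt l \<xi> * (1 + \<eta>\<^sup>2)\<^sup>2)) * b \<eta>"
      by (intro mult_right_mono mult_left_mono wt_shift l a b0)
    finally show ?thesis by (simp add: mult_ac)
  qed
  show "integrable lborel (\<lambda>\<eta>. h (\<xi> - \<eta>) * k \<eta>)"
    by (rule bound_integrable[OF _ gi bd]) measurable
  have "norm (conv h k \<xi>) \<le> integral\<^sup>L lborel ?g"
    unfolding conv_def by (rule norm_integral_le[OF gi bd])
  then show "norm (conv h k \<xi>) \<le> 16 * a * (LINT \<eta>|lborel. b \<eta> * (1 + \<eta>\<^sup>2)\<^sup>2) * wt l \<xi>"
    unfolding integral_mult_right_zero by (simp add: mult_ac)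
qed

lemma conv_commute: "conv h k = conv k h"
proof
  fix \<xi>
  have "conv h k \<xi> = \<bar>-1\<bar> *\<^sub>R (LINT \<eta>|lborel. h (\<xi> - (\<xi> + (-1) * \<eta>)) * k (\<xi> + (-1) * \<eta>))"
    unfolding conv_def by (rule lborel_integral_real_affine) simp
  then show "conv h k \<xi> = conv k h \<xi>" by (simp add: conv_def mult.commute)
qed

lemma conv_measurable[measurable]:
  assumes [measurable]: "h \<in> borel_measurable borel" "k \<in> borel_measurable borel"
  shows "conv h k \<in> borel_measurable borel"
  unfolding conv_def[abs_def] by measurable

lemma conv_joint_measurable[measurable (raw)]:
  assumes [measurable]: "(\<lambda>(s, x). h s x) \<in> borel_measurable (N \<Otimes>\<^sub>M borel)" "(\<lambda>(s, x). k s x) \<in> borel_measurable (N \<Otimes>\<^sub>M borel)"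
   "f \<in> measurable K N" "g \<in> borel_measurable K"
  shows "(\<lambda>z. conv (h (f z)) (k (f z)) (g z)) \<in> borel_measurable K"
  unfolding conv_def by measurable

text \<open>Complex conjugation in space, seen on the Fourier side.\<close>

definition cnj_reflect :: "(real \<Rightarrow> complex) \<Rightarrow> real \<Rightarrow> complex" where
  "cnj_reflect h \<xi> = cnj (h (- \<xi>))"

lemma cnj_reflect_measurable[measurable]:
  assumes [measurable]: "h \<in> borel_measurable borel"
  shows "cnj_reflect h \<in> borel_measurable borel"
  unfolding cnj_reflect_def[abs_def] by measurable

lemma cnj_reflect_bound: "(\<And>x. norm (h x) \<le> a * wt l x) \<Longrightarrow> norm (cnj_reflect h x) \<le> a * wt l x"
  using wt_even[of l x] by (metis cnj_reflect_def complex_mod_cnj)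

lemma cnj_reflect_diff: "cnj_reflect (\<lambda>x. h x - k x) = (\<lambda>x. cnj_reflect h x - cnj_reflect k x)"
  by (auto simp: cnj_reflect_def)

text \<open>The Fourier form of the fact that a squared modulus is real. It is the source of the
  reality of \<open>\<phi>\<close>.\<close>

lemma conv_cnj_reflect_sym: "conv (cnj_reflect h) h (- \<xi>) = cnj (conv (cnj_reflect h) h \<xi>)"
proof -
  have "cnj (conv (cnj_reflect h) h \<xi>) = (LINT \<eta>|lborel. h (\<eta> - \<xi>) * cnj (h \<eta>))"
    unfolding conv_def Bochner_Integration.integral_cnj[symmetric] by (simp add: cnj_reflect_def)
  also have "\<dots> = \<bar>1\<bar> *\<^sub>R (LINT \<eta>|lborel. h ((\<xi> + 1 * \<eta>) - \<xi>) * cnj (h (\<xi> + 1 * \<eta>)))"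
    by (rule lborel_integral_real_affine) simp
  also have "\<dots> = conv (cnj_reflect h) h (- \<xi>)"
    unfolding conv_def by (simp add: cnj_reflect_def mult.commute add.commute)
  finally show ?thesis ..
qed

lemma ift_cnj_reflect: "ift (cnj_reflect h) x = cnj (ift h x)"
proof -
  have "(LINT \<xi>|lborel. exp (\<i> * of_real (x * \<xi>)) * cnj_reflect h \<xi>) = (LINT \<xi>|lborel. exp (\<i> * of_real (x * (- \<xi>))) * cnj_reflect h (- \<xi>))"
    by (rule integral_reflect[symmetric])
  also have "\<dots> = cnj (LINT \<xi>|lborel. exp (\<i> * of_real (x * \<xi>)) * h \<xi>)"
    unfolding Bochner_Integration.integral_cnj[symmetric] by (simp add: cnj_reflect_def exp_cnj)
  finally show ?thesis by (simp add: ift_def)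
qed

lemma ift_conv:
  assumes h: "integrable lborel h" and k: "integrable lborel k"
  shows "ift (conv h k) x = 2 * of_real pi * (ift h x * ift k x)"
proof -
  have [measurable]: "h \<in> borel_measurable borel" "k \<in> borel_measurable borel" using h k by auto
  let ?e = "\<lambda>\<xi>. exp (\<i> * of_real (x * \<xi>))"
  define F where "F \<eta> z = (?e (z) * h z) * (?e \<eta> * k \<eta>)" for \<eta> z
  define F2 where "F2 \<eta> \<xi> = ?e \<xi> * (h (\<xi> - \<eta>) * k \<eta>)" for \<eta> \<xi>
  have e: "?e (\<xi> - \<eta>) * ?e \<eta> = ?e \<xi>" for \<xi> \<eta>
    unfolding exp_add[symmetric] by (simp add: algebra_simps)
  \<comment> \<open>The natural majorant |h (\<xi> - \<eta>)| |k \<eta>| is not a product in these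
    two variables, so integrability is obtained from the iterated norms, translation invariance
    making the inner one independent of \<open>\<eta>\<close>.\<close>
  have i1: "integrable (lborel \<Otimes>\<^sub>M lborel) (\<lambda>(\<eta>, \<xi>). F2 \<eta> \<xi>)"
  proof (rule lborel_pair.Fubini_integrable)
    have sh: "integrable lborel (\<lambda>\<xi>. h (\<xi> - \<eta>))" "(LINT \<xi>|lborel. norm (h (\<xi> - \<eta>))) = (LINT \<xi>|lborel. norm (h \<xi>))" for \<eta>
    proof -
      show "integrable lborel (\<lambda>\<xi>. h (\<xi> - \<eta>))" using lborel_integrable_real_affine[OF h, of 1 "- \<eta>"] by simp
      have "(LINT \<xi>|lborel. norm (h \<xi>)) = \<bar>1\<bar> *\<^sub>R (LINT \<xi>|lborel. norm (h (- \<eta> + 1 * \<xi>)))"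
        by (rule lborel_integral_real_affine) simp
      then show "(LINT \<xi>|lborel. norm (h (\<xi> - \<eta>))) = (LINT \<xi>|lborel. norm (h \<xi>))" by simp
    qed
    show "(\<lambda>(\<eta>, \<xi>). F2 \<eta> \<xi>) \<in> borel_measurable (lborel \<Otimes>\<^sub>M lborel)"
      unfolding F2_def by measurable
    have "(LINT \<xi>|lborel. norm (F2 \<eta> \<xi>)) = (LINT \<xi>|lborel. norm (h \<xi>)) * norm (k \<eta>)" for \<eta>
      unfolding F2_def using sh(2)[of \<eta>] by (simp add: norm_mult)
    then show "integrable lborel (\<lambda>\<eta>. LINT \<xi>|lborel. norm (case (\<eta>, \<xi>) of (\<eta>, \<xi>) \<Rightarrow> F2 \<eta> \<xi>))"
      using k by simp
    have "integrable lborel (\<lambda>\<xi>. F2 \<eta> \<xi>)" for \<eta>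
    proof (rule bound_integrable)
      show "(\<lambda>\<xi>. F2 \<eta> \<xi>) \<in> borel_measurable borel" unfolding F2_def by measurable
      show "integrable lborel (\<lambda>\<xi>. norm (h (\<xi> - \<eta>)) * norm (k \<eta>))" using sh(1) by auto
      show "norm (F2 \<eta> \<xi>) \<le> norm (h (\<xi> - \<eta>)) * norm (k \<eta>)" for \<xi> unfolding F2_def by (simp add: norm_mult)
    qed
    then show "AE \<eta> in lborel. integrable lborel (\<lambda>\<xi>. case (\<eta>, \<xi>) of (\<eta>, \<xi>) \<Rightarrow> F2 \<eta> \<xi>)" by simp
  qed
  have "(LINT \<xi>|lborel. ?e \<xi> * conv h k \<xi>) = (LINT \<xi>|lborel. LINT \<eta>|lborel. F2 \<eta> \<xi>)"
    unfolding conv_def F2_def by simp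
  also have "\<dots> = (LINT \<eta>|lborel. LINT \<xi>|lborel. F2 \<eta> \<xi>)"
    using lborel_pair.Fubini_integral[OF i1] by simp
  also have "\<dots> = (LINT \<eta>|lborel. LINT z|lborel. F \<eta> z)"
  proof (rule Bochner_Integration.integral_cong[OF refl])
    fix \<eta>
    have "(LINT \<xi>|lborel. F2 \<eta> \<xi>) = \<bar>1\<bar> *\<^sub>R (LINT z|lborel. F2 \<eta> (\<eta> + 1 * z))"
      by (rule lborel_integral_real_affine) simp
    also have "\<dots> = (LINT z|lborel. F \<eta> z)"
    proof -
      have "F2 \<eta> (\<eta> + 1 * z) = F \<eta> z" for z
        using e[of "\<eta> + z" \<eta>] unfolding F2_def F_def by (simp add: mult_ac)
      then show ?thesis by simp
    qed
    finally show "(LINT \<xi>|lborel. F2 \<eta> \<xi>) = (LINT z|lborel. F \<eta> z)" .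
  qed
  also have "\<dots> = (LINT \<xi>|lborel. ?e \<xi> * h \<xi>) * (LINT \<xi>|lborel. ?e \<xi> * k \<xi>)"
    unfolding F_def integral_mult_left_zero integral_mult_right_zero ..
  finally show ?thesis by (simp add: ift_def)
qed

section \<open>Bounds for the propagators and for integrals over time intervals\<close>

lemma omega_nonneg: "0 \<le> omega M \<xi>"
  by (simp add: omega_def)

lemma abs_le_omega: "\<bar>\<xi>\<bar> \<le> omega M \<xi>" "\<bar>M\<bar> \<le> omega M \<xi>"
  unfolding omega_def by (simp_all add: real_le_rsqrt)

lemma kg_cos_bound: "\<bar>kg_cos M t \<xi>\<bar> \<le> 1"
  by (simp add: kg_cos_def)

lemma kg_sin_bound: "\<bar>kg_sin M t \<xi>\<bar> \<le> \<bar>t\<bar>"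
proof (cases "omega M \<xi> = 0")
  case False
  then have "omega M \<xi> > 0" using omega_nonneg[of M \<xi>] by simp
  moreover have "\<bar>sin (t * omega M \<xi>)\<bar> \<le> \<bar>t * omega M \<xi>\<bar>" by (rule abs_sin_x_le_abs_x)
  ultimately show ?thesis using False by (simp add: kg_sin_def abs_mult divide_le_eq)
qed (simp add: kg_sin_def)

text \<open>The sine propagator gains one derivative. The cases a = m and a = \<xi> bound the
  entries of the Dirac propagator.\<close>

lemma kg_sin_times:
  assumes "\<bar>a\<bar> \<le> omega M \<xi>"
  shows "\<bar>kg_sin M t \<xi> * a\<bar> \<le> 1"
proof (cases "omega M \<xi> = 0")
  case False
  then have w: "omega M \<xi> > 0" using omega_nonneg[of M \<xi>] by simp
  have "\<bar>kg_sin M t \<xi> * a\<bar> = \<bar>sin (t * omega M \<xi>)\<bar> * (\<bar>a\<bar> / omega M \<xi>)"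
    using False w by (simp add: kg_sin_def abs_mult)
  also have "\<dots> \<le> 1 * 1" using assms w by (intro mult_mono) auto
  finally show ?thesis by simp
qed (use assms in simp)

lemma kg_measurable[measurable (raw)]:
  assumes [measurable]: "f \<in> borel_measurable N" "g \<in> borel_measurable N"
  shows "(\<lambda>z. kg_sin M (f z) (g z)) \<in> borel_measurable N" "(\<lambda>z. kg_cos M (f z) (g z)) \<in> borel_measurable N"
  unfolding kg_sin_def kg_cos_def omega_def by measurable

lemma dirac_prop_entries:
  "dirac_prop m t \<xi> $ 1 $ 1 = of_real (kg_cos m t \<xi>) + \<i> * of_real (kg_sin m t \<xi> * m)"
  "dirac_prop m t \<xi> $ 1 $ 2 = \<i> * of_real (kg_sin m t \<xi> * \<xi>)"
  "dirac_prop m t \<xi> $ 2 $ 1 = \<i> * of_real (kg_sin m t \<xi> * \<xi>)"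
  "dirac_prop m t \<xi> $ 2 $ 2 = of_real (kg_cos m t \<xi>) - \<i> * of_real (kg_sin m t \<xi> * m)"
  by (simp_all add: dirac_prop_def dirac_symbol_def gamma0_def gamma1_def matrix_matrix_mult_def mat_def
      sum_2 vector_2 algebra_simps)

lemma dirac_prop_bound: "norm (dirac_prop m t \<xi> $ j $ k) \<le> 2"
proof -
  have 1: "\<bar>kg_sin m t \<xi> * m\<bar> \<le> 1" "\<bar>kg_sin m t \<xi> * \<xi>\<bar> \<le> 1"
    by (intro kg_sin_times abs_le_omega)+
  have "norm (complex_of_real a + \<i> * of_real b) \<le> 2" "norm (complex_of_real a - \<i> * of_real b) \<le> 2" "norm (\<i> * complex_of_real b) \<le> 2" if "\<bar>a\<bar> \<le> 1" "\<bar>b\<bar> \<le> 1" for a b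
    using norm_triangle_ineq[of "complex_of_real a" "\<i> * of_real b"] norm_triangle_ineq4[of "complex_of_real a" "\<i> * of_real b"] that
    by (simp_all add: norm_mult)
  then show ?thesis using exhaust_2[of j] exhaust_2[of k] 1 kg_cos_bound[of m t \<xi>]
    by (metis dirac_prop_entries)
qed

lemma dirac_prop_measurable[measurable (raw)]:
  assumes [measurable]: "f \<in> borel_measurable N" "g \<in> borel_measurable N"
  shows "(\<lambda>z. dirac_prop m (f z) (g z) $ j $ k) \<in> borel_measurable N"
proof -
  have "(\<lambda>z. dirac_prop m (f z) (g z) $ 1 $ 1) \<in> borel_measurable N" "(\<lambda>z. dirac_prop m (f z) (g z) $ 1 $ 2) \<in> borel_measurable N"
    "(\<lambda>z. dirac_prop m (f z) (g z) $ 2 $ 1) \<in> borel_measurable N" "(\<lambda>z. dirac_prop m (f z) (g z) $ 2 $ 2) \<in> borel_measurable N"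
    unfolding dirac_prop_entries by measurable
  then show ?thesis using exhaust_2[of j] exhaust_2[of k] by auto
qed

lemma set_lint_bound:
  fixes f :: "real \<Rightarrow> complex"
  assumes "a \<le> b" and f: "\<And>s. s \<in> {a..b} \<Longrightarrow> norm (f s) \<le> B" and B: "B \<ge> 0"
  shows "norm (LINT s:{a..b}|lborel. f s) \<le> (b - a) * B"
proof -
  have i: "integrable lborel (\<lambda>s. indicat_real {a..b} s * B)"
    by (intro integrable_mult_left integrable_real_indicator) (use assms in auto)
  have "norm (LINT s:{a..b}|lborel. f s) \<le> (LINT s|lborel. indicat_real {a..b} s * B)"
    unfolding set_lebesgue_integral_def
    by (rule norm_integral_le[OF i]) (use f in \<open>auto simp: indicator_def\<close>)
  also have "\<dots> = (b - a) * B" using assms by simp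
  finally show ?thesis .
qed

lemma set_lint_integrable:
  fixes f :: "real \<Rightarrow> complex"
  assumes [measurable]: "f \<in> borel_measurable borel" and f: "\<And>s. s \<in> {a..b} \<Longrightarrow> norm (f s) \<le> B"
  shows "set_integrable lborel {a..b} f"
proof -
  have "integrable lborel (\<lambda>s. indicat_real {a..b} s * B)"
    by (intro integrable_mult_left integrable_real_indicator) (auto simp: emeasure_lborel_Icc_eq)
  then show ?thesis unfolding set_integrable_def
    by (rule bound_integrable[rotated]) (use f in \<open>auto simp: indicator_def\<close>)
qed

text \<open>The diagonal entries of \<open>gamma0\<close>.\<close>

definition spinor_sign :: "2 \<Rightarrow> complex" where "spinor_sign k = (if k = 1 then 1 else - 1)"

lemma norm_spinor_sign[simp]: "norm (spinor_sign k) = 1" by (simp add: spinor_sign_def)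

section \<open>Quadratic densities and the field that they generate\<close>

type_synonym spinor = "2 \<Rightarrow> real \<Rightarrow> real \<Rightarrow> complex"

text \<open>The Fourier transform of p^* gamma0 r, with the division by 2 pi due to the convolution
  theorem. Two arguments are kept so that differences of densities can be expanded
  bilinearly.\<close>

definition scalar_density :: "spinor \<Rightarrow> spinor \<Rightarrow> real \<Rightarrow> real \<Rightarrow> complex" where
  "scalar_density p r s \<xi> = (\<Sum>k\<in>UNIV. spinor_sign k * conv (cnj_reflect (p k s)) (r k s) \<xi>) / (2 * of_real pi)"

text \<open>Time integrals, convolutions in frequency and their exchange all call for joint
  measurability, which therefore has to be carried through the iteration.\<close>

definition joint_meas :: "spinor \<Rightarrow> bool" where
  "joint_meas p \<longleftrightarrow> (\<forall>k. (\<lambda>(s, x). p k s x) \<in> borel_measurable (borel \<Otimes>\<^sub>M borel))"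

lemma joint_measD[measurable_dest]: "joint_meas p \<Longrightarrow> (\<lambda>(s, x). p k s x) \<in> borel_measurable (borel \<Otimes>\<^sub>M borel)"
  by (simp add: joint_meas_def)

lemma joint_meas_section:
  assumes "joint_meas p" shows "p k s \<in> borel_measurable borel"
proof -
  have "(\<lambda>x. case (s, x) of (s, x) \<Rightarrow> p k s x) \<in> borel_measurable borel"
    by (rule measurable_compose[OF _ joint_measD[OF assms]]) measurable
  then show ?thesis by simp
qed

lemma joint_meas_compose:
  assumes p: "joint_meas p" and [measurable]: "f \<in> borel_measurable N" "g \<in> borel_measurable N"
  shows "(\<lambda>z. p k (f z) (g z)) \<in> borel_measurable N"
proof -
  have "(\<lambda>z. case (f z, g z) of (s, x) \<Rightarrow> p k s x) \<in> borel_measurable N"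
    by (rule measurable_compose[OF _ joint_measD[OF p]]) measurable
  then show ?thesis by simp
qed

lemma joint_meas_diff:
  assumes "joint_meas p" "joint_meas r"
  shows "joint_meas (\<lambda>k s x. p k s x - r k s x)"
  using assms unfolding joint_meas_def by (auto simp: case_prod_beta' intro!: borel_measurable_diff)

lemma scalar_density_measurable:
  assumes p: "joint_meas p" and r: "joint_meas r" and [measurable]: "f \<in> borel_measurable N" "g \<in> borel_measurable N"
  shows "(\<lambda>z. scalar_density p r (f z) (g z)) \<in> borel_measurable N"
proof -
  have [measurable]: "(\<lambda>(s, x). cnj_reflect (p k s) x) \<in> borel_measurable (borel \<Otimes>\<^sub>M borel)"
      "(\<lambda>(s, x). r k s x) \<in> borel_measurable (borel \<Otimes>\<^sub>M borel)" for k
  proof -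
    have "(\<lambda>z. p k (fst z) (- snd z)) \<in> borel_measurable (borel \<Otimes>\<^sub>M borel)"
      by (intro joint_meas_compose[OF p]) measurable
    then show "(\<lambda>(s, x). cnj_reflect (p k s) x) \<in> borel_measurable (borel \<Otimes>\<^sub>M borel)"
      unfolding cnj_reflect_def case_prod_beta' by (rule borel_measurable_cnj)
    show "(\<lambda>(s, x). r k s x) \<in> borel_measurable (borel \<Otimes>\<^sub>M borel)" by (rule joint_measD[OF r])
  qed
  show ?thesis unfolding scalar_density_def by measurable
qed

text \<open>The Duhamel term of the Klein-Gordon equation, that is, the field produced from zero
  data.\<close>

definition kg_response :: "real \<Rightarrow> spinor \<Rightarrow> spinor \<Rightarrow> real \<Rightarrow> real \<Rightarrow> complex" where
  "kg_response M p r t \<xi> = (LINT s:{0..t}|lborel. of_real (kg_sin M (t - s) \<xi>) * scalar_density p r s \<xi>)"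

lemma kg_response_measurable:
  assumes p: "joint_meas p" and r: "joint_meas r" and [measurable]: "f \<in> borel_measurable N" "g \<in> borel_measurable N"
  shows "(\<lambda>z. kg_response M p r (f z) (g z)) \<in> borel_measurable N"
proof -
  have [measurable]: "(\<lambda>(z, s). scalar_density p r s (g z)) \<in> borel_measurable (N \<Otimes>\<^sub>M borel)"
    unfolding case_prod_beta' by (intro scalar_density_measurable p r) measurable
  have [measurable]: "Measurable.pred (N \<Otimes>\<^sub>M borel) (\<lambda>(z, s). s \<in> {0..f z})"
    unfolding atLeastAtMost_iff case_prod_beta' by measurable
  have "kg_response M p r (f z) (g z) = (LINT s|lborel. (if s \<in> {0..f z} then of_real (kg_sin M (f z - s) (g z)) * scalar_density p r s (g z) else 0))" for z
    unfolding kg_response_def set_lebesgue_integral_def by (intro Bochner_Integration.integral_cong) (auto simp: indicator_def)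
  then show ?thesis by simp
qed

lemma scalar_density_bound:
  assumes l: "l > 0" and p: "joint_meas p" and r: "joint_meas r"
    and a: "\<And>k x. norm (p k s x) \<le> a * wt l x" and b: "\<And>k x. norm (r k s x) \<le> b * wt l x"
  shows "norm (scalar_density p r s \<xi>) \<le> 16 * wmass * l * a * b * wt l \<xi>"
proof -
  define B where "B = 16 * wmass * l * a * b * wt l \<xi>"
  have c: "norm (conv (cnj_reflect (p k s)) (r k s) \<xi>) \<le> B" for k
    unfolding B_def using joint_meas_section[OF p] joint_meas_section[OF r]
    by (intro conv_bound(2)[OF l] cnj_reflect_measurable cnj_reflect_bound a b)
  have B_nonneg: "B \<ge> 0" using order_trans[OF norm_ge_zero c] .
  have "norm (\<Sum>k\<in>(UNIV :: 2 set). spinor_sign k * conv (cnj_reflect (p k s)) (r k s) \<xi>) \<le> (\<Sum>k\<in>(UNIV :: 2 set). B)"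
    by (rule sum_norm_le) (simp add: norm_mult c)
  from divide_right_mono[OF this, of "2 * pi"] have "norm (scalar_density p r s \<xi>) \<le> 2 * B / (2 * pi)"
    unfolding scalar_density_def norm_divide by simp
  also have "\<dots> \<le> B / 1" using B_nonneg pi_gt3 by (simp add: divide_le_eq mult_le_cancel_left1)
  finally show ?thesis unfolding B_def by simp
qed

lemma scalar_density_diff:
  assumes l: "l > 0" and p: "joint_meas p" and r: "joint_meas r" and p': "joint_meas p'" and r': "joint_meas r'"
    and a: "\<And>k x. norm (p k s x) \<le> a * wt l x" "\<And>k x. norm (r k s x) \<le> b * wt l x"
    and a': "\<And>k x. norm (p' k s x) \<le> a' * wt l x" "\<And>k x. norm (r' k s x) \<le> b' * wt l x"
  shows "scalar_density p r s \<xi> - scalar_density p' r' s \<xi> = scalar_density (\<lambda>k s x. p k s x - p' k s x) r s \<xi> + scalar_density p' (\<lambda>k s x. r k s x - r' k s x) s \<xi>"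
proof -
  note sec = joint_meas_section[OF p] joint_meas_section[OF r] joint_meas_section[OF p'] joint_meas_section[OF r']
  have i: "integrable lborel (\<lambda>\<eta>. cnj_reflect (p k s) (\<xi> - \<eta>) * r k s \<eta>)"
    "integrable lborel (\<lambda>\<eta>. cnj_reflect (p' k s) (\<xi> - \<eta>) * r k s \<eta>)"
    "integrable lborel (\<lambda>\<eta>. cnj_reflect (p' k s) (\<xi> - \<eta>) * r' k s \<eta>)" for k
    using conv_bound(1)[OF l cnj_reflect_measurable[OF sec(1)] sec(2) cnj_reflect_bound[OF a(1)] a(2)]
      conv_bound(1)[OF l cnj_reflect_measurable[OF sec(3)] sec(2) cnj_reflect_bound[OF a'(1)] a(2)]
      conv_bound(1)[OF l cnj_reflect_measurable[OF sec(3)] sec(4) cnj_reflect_bound[OF a'(1)] a'(2)] by auto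
  have "conv (cnj_reflect (p k s)) (r k s) \<xi> - conv (cnj_reflect (p' k s)) (r' k s) \<xi> =
     conv (cnj_reflect (\<lambda>x. p k s x - p' k s x)) (r k s) \<xi> + conv (cnj_reflect (p' k s)) (\<lambda>x. r k s x - r' k s x) \<xi>" for k
    unfolding conv_def cnj_reflect_diff left_diff_distrib right_diff_distrib using i by simp
  then have "spinor_sign k * conv (cnj_reflect (p k s)) (r k s) \<xi> - spinor_sign k * conv (cnj_reflect (p' k s)) (r' k s) \<xi> =
     spinor_sign k * conv (cnj_reflect (\<lambda>x. p k s x - p' k s x)) (r k s) \<xi> + spinor_sign k * conv (cnj_reflect (p' k s)) (\<lambda>x. r k s x - r' k s x) \<xi>" for k
    by (metis right_diff_distrib distrib_left)
  then show ?thesis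
    unfolding scalar_density_def diff_divide_distrib[symmetric] add_divide_distrib[symmetric] sum_subtractf[symmetric] sum.distrib[symmetric]
    by simp
qed

text \<open>Two components, propagator entries bounded by 2 and the division by 2 pi combine to 2 /
  pi, which is at most 1.\<close>

lemma dirac_sum_bound:
  assumes c: "\<And>k. norm (c k) \<le> X"
  shows "norm (\<Sum>k\<in>UNIV. dirac_prop m t \<xi> $ j $ k * (spinor_sign k * c k / (2 * of_real pi))) \<le> X"
proof -
  have X: "X \<ge> 0" using order_trans[OF norm_ge_zero c] .
  have "norm (\<Sum>k\<in>(UNIV :: 2 set). dirac_prop m t \<xi> $ j $ k * (spinor_sign k * c k / (2 * of_real pi))) \<le> (\<Sum>k\<in>(UNIV :: 2 set). 2 * (X / (2 * pi)))"
  proof (rule sum_norm_le)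
    fix k
    have "norm (spinor_sign k * c k / (2 * of_real pi)) \<le> X / (2 * pi)"
      using c[of k] by (simp add: norm_divide norm_mult divide_right_mono)
    then show "norm (dirac_prop m t \<xi> $ j $ k * (spinor_sign k * c k / (2 * of_real pi))) \<le> 2 * (X / (2 * pi))"
      unfolding norm_mult[of "dirac_prop m t \<xi> $ j $ k"] by (intro mult_mono dirac_prop_bound) auto
  qed
  also have "\<dots> = 2 * X / pi" by simp
  also have "\<dots> \<le> X" using X pi_gt3 mult_right_mono[of 2 pi X] by (simp add: divide_le_eq mult.commute)
  finally show ?thesis .
qed

lemma conv_add_right:
  assumes "integrable lborel (\<lambda>\<eta>. h (\<xi> - \<eta>) * f \<eta>)" "integrable lborel (\<lambda>\<eta>. h (\<xi> - \<eta>) * g \<eta>)"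
  shows "conv h (\<lambda>x. f x + g x) \<xi> = conv h f \<xi> + conv h g \<xi>"
  using assms by (simp add: conv_def distrib_left)

section \<open>The Duhamel contraction\<close>

text \<open>\<open>p0\<close>, \<open>q0\<close> and \<open>q1\<close> stand for the Fourier transforms of \<open>\<psi>(0)\<close>, \<open>\<phi>(0)\<close> and \<open>\<partial>\<^sub>t\<phi>(0)\<close>. The field
  \<open>\<phi>\<close> is eliminated by its Duhamel formula \<open>Q\<close>, so that \<open>G\<close> acts on the Fourier transform of
  \<open>\<psi>\<close> alone. Both nonlinear terms lose a factor \<open>l\<close> in \<open>conv_bound\<close> and regain it from the length
  \<open>T = 1 / l\<close> of the time interval.\<close>

locale dkg_data =
  fixes m M l A0 :: real and p0 :: "2 \<Rightarrow> real \<Rightarrow> complex" and q0 q1 :: "real \<Rightarrow> complex"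
  assumes l1: "l \<ge> 1"
    and p0m[measurable]: "\<And>k. p0 k \<in> borel_measurable borel"
    and q0m[measurable]: "q0 \<in> borel_measurable borel"
    and q1m[measurable]: "q1 \<in> borel_measurable borel"
    and p0b: "\<And>k x. norm (p0 k x) \<le> A0 * wt l x"
    and Li: "integrable lborel (\<lambda>\<eta>. (norm (q0 \<eta>) + norm (q1 \<eta>)) * (1 + \<eta>\<^sup>2)\<^sup>2)"
    and small: "(16 * (LINT \<eta>|lborel. (norm (q0 \<eta>) + norm (q1 \<eta>)) * (1 + \<eta>\<^sup>2)\<^sup>2) + 3 * (16 * wmass)\<^sup>2 * (8 * A0)\<^sup>2) / l \<le> 1/2"
begin

definition "T = 1 / l"
text \<open>The free evolution is bounded by \<open>4 * A0\<close>, half of this radius; the other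
  half is room for the Duhamel term.\<close>

definition "A = 8 * A0"
definition "\<kappa> = 16 * wmass"
definition "L = (LINT \<eta>|lborel. (norm (q0 \<eta>) + norm (q1 \<eta>)) * (1 + \<eta>\<^sup>2)\<^sup>2)"
text \<open>Bounds the nonlinearity relative to the spinor: \<open>16 * L\<close> comes from the
  free field via \<open>conv_bound_low\<close>, and \<open>\<kappa>\<^sup>2 * A\<^sup>2\<close> from
  the generated field, where the factors \<open>l\<close> and \<open>T\<close> have
  cancelled.\<close>

definition "K1 = 16 * L + \<kappa>\<^sup>2 * A\<^sup>2"

lemma l0: "l > 0" using l1 by simp
lemma T0: "T > 0" "T \<le> 1" unfolding T_def using l1 by auto
lemma Tl: "T * l = 1" "l * T = 1" unfolding T_def using l0 by auto
lemma A0_nonneg: "A0 \<ge> 0" using order_trans[OF norm_ge_zero p0b[of 1 0]] wt_pos[of l 0] by (simp add: zero_le_mult_iff)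
lemma A_nonneg: "A \<ge> 0" using A0_nonneg by (simp add: A_def)
lemma kappa_nonneg: "\<kappa> \<ge> 0" using wmass_nonneg by (simp add: \<kappa>_def)
lemma L_nonneg: "L \<ge> 0" unfolding L_def by (intro integral_nonneg_AE AE_I2) auto
lemma K1_nonneg: "K1 \<ge> 0" unfolding K1_def using L_nonneg by (intro add_nonneg_nonneg mult_nonneg_nonneg) auto
text \<open>The Lipschitz constant of the Duhamel map. Compared with \<open>K1\<close>, the cubic
  term counts three times: once for varying the spinor and twice for varying the density, which is
  quadratic.\<close>

lemma small': "T * (16 * L + 3 * \<kappa>\<^sup>2 * A\<^sup>2) \<le> 1/2"
  using small unfolding T_def L_def[symmetric] A_def[symmetric] \<kappa>_def[symmetric] by simp
lemma smallK1: "T * K1 \<le> 1/2"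
proof -
  have "K1 \<le> 16 * L + 3 * \<kappa>\<^sup>2 * A\<^sup>2" unfolding K1_def by (simp add: mult_right_mono)
  then have "T * K1 \<le> T * (16 * L + 3 * \<kappa>\<^sup>2 * A\<^sup>2)" using T0 by (intro mult_left_mono) auto
  then show ?thesis using small' by linarith
qed

text \<open>The ball of radius \<open>a\<close> in the weighted supremum norm over the time
  interval; it is the ball of radius \<open>A\<close> that \<open>G\<close> maps into
  itself.\<close>

definition admissible :: "real \<Rightarrow> spinor \<Rightarrow> bool" where
  "admissible a p \<longleftrightarrow> joint_meas p \<and> (\<forall>k. \<forall>s\<in>{0..T}. \<forall>x. norm (p k s x) \<le> a * wt l x)"

lemma admissible_meas: "admissible a p \<Longrightarrow> joint_meas p" by (simp add: admissible_def)
lemma admissible_bound: "admissible a p \<Longrightarrow> s \<in> {0..T} \<Longrightarrow> norm (p k s x) \<le> a * wt l x" by (simp add: admissible_def)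
lemma admissible_nonneg: assumes "admissible a p" shows "a \<ge> 0"
  using order_trans[OF norm_ge_zero admissible_bound[OF assms, of 0 1 0]] T0 wt_pos[of l 0] by (simp add: zero_le_mult_iff)

lemma admissible_diff:
  assumes "admissible A p" "admissible A r" "\<And>k s x. s \<in> {0..T} \<Longrightarrow> norm (p k s x - r k s x) \<le> d * wt l x"
  shows "admissible d (\<lambda>k s x. p k s x - r k s x)"
  using assms joint_meas_diff unfolding admissible_def by auto

lemma scalar_density_adm:
  assumes "admissible a p" "admissible b r" "s \<in> {0..T}"
  shows "norm (scalar_density p r s \<xi>) \<le> \<kappa> * l * a * b * wt l \<xi>"
  unfolding \<kappa>_def using assms by (intro scalar_density_bound[OF l0] admissible_meas admissible_bound) auto

text \<open>The sine propagator is at most the elapsed time, hence at most \<open>T\<close>, which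
  cancels the \<open>l\<close> in the density.\<close>

lemma kg_src_bound:
  assumes "admissible a p" "admissible b r" "t \<in> {0..T}" "s \<in> {0..t}"
  shows "norm (of_real (kg_sin M (t - s) \<xi>) * scalar_density p r s \<xi>) \<le> \<kappa> * a * b * wt l \<xi>"
proof -
  have "norm (of_real (kg_sin M (t - s) \<xi>) * scalar_density p r s \<xi>) \<le> T * (\<kappa> * l * a * b * wt l \<xi>)"
    unfolding norm_mult norm_of_real
    using assms T0 kg_sin_bound[of M "t - s" \<xi>] by (intro mult_mono scalar_density_adm) auto
  also have "\<dots> = (T * l) * (\<kappa> * a * b * wt l \<xi>)" by (simp add: mult_ac)
  finally show ?thesis by (simp add: Tl)
qed

lemma section_meas:
  assumes "joint_meas p" "joint_meas r"
  shows "(\<lambda>s. of_real (kg_sin M (t - s) \<xi>) * scalar_density p r s \<xi>) \<in> borel_measurable borel"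
proof -
  have [measurable]: "(\<lambda>s. scalar_density p r s \<xi>) \<in> borel_measurable borel" by (rule scalar_density_measurable[OF assms]) auto
  show ?thesis by measurable
qed

lemma kg_src_integrable:
  assumes "admissible a p" "admissible b r" "t \<in> {0..T}"
  shows "set_integrable lborel {0..t} (\<lambda>s. of_real (kg_sin M (t - s) \<xi>) * scalar_density p r s \<xi>)"
  by (rule set_lint_integrable[OF section_meas kg_src_bound]) (use assms admissible_meas in auto)

lemma kg_response_bound:
  assumes "admissible a p" "admissible b r" "t \<in> {0..T}"
  shows "norm (kg_response M p r t \<xi>) \<le> T * \<kappa> * a * b * wt l \<xi>"
proof -
  have nn: "0 \<le> \<kappa> * a * b * wt l \<xi>"
    using kappa_nonneg admissible_nonneg[OF assms(1)] admissible_nonneg[OF assms(2)] wt_nonneg by simp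
  have "norm (kg_response M p r t \<xi>) \<le> (t - 0) * (\<kappa> * a * b * wt l \<xi>)"
    unfolding kg_response_def using assms nn by (intro set_lint_bound kg_src_bound) auto
  also have "\<dots> \<le> T * (\<kappa> * a * b * wt l \<xi>)" using assms nn by (intro mult_right_mono) auto
  finally show ?thesis by (simp add: mult_ac)
qed

lemma kg_response_diff:
  assumes p: "admissible A p" and r: "admissible A r" and d: "admissible d (\<lambda>k s x. p k s x - r k s x)" and t: "t \<in> {0..T}"
  shows "norm (kg_response M p p t \<xi> - kg_response M r r t \<xi>) \<le> 2 * T * \<kappa> * A * d * wt l \<xi>"
proof -
  let ?d = "\<lambda>k s x. p k s x - r k s x"
  have "kg_response M p p t \<xi> - kg_response M r r t \<xi> = (LINT s:{0..t}|lborel. of_real (kg_sin M (t - s) \<xi>) * scalar_density p p s \<xi> - of_real (kg_sin M (t - s) \<xi>) * scalar_density r r s \<xi>)"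
    unfolding kg_response_def by (rule set_integral_diff(2)[OF kg_src_integrable[OF p p t] kg_src_integrable[OF r r t], symmetric])
  also have "\<dots> = (LINT s:{0..t}|lborel. of_real (kg_sin M (t - s) \<xi>) * scalar_density ?d p s \<xi> + of_real (kg_sin M (t - s) \<xi>) * scalar_density r ?d s \<xi>)"
  proof (rule set_lebesgue_integral_cong)
    show "\<forall>s. s \<in> {0..t} \<longrightarrow> of_real (kg_sin M (t - s) \<xi>) * scalar_density p p s \<xi> - of_real (kg_sin M (t - s) \<xi>) * scalar_density r r s \<xi> = of_real (kg_sin M (t - s) \<xi>) * scalar_density ?d p s \<xi> + of_real (kg_sin M (t - s) \<xi>) * scalar_density r ?d s \<xi>"
    proof (intro allI impI)
      fix s assume s: "s \<in> {0..t}"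
      then have s': "s \<in> {0..T}" using t by auto
      have "scalar_density p p s \<xi> - scalar_density r r s \<xi> = scalar_density ?d p s \<xi> + scalar_density r ?d s \<xi>"
        by (rule scalar_density_diff[OF l0 admissible_meas[OF p] admissible_meas[OF p] admissible_meas[OF r] admissible_meas[OF r] admissible_bound[OF p s'] admissible_bound[OF p s'] admissible_bound[OF r s'] admissible_bound[OF r s']])
      then show "of_real (kg_sin M (t - s) \<xi>) * scalar_density p p s \<xi> - of_real (kg_sin M (t - s) \<xi>) * scalar_density r r s \<xi> = of_real (kg_sin M (t - s) \<xi>) * scalar_density ?d p s \<xi> + of_real (kg_sin M (t - s) \<xi>) * scalar_density r ?d s \<xi>"
        by (simp only: right_diff_distrib[symmetric] distrib_left[symmetric])
    qed
  qed simp
  also have "\<dots> = kg_response M ?d p t \<xi> + kg_response M r ?d t \<xi>"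
    unfolding kg_response_def by (rule set_integral_add(2)[OF kg_src_integrable[OF d p t] kg_src_integrable[OF r d t]])
  finally have e: "kg_response M p p t \<xi> - kg_response M r r t \<xi> = kg_response M ?d p t \<xi> + kg_response M r ?d t \<xi>" .
  have "norm (kg_response M ?d p t \<xi> + kg_response M r ?d t \<xi>) \<le> T * \<kappa> * d * A * wt l \<xi> + T * \<kappa> * A * d * wt l \<xi>"
    by (intro norm_triangle_mono kg_response_bound p r d t)
  then show ?thesis unfolding e by (simp add: mult_ac)
qed

definition "free_field t \<xi> = of_real (kg_cos M t \<xi>) * q0 \<xi> + of_real (kg_sin M t \<xi>) * q1 \<xi>"

lemma free_field_bound:
  assumes "\<bar>t\<bar> \<le> 1"
  shows "norm (free_field t \<xi>) \<le> norm (q0 \<xi>) + norm (q1 \<xi>)"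
  unfolding free_field_def
  by (intro norm_triangle_mono; unfold norm_mult norm_of_real; rule mult_left_le_one_le)
    (use kg_cos_bound kg_sin_bound[of M t \<xi>] assms in auto)

definition Q :: "spinor \<Rightarrow> spinor \<Rightarrow> real \<Rightarrow> real \<Rightarrow> complex" where
  "Q p r t \<xi> = free_field t \<xi> + kg_response M p r t \<xi>"

lemma free_field_measurable[measurable]: "(\<lambda>(t, \<xi>). free_field t \<xi>) \<in> borel_measurable (borel \<Otimes>\<^sub>M borel)" "free_field t \<in> borel_measurable borel"
  unfolding free_field_def[abs_def] by measurable

lemma Q_measurable:
  assumes "joint_meas p" "joint_meas r"
  shows "(\<lambda>(t, \<xi>). Q p r t \<xi>) \<in> borel_measurable (borel \<Otimes>\<^sub>M borel)"
proof -
  have [measurable]: "(\<lambda>(t, \<xi>). kg_response M p r t \<xi>) \<in> borel_measurable (borel \<Otimes>\<^sub>M borel)"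
    unfolding case_prod_beta' by (rule kg_response_measurable[OF assms]) measurable
  show ?thesis unfolding Q_def by measurable
qed

lemma sections:
  assumes "joint_meas p" "joint_meas r"
  shows "Q p r t \<in> borel_measurable borel" "kg_response M p r t \<in> borel_measurable borel"
proof -
  have "(\<lambda>x. case (t, x) of (t, \<xi>) \<Rightarrow> Q p r t \<xi>) \<in> borel_measurable borel"
    by (rule measurable_compose[OF _ Q_measurable[OF assms]]) measurable
  then show "Q p r t \<in> borel_measurable borel" by simp
  show "kg_response M p r t \<in> borel_measurable borel"
    by (rule kg_response_measurable[OF assms, of "\<lambda>x. t" borel "\<lambda>x. x"]) measurable
qed

text \<open>The two parts of the field are treated differently. The free part stems from fixed data
  and costs no power of \<open>l\<close>; the response lies in the weighted class and brings a
  factor \<open>T\<close> against the \<open>l\<close> of \<open>conv_bound\<close>.\<close>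

lemma conv_Q:
  assumes p: "admissible a p" and r: "admissible A r" and s: "s \<in> {0..T}"
  shows "integrable lborel (\<lambda>\<eta>. p k s (\<xi> - \<eta>) * Q r r s \<eta>)"
    and "norm (conv (p k s) (Q r r s) \<xi>) \<le> a * K1 * wt l \<xi>"
proof -
  note pm = joint_meas_section[OF admissible_meas[OF p], of k s]
  note rm = sections(2)[OF admissible_meas[OF r] admissible_meas[OF r], of s]
  have s1: "\<bar>s\<bar> \<le> 1" using s T0 by auto
  note b1 = conv_bound_low[OF l1 pm free_field_measurable(2)[of s] admissible_bound[OF p s] free_field_bound[OF s1] Li]
  note b2 = conv_bound[OF l0 pm rm admissible_bound[OF p s] kg_response_bound[OF r r s]]
  show "integrable lborel (\<lambda>\<eta>. p k s (\<xi> - \<eta>) * Q r r s \<eta>)"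
    unfolding Q_def distrib_left by (rule Bochner_Integration.integrable_add[OF b1(1) b2(1)])
  have e: "conv (p k s) (Q r r s) \<xi> = conv (p k s) (free_field s) \<xi> + conv (p k s) (kg_response M r r s) \<xi>"
    unfolding Q_def[abs_def] by (rule conv_add_right[OF b1(1) b2(1)])
  have "norm (conv (p k s) (Q r r s) \<xi>) \<le> 16 * a * L * wt l \<xi> + 16 * wmass * l * a * (T * \<kappa> * A * A) * wt l \<xi>"
    unfolding e L_def by (intro norm_triangle_mono b1(2) b2(2))
  also have "16 * wmass * l * a * (T * \<kappa> * A * A) * wt l \<xi> = (T * l) * (\<kappa>\<^sup>2 * A\<^sup>2 * a * wt l \<xi>)"
    by (simp add: \<kappa>_def power2_eq_square mult_ac)
  finally show "norm (conv (p k s) (Q r r s) \<xi>) \<le> a * K1 * wt l \<xi>"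
    unfolding K1_def Tl by (simp add: algebra_simps)
qed

text \<open>The free field does not depend on the spinor, so it cancels in the difference of the two
  fields, and only the difference of the responses is convolved with \<open>r\<close>.\<close>

lemma conv_Q_diff:
  assumes p: "admissible A p" and r: "admissible A r" and d: "admissible d (\<lambda>k s x. p k s x - r k s x)" and s: "s \<in> {0..T}"
  shows "norm (conv (p k s) (Q p p s) \<xi> - conv (r k s) (Q r r s) \<xi>) \<le> d * (16 * L + 3 * \<kappa>\<^sup>2 * A\<^sup>2) * wt l \<xi>"
proof -
  let ?d = "\<lambda>k s x. p k s x - r k s x"
  note rm = joint_meas_section[OF admissible_meas[OF r], of k s]
  have Rd: "norm (kg_response M p p s x - kg_response M r r s x) \<le> (2 * T * \<kappa> * A * d) * wt l x" for x
    by (rule kg_response_diff[OF p r d s])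
  have Rm: "(\<lambda>x. kg_response M p p s x - kg_response M r r s x) \<in> borel_measurable borel"
    by (intro borel_measurable_diff sections admissible_meas[OF p] admissible_meas[OF r])
  note b1 = conv_Q[OF d p s, of k \<xi>]
  note b2 = conv_bound[OF l0 rm Rm admissible_bound[OF r s] Rd, of \<xi>]
  note b3 = conv_Q(1)[OF r r s, of k \<xi>]
  have "conv (p k s) (Q p p s) \<xi> - conv (r k s) (Q r r s) \<xi> = conv (\<lambda>x. p k s x - r k s x) (Q p p s) \<xi> + conv (r k s) (\<lambda>x. kg_response M p p s x - kg_response M r r s x) \<xi>"
    unfolding conv_def Bochner_Integration.integral_diff[OF conv_Q(1)[OF p p s, of k \<xi>] b3, symmetric]
      Bochner_Integration.integral_add[OF b1(1) b2(1), symmetric]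
    by (intro Bochner_Integration.integral_cong refl) (simp add: Q_def left_diff_distrib right_diff_distrib distrib_left)
  then have "norm (conv (p k s) (Q p p s) \<xi> - conv (r k s) (Q r r s) \<xi>) \<le> d * K1 * wt l \<xi> + 16 * wmass * l * A * (2 * T * \<kappa> * A * d) * wt l \<xi>"
    using norm_triangle_mono[OF b1(2) b2(2)] by simp
  also have "16 * wmass * l * A * (2 * T * \<kappa> * A * d) * wt l \<xi> = (T * l) * (2 * \<kappa>\<^sup>2 * A\<^sup>2 * d * wt l \<xi>)"
    by (simp add: \<kappa>_def power2_eq_square mult_ac)
  finally show ?thesis unfolding Tl K1_def by (simp add: algebra_simps)
qed

text \<open>The transform of the integrand in the Dirac Duhamel formula: the convolution stands for
  the product phi psi, and \<open>spinor_sign\<close> for gamma0.\<close>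

definition feedback :: "spinor \<Rightarrow> 2 \<Rightarrow> real \<Rightarrow> real \<Rightarrow> real \<Rightarrow> complex" where
  "feedback p j t \<xi> s = (\<Sum>k\<in>UNIV. dirac_prop m (t - s) \<xi> $ j $ k * (spinor_sign k * conv (p k s) (Q p p s) \<xi> / (2 * of_real pi)))"

definition free_spinor :: "2 \<Rightarrow> real \<Rightarrow> real \<Rightarrow> complex" where
  "free_spinor j t \<xi> = (\<Sum>k\<in>UNIV. dirac_prop m t \<xi> $ j $ k * p0 k \<xi>)"

definition G :: "spinor \<Rightarrow> spinor" where
  "G p j t \<xi> = free_spinor j t \<xi> - \<i> * (LINT s:{0..t}|lborel. feedback p j t \<xi> s)"

lemma feedback_measurable:
  assumes p: "joint_meas p" and [measurable]: "f \<in> borel_measurable N" "g \<in> borel_measurable N" "h \<in> borel_measurable N"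
  shows "(\<lambda>z. feedback p j (f z) (g z) (h z)) \<in> borel_measurable N"
proof -
  have [measurable]: "(\<lambda>(s, x). p k s x) \<in> borel_measurable (borel \<Otimes>\<^sub>M borel)" for k by (rule joint_measD[OF p])
  have [measurable]: "(\<lambda>(s, x). Q p p s x) \<in> borel_measurable (borel \<Otimes>\<^sub>M borel)" by (rule Q_measurable[OF p p])
  show ?thesis unfolding feedback_def by measurable
qed

lemma free_spinor_measurable[measurable (raw)]:
  assumes [measurable]: "f \<in> borel_measurable N" "g \<in> borel_measurable N"
  shows "(\<lambda>z. free_spinor j (f z) (g z)) \<in> borel_measurable N"
  unfolding free_spinor_def by measurable

lemma G_measurable:
  assumes p: "joint_meas p"
  shows "joint_meas (G p)"
  unfolding joint_meas_def
proof
  fix j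
  have [measurable]: "(\<lambda>(z, s). feedback p j (fst z) (snd z) s) \<in> borel_measurable ((borel \<Otimes>\<^sub>M borel) \<Otimes>\<^sub>M borel)"
    unfolding case_prod_beta' by (intro feedback_measurable p) measurable
  have "G p j t \<xi> = free_spinor j t \<xi> - \<i> * (LINT s|lborel. (if 0 \<le> s \<and> s \<le> t then feedback p j t \<xi> s else 0))" for t \<xi>
    unfolding G_def set_lebesgue_integral_def
    by (intro arg_cong2[where f="(-)"] arg_cong2[where f="(*)"] refl Bochner_Integration.integral_cong) (auto simp: indicator_def)
  then show "(\<lambda>(t, x). G p j t x) \<in> borel_measurable (borel \<Otimes>\<^sub>M borel)"
    unfolding case_prod_beta' by simp
qed

lemma feedback_bound:
  assumes p: "admissible A p" and s: "s \<in> {0..T}"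
  shows "norm (feedback p j t \<xi> s) \<le> A * K1 * wt l \<xi>"
  unfolding feedback_def by (intro dirac_sum_bound conv_Q p s)

lemma feedback_integrable:
  assumes p: "admissible A p" and t: "t \<in> {0..T}"
  shows "set_integrable lborel {0..t} (feedback p j t \<xi>)"
proof (rule set_lint_integrable)
  show "feedback p j t \<xi> \<in> borel_measurable borel" by (rule feedback_measurable[OF admissible_meas[OF p]]) measurable
  show "norm (feedback p j t \<xi> s) \<le> A * K1 * wt l \<xi>" if "s \<in> {0..t}" for s
    by (rule feedback_bound[OF p]) (use that t in auto)
qed

lemma free_spinor_bound: "norm (free_spinor j t \<xi>) \<le> 4 * A0 * wt l \<xi>"
proof -
  have "norm (free_spinor j t \<xi>) \<le> (\<Sum>k\<in>(UNIV :: 2 set). 2 * (A0 * wt l \<xi>))"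
    unfolding free_spinor_def by (rule sum_norm_le) (unfold norm_mult, intro mult_mono dirac_prop_bound p0b, auto)
  then show ?thesis by simp
qed

text \<open>The nonlinear correction to the free spinor is of order \<open>T\<close>. Besides the
  invariance of the ball, this later shows that the solution is close to a free wave.\<close>

lemma G_plin:
  assumes p: "admissible A p" and t: "t \<in> {0..T}"
  shows "norm (G p j t \<xi> - free_spinor j t \<xi>) \<le> T * (A * K1) * wt l \<xi>"
proof -
  have nn: "0 \<le> A * K1 * wt l \<xi>" using A_nonneg K1_nonneg wt_nonneg by simp
  have "norm (LINT s:{0..t}|lborel. feedback p j t \<xi> s) \<le> (t - 0) * (A * K1 * wt l \<xi>)"
    using t nn by (intro set_lint_bound feedback_bound p) auto
  also have "\<dots> \<le> T * (A * K1 * wt l \<xi>)" using t nn by (intro mult_right_mono) auto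
  finally show ?thesis by (simp add: G_def norm_mult mult_ac)
qed

lemma G_adm:
  assumes p: "admissible A p"
  shows "admissible A (G p)"
  unfolding admissible_def
proof (intro conjI allI ballI)
  show "joint_meas (G p)" by (rule G_measurable[OF admissible_meas[OF p]])
  fix k s x assume s: "s \<in> {0..T}"
  have "norm (G p k s x) \<le> norm (G p k s x - free_spinor k s x) + norm (free_spinor k s x)"
    using norm_triangle_ineq[of "G p k s x - free_spinor k s x" "free_spinor k s x"] by simp
  also have "\<dots> \<le> T * (A * K1) * wt l x + 4 * A0 * wt l x"
    by (intro add_mono G_plin p s free_spinor_bound)
  also have "T * (A * K1) * wt l x = (T * K1) * (A * wt l x)" by (simp add: mult_ac)
  also have "\<dots> \<le> 1/2 * (A * wt l x)"
    using smallK1 A_nonneg wt_nonneg by (intro mult_right_mono) auto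
  also have "1/2 * (A * wt l x) + 4 * A0 * wt l x = A * wt l x" by (simp add: A_def)
  finally show "norm (G p k s x) \<le> A * wt l x" by simp
qed

lemma G_contraction:
  assumes p: "admissible A p" and r: "admissible A r" and d: "\<And>k s x. s \<in> {0..T} \<Longrightarrow> norm (p k s x - r k s x) \<le> d * wt l x" and t: "t \<in> {0..T}"
  shows "norm (G p j t \<xi> - G r j t \<xi>) \<le> d / 2 * wt l \<xi>"
proof -
  have da: "admissible d (\<lambda>k s x. p k s x - r k s x)" by (rule admissible_diff[OF p r d])
  have d0: "d \<ge> 0" by (rule admissible_nonneg[OF da])
  have nn: "0 \<le> d * (16 * L + 3 * \<kappa>\<^sup>2 * A\<^sup>2) * wt l \<xi>" using d0 L_nonneg wt_nonneg by simp
  have "G p j t \<xi> - G r j t \<xi> = - (\<i> * (LINT s:{0..t}|lborel. feedback p j t \<xi> s - feedback r j t \<xi> s))"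
    unfolding G_def set_integral_diff(2)[OF feedback_integrable[OF p t] feedback_integrable[OF r t]] by (simp add: right_diff_distrib)
  then have "norm (G p j t \<xi> - G r j t \<xi>) = norm (LINT s:{0..t}|lborel. feedback p j t \<xi> s - feedback r j t \<xi> s)"
    by (simp add: norm_mult)
  also have "\<dots> \<le> (t - 0) * (d * (16 * L + 3 * \<kappa>\<^sup>2 * A\<^sup>2) * wt l \<xi>)"
  proof (rule set_lint_bound)
    fix s assume "s \<in> {0..t}"
    then have s: "s \<in> {0..T}" using t by auto
    have "feedback p j t \<xi> s - feedback r j t \<xi> s = (\<Sum>k\<in>UNIV. dirac_prop m (t - s) \<xi> $ j $ k * (spinor_sign k * (conv (p k s) (Q p p s) \<xi> - conv (r k s) (Q r r s) \<xi>) / (2 * of_real pi)))"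
      unfolding feedback_def sum_subtractf[symmetric] by (simp only: right_diff_distrib diff_divide_distrib)
    also have "norm \<dots> \<le> d * (16 * L + 3 * \<kappa>\<^sup>2 * A\<^sup>2) * wt l \<xi>"
      by (intro dirac_sum_bound conv_Q_diff p r da s)
    finally show "norm (feedback p j t \<xi> s - feedback r j t \<xi> s) \<le> d * (16 * L + 3 * \<kappa>\<^sup>2 * A\<^sup>2) * wt l \<xi>" .
  qed (use t nn in auto)
  also have "\<dots> \<le> T * (d * (16 * L + 3 * \<kappa>\<^sup>2 * A\<^sup>2) * wt l \<xi>)" using t nn by (intro mult_right_mono) auto
  also have "\<dots> = (T * (16 * L + 3 * \<kappa>\<^sup>2 * A\<^sup>2)) * (d * wt l \<xi>)" by (simp add: mult_ac)
  also have "\<dots> \<le> 1/2 * (d * wt l \<xi>)" using small' d0 wt_nonneg by (intro mult_right_mono) auto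
  finally show ?thesis by simp
qed

end

section \<open>Picard iteration and the fixed point of the Duhamel map\<close>

lemma geometric_limit:
  fixes x :: "nat \<Rightarrow> complex"
  assumes x: "\<And>n. norm (x (Suc n) - x n) \<le> C / 2 ^ n"
  shows "x \<longlonglongrightarrow> lim x" and "norm (lim x - x n) \<le> 2 * C / 2 ^ n"
proof -
  have C: "C \<ge> 0" using order_trans[OF norm_ge_zero x[of 0]] by simp
  \<comment> \<open>The subtracted term is the tail of the geometric series; keeping it lets the
    induction close.\<close>
  have k: "norm (x (n + k) - x n) \<le> 2 * C / 2 ^ n - 2 * C / 2 ^ (n + k)" for n k
  proof (induction k)
    case (Suc k)
    have "norm (x (n + Suc k) - x n) \<le> norm (x (Suc (n + k)) - x (n + k)) + norm (x (n + k) - x n)"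
      using norm_triangle_ineq[of "x (Suc (n + k)) - x (n + k)" "x (n + k) - x n"] by simp
    also have "\<dots> \<le> C / 2 ^ (n + k) + (2 * C / 2 ^ n - 2 * C / 2 ^ (n + k))"
      by (intro add_mono x Suc)
    also have "\<dots> = 2 * C / 2 ^ n - 2 * C / 2 ^ (n + Suc k)" by (simp add: field_simps)
    finally show ?case .
  qed simp
  have k': "norm (x m - x n) \<le> 2 * C / 2 ^ n" if "m \<ge> n" for m n
  proof -
    have "n + (m - n) = m" using that by simp
    moreover have "0 \<le> 2 * C / 2 ^ m" using C by simp
    ultimately show ?thesis using k[of n "m - n"] by simp
  qed
  have z: "(\<lambda>n. 2 * C / 2 ^ n) \<longlonglongrightarrow> 0"
    using LIMSEQ_inverse_realpow_zero[of 2, THEN tendsto_mult_left, of "2 * C"] by (simp add: divide_inverse)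
  have "Cauchy x"
  proof (rule metric_CauchyI)
    fix e :: real assume "e > 0"
    with z have "\<forall>\<^sub>F n in sequentially. 2 * C / 2 ^ n < e" by (rule order_tendstoD(2))
    then obtain N where N: "\<And>n. n \<ge> N \<Longrightarrow> 2 * C / 2 ^ n < e" by (auto simp: eventually_sequentially)
    have 1: "dist (x i) (x j) < e" if "i \<ge> N" "j \<ge> i" for i j
      using k'[of i j] N[of i] that by (simp add: dist_norm norm_minus_commute)
    show "\<exists>M. \<forall>m\<ge>M. \<forall>n\<ge>M. dist (x m) (x n) < e"
    proof (intro exI allI impI)
      fix i j assume "i \<ge> N" "j \<ge> N"
      then show "dist (x i) (x j) < e" using 1[of i j] 1[of j i] by (cases "i \<le> j") (auto simp: dist_commute)
    qed
  qed
  then have "convergent x" by (rule Cauchy_convergent)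
  then show l: "x \<longlonglongrightarrow> lim x" by (simp add: convergent_LIMSEQ_iff)
  show "norm (lim x - x n) \<le> 2 * C / 2 ^ n"
  proof (rule tendsto_upperbound)
    show "(\<lambda>m. norm (x m - x n)) \<longlonglongrightarrow> norm (lim x - x n)" by (intro tendsto_intros l)
    show "\<forall>\<^sub>F m in sequentially. norm (x m - x n) \<le> 2 * C / 2 ^ n"
      using k' by (auto simp: eventually_sequentially)
  qed simp
qed

context dkg_data
begin

text \<open>The iteration starts from 0 and converges at each component, time and frequency
  separately. The explicit geometric rate, proportional to the weight, takes the place of
  completeness of a function space.\<close>

lemma fixed_point: "\<exists>p. admissible A p \<and> (\<forall>j. \<forall>t\<in>{0..T}. \<forall>\<xi>. p j t \<xi> = G p j t \<xi>)"
proof -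
  define P where "P n = (G ^^ n) (\<lambda>j t \<xi>. 0)" for n
  have P0: "P 0 = (\<lambda>j t \<xi>. 0)" and PS: "P (Suc n) = G (P n)" for n by (simp_all add: P_def)
  have Pa: "admissible A (P n)" for n
  proof (induction n)
    case 0
    have "joint_meas (\<lambda>j t \<xi>. 0)" unfolding joint_meas_def by (simp add: case_prod_beta')
    then show ?case using A_nonneg wt_nonneg unfolding P0 admissible_def by simp
  next
    case (Suc n)
    then show ?case unfolding PS by (rule G_adm)
  qed
  \<comment> \<open>The first iterate differs from 0 by at most the radius \<open>A\<close>; each
    application of \<open>G\<close> then halves the difference.\<close>
  have step: "s \<in> {0..T} \<Longrightarrow> norm (P (Suc n) k s x - P n k s x) \<le> (A / 2 ^ n) * wt l x" for n k s x
  proof (induction n arbitrary: k s x)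
    case 0
    then show ?case using admissible_bound[OF Pa[of 1], of s k x] by (simp add: P0)
  next
    case (Suc n)
    then show ?case unfolding PS[of "Suc n"] PS[of n]
      using G_contraction[OF Pa[of "Suc n"] Pa[of n], of "A / 2 ^ n" s k x] PS[of n] by (simp add: mult.commute)
  qed
  \<comment> \<open>Outside the time interval nothing controls the iterates, and the value 0 is
    taken instead.\<close>
  define p where "p k s x = (if s \<in> {0..T} then lim (\<lambda>n. P n k s x) else 0)" for k s x
  have g: "(\<lambda>n. P n k s x) \<longlonglongrightarrow> p k s x" "norm (p k s x - P n k s x) \<le> (2 * A / 2 ^ n) * wt l x" if s: "s \<in> {0..T}" for k s x n
    using geometric_limit[of "\<lambda>n. P n k s x" "A * wt l x"] step[OF s] s by (auto simp: p_def mult_ac)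
  have "joint_meas p"
    unfolding joint_meas_def
  proof
    fix k
    have [measurable]: "(\<lambda>z. P n k (fst z) (snd z)) \<in> borel_measurable (borel \<Otimes>\<^sub>M borel)" for n
      using joint_measD[OF admissible_meas[OF Pa[of n]], of k] by (simp add: case_prod_beta')
    have [measurable]: "(\<lambda>z. lim (\<lambda>n. P n k (fst z) (snd z))) \<in> borel_measurable (borel \<Otimes>\<^sub>M borel)"
      by (rule borel_measurable_lim_metric) measurable
    have "(\<lambda>z. if 0 \<le> fst z \<and> fst z \<le> T then lim (\<lambda>n. P n k (fst z) (snd z)) else 0) \<in> borel_measurable (borel \<Otimes>\<^sub>M borel)"
      by measurable
    then show "(\<lambda>(s, x). p k s x) \<in> borel_measurable (borel \<Otimes>\<^sub>M borel)"
      unfolding p_def case_prod_beta' by simp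
  qed
  then have pa: "admissible A p"
    unfolding admissible_def
  proof (intro conjI allI ballI)
    fix k s x assume s: "s \<in> {0..T}"
    show "norm (p k s x) \<le> A * wt l x"
    proof (rule tendsto_upperbound)
      show "(\<lambda>n. norm (P n k s x)) \<longlonglongrightarrow> norm (p k s x)" by (intro tendsto_norm g s)
      show "\<forall>\<^sub>F n in sequentially. norm (P n k s x) \<le> A * wt l x" using admissible_bound[OF Pa s] by simp
    qed simp
  qed
  have "p j t \<xi> = G p j t \<xi>" if t: "t \<in> {0..T}" for j t \<xi>
  proof -
    \<comment> \<open>Both \<open>G p\<close> and \<open>p\<close> are compared with
      \<open>G (P n)\<close>: the one by contraction, the other because \<open>G (P n)\<close> is
      the next iterate.\<close>
    have b: "norm (G p j t \<xi> - p j t \<xi>) \<le> 2 * A * wt l \<xi> * inverse (2 ^ n)" for n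
    proof -
      have "norm (G p j t \<xi> - G (P n) j t \<xi>) \<le> (2 * A / 2 ^ n) / 2 * wt l \<xi>"
        by (rule G_contraction[OF pa Pa g(2) t])
      moreover have "norm (p j t \<xi> - G (P n) j t \<xi>) \<le> (2 * A / 2 ^ Suc n) * wt l \<xi>"
        using g(2)[OF t, of j \<xi> "Suc n"] unfolding PS .
      ultimately have "norm (G p j t \<xi> - p j t \<xi>) \<le> (2 * A / 2 ^ n) / 2 * wt l \<xi> + (2 * A / 2 ^ Suc n) * wt l \<xi>"
        using norm_triangle_ineq4[of "G p j t \<xi> - G (P n) j t \<xi>" "p j t \<xi> - G (P n) j t \<xi>"] by simp
      also have "\<dots> = 2 * A * wt l \<xi> * inverse (2 ^ n)" by (simp add: field_simps)
      finally show ?thesis .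
    qed
    have "norm (G p j t \<xi> - p j t \<xi>) \<le> 0"
    proof (rule tendsto_lowerbound)
      show "(\<lambda>n. 2 * A * wt l \<xi> * inverse (2 ^ n)) \<longlonglongrightarrow> 0"
        using LIMSEQ_inverse_realpow_zero[of 2, THEN tendsto_mult_left, of "2 * A * wt l \<xi>"] by simp
      show "\<forall>\<^sub>F n in sequentially. norm (G p j t \<xi> - p j t \<xi>) \<le> 2 * A * wt l \<xi> * inverse (2 ^ n)" using b by simp
    qed simp
    then show ?thesis by simp
  qed
  then show ?thesis using pa by blast
qed

end

section \<open>Regularity in time\<close>

lemma kg_sin_lip: "\<bar>kg_sin M t \<xi> - kg_sin M u \<xi>\<bar> \<le> \<bar>t - u\<bar>"
proof -
  have "norm (kg_sin M t \<xi> - kg_sin M u \<xi>) \<le> 1 * norm (t - u)"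
    by (rule field_differentiable_bound[OF convex_UNIV, where f' = "\<lambda>t. kg_cos M t \<xi>"])
      (use kg_sin_deriv kg_cos_bound in auto)
  then show ?thesis by simp
qed

lemma kg_cos_lip: "\<bar>kg_cos M t \<xi> - kg_cos M u \<xi>\<bar> \<le> omega M \<xi> * \<bar>t - u\<bar>"
proof -
  have "norm (kg_cos M t \<xi> - kg_cos M u \<xi>) \<le> omega M \<xi> * norm (t - u)"
  proof (rule field_differentiable_bound[OF convex_UNIV, where f' = "\<lambda>t. - (sin (t * omega M \<xi>) * omega M \<xi>)"])
    show "((\<lambda>t. kg_cos M t \<xi>) has_field_derivative - (sin (z * omega M \<xi>) * omega M \<xi>)) (at z within UNIV)" for z
      unfolding kg_cos_def by (auto intro!: derivative_eq_intros)
    show "norm (- (sin (z * omega M \<xi>) * omega M \<xi>)) \<le> omega M \<xi>" for z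
      using omega_nonneg[of M \<xi>] by (simp add: abs_mult mult_left_le_one_le)
  qed auto
  then show ?thesis by simp
qed

text \<open>The mean value theorem on the segment, where the derivative deviates from
  \<open>g u\<close> by at most \<open>K * \<bar>t - u\<bar>\<close>. A quadratic error is what
  survives division by \<open>t - u\<close> in a difference quotient.\<close>

lemma taylor2:
  fixes f g :: "real \<Rightarrow> real"
  assumes d: "\<And>t. (f has_real_derivative g t) (at t)" and l: "\<And>t u. \<bar>g t - g u\<bar> \<le> K * \<bar>t - u\<bar>"
  shows "\<bar>f t - f u - (t - u) * g u\<bar> \<le> K * \<bar>t - u\<bar>\<^sup>2"
proof -
  have K: "K \<ge> 0" using order_trans[OF abs_ge_zero l[of 1 0]] by simp
  have "norm ((f t - t * g u) - (f u - u * g u)) \<le> (K * \<bar>t - u\<bar>) * norm (t - u)"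
  proof (rule field_differentiable_bound[where S="closed_segment t u" and f' = "\<lambda>s. g s - g u"])
    show "((\<lambda>s. f s - s * g u) has_field_derivative g z - g u) (at z within closed_segment t u)" for z
      by (auto intro!: derivative_eq_intros has_field_derivative_at_within[OF d])
    fix z assume "z \<in> closed_segment t u"
    then have "\<bar>z - u\<bar> \<le> \<bar>t - u\<bar>" by (auto simp: closed_segment_eq_real_ivl split: if_splits)
    then have "K * \<bar>z - u\<bar> \<le> K * \<bar>t - u\<bar>" using K by (intro mult_left_mono)
    then show "norm (g z - g u) \<le> K * \<bar>t - u\<bar>" using l[of z u] by simp
  qed auto
  then show ?thesis by (simp add: power2_eq_square algebra_simps)
qed

lemma kg_sin_taylor: "\<bar>kg_sin M t \<xi> - kg_sin M u \<xi> - (t - u) * kg_cos M u \<xi>\<bar> \<le> omega M \<xi> * \<bar>t - u\<bar>\<^sup>2"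
  by (rule taylor2[OF kg_sin_deriv kg_cos_lip])

lemma kg_cos_taylor: "\<bar>kg_cos M t \<xi> - kg_cos M u \<xi> - (t - u) * (- (M\<^sup>2 + \<xi>\<^sup>2) * kg_sin M u \<xi>)\<bar> \<le> (M\<^sup>2 + \<xi>\<^sup>2) * \<bar>t - u\<bar>\<^sup>2"
proof (rule taylor2[OF kg_cos_deriv])
  fix t u
  have "\<bar>- (M\<^sup>2 + \<xi>\<^sup>2) * kg_sin M t \<xi> - - (M\<^sup>2 + \<xi>\<^sup>2) * kg_sin M u \<xi>\<bar> = (M\<^sup>2 + \<xi>\<^sup>2) * \<bar>kg_sin M t \<xi> - kg_sin M u \<xi>\<bar>"
  proof -
    have "- (M\<^sup>2 + \<xi>\<^sup>2) * kg_sin M t \<xi> - - (M\<^sup>2 + \<xi>\<^sup>2) * kg_sin M u \<xi> = - ((M\<^sup>2 + \<xi>\<^sup>2) * (kg_sin M t \<xi> - kg_sin M u \<xi>))"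
      by (simp add: algebra_simps)
    then show ?thesis by (simp add: abs_mult)
  qed
  also have "\<dots> \<le> (M\<^sup>2 + \<xi>\<^sup>2) * \<bar>t - u\<bar>" by (intro mult_left_mono kg_sin_lip) auto
  finally show "\<bar>- (M\<^sup>2 + \<xi>\<^sup>2) * kg_sin M t \<xi> - - (M\<^sup>2 + \<xi>\<^sup>2) * kg_sin M u \<xi>\<bar> \<le> (M\<^sup>2 + \<xi>\<^sup>2) * \<bar>t - u\<bar>" .
qed

lemma omega_le: "omega M \<xi> \<le> (\<bar>M\<bar> + 1) * (1 + \<xi>\<^sup>2)"
proof -
  have "omega M \<xi> \<le> \<bar>M\<bar> + \<bar>\<xi>\<bar>" unfolding omega_def using sqrt_sum_squares_le_sum_abs[of M \<xi>] .
  moreover have "\<bar>\<xi>\<bar> \<le> 1 + \<xi>\<^sup>2" using sum_squares_bound[of 1 "\<bar>\<xi>\<bar>"] by simp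
  moreover have "\<bar>M\<bar> \<le> \<bar>M\<bar> * (1 + \<xi>\<^sup>2)" using mult_left_mono[of 1 "1 + \<xi>\<^sup>2" "\<bar>M\<bar>"] by simp
  ultimately show ?thesis by (simp add: distrib_right)
qed

lemma sq_le: "M\<^sup>2 + \<xi>\<^sup>2 \<le> (M\<^sup>2 + 1) * (1 + (\<xi>::real)\<^sup>2)"
  by (simp add: distrib_left distrib_right)

lemma dirac_lip: "norm (dirac_prop m t \<xi> $ j $ k - dirac_prop m u \<xi> $ j $ k) \<le> 2 * omega m \<xi> * \<bar>t - u\<bar>"
proof -
  define a where "a = kg_cos m t \<xi> - kg_cos m u \<xi>"
  define b where "b = kg_sin m t \<xi> - kg_sin m u \<xi>"
  have a: "\<bar>a\<bar> \<le> omega m \<xi> * \<bar>t - u\<bar>" unfolding a_def by (rule kg_cos_lip)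
  have b: "\<bar>b * c\<bar> \<le> omega m \<xi> * \<bar>t - u\<bar>" if "\<bar>c\<bar> \<le> omega m \<xi>" for c
  proof -
    have "\<bar>b\<bar> * \<bar>c\<bar> \<le> \<bar>t - u\<bar> * omega m \<xi>" unfolding b_def using that by (intro mult_mono kg_sin_lip) auto
    then show ?thesis by (simp add: abs_mult mult.commute)
  qed
  have bm: "\<bar>b * m\<bar> \<le> omega m \<xi> * \<bar>t - u\<bar>" "\<bar>b * \<xi>\<bar> \<le> omega m \<xi> * \<bar>t - u\<bar>" by (intro b abs_le_omega)+
  have "dirac_prop m t \<xi> $ 1 $ 1 - dirac_prop m u \<xi> $ 1 $ 1 = of_real a + \<i> * of_real (b * m)"
    "dirac_prop m t \<xi> $ 1 $ 2 - dirac_prop m u \<xi> $ 1 $ 2 = \<i> * of_real (b * \<xi>)"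
    "dirac_prop m t \<xi> $ 2 $ 1 - dirac_prop m u \<xi> $ 2 $ 1 = \<i> * of_real (b * \<xi>)"
    "dirac_prop m t \<xi> $ 2 $ 2 - dirac_prop m u \<xi> $ 2 $ 2 = of_real a - \<i> * of_real (b * m)"
    unfolding dirac_prop_entries a_def b_def by (simp_all add: algebra_simps)
  moreover have "norm (of_real a + \<i> * of_real (b * m)) \<le> 2 * omega m \<xi> * \<bar>t - u\<bar>"
     "norm (of_real a - \<i> * of_real (b * m)) \<le> 2 * omega m \<xi> * \<bar>t - u\<bar>"
     "norm (\<i> * of_real (b * \<xi>)) \<le> 2 * omega m \<xi> * \<bar>t - u\<bar>"
  proof -
    have n: "norm (complex_of_real a) \<le> omega m \<xi> * \<bar>t - u\<bar>" "norm (\<i> * complex_of_real (b * m)) \<le> omega m \<xi> * \<bar>t - u\<bar>"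
      "norm (\<i> * complex_of_real (b * \<xi>)) \<le> omega m \<xi> * \<bar>t - u\<bar>"
      unfolding norm_mult[of \<i>] norm_of_real using a bm by simp_all
    show "norm (of_real a + \<i> * of_real (b * m)) \<le> 2 * omega m \<xi> * \<bar>t - u\<bar>"
      using norm_triangle_ineq[of "complex_of_real a" "\<i> * of_real (b * m)"] n by linarith
    show "norm (of_real a - \<i> * of_real (b * m)) \<le> 2 * omega m \<xi> * \<bar>t - u\<bar>"
      using norm_triangle_ineq4[of "complex_of_real a" "\<i> * of_real (b * m)"] n by linarith
    show "norm (\<i> * of_real (b * \<xi>)) \<le> 2 * omega m \<xi> * \<bar>t - u\<bar>"
    proof -
      have "0 \<le> omega m \<xi> * \<bar>t - u\<bar>" using omega_nonneg[of m \<xi>] by simp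
      then show ?thesis using n(3) by simp
    qed
  qed
  ultimately show ?thesis using exhaust_2[of j] exhaust_2[of k] by auto
qed

lemma set_lint_split:
  fixes f :: "real \<Rightarrow> complex"
  assumes ab: "a \<le> b" "b \<le> c" and f: "set_integrable lborel {a..c} f"
  shows "(LINT s:{a..c}|lborel. f s) = (LINT s:{a..b}|lborel. f s) + (LINT s:{b..c}|lborel. f s)"
proof -
  have i: "set_integrable lborel {a..b} f" "set_integrable lborel {b..c} f"
    by (rule set_integrable_subset[OF f]; use ab in auto)+
  then have [measurable]: "(\<lambda>s. indicat_real {a..b} s *\<^sub>R f s) \<in> borel_measurable lborel"
    "(\<lambda>s. indicat_real {b..c} s *\<^sub>R f s) \<in> borel_measurable lborel"
    "(\<lambda>s. indicat_real {a..c} s *\<^sub>R f s) \<in> borel_measurable lborel"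
    using f unfolding set_integrable_def by auto
  have "(LINT s|lborel. indicat_real {a..c} s *\<^sub>R f s) = (LINT s|lborel. indicat_real {a..b} s *\<^sub>R f s + indicat_real {b..c} s *\<^sub>R f s)"
  proof (rule integral_cong_AE)
    have "AE s in lborel. s \<noteq> b" by (rule AE_lborel_singleton)
    then show "AE s in lborel. indicat_real {a..c} s *\<^sub>R f s = indicat_real {a..b} s *\<^sub>R f s + indicat_real {b..c} s *\<^sub>R f s"
      by eventually_elim (use ab in \<open>auto simp: indicator_def\<close>)
  qed measurable
  then show ?thesis using i unfolding set_lebesgue_integral_def set_integrable_def by simp
qed

text \<open>For \<open>u \<le> t\<close> the difference consists of the increment of the kernel over
  {0..u} and of the newly added interval {u..t}, which contribute \<open>T * c1\<close> and
  \<open>c0\<close> respectively.\<close>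

lemma volterra_lip_ordered:
  fixes k N :: "real \<Rightarrow> complex"
  assumes [measurable]: "k \<in> borel_measurable borel" "N \<in> borel_measurable borel"
    and k0: "\<And>r. r \<in> {0..T} \<Longrightarrow> norm (k r) \<le> c0" and k1: "\<And>r r'. norm (k r - k r') \<le> c1 * \<bar>r - r'\<bar>"
    and N: "\<And>s. s \<in> {0..T} \<Longrightarrow> norm (N s) \<le> n" and tu: "0 \<le> u" "u \<le> t" "t \<le> T"
  shows "norm ((LINT s:{0..t}|lborel. k (t - s) * N s) - (LINT s:{0..u}|lborel. k (u - s) * N s)) \<le> (c0 + T * c1) * n * (t - u)"
proof -
  have n0: "n \<ge> 0" using order_trans[OF norm_ge_zero N[of 0]] tu by simp
  have c00: "c0 \<ge> 0" using order_trans[OF norm_ge_zero k0[of 0]] tu by simp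
  have c10: "c1 \<ge> 0" using order_trans[OF norm_ge_zero k1[of 1 0]] by simp
  have b: "norm (k (a - s) * N s) \<le> c0 * n" if "s \<in> {0..a}" "a \<le> T" for a s
    unfolding norm_mult using that by (intro mult_mono k0 N c00) auto
  have i: "set_integrable lborel {0..a} (\<lambda>s. k (a - s) * N s)" if "a \<le> T" for a
    by (rule set_lint_integrable[OF _ b[OF _ that]]) measurable
  have i': "set_integrable lborel {0..u} (\<lambda>s. k (t - s) * N s)"
    by (rule set_integrable_subset[OF i[OF tu(3)]]) (use tu in auto)
  have "(LINT s:{0..t}|lborel. k (t - s) * N s) = (LINT s:{0..u}|lborel. k (t - s) * N s) + (LINT s:{u..t}|lborel. k (t - s) * N s)"
    by (rule set_lint_split) (use tu i in auto)
  moreover have "(LINT s:{0..u}|lborel. k (t - s) * N s) - (LINT s:{0..u}|lborel. k (u - s) * N s) = (LINT s:{0..u}|lborel. k (t - s) * N s - k (u - s) * N s)"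
    by (rule set_integral_diff(2)[OF i' i, symmetric]) (use tu in auto)
  ultimately have e: "(LINT s:{0..t}|lborel. k (t - s) * N s) - (LINT s:{0..u}|lborel. k (u - s) * N s) =
     (LINT s:{0..u}|lborel. k (t - s) * N s - k (u - s) * N s) + (LINT s:{u..t}|lborel. k (t - s) * N s)" by simp
  have "norm (LINT s:{0..u}|lborel. k (t - s) * N s - k (u - s) * N s) \<le> (u - 0) * (c1 * (t - u) * n)"
  proof (rule set_lint_bound)
    fix s assume "s \<in> {0..u}"
    then show "norm (k (t - s) * N s - k (u - s) * N s) \<le> c1 * (t - u) * n"
      unfolding left_diff_distrib[symmetric] norm_mult using k1[of "t - s" "u - s"] N[of s] tu c10 by (intro mult_mono) auto
  qed (use tu c10 n0 in auto)
  also have "\<dots> \<le> T * (c1 * (t - u) * n)" using tu c10 n0 by (intro mult_right_mono) auto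
  finally have 1: "norm (LINT s:{0..u}|lborel. k (t - s) * N s - k (u - s) * N s) \<le> T * (c1 * (t - u) * n)" .
  have 2: "norm (LINT s:{u..t}|lborel. k (t - s) * N s) \<le> (t - u) * (c0 * n)"
  proof (rule set_lint_bound)
    show "norm (k (t - s) * N s) \<le> c0 * n" if "s \<in> {u..t}" for s using that tu by (intro b) auto
  qed (use tu c00 n0 in auto)
  show ?thesis unfolding e using norm_triangle_mono[OF 1 2] by (simp add: algebra_simps)
qed

lemma volterra_lip:
  fixes k N :: "real \<Rightarrow> complex"
  assumes m: "k \<in> borel_measurable borel" "N \<in> borel_measurable borel"
    and k: "\<And>r. r \<in> {0..T} \<Longrightarrow> norm (k r) \<le> c0" "\<And>r r'. norm (k r - k r') \<le> c1 * \<bar>r - r'\<bar>"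
    and N: "\<And>s. s \<in> {0..T} \<Longrightarrow> norm (N s) \<le> n" and tu: "t \<in> {0..T}" "u \<in> {0..T}"
  shows "norm ((LINT s:{0..t}|lborel. k (t - s) * N s) - (LINT s:{0..u}|lborel. k (u - s) * N s)) \<le> (c0 + T * c1) * n * \<bar>t - u\<bar>"
proof (cases "u \<le> t")
  case True
  then show ?thesis using volterra_lip_ordered[OF m k N, of T u t] tu by simp
next
  case False
  then show ?thesis using volterra_lip_ordered[OF m k N, of T t u] tu by (simp add: norm_minus_commute)
qed

lemma volterra_bound:
  fixes k N :: "real \<Rightarrow> complex"
  assumes k: "\<And>r. r \<in> {0..T} \<Longrightarrow> norm (k r) \<le> c0"
    and N: "\<And>s. s \<in> {0..T} \<Longrightarrow> norm (N s) \<le> n" and t: "t \<in> {0..T}"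
  shows "norm (LINT s:{0..t}|lborel. k (t - s) * N s) \<le> T * c0 * n"
proof -
  have n0: "n \<ge> 0" using order_trans[OF norm_ge_zero N[of 0]] t by simp
  have c00: "c0 \<ge> 0" using order_trans[OF norm_ge_zero k[of 0]] t by simp
  have "norm (LINT s:{0..t}|lborel. k (t - s) * N s) \<le> (t - 0) * (c0 * n)"
  proof (rule set_lint_bound)
    show "norm (k (t - s) * N s) \<le> c0 * n" if "s \<in> {0..t}" for s
      unfolding norm_mult using that t by (intro mult_mono k N c00) auto
  qed (use t c00 n0 in auto)
  also have "\<dots> \<le> T * (c0 * n)" using t c00 n0 by (intro mult_right_mono) auto
  finally show ?thesis by (simp add: mult.assoc)
qed

text \<open>Differentiating the Volterra integral with kernel \<open>S\<close> gives the one with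
  kernel \<open>C\<close>. There is no boundary term to first order because \<open>S\<close>
  vanishes at 0: by \<open>\<bar>r\<bar>\<close>-smallness of \<open>S\<close>, the interval between
  the two times contributes only a quadratic error.\<close>

lemma volterra_taylor:
  fixes S C N :: "real \<Rightarrow> complex"
  assumes m[measurable]: "S \<in> borel_measurable borel" "C \<in> borel_measurable borel" "N \<in> borel_measurable borel"
    and S: "\<And>r. norm (S r) \<le> \<bar>r\<bar>" and C: "\<And>r. norm (C r) \<le> 1"
    and ty: "\<And>r r'. norm (S r - S r' - of_real (r - r') * C r') \<le> c * \<bar>r - r'\<bar>\<^sup>2"
    and N: "\<And>s. s \<in> {0..T} \<Longrightarrow> norm (N s) \<le> n" and tu: "t \<in> {0..T}" "u \<in> {0..T}"
  shows "norm ((LINT s:{0..t}|lborel. S (t - s) * N s) - (LINT s:{0..u}|lborel. S (u - s) * N s) - of_real (t - u) * (LINT s:{0..u}|lborel. C (u - s) * N s)) \<le> (2 + T * c) * n * \<bar>t - u\<bar>\<^sup>2"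
proof -
  have n0: "n \<ge> 0" using order_trans[OF norm_ge_zero N[of 0]] tu by simp
  have c0: "c \<ge> 0" using order_trans[OF norm_ge_zero ty[of 1 0]] by simp
  have bS: "norm (S (a - s) * N s) \<le> T * n" if "s \<in> {0..T}" "a \<in> {0..T}" for a s
    unfolding norm_mult using that S[of "a - s"] by (intro mult_mono N) auto
  have bC: "norm (C (a - s) * N s) \<le> 1 * n" if "s \<in> {0..T}" for a s
    unfolding norm_mult using that by (intro mult_mono N C) auto
  have iS: "set_integrable lborel {b..b'} (\<lambda>s. S (a - s) * N s)" if "a \<in> {0..T}" "0 \<le> b" "b' \<le> T" for a b b'
    by (rule set_lint_integrable[OF _ bS]) (use that in \<open>auto intro!: borel_measurable_times measurable_compose[OF _ m(1)]\<close>)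
  have iC: "set_integrable lborel {b..b'} (\<lambda>s. of_real (t - u) * (C (a - s) * N s))" if "a \<in> {0..T}" "0 \<le> b" "b' \<le> T" for a b b'
    by (rule set_integrable_mult_right, rule set_lint_integrable[OF _ bC]) (use that in \<open>auto intro!: borel_measurable_times measurable_compose[OF _ m(2)]\<close>)
  \<comment> \<open>Up to the earlier of the two times the three integrals can be compared under one
    integral sign; the rest has length \<open>\<bar>t - u\<bar>\<close>. If \<open>t\<close> is the
    earlier time, the term with \<open>C\<close> also leaves a rest, whence the 2 in the
    constant.\<close>
  define m0 where "m0 = min t u"
  have m0: "0 \<le> m0" "m0 \<le> t" "m0 \<le> u" "m0 \<le> T" using tu by (auto simp: m0_def)
  have core: "norm (LINT s:{0..m0}|lborel. S (t - s) * N s - S (u - s) * N s - of_real (t - u) * (C (u - s) * N s)) \<le> T * (c * \<bar>t - u\<bar>\<^sup>2 * n)"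
  proof -
    have "norm (LINT s:{0..m0}|lborel. S (t - s) * N s - S (u - s) * N s - of_real (t - u) * (C (u - s) * N s)) \<le> (m0 - 0) * (c * \<bar>t - u\<bar>\<^sup>2 * n)"
    proof (rule set_lint_bound)
      fix s assume s: "s \<in> {0..m0}"
      have "S (t - s) * N s - S (u - s) * N s - of_real (t - u) * (C (u - s) * N s) = (S (t - s) - S (u - s) - of_real ((t - s) - (u - s)) * C (u - s)) * N s"
        by (simp add: algebra_simps)
      also have "norm \<dots> \<le> (c * \<bar>(t - s) - (u - s)\<bar>\<^sup>2) * n"
        unfolding norm_mult using s m0 c0 by (intro mult_mono ty N) auto
      finally show "norm (S (t - s) * N s - S (u - s) * N s - of_real (t - u) * (C (u - s) * N s)) \<le> c * \<bar>t - u\<bar>\<^sup>2 * n" by simp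
    qed (use m0 c0 n0 in auto)
    also have "\<dots> \<le> T * (c * \<bar>t - u\<bar>\<^sup>2 * n)" using m0 c0 n0 by (intro mult_right_mono) auto
    finally show ?thesis .
  qed
  have sp: "(LINT s:{0..m0}|lborel. S (t - s) * N s - S (u - s) * N s - of_real (t - u) * (C (u - s) * N s)) =
    (LINT s:{0..m0}|lborel. S (t - s) * N s) - (LINT s:{0..m0}|lborel. S (u - s) * N s) - (LINT s:{0..m0}|lborel. of_real (t - u) * (C (u - s) * N s))"
  proof -
    have i1: "set_integrable lborel {0..m0} (\<lambda>s. S (t - s) * N s)" by (rule iS) (use tu m0 in auto)
    have i2: "set_integrable lborel {0..m0} (\<lambda>s. S (u - s) * N s)" by (rule iS) (use tu m0 in auto)
    have i3: "set_integrable lborel {0..m0} (\<lambda>s. of_real (t - u) * (C (u - s) * N s))" by (rule iC) (use tu m0 in auto)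
    show ?thesis unfolding set_integral_diff(2)[OF set_integral_diff(1)[OF i1 i2] i3] set_integral_diff(2)[OF i1 i2] ..
  qed
  have mr: "(LINT s:{0..u}|lborel. of_real (t - u) * (C (u - s) * N s)) = of_real (t - u) * (LINT s:{0..u}|lborel. C (u - s) * N s)"
    by (rule set_integral_mult_right)
  have ring: "a + b - c - d = a - c - d + b" "a - (c + b) - (d + e) = (a - c - d) - (b + e)" for a b c d e :: complex
    by simp_all
  show ?thesis
  proof (cases "u \<le> t")
    case True
    then have mm: "m0 = u" by (simp add: m0_def)
    have sa: "(LINT s:{0..t}|lborel. S (t - s) * N s) = (LINT s:{0..u}|lborel. S (t - s) * N s) + (LINT s:{u..t}|lborel. S (t - s) * N s)"
      by (rule set_lint_split) (use True tu iS in auto)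
    have sc: "norm (LINT s:{u..t}|lborel. S (t - s) * N s) \<le> (t - u) * (\<bar>t - u\<bar> * n)"
    proof (rule set_lint_bound)
      fix s assume "s \<in> {u..t}"
      then show "norm (S (t - s) * N s) \<le> \<bar>t - u\<bar> * n"
        unfolding norm_mult using tu S[of "t - s"] by (intro mult_mono N) auto
    qed (use True n0 in auto)
    have "(LINT s:{0..t}|lborel. S (t - s) * N s) - (LINT s:{0..u}|lborel. S (u - s) * N s) - of_real (t - u) * (LINT s:{0..u}|lborel. C (u - s) * N s)
      = (LINT s:{0..m0}|lborel. S (t - s) * N s - S (u - s) * N s - of_real (t - u) * (C (u - s) * N s)) + (LINT s:{u..t}|lborel. S (t - s) * N s)"
      unfolding mm sp[unfolded mm] sa mr by (rule ring(1))
    then have "norm ((LINT s:{0..t}|lborel. S (t - s) * N s) - (LINT s:{0..u}|lborel. S (u - s) * N s) - of_real (t - u) * (LINT s:{0..u}|lborel. C (u - s) * N s))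
       \<le> T * (c * \<bar>t - u\<bar>\<^sup>2 * n) + (t - u) * (\<bar>t - u\<bar> * n)"
      using norm_triangle_mono[OF core sc] by simp
    also have "\<dots> = (1 + T * c) * n * \<bar>t - u\<bar>\<^sup>2" using True by (simp add: power2_eq_square algebra_simps)
    also have "\<dots> \<le> (2 + T * c) * n * \<bar>t - u\<bar>\<^sup>2" using n0 by (intro mult_right_mono) auto
    finally show ?thesis .
  next
    case False
    then have mm: "m0 = t" by (simp add: m0_def)
    have sa: "(LINT s:{0..u}|lborel. S (u - s) * N s) = (LINT s:{0..t}|lborel. S (u - s) * N s) + (LINT s:{t..u}|lborel. S (u - s) * N s)"
      by (rule set_lint_split) (use False tu iS in auto)
    have sb: "(LINT s:{0..u}|lborel. of_real (t - u) * (C (u - s) * N s)) = (LINT s:{0..t}|lborel. of_real (t - u) * (C (u - s) * N s)) + (LINT s:{t..u}|lborel. of_real (t - u) * (C (u - s) * N s))"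
      by (rule set_lint_split) (use False tu iC in auto)
    have sc: "norm (LINT s:{t..u}|lborel. S (u - s) * N s + of_real (t - u) * (C (u - s) * N s)) \<le> (u - t) * (2 * \<bar>t - u\<bar> * n)"
    proof (rule set_lint_bound)
      fix s assume s: "s \<in> {t..u}"
      have "norm (S (u - s) * N s) \<le> \<bar>t - u\<bar> * n"
        unfolding norm_mult using s tu S[of "u - s"] by (intro mult_mono N) auto
      moreover have "norm (of_real (t - u) * (C (u - s) * N s)) \<le> \<bar>t - u\<bar> * (1 * n)"
        unfolding norm_mult[of "of_real (t - u)"] norm_of_real using s tu by (intro mult_mono bC) auto
      ultimately show "norm (S (u - s) * N s + of_real (t - u) * (C (u - s) * N s)) \<le> 2 * \<bar>t - u\<bar> * n"
        using norm_triangle_ineq[of "S (u - s) * N s" "of_real (t - u) * (C (u - s) * N s)"] by simp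
    qed (use False n0 in auto)
    have sd: "(LINT s:{t..u}|lborel. S (u - s) * N s + of_real (t - u) * (C (u - s) * N s)) = (LINT s:{t..u}|lborel. S (u - s) * N s) + (LINT s:{t..u}|lborel. of_real (t - u) * (C (u - s) * N s))"
      using tu by (intro set_integral_add iS iC) auto
    have "(LINT s:{0..t}|lborel. S (t - s) * N s) - (LINT s:{0..u}|lborel. S (u - s) * N s) - of_real (t - u) * (LINT s:{0..u}|lborel. C (u - s) * N s)
      = (LINT s:{0..m0}|lborel. S (t - s) * N s - S (u - s) * N s - of_real (t - u) * (C (u - s) * N s)) - (LINT s:{t..u}|lborel. S (u - s) * N s + of_real (t - u) * (C (u - s) * N s))"
      unfolding mm sp[unfolded mm] mr[symmetric] sa sb sd by (rule ring(2))
    then have "norm ((LINT s:{0..t}|lborel. S (t - s) * N s) - (LINT s:{0..u}|lborel. S (u - s) * N s) - of_real (t - u) * (LINT s:{0..u}|lborel. C (u - s) * N s))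
       \<le> T * (c * \<bar>t - u\<bar>\<^sup>2 * n) + (u - t) * (2 * \<bar>t - u\<bar> * n)"
      using order_trans[OF norm_triangle_ineq4 add_mono[OF core sc]] by simp
    also have "\<dots> = (2 + T * c) * n * \<bar>t - u\<bar>\<^sup>2" using False by (simp add: power2_eq_square algebra_simps)
    finally show ?thesis .
  qed
qed

section \<open>Decay and time regularity of the solution on the Fourier side\<close>

abbreviation "e2 \<xi> \<equiv> 1 / (1 + (\<xi>::real)\<^sup>2)"

lemma e2_nonneg: "0 \<le> e2 \<xi>" by (simp add: add_nonneg_nonneg)

lemma norm_sum2:
  fixes f :: "2 \<Rightarrow> complex"
  shows "norm (\<Sum>k\<in>UNIV. f k) \<le> norm (f 1) + norm (f 2)"
  unfolding sum_2 by (rule norm_triangle_ineq)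

text \<open>\<open>p\<close> is the fixed point. The extra factor 1 + x^2 in \<open>qB\<close> pays
  for the symbol M^2 + x^2 that acts on \<open>q0\<close> in the time derivative, and the symmetries
  \<open>q0s\<close>, \<open>q1s\<close> express that the data of the field are real.\<close>

locale dkg_sol = dkg_data +
  fixes p :: spinor and B :: real
  assumes padm: "admissible A p"
    and pG: "\<And>j t \<xi>. t \<in> {0..T} \<Longrightarrow> p j t \<xi> = G p j t \<xi>"
    and qB: "\<And>\<xi>. (1 + \<xi>\<^sup>2) * (norm (q0 \<xi>) + norm (q1 \<xi>)) \<le> B * e2 \<xi>"
    and q0s: "\<And>\<xi>. q0 (- \<xi>) = cnj (q0 \<xi>)" and q1s: "\<And>\<xi>. q1 (- \<xi>) = cnj (q1 \<xi>)"
begin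

abbreviation "q \<equiv> Q p p"
abbreviation "N s \<xi> \<equiv> scalar_density p p s \<xi>"

text \<open>The transform of the time derivative of the field, obtained by differentiating the
  formula for \<open>q\<close> in time. The Duhamel term yields no boundary term, since the sine
  propagator vanishes at time 0.\<close>

definition "qt t \<xi> = of_real (- (M\<^sup>2 + \<xi>\<^sup>2) * kg_sin M t \<xi>) * q0 \<xi> + of_real (kg_cos M t \<xi>) * q1 \<xi>
    + (LINT s:{0..t}|lborel. of_real (kg_cos M (t - s) \<xi>) * N s \<xi>)"

lemma pm: "joint_meas p" by (rule admissible_meas[OF padm])

lemma B_nonneg: "B \<ge> 0"
  using order_trans[OF _ qB[of 0]] by simp

lemma qB': "norm (q0 \<xi>) + norm (q1 \<xi>) \<le> B * e2 \<xi>"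
proof -
  have "1 * (norm (q0 \<xi>) + norm (q1 \<xi>)) \<le> (1 + \<xi>\<^sup>2) * (norm (q0 \<xi>) + norm (q1 \<xi>))" by (intro mult_right_mono) auto
  then show ?thesis using qB[of \<xi>] by simp
qed

definition "n0 = \<kappa> * l * A * A"

lemma n0_nonneg: "n0 \<ge> 0" unfolding n0_def using kappa_nonneg l0 A_nonneg by simp

lemma N_bound: "s \<in> {0..T} \<Longrightarrow> norm (N s \<xi>) \<le> n0 * wt l \<xi>"
  unfolding n0_def by (rule scalar_density_adm[OF padm padm])

text \<open>For showing that a solution has been found \<open>l\<close> is fixed, so the crude
  factor \<open>l ^ 4\<close> is harmless.\<close>

lemma wtE: "(1 + \<xi>\<^sup>2) * (c * wt l \<xi>) \<le> (c * l ^ 4) * e2 \<xi>" if "c \<ge> 0"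
  using mult_left_mono[OF wt_decay[OF l1, of \<xi>] that] by (simp add: mult_ac)

lemma wtE': "c * wt l \<xi> \<le> (c * l ^ 4) * e2 \<xi>" if "c \<ge> 0"
  using mult_left_mono[OF wt_decay'[OF l1, of \<xi>] that] by (simp add: mult_ac)

lemma p_decay: "t \<in> {0..T} \<Longrightarrow> norm (p j t \<xi>) \<le> (A * l ^ 4) * e2 \<xi>"
  by (rule order_trans[OF admissible_bound[OF padm] wtE'[OF A_nonneg]])

lemma N_decay: "s \<in> {0..T} \<Longrightarrow> norm (N s \<xi>) \<le> (n0 * l ^ 4) * e2 \<xi>"
  by (rule order_trans[OF N_bound wtE'[OF n0_nonneg]])

lemma N_meas: "(\<lambda>s. N s \<xi>) \<in> borel_measurable borel"
  by (rule scalar_density_measurable[OF pm pm]) auto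

lemma kgc_meas: "(\<lambda>t. complex_of_real (kg_cos M t \<xi>)) \<in> borel_measurable borel"
   "(\<lambda>t. complex_of_real (kg_sin M t \<xi>)) \<in> borel_measurable borel"
  by measurable

lemma kg_response_eq: "kg_response M p p t \<xi> = (LINT s:{0..t}|lborel. (\<lambda>r. complex_of_real (kg_sin M r \<xi>)) (t - s) * N s \<xi>)"
  by (simp add: kg_response_def)

lemma q_decay:
  assumes t: "t \<in> {0..T}"
  shows "norm (q t \<xi>) \<le> (B + T * T * (n0 * l ^ 4)) * e2 \<xi>"
proof -
  have "norm (free_field t \<xi>) \<le> B * e2 \<xi>"
    using free_field_bound[of t \<xi>] qB'[of \<xi>] t T0 by auto
  moreover have "norm (kg_response M p p t \<xi>) \<le> T * T * ((n0 * l ^ 4) * e2 \<xi>)"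
    unfolding kg_response_eq
  proof (rule volterra_bound[OF _ N_decay t])
    show "norm (complex_of_real (kg_sin M r \<xi>)) \<le> T" if "r \<in> {0..T}" for r
      using kg_sin_bound[of M r \<xi>] that by simp
  qed
  ultimately show ?thesis unfolding Q_def using norm_triangle_ineq[of "free_field t \<xi>" "kg_response M p p t \<xi>"] by (simp add: algebra_simps)
qed

lemma qt_decay:
  assumes t: "t \<in> {0..T}"
  shows "norm (qt t \<xi>) \<le> ((M\<^sup>2 + 1) * B + B + T * (n0 * l ^ 4)) * e2 \<xi>"
proof -
  have sb: "\<bar>kg_sin M t \<xi>\<bar> \<le> 1" using kg_sin_bound[of M t \<xi>] t T0 by auto
  have "norm (complex_of_real (- (M\<^sup>2 + \<xi>\<^sup>2) * kg_sin M t \<xi>) * q0 \<xi>) = (M\<^sup>2 + \<xi>\<^sup>2) * (\<bar>kg_sin M t \<xi>\<bar> * norm (q0 \<xi>))"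
    unfolding norm_mult norm_of_real by (simp add: abs_mult)
  also have "\<dots> \<le> ((M\<^sup>2 + 1) * (1 + \<xi>\<^sup>2)) * (1 * norm (q0 \<xi>))"
    using sb by (intro mult_mono sq_le) auto
  also have "\<dots> \<le> (M\<^sup>2 + 1) * ((1 + \<xi>\<^sup>2) * (norm (q0 \<xi>) + norm (q1 \<xi>)))"
    by (simp add: mult.assoc) (intro mult_left_mono; simp)
  also have "\<dots> \<le> (M\<^sup>2 + 1) * (B * e2 \<xi>)" by (intro mult_left_mono qB) simp
  finally have 1: "norm (complex_of_real (- (M\<^sup>2 + \<xi>\<^sup>2) * kg_sin M t \<xi>) * q0 \<xi>) \<le> (M\<^sup>2 + 1) * B * e2 \<xi>" by (simp add: mult.assoc)
  have "norm (complex_of_real (kg_cos M t \<xi>) * q1 \<xi>) \<le> 1 * norm (q1 \<xi>)"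
    unfolding norm_mult norm_of_real by (intro mult_right_mono kg_cos_bound) simp
  then have 2: "norm (complex_of_real (kg_cos M t \<xi>) * q1 \<xi>) \<le> B * e2 \<xi>"
    using qB'[of \<xi>] norm_ge_zero[of "q0 \<xi>"] by linarith
  have 3: "norm (LINT s:{0..t}|lborel. (\<lambda>r. complex_of_real (kg_cos M r \<xi>)) (t - s) * N s \<xi>) \<le> T * 1 * ((n0 * l ^ 4) * e2 \<xi>)"
    by (rule volterra_bound[OF _ N_decay t]) (use kg_cos_bound in auto)
  have "norm (qt t \<xi>) \<le> ((M\<^sup>2 + 1) * B * e2 \<xi> + B * e2 \<xi>) + T * 1 * ((n0 * l ^ 4) * e2 \<xi>)"
    unfolding qt_def using 3 by (intro norm_triangle_mono 1 2) simp
  also have "\<dots> = ((M\<^sup>2 + 1) * B + B + T * (n0 * l ^ 4)) * e2 \<xi>" by (simp only: distrib_right mult.assoc mult_1 mult_1_right)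
  finally show ?thesis .
qed

text \<open>A time increment of the Dirac propagator costs a factor \<open>omega m\<close>, which
  the fourth-order decay of the weight absorbs with the decay \<open>e2\<close> to spare.\<close>

lemma p_lip: "\<exists>C. \<forall>t\<in>{0..T}. \<forall>u\<in>{0..T}. \<forall>\<xi>. norm (p j t \<xi> - p j u \<xi>) \<le> C * \<bar>t - u\<bar> * e2 \<xi>"
proof -
  define X where "X = A * K1"
  have X0: "X \<ge> 0" unfolding X_def using A_nonneg K1_nonneg by simp
  have cb: "norm (spinor_sign k * conv (p k s) (q s) \<xi> / (2 * of_real pi)) \<le> X * wt l \<xi>" if "s \<in> {0..T}" for k s \<xi>
  proof -
    have "norm (spinor_sign k * conv (p k s) (q s) \<xi> / (2 * of_real pi)) = norm (conv (p k s) (q s) \<xi>) / (2 * pi)"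
      by (simp add: norm_divide norm_mult)
    also have "\<dots> \<le> norm (conv (p k s) (q s) \<xi>) / 1" using pi_gt3 by (intro divide_left_mono) auto
    also have "\<dots> \<le> X * wt l \<xi>" using conv_Q(2)[OF padm padm that, of k \<xi>] by (simp add: X_def)
    finally show ?thesis .
  qed
  define m1 where "m1 = \<bar>m\<bar> + 1"
  have m1: "m1 \<ge> 0" by (simp add: m1_def)
  define C1 where "C1 = 4 * m1 * (A0 * l ^ 4)"
  define C2 where "C2 = 2 * (2 + T * (2 * m1)) * (X * l ^ 4)"
  have "norm (p j t \<xi> - p j u \<xi>) \<le> (C1 + C2) * \<bar>t - u\<bar> * e2 \<xi>" if t: "t \<in> {0..T}" and u: "u \<in> {0..T}" for t u \<xi>
  proof -
    define w where "w = omega m \<xi>"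
    have w: "0 \<le> w" "w \<le> m1 * (1 + \<xi>\<^sup>2)" unfolding w_def m1_def by (rule omega_nonneg, rule omega_le)
    have wW: "w * (c * wt l \<xi>) \<le> m1 * ((c * l ^ 4) * e2 \<xi>)" if "c \<ge> 0" for c
    proof -
      have "w * (c * wt l \<xi>) \<le> (m1 * (1 + \<xi>\<^sup>2)) * (c * wt l \<xi>)" using that wt_nonneg by (intro mult_right_mono w) auto
      also have "\<dots> = m1 * ((1 + \<xi>\<^sup>2) * (c * wt l \<xi>))" by (rule mult.assoc)
      also have "\<dots> \<le> m1 * ((c * l ^ 4) * e2 \<xi>)" by (intro mult_left_mono wtE that m1)
      finally show ?thesis .
    qed
    have "norm (free_spinor j t \<xi> - free_spinor j u \<xi>) \<le> (\<Sum>k\<in>(UNIV::2 set). (2 * w * \<bar>t - u\<bar>) * (A0 * wt l \<xi>))"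
      unfolding free_spinor_def sum_subtractf[symmetric] left_diff_distrib[symmetric] w_def
      by (rule sum_norm_le) (unfold norm_mult, intro mult_mono dirac_lip p0b, use omega_nonneg in auto)
    also have "\<dots> = 4 * \<bar>t - u\<bar> * (w * (A0 * wt l \<xi>))" by simp
    also have "\<dots> \<le> 4 * \<bar>t - u\<bar> * (m1 * ((A0 * l ^ 4) * e2 \<xi>))" by (intro mult_left_mono wW A0_nonneg) auto
    also have "\<dots> = C1 * \<bar>t - u\<bar> * e2 \<xi>" unfolding C1_def by (simp only: mult_ac)
    finally have 1: "norm (free_spinor j t \<xi> - free_spinor j u \<xi>) \<le> C1 * \<bar>t - u\<bar> * e2 \<xi>" .
    \<comment> \<open>The contribution of a single component, brought into the scalar Volterra form
      of \<open>volterra_lip\<close>.\<close>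
    define V where "V k t = (LINT s:{0..t}|lborel. (\<lambda>r. dirac_prop m r \<xi> $ j $ k) (t - s) * (spinor_sign k * conv (p k s) (q s) \<xi> / (2 * of_real pi)))" for k t
    have km: "(\<lambda>r. dirac_prop m r \<xi> $ j $ k) \<in> borel_measurable borel" for k by measurable
    have Nm: "(\<lambda>s. spinor_sign k * conv (p k s) (q s) \<xi> / (2 * of_real pi)) \<in> borel_measurable borel" for k
    proof -
      have [measurable]: "(\<lambda>(s, x). p k s x) \<in> borel_measurable (borel \<Otimes>\<^sub>M borel)" by (rule joint_measD[OF pm])
      have [measurable]: "(\<lambda>(s, x). q s x) \<in> borel_measurable (borel \<Otimes>\<^sub>M borel)" by (rule Q_measurable[OF pm pm])
      show ?thesis by measurable
    qed
    have Vs: "(LINT s:{0..t}|lborel. feedback p j t \<xi> s) = (\<Sum>k\<in>UNIV. V k t)" if t: "t \<in> {0..T}" for t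
    proof -
      have i: "set_integrable lborel {0..t} (\<lambda>s. dirac_prop m (t - s) \<xi> $ j $ k * (spinor_sign k * conv (p k s) (q s) \<xi> / (2 * of_real pi)))" for k
      proof (rule set_lint_integrable)
        show "(\<lambda>s. dirac_prop m (t - s) \<xi> $ j $ k * (spinor_sign k * conv (p k s) (q s) \<xi> / (2 * of_real pi))) \<in> borel_measurable borel"
          by (intro borel_measurable_times Nm) measurable
        show "norm (dirac_prop m (t - s) \<xi> $ j $ k * (spinor_sign k * conv (p k s) (q s) \<xi> / (2 * of_real pi))) \<le> 2 * (X * wt l \<xi>)" if "s \<in> {0..t}" for s
          unfolding norm_mult[of "dirac_prop m (t - s) \<xi> $ j $ k"] using that t by (intro mult_mono dirac_prop_bound cb) auto
      qed
      show ?thesis unfolding feedback_def V_def sum_2 by (rule set_integral_add(2)[OF i i])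
    qed
    have Vl: "norm (V k t - V k u) \<le> (2 + T * (2 * w)) * (X * wt l \<xi>) * \<bar>t - u\<bar>" for k
      unfolding V_def w_def
      by (rule volterra_lip[OF km Nm _ _ cb t u]) (auto intro: dirac_prop_bound dirac_lip)
    have "(LINT s:{0..t}|lborel. feedback p j t \<xi> s) - (LINT s:{0..u}|lborel. feedback p j u \<xi> s) = (\<Sum>k\<in>UNIV. V k t - V k u)"
      unfolding Vs[OF t] Vs[OF u] sum_subtractf ..
    then have "norm ((LINT s:{0..t}|lborel. feedback p j t \<xi> s) - (LINT s:{0..u}|lborel. feedback p j u \<xi> s)) \<le> 2 * ((2 + T * (2 * w)) * (X * wt l \<xi>) * \<bar>t - u\<bar>)"
      using norm_sum2[of "\<lambda>k. V k t - V k u"] Vl[of 1] Vl[of 2] by simp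
    also have "\<dots> = 2 * \<bar>t - u\<bar> * (2 * (X * wt l \<xi>) + 2 * T * (w * (X * wt l \<xi>)))" by (simp add: algebra_simps)
    also have "\<dots> \<le> 2 * \<bar>t - u\<bar> * (2 * ((X * l ^ 4) * e2 \<xi>) + 2 * T * (m1 * ((X * l ^ 4) * e2 \<xi>)))"
      using T0 by (intro mult_left_mono add_mono wtE' wW X0) auto
    also have "\<dots> = C2 * \<bar>t - u\<bar> * e2 \<xi>" unfolding C2_def by (simp only: distrib_left distrib_right mult_ac)
    finally have 2: "norm ((LINT s:{0..t}|lborel. feedback p j t \<xi> s) - (LINT s:{0..u}|lborel. feedback p j u \<xi> s)) \<le> C2 * \<bar>t - u\<bar> * e2 \<xi>" .
    have "p j t \<xi> - p j u \<xi> = (free_spinor j t \<xi> - free_spinor j u \<xi>) - \<i> * ((LINT s:{0..t}|lborel. feedback p j t \<xi> s) - (LINT s:{0..u}|lborel. feedback p j u \<xi> s))"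
      unfolding pG[OF t] pG[OF u] G_def by (simp add: right_diff_distrib)
    then have "norm (p j t \<xi> - p j u \<xi>) \<le> C1 * \<bar>t - u\<bar> * e2 \<xi> + C2 * \<bar>t - u\<bar> * e2 \<xi>"
      using order_trans[OF norm_triangle_ineq4 add_mono[OF 1, of "norm (\<i> * ((LINT s:{0..t}|lborel. feedback p j t \<xi> s) - (LINT s:{0..u}|lborel. feedback p j u \<xi> s)))"]] 2
      by (simp add: norm_mult)
    then show ?thesis by (simp only: distrib_right)
  qed
  then show ?thesis by blast
qed

end

context dkg_sol
begin

definition "M1 = M\<^sup>2 + 1 + (\<bar>M\<bar> + 1)"
definition "n1 = n0 * l ^ 4"
text \<open>One constant for \<open>q_lip\<close>, \<open>qt_lip\<close> and
  \<open>q_taylor\<close>. The three summands bound the data, the density, and the density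
  multiplied by the frequency factor of the propagator.\<close>

definition "CC = M1 * B + 2 * n1 + T * M1 * n1"

lemma M1: "1 \<le> M1" "omega M \<xi> \<le> M1 * (1 + \<xi>\<^sup>2)" "M\<^sup>2 + \<xi>\<^sup>2 \<le> M1 * (1 + \<xi>\<^sup>2)"
proof -
  show "1 \<le> M1" by (simp add: M1_def)
  have "(\<bar>M\<bar> + 1) * (1 + \<xi>\<^sup>2) \<le> M1 * (1 + \<xi>\<^sup>2)" "(M\<^sup>2 + 1) * (1 + \<xi>\<^sup>2) \<le> M1 * (1 + \<xi>\<^sup>2)"
    by (intro mult_right_mono; simp add: M1_def)+
  then show "omega M \<xi> \<le> M1 * (1 + \<xi>\<^sup>2)" "M\<^sup>2 + \<xi>\<^sup>2 \<le> M1 * (1 + \<xi>\<^sup>2)"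
    using omega_le[of M \<xi>] sq_le[of M \<xi>] by linarith+
qed

lemma n1_nonneg: "n1 \<ge> 0" unfolding n1_def using n0_nonneg by simp

lemma nwt: "n0 * wt l \<xi> \<le> n1 * e2 \<xi>" "omega M \<xi> * (n0 * wt l \<xi>) \<le> M1 * n1 * e2 \<xi>"
proof -
  show "n0 * wt l \<xi> \<le> n1 * e2 \<xi>" unfolding n1_def by (rule wtE'[OF n0_nonneg])
  have "omega M \<xi> * (n0 * wt l \<xi>) \<le> (M1 * (1 + \<xi>\<^sup>2)) * (n0 * wt l \<xi>)"
    using n0_nonneg wt_nonneg by (intro mult_right_mono M1) auto
  also have "\<dots> = M1 * ((1 + \<xi>\<^sup>2) * (n0 * wt l \<xi>))" by (rule mult.assoc)
  also have "\<dots> \<le> M1 * (n1 * e2 \<xi>)" unfolding n1_def using M1(1) by (intro mult_left_mono wtE n0_nonneg) auto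
  finally show "omega M \<xi> * (n0 * wt l \<xi>) \<le> M1 * n1 * e2 \<xi>" by (simp add: mult.assoc)
qed

lemma data_term_bound: assumes "a \<le> M1 * (1 + \<xi>\<^sup>2)" "b \<le> M1 * (1 + \<xi>\<^sup>2)"
  shows "a * norm (q0 \<xi>) + b * norm (q1 \<xi>) \<le> M1 * B * e2 \<xi>"
proof -
  have "a * norm (q0 \<xi>) + b * norm (q1 \<xi>) \<le> (M1 * (1 + \<xi>\<^sup>2)) * norm (q0 \<xi>) + (M1 * (1 + \<xi>\<^sup>2)) * norm (q1 \<xi>)"
    using assms by (intro add_mono mult_right_mono) auto
  also have "\<dots> = M1 * ((1 + \<xi>\<^sup>2) * (norm (q0 \<xi>) + norm (q1 \<xi>)))" by (simp add: algebra_simps)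
  also have "\<dots> \<le> M1 * (B * e2 \<xi>)" using M1(1) by (intro mult_left_mono qB) auto
  finally show ?thesis by (simp add: mult.assoc)
qed

lemma q_lip:
  assumes t: "t \<in> {0..T}" and u: "u \<in> {0..T}"
  shows "norm (q t \<xi> - q u \<xi>) \<le> CC * \<bar>t - u\<bar> * e2 \<xi>"
proof -
  define D where "D = \<bar>t - u\<bar>"
  have D: "D \<ge> 0" by (simp add: D_def)
  have q: "norm (free_field t \<xi> - free_field u \<xi>) \<le> D * (M1 * B * e2 \<xi>)"
  proof -
    have "free_field t \<xi> - free_field u \<xi> = of_real (kg_cos M t \<xi> - kg_cos M u \<xi>) * q0 \<xi> + of_real (kg_sin M t \<xi> - kg_sin M u \<xi>) * q1 \<xi>"
      unfolding free_field_def by (simp add: algebra_simps)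
    also have "norm \<dots> \<le> (omega M \<xi> * D) * norm (q0 \<xi>) + D * norm (q1 \<xi>)"
      unfolding D_def by (intro norm_triangle_mono; unfold norm_mult norm_of_real; intro mult_right_mono kg_cos_lip kg_sin_lip norm_ge_zero)
    also have "\<dots> = D * (omega M \<xi> * norm (q0 \<xi>) + 1 * norm (q1 \<xi>))" by (simp add: algebra_simps)
    also have "\<dots> \<le> D * (M1 * B * e2 \<xi>)"
    proof (intro mult_left_mono data_term_bound M1 D)
      have "1 * 1 \<le> M1 * (1 + \<xi>\<^sup>2)" using M1(1) by (intro mult_mono) auto
      then show "1 \<le> M1 * (1 + \<xi>\<^sup>2)" by simp
    qed
    finally show ?thesis .
  qed
  have "norm (kg_response M p p t \<xi> - kg_response M p p u \<xi>) \<le> (1 + T * 1) * (n0 * wt l \<xi>) * \<bar>t - u\<bar>"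
    unfolding kg_response_eq
  proof (rule volterra_lip[OF kgc_meas(2) N_meas _ _ N_bound t u])
    show "norm (complex_of_real (kg_sin M r \<xi>)) \<le> 1" if "r \<in> {0..T}" for r
      using kg_sin_bound[of M r \<xi>] that T0 by simp
    show "norm (complex_of_real (kg_sin M r \<xi>) - complex_of_real (kg_sin M r' \<xi>)) \<le> 1 * \<bar>r - r'\<bar>" for r r'
      using kg_sin_lip[of M r \<xi> r'] by (metis mult_1 norm_of_real of_real_diff)
  qed
  also have "\<dots> \<le> 2 * (n1 * e2 \<xi>) * D"
    unfolding D_def using T0 n0_nonneg wt_nonneg by (intro mult_right_mono mult_mono nwt) auto
  finally have r: "norm (kg_response M p p t \<xi> - kg_response M p p u \<xi>) \<le> D * (2 * (n1 * e2 \<xi>))" by (simp add: mult_ac)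
  have "q t \<xi> - q u \<xi> = (free_field t \<xi> - free_field u \<xi>) + (kg_response M p p t \<xi> - kg_response M p p u \<xi>)" unfolding Q_def by simp
  then have "norm (q t \<xi> - q u \<xi>) \<le> D * (M1 * B * e2 \<xi>) + D * (2 * (n1 * e2 \<xi>))"
    using norm_triangle_mono[OF q r] by simp
  also have "\<dots> = (M1 * B + 2 * n1) * D * e2 \<xi>" by (simp add: algebra_simps)
  also have "\<dots> \<le> CC * D * e2 \<xi>"
    unfolding CC_def using D e2_nonneg T0 M1(1) n1_nonneg by (intro mult_right_mono) auto
  finally show ?thesis unfolding D_def .
qed

lemma qt_lip:
  assumes t: "t \<in> {0..T}" and u: "u \<in> {0..T}"
  shows "norm (qt t \<xi> - qt u \<xi>) \<le> CC * \<bar>t - u\<bar> * e2 \<xi>"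
proof -
  define D where "D = \<bar>t - u\<bar>"
  have D: "D \<ge> 0" by (simp add: D_def)
  define Y where "Y t = (LINT s:{0..t}|lborel. (\<lambda>r. complex_of_real (kg_cos M r \<xi>)) (t - s) * N s \<xi>)" for t
  define Z where "Z t = of_real (- (M\<^sup>2 + \<xi>\<^sup>2) * kg_sin M t \<xi>) * q0 \<xi> + of_real (kg_cos M t \<xi>) * q1 \<xi>" for t
  have qtY: "qt t \<xi> = Z t + Y t" for t unfolding qt_def Y_def Z_def by simp
  have q: "norm (Z t - Z u) \<le> D * (M1 * B * e2 \<xi>)"
  proof -
    have "Z t - Z u = of_real (- (M\<^sup>2 + \<xi>\<^sup>2) * (kg_sin M t \<xi> - kg_sin M u \<xi>)) * q0 \<xi> + of_real (kg_cos M t \<xi> - kg_cos M u \<xi>) * q1 \<xi>"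
      unfolding Z_def by (simp add: algebra_simps)
    also have "norm \<dots> \<le> ((M\<^sup>2 + \<xi>\<^sup>2) * D) * norm (q0 \<xi>) + (omega M \<xi> * D) * norm (q1 \<xi>)"
    proof (intro norm_triangle_mono; unfold norm_mult norm_of_real; intro mult_right_mono norm_ge_zero)
      show "\<bar>- (M\<^sup>2 + \<xi>\<^sup>2) * (kg_sin M t \<xi> - kg_sin M u \<xi>)\<bar> \<le> (M\<^sup>2 + \<xi>\<^sup>2) * D"
        unfolding abs_mult abs_minus_cancel D_def by (intro mult_mono kg_sin_lip) auto
      show "\<bar>kg_cos M t \<xi> - kg_cos M u \<xi>\<bar> \<le> omega M \<xi> * D" unfolding D_def by (rule kg_cos_lip)
    qed
    also have "\<dots> = D * ((M\<^sup>2 + \<xi>\<^sup>2) * norm (q0 \<xi>) + omega M \<xi> * norm (q1 \<xi>))" by (simp add: algebra_simps)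
    also have "\<dots> \<le> D * (M1 * B * e2 \<xi>)" by (intro mult_left_mono data_term_bound M1 D)
    finally show ?thesis .
  qed
  have "norm (Y t - Y u) \<le> (1 + T * omega M \<xi>) * (n0 * wt l \<xi>) * \<bar>t - u\<bar>"
    unfolding Y_def
  proof (rule volterra_lip[OF kgc_meas(1) N_meas _ _ N_bound t u])
    show "norm (complex_of_real (kg_cos M r \<xi>)) \<le> 1" for r
      using kg_cos_bound[of M r \<xi>] by simp
    show "norm (complex_of_real (kg_cos M r \<xi>) - complex_of_real (kg_cos M r' \<xi>)) \<le> omega M \<xi> * \<bar>r - r'\<bar>" for r r'
      using kg_cos_lip[of M r \<xi> r'] by (metis norm_of_real of_real_diff)
  qed
  also have "\<dots> = D * (n0 * wt l \<xi> + T * (omega M \<xi> * (n0 * wt l \<xi>)))" unfolding D_def by (simp add: algebra_simps)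
  also have "\<dots> \<le> D * (n1 * e2 \<xi> + T * (M1 * n1 * e2 \<xi>))"
    using T0 by (intro mult_left_mono add_mono nwt D) auto
  finally have r: "norm (Y t - Y u) \<le> D * (n1 * e2 \<xi> + T * (M1 * n1 * e2 \<xi>))" .
  have "qt t \<xi> - qt u \<xi> = (Z t - Z u) + (Y t - Y u)" unfolding qtY by simp
  then have "norm (qt t \<xi> - qt u \<xi>) \<le> D * (M1 * B * e2 \<xi>) + D * (n1 * e2 \<xi> + T * (M1 * n1 * e2 \<xi>))"
    using norm_triangle_mono[OF q r] by simp
  also have "\<dots> = (M1 * B + n1 + T * M1 * n1) * D * e2 \<xi>" by (simp add: algebra_simps)
  also have "\<dots> \<le> CC * D * e2 \<xi>"
    unfolding CC_def using D e2_nonneg n1_nonneg by (intro mult_right_mono) auto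
  finally show ?thesis unfolding D_def .
qed

text \<open>Identifies \<open>qt\<close> as the derivative of \<open>q\<close> with a quadratic
  error that decays uniformly in frequency, so that the difference quotients converge in the Sobolev
  norm and not merely at each frequency.\<close>

lemma q_taylor:
  assumes t: "t \<in> {0..T}" and u: "u \<in> {0..T}"
  shows "norm (q t \<xi> - q u \<xi> - of_real (t - u) * qt u \<xi>) \<le> CC * \<bar>t - u\<bar>\<^sup>2 * e2 \<xi>"
proof -
  define D where "D = \<bar>t - u\<bar>\<^sup>2"
  have D: "D \<ge> 0" by (simp add: D_def)
  define Y where "Y = (LINT s:{0..u}|lborel. (\<lambda>r. complex_of_real (kg_cos M r \<xi>)) (u - s) * N s \<xi>)"
  define Z where "Z = of_real (- (M\<^sup>2 + \<xi>\<^sup>2) * kg_sin M u \<xi>) * q0 \<xi> + of_real (kg_cos M u \<xi>) * q1 \<xi>"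
  have qtY: "qt u \<xi> = Z + Y" unfolding qt_def Y_def Z_def by simp
  have q: "norm (free_field t \<xi> - free_field u \<xi> - of_real (t - u) * Z) \<le> D * (M1 * B * e2 \<xi>)"
  proof -
    have "free_field t \<xi> - free_field u \<xi> - of_real (t - u) * Z
      = of_real (kg_cos M t \<xi> - kg_cos M u \<xi> - (t - u) * (- (M\<^sup>2 + \<xi>\<^sup>2) * kg_sin M u \<xi>)) * q0 \<xi>
       + of_real (kg_sin M t \<xi> - kg_sin M u \<xi> - (t - u) * kg_cos M u \<xi>) * q1 \<xi>"
      unfolding Z_def free_field_def of_real_diff of_real_mult by (simp only: algebra_simps)
    also have "norm \<dots> \<le> ((M\<^sup>2 + \<xi>\<^sup>2) * D) * norm (q0 \<xi>) + (omega M \<xi> * D) * norm (q1 \<xi>)"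
      unfolding D_def by (intro norm_triangle_mono; unfold norm_mult norm_of_real; intro mult_right_mono norm_ge_zero kg_cos_taylor kg_sin_taylor)
    also have "\<dots> = D * ((M\<^sup>2 + \<xi>\<^sup>2) * norm (q0 \<xi>) + omega M \<xi> * norm (q1 \<xi>))" by (simp add: algebra_simps)
    also have "\<dots> \<le> D * (M1 * B * e2 \<xi>)" by (intro mult_left_mono data_term_bound M1 D)
    finally show ?thesis .
  qed
  have "norm (kg_response M p p t \<xi> - kg_response M p p u \<xi> - of_real (t - u) * Y) \<le> (2 + T * omega M \<xi>) * (n0 * wt l \<xi>) * \<bar>t - u\<bar>\<^sup>2"
    unfolding Y_def kg_response_eq
  proof (rule volterra_taylor[OF kgc_meas(2) kgc_meas(1) N_meas _ _ _ N_bound t u])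
    show "norm (complex_of_real (kg_sin M r \<xi>)) \<le> \<bar>r\<bar>" for r using kg_sin_bound[of M r \<xi>] by simp
    show "norm (complex_of_real (kg_cos M r \<xi>)) \<le> 1" for r using kg_cos_bound[of M r \<xi>] by simp
    show "norm (complex_of_real (kg_sin M r \<xi>) - complex_of_real (kg_sin M r' \<xi>) - complex_of_real (r - r') * complex_of_real (kg_cos M r' \<xi>)) \<le> omega M \<xi> * \<bar>r - r'\<bar>\<^sup>2" for r r'
      using kg_sin_taylor[of M r \<xi> r'] unfolding of_real_diff[symmetric] of_real_mult[symmetric] norm_of_real .
  qed
  also have "\<dots> = D * (2 * (n0 * wt l \<xi>) + T * (omega M \<xi> * (n0 * wt l \<xi>)))" unfolding D_def by (simp add: algebra_simps)
  also have "\<dots> \<le> D * (2 * (n1 * e2 \<xi>) + T * (M1 * n1 * e2 \<xi>))"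
    using T0 by (intro mult_left_mono add_mono nwt D) auto
  finally have r: "norm (kg_response M p p t \<xi> - kg_response M p p u \<xi> - of_real (t - u) * Y) \<le> D * (2 * (n1 * e2 \<xi>) + T * (M1 * n1 * e2 \<xi>))" .
  have "q t \<xi> - q u \<xi> - of_real (t - u) * qt u \<xi> = (free_field t \<xi> - free_field u \<xi> - of_real (t - u) * Z) + (kg_response M p p t \<xi> - kg_response M p p u \<xi> - of_real (t - u) * Y)"
    unfolding qtY Q_def by (simp add: algebra_simps)
  then have "norm (q t \<xi> - q u \<xi> - of_real (t - u) * qt u \<xi>) \<le> D * (M1 * B * e2 \<xi>) + D * (2 * (n1 * e2 \<xi>) + T * (M1 * n1 * e2 \<xi>))"
    using norm_triangle_mono[OF q r] by simp
  also have "\<dots> = CC * D * e2 \<xi>" unfolding CC_def by (simp add: algebra_simps)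
  finally show ?thesis unfolding D_def .
qed

lemma kg_even: "kg_cos M t (- \<xi>) = kg_cos M t \<xi>" "kg_sin M t (- \<xi>) = kg_sin M t \<xi>"
  by (simp_all add: kg_cos_def kg_sin_def omega_def)

lemma N_sym: "N s (- \<xi>) = cnj (N s \<xi>)"
  unfolding scalar_density_def by (simp add: conv_cnj_reflect_sym spinor_sign_def sum_2)

lemma q_sym: "q t (- \<xi>) = cnj (q t \<xi>)"
proof -
  have "free_field t (- \<xi>) = cnj (free_field t \<xi>)"
    unfolding free_field_def by (simp add: kg_even q0s q1s)
  moreover have "kg_response M p p t (- \<xi>) = cnj (kg_response M p p t \<xi>)"
    unfolding kg_response_def set_lebesgue_integral_def Bochner_Integration.integral_cnj[symmetric]
    by (intro Bochner_Integration.integral_cong refl) (simp add: kg_even N_sym)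
  ultimately show ?thesis unfolding Q_def by simp
qed

lemma p_meas: "p j t \<in> borel_measurable borel" by (rule joint_meas_section[OF pm])
lemma q_meas: "q t \<in> borel_measurable borel" by (rule sections(1)[OF pm pm])

lemma qt_meas: "qt t \<in> borel_measurable borel"
proof -
  have [measurable]: "(\<lambda>(z, s). N s z) \<in> borel_measurable (borel \<Otimes>\<^sub>M borel)"
    unfolding case_prod_beta' by (rule scalar_density_measurable[OF pm pm]) measurable
  have e: "(LINT s:{0..t}|lborel. of_real (kg_cos M (t - s) \<xi>) * N s \<xi>) = (LINT s|lborel. (if 0 \<le> s \<and> s \<le> t then of_real (kg_cos M (t - s) \<xi>) * N s \<xi> else 0))" for \<xi>
    unfolding set_lebesgue_integral_def by (intro Bochner_Integration.integral_cong) (auto simp: indicator_def)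
  show ?thesis unfolding qt_def[abs_def] e by measurable
qed

definition \<psi> :: "real \<Rightarrow> real \<Rightarrow> complex ^ 2" where "\<psi> t x = (\<chi> j. ift (p j t) x)"
definition \<phi> :: "real \<Rightarrow> real \<Rightarrow> real" where "\<phi> t x = Re (ift (q t) x)"
definition \<phi>t :: "real \<Rightarrow> dist" where "\<phi>t t = dist_of (ift (qt t))"

text \<open>By the Hermitian symmetry of \<open>q t\<close> its inverse transform is real, so the
  real part in the definition of \<open>\<phi>\<close> discards nothing.\<close>

lemma \<phi>_ift: "complex_of_real (\<phi> t x) = ift (q t) x"
proof -
  have "cnj_reflect (q t) = q t" unfolding cnj_reflect_def[abs_def] using q_sym[of t] by (simp add: fun_eq_iff)
  then have "cnj (ift (q t) x) = ift (q t) x" using ift_cnj_reflect[of "q t" x] by simp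
  then have "ift (q t) x \<in> \<real>" by (simp add: Reals_cnj_iff)
  then show ?thesis unfolding \<phi>_def by simp
qed

lemma zero_T: "0 \<in> {0..T}" using T0 by simp

lemma initial: "p j 0 \<xi> = p0 j \<xi>" "q 0 \<xi> = q0 \<xi>" "qt 0 \<xi> = q1 \<xi>"
proof -
  have z: "(LINT s:{0..0}|lborel. f s) = 0" for f :: "real \<Rightarrow> complex"
  proof -
    have "AE s in lborel. indicat_real {0..0} s *\<^sub>R f s = 0"
      using AE_lborel_singleton[of 0] by eventually_elim (auto simp: indicator_def)
    then show ?thesis unfolding set_lebesgue_integral_def by (rule integral_eq_zero_AE)
  qed
  show "p j 0 \<xi> = p0 j \<xi>"
    unfolding pG[OF zero_T] G_def z free_spinor_def dirac_prop_0 sum_2 using exhaust_2[of j] by (auto simp: mat_def)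
  show "q 0 \<xi> = q0 \<xi>" unfolding Q_def free_field_def kg_response_def z by (simp add: kg_cos_0 kg_sin_0)
  show "qt 0 \<xi> = q1 \<xi>" unfolding qt_def z by (simp add: kg_cos_0 kg_sin_0)
qed

end

section \<open>The Duhamel formulas\<close>

text \<open>The test function supplies integrability in frequency and the bounded interval that in
  time, so a mere bound on \<open>g\<close> suffices.\<close>

lemma Fubini_time:
  fixes g :: "real \<Rightarrow> real \<Rightarrow> complex"
  assumes gm: "(\<lambda>(\<xi>, s). g \<xi> s) \<in> borel_measurable (borel \<Otimes>\<^sub>M borel)"
    and gb: "\<And>s \<xi>. s \<in> {0..t} \<Longrightarrow> norm (g \<xi> s) \<le> K" and K: "K \<ge> 0" and f: "integrable lborel f"
  shows "set_integrable lborel {0..t} (\<lambda>s. LINT \<xi>|lborel. g \<xi> s * f \<xi>)"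
    and "(LINT s:{0..t}|lborel. (LINT \<xi>|lborel. g \<xi> s * f \<xi>)) = (LINT \<xi>|lborel. (LINT s:{0..t}|lborel. g \<xi> s) * f \<xi>)"
proof -
  have [measurable]: "(\<lambda>(\<xi>, s). g \<xi> s) \<in> borel_measurable (borel \<Otimes>\<^sub>M borel)" "f \<in> borel_measurable borel" using gm f by auto
  let ?F = "\<lambda>s \<xi>. indicat_real {0..t} s *\<^sub>R (g \<xi> s * f \<xi>)"
  have a: "integrable lborel (\<lambda>s. indicat_real {0..t} s * K)"
    by (intro integrable_mult_left integrable_real_indicator) (auto simp: emeasure_lborel_Icc_eq)
  have m: "case_prod ?F \<in> borel_measurable (lborel \<Otimes>\<^sub>M lborel)"
  proof -
    have "(\<lambda>z. g (snd z) (fst z)) \<in> borel_measurable (borel \<Otimes>\<^sub>M borel)"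
      using measurable_compose[OF measurable_Pair[OF measurable_snd measurable_fst] gm] by simp
    then have [measurable]: "(\<lambda>(s, \<xi>). g \<xi> s) \<in> borel_measurable (borel \<Otimes>\<^sub>M borel)"
      by (simp add: case_prod_beta')
    show ?thesis by measurable
  qed
  have b: "norm (?F s \<xi>) \<le> (indicat_real {0..t} s * K) * norm (f \<xi>)" for s \<xi>
    using mult_right_mono[OF gb[of s \<xi>] norm_ge_zero[of "f \<xi>"]] by (auto simp: indicator_def norm_mult)
  note F = Fubini_dominated[OF m a integrable_norm[OF f] b]
  show "set_integrable lborel {0..t} (\<lambda>s. LINT \<xi>|lborel. g \<xi> s * f \<xi>)"
    using F(3) unfolding set_integrable_def by simp
  have "(LINT s:{0..t}|lborel. (LINT \<xi>|lborel. g \<xi> s * f \<xi>)) = (LINT s|lborel. LINT \<xi>|lborel. ?F s \<xi>)"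
    unfolding set_lebesgue_integral_def by simp
  also have "\<dots> = (LINT \<xi>|lborel. LINT s|lborel. ?F s \<xi>)" by (rule F(2))
  also have "\<dots> = (LINT \<xi>|lborel. (LINT s:{0..t}|lborel. g \<xi> s) * f \<xi>)"
    unfolding set_lebesgue_integral_def
    by (subst integral_mult_left_zero[symmetric]) simp
  finally show "(LINT s:{0..t}|lborel. (LINT \<xi>|lborel. g \<xi> s * f \<xi>)) = (LINT \<xi>|lborel. (LINT s:{0..t}|lborel. g \<xi> s) * f \<xi>)" .
qed

lemma omega_isCont: "isCont (omega M) \<xi>"
  unfolding omega_def[abs_def] by (intro continuous_intros)

lemma kg_isCont: "isCont (kg_cos M t) \<xi>" "isCont (kg_sin M t) \<xi>"
proof -
  show "isCont (kg_cos M t) \<xi>" unfolding kg_cos_def[abs_def] by (intro continuous_intros omega_isCont)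
  \<comment> \<open>Through sinc the case distinction at \<open>omega M \<xi> = 0\<close> disappears
    and continuity follows at once.\<close>
  have "kg_sin M t = (\<lambda>\<xi>. t * sinc (t * omega M \<xi>))"
    by (auto simp: kg_sin_def fun_eq_iff)
  moreover have "isCont (\<lambda>\<xi>. t * sinc (t * omega M \<xi>)) \<xi>"
    by (intro continuous_intros isCont_o2[OF _ isCont_sinc] omega_isCont)
  ultimately show "isCont (kg_sin M t) \<xi>" by simp
qed

lemma dirac_isCont: "isCont (\<lambda>\<xi>. dirac_prop m t \<xi> $ j $ k) \<xi>"
proof -
  have "isCont (\<lambda>\<xi>. dirac_prop m t \<xi> $ 1 $ 1) \<xi>" "isCont (\<lambda>\<xi>. dirac_prop m t \<xi> $ 1 $ 2) \<xi>"
    "isCont (\<lambda>\<xi>. dirac_prop m t \<xi> $ 2 $ 1) \<xi>" "isCont (\<lambda>\<xi>. dirac_prop m t \<xi> $ 2 $ 2) \<xi>"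
    unfolding dirac_prop_entries by (intro continuous_intros kg_isCont)+
  then show ?thesis using exhaust_2[of j] exhaust_2[of k] by auto
qed

text \<open>A test function multiplied by a propagator enters only through Parseval's identity,
  which asks for a bounded, integrable and continuous function.\<close>

lemma test_multiplier:
  assumes f: "schwartz f" and c: "\<And>\<xi>. isCont a \<xi>" and b: "\<And>\<xi>. norm (a \<xi>) \<le> (K::real)"
  shows "bounded_integrable (\<lambda>\<xi>. a \<xi> * f \<xi> :: complex)" "isCont (\<lambda>\<xi>. a \<xi> * f \<xi>) \<xi>"
proof -
  have K: "K \<ge> 0" using order_trans[OF norm_ge_zero b] .
  have [measurable]: "a \<in> borel_measurable borel"
    by (intro borel_measurable_continuous_onI continuous_at_imp_continuous_on ballI c)
  have [measurable]: "f \<in> borel_measurable borel" by (rule schwartz_measurable[OF f])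
  show "bounded_integrable (\<lambda>\<xi>. a \<xi> * f \<xi>)"
  proof (rule bounded_integrable_of_decay)
    fix x
    have "norm (a x * f x) \<le> K * ((schwartz_seminorm 0 0 f + schwartz_seminorm 2 0 f) * (1 / (1 + x\<^sup>2)))"
      unfolding norm_mult by (intro mult_mono b schwartz_decay[OF f] K) auto
    then show "norm (a x * f x) \<le> K * (schwartz_seminorm 0 0 f + schwartz_seminorm 2 0 f) * (1 / (1 + x\<^sup>2))"
      by (simp only: mult.assoc)
  qed measurable
  show "isCont (\<lambda>\<xi>. a \<xi> * f \<xi>) \<xi>" by (intro continuous_intros c schwartz_isCont[OF f])
qed

lemma bounded_integrable_mult_integrable:
  assumes h: "bounded_integrable h" and F: "integrable lborel F"
  shows "integrable lborel (\<lambda>\<xi>. h \<xi> * F \<xi>)"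
proof -
  obtain B where B: "\<And>x. norm (h x) \<le> B" using h by (auto simp: bounded_integrable_def)
  show ?thesis by (rule bounded_times_integrable[OF bounded_integrable_measurable[OF h] B F])
qed

lemma gamma0_mult: "(gamma0 *v (v :: complex ^ 2)) $ k = spinor_sign k * v $ k"
  using exhaust_2[of k] by (auto simp: gamma0_def spinor_sign_def matrix_vector_mult_def sum_2 vector_2)

context dkg_sol
begin

lemma p_bounded_integrable: "t \<in> {0..T} \<Longrightarrow> bounded_integrable (p j t)"
  by (rule bounded_integrable_of_decay[OF p_meas p_decay])
lemma q_bounded_integrable: "t \<in> {0..T} \<Longrightarrow> bounded_integrable (q t)"
  by (rule bounded_integrable_of_decay[OF q_meas q_decay])
lemma qt_bounded_integrable: "t \<in> {0..T} \<Longrightarrow> bounded_integrable (qt t)"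
  by (rule bounded_integrable_of_decay[OF qt_meas qt_decay])

lemma conv_pq_bounded_integrable:
  assumes s: "s \<in> {0..T}" shows "bounded_integrable (\<lambda>\<xi>. spinor_sign k * conv (p k s) (q s) \<xi> / (2 * of_real pi))"
proof (rule bounded_integrable_of_decay)
  show "(\<lambda>\<xi>. spinor_sign k * conv (p k s) (q s) \<xi> / (2 * of_real pi)) \<in> borel_measurable borel"
    using conv_measurable[OF p_meas q_meas] by measurable
  fix \<xi>
  have "norm (spinor_sign k * conv (p k s) (q s) \<xi> / (2 * of_real pi)) = norm (conv (p k s) (q s) \<xi>) / (2 * pi)"
    by (simp add: norm_divide norm_mult)
  also have "\<dots> \<le> norm (conv (p k s) (q s) \<xi>) / 1" using pi_gt3 by (intro divide_left_mono) auto
  also have "\<dots> \<le> A * K1 * wt l \<xi>" using conv_Q(2)[OF padm padm s] by simp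
  also have "\<dots> \<le> (A * K1 * l ^ 4) * e2 \<xi>" using A_nonneg K1_nonneg by (intro wtE') auto
  finally show "norm (spinor_sign k * conv (p k s) (q s) \<xi> / (2 * of_real pi)) \<le> (A * K1 * l ^ 4) * e2 \<xi>" .
qed

lemma N_bounded_integrable:
  assumes s: "s \<in> {0..T}" shows "bounded_integrable (N s)"
proof (rule bounded_integrable_of_decay[OF _ N_decay[OF s]])
  show "N s \<in> borel_measurable borel"
    by (rule scalar_density_measurable[OF pm pm, of "\<lambda>_. s" borel "\<lambda>x. x"]) measurable
qed

text \<open>By the convolution theorem the convolution built into \<open>feedback\<close> is the
  transform of the pointwise product of the functions \<open>\<phi>\<close> and
  \<open>\<psi>\<close>, as the definition of a solution demands.\<close>

lemma dirac_term:
  assumes s: "s \<in> {0..T}"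
  shows "(\<lambda>x. (gamma0 *v dirac_source (\<phi> s) (\<psi> s) x) $ k) = ift (\<lambda>\<xi>. spinor_sign k * conv (p k s) (q s) \<xi> / (2 * of_real pi))"
proof
  fix x
  have "ift (\<lambda>\<xi>. spinor_sign k * conv (p k s) (q s) \<xi> / (2 * of_real pi)) x = (spinor_sign k / (2 * of_real pi)) * ift (conv (p k s) (q s)) x"
  proof -
    have "(LINT \<xi>|lborel. exp (\<i> * of_real (x * \<xi>)) * (spinor_sign k * conv (p k s) (q s) \<xi> / (2 * of_real pi))) = (LINT \<xi>|lborel. (spinor_sign k / (2 * of_real pi)) * (exp (\<i> * of_real (x * \<xi>)) * conv (p k s) (q s) \<xi>))"
      by (intro Bochner_Integration.integral_cong refl) (simp add: mult_ac)
    then show ?thesis unfolding ift_def by (simp add: mult_ac)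
  qed
  also have "\<dots> = spinor_sign k * (ift (p k s) x * ift (q s) x)"
    using p_bounded_integrable[OF s] q_bounded_integrable[OF s] by (subst ift_conv) (auto simp: bounded_integrable_def)
  also have "\<dots> = (gamma0 *v dirac_source (\<phi> s) (\<psi> s) x) $ k"
    unfolding gamma0_mult dirac_source_def by (simp add: \<psi>_def \<phi>_ift mult.commute)
  finally show "(gamma0 *v dirac_source (\<phi> s) (\<psi> s) x) $ k = ift (\<lambda>\<xi>. spinor_sign k * conv (p k s) (q s) \<xi> / (2 * of_real pi)) x" ..
qed

text \<open>The same identification for the density: conjugation becomes \<open>cnj_reflect\<close>,
  the pointwise product becomes a convolution.\<close>

lemma kg_term:
  assumes s: "s \<in> {0..T}"
  shows "kg_source (\<psi> s) = ift (N s)"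
proof
  fix x
  have i: "integrable lborel (p k s)" for k using p_bounded_integrable[OF s] by (auto simp: bounded_integrable_def)
  have i': "integrable lborel (cnj_reflect (p k s))" for k
    using bounded_integrable_reflect[OF bounded_integrable_cnj[OF p_bounded_integrable[OF s]]] by (auto simp: bounded_integrable_def cnj_reflect_def[abs_def])
  have c: "norm (conv (cnj_reflect (p k s)) (p k s) \<xi>) \<le> 16 * wmass * l * A * A * wt l \<xi>" for k \<xi>
    by (intro conv_bound(2)[OF l0] cnj_reflect_measurable p_meas cnj_reflect_bound admissible_bound[OF padm s])
  have ic: "integrable lborel (\<lambda>\<xi>. exp (\<i> * of_real (x * \<xi>)) * (spinor_sign k * conv (cnj_reflect (p k s)) (p k s) \<xi>))" for k
  proof (rule bound_integrable)
    show "(\<lambda>\<xi>. exp (\<i> * of_real (x * \<xi>)) * (spinor_sign k * conv (cnj_reflect (p k s)) (p k s) \<xi>)) \<in> borel_measurable borel"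
      using conv_measurable[OF cnj_reflect_measurable[OF p_meas] p_meas] by measurable
    show "integrable lborel (\<lambda>\<xi>. 16 * wmass * l * A * A * wt l \<xi>)" by (intro integrable_mult_right wt_integrable l0)
    show "norm (exp (\<i> * of_real (x * \<xi>)) * (spinor_sign k * conv (cnj_reflect (p k s)) (p k s) \<xi>)) \<le> 16 * wmass * l * A * A * wt l \<xi>" for \<xi>
      using c[of k \<xi>] by (simp add: norm_mult)
  qed
  have "ift (N s) x = (LINT \<xi>|lborel. (exp (\<i> * of_real (x * \<xi>)) * (spinor_sign 1 * conv (cnj_reflect (p 1 s)) (p 1 s) \<xi>) + exp (\<i> * of_real (x * \<xi>)) * (spinor_sign 2 * conv (cnj_reflect (p 2 s)) (p 2 s) \<xi>)) / (2 * of_real pi)) / (2 * of_real pi)"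
    unfolding ift_def scalar_density_def sum_2 by (simp add: distrib_left)
  also have "\<dots> = ((LINT \<xi>|lborel. exp (\<i> * of_real (x * \<xi>)) * (spinor_sign 1 * conv (cnj_reflect (p 1 s)) (p 1 s) \<xi>)) + (LINT \<xi>|lborel. exp (\<i> * of_real (x * \<xi>)) * (spinor_sign 2 * conv (cnj_reflect (p 2 s)) (p 2 s) \<xi>))) / (2 * of_real pi) / (2 * of_real pi)"
    unfolding integral_divide_zero Bochner_Integration.integral_add[OF ic ic] ..
  also have "\<dots> = (spinor_sign 1 * ift (conv (cnj_reflect (p 1 s)) (p 1 s)) x + spinor_sign 2 * ift (conv (cnj_reflect (p 2 s)) (p 2 s)) x) / (2 * of_real pi)"
  proof -
    have "(LINT \<xi>|lborel. exp (\<i> * of_real (x * \<xi>)) * (spinor_sign k * conv (cnj_reflect (p k s)) (p k s) \<xi>)) = spinor_sign k * (LINT \<xi>|lborel. exp (\<i> * of_real (x * \<xi>)) * conv (cnj_reflect (p k s)) (p k s) \<xi>)" for k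
      unfolding mult.left_commute[of _ "spinor_sign k"] integral_mult_right_zero ..
    then show ?thesis unfolding ift_def by (simp add: add_divide_distrib)
  qed
  also have "\<dots> = spinor_sign 1 * (cnj (ift (p 1 s) x) * ift (p 1 s) x) + spinor_sign 2 * (cnj (ift (p 2 s) x) * ift (p 2 s) x)"
    unfolding ift_conv[OF i' i] ift_cnj_reflect by (simp add: add_divide_distrib)
  also have "\<dots> = kg_source (\<psi> s) x"
    unfolding kg_source_def sum_2 gamma0_mult by (simp add: \<psi>_def mult_ac)
  finally show "kg_source (\<psi> s) x = ift (N s) x" ..
qed

lemma dist_of2_psi: "dist_of2 (\<psi> t) $ j = dist_of (ift (p j t))"
  by (simp add: dist_of2_def \<psi>_def)

lemma dist\<phi>: "dist_of (\<lambda>x. of_real (\<phi> t x)) = dist_of (ift (q t))"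
  by (simp add: \<phi>_ift)

lemma dirac_integrand_eq:
  assumes t: "t \<in> {0..T}" and s: "s \<in> {0..t}" and f: "schwartz f"
  shows "dirac_integrand m \<psi> \<phi> t j f s = (LINT \<xi>|lborel. feedback p j t \<xi> s * f \<xi>)"
proof -
  have s': "s \<in> {0..T}" using t s by auto
  have b: "dist_fourier (dist_of (\<lambda>x. (gamma0 *v dirac_source (\<phi> s) (\<psi> s) x) $ k)) (\<lambda>\<xi>. dirac_prop m (t - s) \<xi> $ j $ k * f \<xi>)
    = (LINT \<xi>|lborel. (spinor_sign k * conv (p k s) (q s) \<xi> / (2 * of_real pi)) * (dirac_prop m (t - s) \<xi> $ j $ k * f \<xi>))" for k
    unfolding dirac_term[OF s']
    by (rule dist_fourier_ift[OF conv_pq_bounded_integrable[OF s'] test_multiplier[OF f dirac_isCont dirac_prop_bound]])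
  have i: "integrable lborel (\<lambda>\<xi>. (spinor_sign k * conv (p k s) (q s) \<xi> / (2 * of_real pi)) * (dirac_prop m (t - s) \<xi> $ j $ k * f \<xi>))" for k
    using test_multiplier(1)[OF f dirac_isCont dirac_prop_bound] by (intro bounded_integrable_mult_integrable[OF conv_pq_bounded_integrable[OF s']]) (auto simp: bounded_integrable_def)
  show ?thesis unfolding dirac_integrand_def b sum_2 feedback_def
    by (subst Bochner_Integration.integral_add[OF i i, symmetric], intro Bochner_Integration.integral_cong refl) (simp add: algebra_simps)
qed

text \<open>The fixed-point equation multiplied by \<open>f\<close> and integrated over frequency.
  Parseval's identity turns each pairing of the Duhamel formula into such an integral, and
  \<open>Fubini_time\<close> exchanges it with the time integral.\<close>

lemma dirac_duhamel: "dirac_duhamel m T \<psi> \<phi>"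
  unfolding dirac_duhamel_def
proof (intro ballI allI impI)
  fix t j f assume t: "t \<in> {0..T}" and f: "schwartz f"
  have fi: "integrable lborel f" using schwartz_bounded_integrable[OF f] by (simp add: bounded_integrable_def)
  have Dm: "(\<lambda>(\<xi>, s). feedback p j t \<xi> s) \<in> borel_measurable (borel \<Otimes>\<^sub>M borel)"
    unfolding case_prod_beta' by (rule feedback_measurable[OF pm]) measurable
  have Db: "norm (feedback p j t \<xi> s) \<le> A * K1" if "s \<in> {0..t}" for s \<xi>
  proof -
    have "norm (feedback p j t \<xi> s) \<le> A * K1 * wt l \<xi>" by (rule feedback_bound[OF padm]) (use that t in auto)
    also have "\<dots> \<le> A * K1 * 1" using A_nonneg K1_nonneg by (intro mult_left_mono wt_le_1) auto
    finally show ?thesis by simp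
  qed
  have K: "0 \<le> A * K1" using A_nonneg K1_nonneg by simp
  note F = Fubini_time[OF Dm Db K fi]
  have eq: "set_integrable lborel {0..t} (dirac_integrand m \<psi> \<phi> t j f) \<longleftrightarrow> set_integrable lborel {0..t} (\<lambda>s. LINT \<xi>|lborel. feedback p j t \<xi> s * f \<xi>)"
    by (rule set_integrable_cong) (simp_all add: dirac_integrand_eq[OF t _ f])
  have eq2: "(LINT s:{0..t}|lborel. dirac_integrand m \<psi> \<phi> t j f s) = (LINT \<xi>|lborel. (LINT s:{0..t}|lborel. feedback p j t \<xi> s) * f \<xi>)"
  proof (rule trans[OF _ F(2)])
    show "(LINT s:{0..t}|lborel. dirac_integrand m \<psi> \<phi> t j f s) = (LINT s:{0..t}|lborel. (LINT \<xi>|lborel. feedback p j t \<xi> s * f \<xi>))"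
      by (rule set_lebesgue_integral_cong) (simp_all add: dirac_integrand_eq[OF t _ f])
  qed
  have lhs: "dist_fourier (dist_of2 (\<psi> t) $ j) f = (LINT \<xi>|lborel. p j t \<xi> * f \<xi>)"
    unfolding dist_of2_psi by (rule dist_fourier_ift[OF p_bounded_integrable[OF t] schwartz_bounded_integrable[OF f] schwartz_isCont[OF f]])
  have b: "dist_fourier (dist_of2 (\<psi> 0) $ k) (\<lambda>\<xi>. dirac_prop m t \<xi> $ j $ k * f \<xi>) = (LINT \<xi>|lborel. p k 0 \<xi> * (dirac_prop m t \<xi> $ j $ k * f \<xi>))" for k
    unfolding dist_of2_psi by (rule dist_fourier_ift[OF p_bounded_integrable[OF zero_T] test_multiplier[OF f dirac_isCont dirac_prop_bound]])
  have i: "integrable lborel (\<lambda>\<xi>. p k 0 \<xi> * (dirac_prop m t \<xi> $ j $ k * f \<xi>))" for k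
    using test_multiplier(1)[OF f dirac_isCont dirac_prop_bound] by (intro bounded_integrable_mult_integrable[OF p_bounded_integrable[OF zero_T]]) (auto simp: bounded_integrable_def)
  have s1: "(\<Sum>k\<in>UNIV. dist_fourier (dist_of2 (\<psi> 0) $ k) (\<lambda>\<xi>. dirac_prop m t \<xi> $ j $ k * f \<xi>)) = (LINT \<xi>|lborel. free_spinor j t \<xi> * f \<xi>)"
    unfolding b sum_2 free_spinor_def
    by (subst Bochner_Integration.integral_add[OF i i, symmetric], intro Bochner_Integration.integral_cong refl) (simp add: initial algebra_simps)
  have pl: "bounded_integrable (free_spinor j t)"
  proof (rule bounded_integrable_of_decay)
    show "free_spinor j t \<in> borel_measurable borel" by measurable
    show "norm (free_spinor j t \<xi>) \<le> (4 * A0 * l ^ 4) * e2 \<xi>" for \<xi>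
      by (rule order_trans[OF free_spinor_bound wtE']) (use A0_nonneg in simp)
  qed
  have ip: "integrable lborel (\<lambda>\<xi>. free_spinor j t \<xi> * f \<xi>)" by (rule bounded_integrable_mult_integrable[OF pl fi])
  have ipp: "integrable lborel (\<lambda>\<xi>. p j t \<xi> * f \<xi>)" by (rule bounded_integrable_mult_integrable[OF p_bounded_integrable[OF t] fi])
  have D: "\<i> * ((LINT s:{0..t}|lborel. feedback p j t \<xi> s) * f \<xi>) = free_spinor j t \<xi> * f \<xi> - p j t \<xi> * f \<xi>" for \<xi>
    unfolding pG[OF t] G_def by (simp add: algebra_simps)
  have "\<i> * (LINT \<xi>|lborel. (LINT s:{0..t}|lborel. feedback p j t \<xi> s) * f \<xi>) = (LINT \<xi>|lborel. free_spinor j t \<xi> * f \<xi>) - (LINT \<xi>|lborel. p j t \<xi> * f \<xi>)"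
    unfolding integral_mult_right_zero[symmetric] D by (rule Bochner_Integration.integral_diff[OF ip ipp])
  then show "set_integrable lborel {0..t} (dirac_integrand m \<psi> \<phi> t j f) \<and>
    dist_fourier (dist_of2 (\<psi> t) $ j) f =
    (\<Sum>k\<in>UNIV. dist_fourier (dist_of2 (\<psi> 0) $ k) (\<lambda>\<xi>. dirac_prop m t \<xi> $ j $ k * f \<xi>))
    - \<i> * (LINT s:{0..t}|lborel. dirac_integrand m \<psi> \<phi> t j f s)"
    unfolding eq eq2 lhs s1 using F(1) by simp
qed

lemma kg_integrand_eq:
  assumes t: "t \<in> {0..T}" and s: "s \<in> {0..t}" and f: "schwartz f"
  shows "kg_integrand M \<psi> t f s = (LINT \<xi>|lborel. (of_real (kg_sin M (t - s) \<xi>) * N s \<xi>) * f \<xi>)"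
proof -
  have s': "s \<in> {0..T}" using t s by auto
  have c: "isCont (\<lambda>\<xi>. complex_of_real (kg_sin M (t - s) \<xi>)) \<xi>" for \<xi>
    by (intro continuous_intros kg_isCont)
  have "norm (complex_of_real (kg_sin M (t - s) \<xi>)) \<le> \<bar>t - s\<bar>" for \<xi> using kg_sin_bound by simp
  note tm = test_multiplier[OF f c this]
  show ?thesis unfolding kg_integrand_def kg_term[OF s'] dist_fourier_ift[OF N_bounded_integrable[OF s'] tm]
    by (intro Bochner_Integration.integral_cong refl) (simp add: mult_ac)
qed

text \<open>Here the defining formula of \<open>Q\<close> plays the part of the fixed-point
  equation.\<close>

lemma kg_duhamel: "kg_duhamel M T \<psi> \<phi> \<phi>t"
  unfolding kg_duhamel_def
proof (intro ballI allI impI)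
  fix t f assume t: "t \<in> {0..T}" and f: "schwartz f"
  have fi: "integrable lborel f" using schwartz_bounded_integrable[OF f] by (simp add: bounded_integrable_def)
  let ?D = "\<lambda>\<xi> s. of_real (kg_sin M (t - s) \<xi>) * N s \<xi>"
  have Dm: "(\<lambda>(\<xi>, s). ?D \<xi> s) \<in> borel_measurable (borel \<Otimes>\<^sub>M borel)"
  proof -
    have [measurable]: "(\<lambda>z. N (snd z) (fst z)) \<in> borel_measurable (borel \<Otimes>\<^sub>M borel)"
      by (rule scalar_density_measurable[OF pm pm]) measurable
    show ?thesis unfolding case_prod_beta' by measurable
  qed
  have Db: "norm (?D \<xi> s) \<le> \<kappa> * A * A" if "s \<in> {0..t}" for s \<xi>
  proof -
    have "norm (?D \<xi> s) \<le> \<kappa> * A * A * wt l \<xi>" by (rule kg_src_bound[OF padm padm t that])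
    also have "\<dots> \<le> \<kappa> * A * A * 1" using A_nonneg kappa_nonneg by (intro mult_left_mono wt_le_1) auto
    finally show ?thesis by simp
  qed
  have K: "0 \<le> \<kappa> * A * A" using A_nonneg kappa_nonneg by simp
  note F = Fubini_time[OF Dm Db K fi]
  have eq: "set_integrable lborel {0..t} (kg_integrand M \<psi> t f) \<longleftrightarrow> set_integrable lborel {0..t} (\<lambda>s. LINT \<xi>|lborel. ?D \<xi> s * f \<xi>)"
    by (rule set_integrable_cong) (simp_all add: kg_integrand_eq[OF t _ f])
  have eq2: "(LINT s:{0..t}|lborel. kg_integrand M \<psi> t f s) = (LINT \<xi>|lborel. (LINT s:{0..t}|lborel. ?D \<xi> s) * f \<xi>)"
  proof (rule trans[OF _ F(2)])
    show "(LINT s:{0..t}|lborel. kg_integrand M \<psi> t f s) = (LINT s:{0..t}|lborel. (LINT \<xi>|lborel. ?D \<xi> s * f \<xi>))"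
      by (rule set_lebesgue_integral_cong) (simp_all add: kg_integrand_eq[OF t _ f])
  qed
  have lhs: "dist_fourier (dist_of (\<lambda>x. of_real (\<phi> t x))) f = (LINT \<xi>|lborel. q t \<xi> * f \<xi>)"
    unfolding dist\<phi> by (rule dist_fourier_ift[OF q_bounded_integrable[OF t] schwartz_bounded_integrable[OF f] schwartz_isCont[OF f]])
  have c: "isCont (\<lambda>\<xi>. complex_of_real (kg_sin M t \<xi>)) \<xi>" "isCont (\<lambda>\<xi>. complex_of_real (kg_cos M t \<xi>)) \<xi>" for \<xi>
    by (intro continuous_intros kg_isCont)+
  have b: "norm (complex_of_real (kg_sin M t \<xi>)) \<le> \<bar>t\<bar>" "norm (complex_of_real (kg_cos M t \<xi>)) \<le> 1" for \<xi>
    using kg_sin_bound kg_cos_bound by simp_all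
  note tm1 = test_multiplier[OF f c(1) b(1)] and tm2 = test_multiplier[OF f c(2) b(2)]
  have 1: "dist_fourier (dist_of (\<lambda>x. of_real (\<phi> 0 x))) (\<lambda>\<xi>. of_real (kg_cos M t \<xi>) * f \<xi>) = (LINT \<xi>|lborel. q 0 \<xi> * (of_real (kg_cos M t \<xi>) * f \<xi>))"
    unfolding dist\<phi> by (rule dist_fourier_ift[OF q_bounded_integrable[OF zero_T] tm2])
  have 2: "dist_fourier (\<phi>t 0) (\<lambda>\<xi>. of_real (kg_sin M t \<xi>) * f \<xi>) = (LINT \<xi>|lborel. qt 0 \<xi> * (of_real (kg_sin M t \<xi>) * f \<xi>))"
    unfolding \<phi>t_def by (rule dist_fourier_ift[OF qt_bounded_integrable[OF zero_T] tm1])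
  have i1: "integrable lborel (\<lambda>\<xi>. q 0 \<xi> * (of_real (kg_cos M t \<xi>) * f \<xi>))"
    using tm2(1) by (intro bounded_integrable_mult_integrable[OF q_bounded_integrable[OF zero_T]]) (simp add: bounded_integrable_def)
  have i2: "integrable lborel (\<lambda>\<xi>. qt 0 \<xi> * (of_real (kg_sin M t \<xi>) * f \<xi>))"
    using tm1(1) by (intro bounded_integrable_mult_integrable[OF qt_bounded_integrable[OF zero_T]]) (simp add: bounded_integrable_def)
  have i3: "integrable lborel (\<lambda>\<xi>. q t \<xi> * f \<xi>)" by (rule bounded_integrable_mult_integrable[OF q_bounded_integrable[OF t] fi])
  have D: "(LINT s:{0..t}|lborel. ?D \<xi> s) * f \<xi> = q t \<xi> * f \<xi> - (q 0 \<xi> * (of_real (kg_cos M t \<xi>) * f \<xi>) + qt 0 \<xi> * (of_real (kg_sin M t \<xi>) * f \<xi>))" for \<xi>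
    unfolding initial unfolding Q_def kg_response_def free_field_def by (simp add: algebra_simps)
  have "(LINT \<xi>|lborel. (LINT s:{0..t}|lborel. ?D \<xi> s) * f \<xi>) = (LINT \<xi>|lborel. q t \<xi> * f \<xi>) - ((LINT \<xi>|lborel. q 0 \<xi> * (of_real (kg_cos M t \<xi>) * f \<xi>)) + (LINT \<xi>|lborel. qt 0 \<xi> * (of_real (kg_sin M t \<xi>) * f \<xi>)))"
    unfolding D Bochner_Integration.integral_add[OF i1 i2, symmetric] by (rule Bochner_Integration.integral_diff[OF i3 Bochner_Integration.integrable_add[OF i1 i2]])
  then show "set_integrable lborel {0..t} (kg_integrand M \<psi> t f) \<and>
     dist_fourier (dist_of (\<lambda>x. of_real (\<phi> t x))) f =
     dist_fourier (dist_of (\<lambda>x. of_real (\<phi> 0 x))) (\<lambda>\<xi>. of_real (kg_cos M t \<xi>) * f \<xi>) +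
     dist_fourier (\<phi>t 0) (\<lambda>\<xi>. of_real (kg_sin M t \<xi>) * f \<xi>) +
     (LINT s:{0..t}|lborel. kg_integrand M \<psi> t f s)"
    unfolding eq eq2 lhs 1 2 using F(1) by simp
qed

end

section \<open>Continuity in the Sobolev norms and the solution property\<close>

lemma squeeze_zero:
  fixes f :: "real \<Rightarrow> real"
  assumes f: "\<And>t. t \<in> S \<Longrightarrow> t \<noteq> u \<Longrightarrow> f t \<le> K * \<bar>t - u\<bar>" and nn: "\<And>t. 0 \<le> f t"
  shows "(f \<longlongrightarrow> 0) (at u within S)"
proof (rule tendsto_sandwich)
  show "\<forall>\<^sub>F t in at u within S. 0 \<le> f t" using nn by simp
  show "\<forall>\<^sub>F t in at u within S. f t \<le> K * \<bar>t - u\<bar>"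
    unfolding eventually_at_filter using f by simp
  have "((\<lambda>t. K * \<bar>t - u\<bar>) \<longlongrightarrow> K * \<bar>u - u\<bar>) (at u within S)"
    by (intro tendsto_intros)
  then show "((\<lambda>t. K * \<bar>t - u\<bar>) \<longlongrightarrow> 0) (at u within S)" by simp
qed simp

lemma Hs_norm_ift_diff:
  assumes s: "\<bar>s\<bar> \<le> 1/2" and m: "h \<in> borel_measurable borel" "k \<in> borel_measurable borel"
    and h: "\<And>\<xi>. norm (h \<xi>) \<le> C * (1 / (1 + \<xi>\<^sup>2))" and k: "\<And>\<xi>. norm (k \<xi>) \<le> C' * (1 / (1 + \<xi>\<^sup>2))"
    and d: "\<And>\<xi>. norm (h \<xi> - k \<xi>) \<le> D * (1 / (1 + \<xi>\<^sup>2))"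
  shows "Hs_norm s (dist_diff (dist_of (ift h)) (dist_of (ift k))) \<le> D * decay_mass"
  by (rule Hs_norm_decay[OF s Hs_transform_diff[OF s Hs_transform_ift(1)[OF s m(1) h] Hs_transform_ift(1)[OF s m(2) k]] d])

lemma half_bounds: "\<bar>1/2 :: real\<bar> \<le> 1/2" "\<bar>- 1/2 :: real\<bar> \<le> 1/2" by simp_all

context dkg_sol
begin

lemma p_transform: "t \<in> {0..T} \<Longrightarrow> \<bar>s\<bar> \<le> 1/2 \<Longrightarrow> Hs_transform s (dist_of2 (\<psi> t) $ j) (p j t)"
  unfolding dist_of2_psi by (rule Hs_transform_ift(1)[OF _ p_meas p_decay])

lemma q_transform: "t \<in> {0..T} \<Longrightarrow> \<bar>s\<bar> \<le> 1/2 \<Longrightarrow> Hs_transform s (dist_of (\<lambda>x. of_real (\<phi> t x))) (q t)"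
  unfolding dist\<phi> by (rule Hs_transform_ift(1)[OF _ q_meas q_decay])

lemma qt_transform: "t \<in> {0..T} \<Longrightarrow> \<bar>s\<bar> \<le> 1/2 \<Longrightarrow> Hs_transform s (\<phi>t t) (qt t)"
  unfolding \<phi>t_def by (rule Hs_transform_ift(1)[OF _ qt_meas qt_decay])

text \<open>In each case the difference of transforms is bounded by a multiple of
  \<open>\<bar>t - u\<bar> * e2 \<xi>\<close>, and such a bound controls the Sobolev norm. For the
  difference quotient this is \<open>q_taylor\<close> divided by \<open>t - u\<close>.\<close>

lemma limits:
  assumes u: "u \<in> {0..T}"
  shows "((\<lambda>t. Hs_norm2 (- 1/2) (dist_diff2 (dist_of2 (\<psi> t)) (dist_of2 (\<psi> u)))) \<longlongrightarrow> 0) (at u within {0..T})"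
    and "((\<lambda>t. Hs_norm (1/2) (dist_diff (dist_of (\<lambda>x. of_real (\<phi> t x))) (dist_of (\<lambda>x. of_real (\<phi> u x))))) \<longlongrightarrow> 0) (at u within {0..T})"
    and "((\<lambda>t. Hs_norm (- 1/2) (dist_diff (\<phi>t t) (\<phi>t u))) \<longlongrightarrow> 0) (at u within {0..T})"
    and "((\<lambda>t. Hs_norm (- 1/2) (dist_diff (dist_scale (of_real (1 / (t - u)))
                 (dist_diff (dist_of (\<lambda>x. of_real (\<phi> t x))) (dist_of (\<lambda>x. of_real (\<phi> u x))))) (\<phi>t u))) \<longlongrightarrow> 0) (at u within {0..T})"
proof -
  have "((\<lambda>t. Hs_norm (- 1/2) (dist_diff (dist_of2 (\<psi> t) $ j) (dist_of2 (\<psi> u) $ j))) \<longlongrightarrow> 0) (at u within {0..T})" for j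
  proof -
    obtain C where C: "\<And>t u \<xi>. t \<in> {0..T} \<Longrightarrow> u \<in> {0..T} \<Longrightarrow> norm (p j t \<xi> - p j u \<xi>) \<le> C * \<bar>t - u\<bar> * e2 \<xi>"
      using p_lip[of j] by blast
    show ?thesis
    proof (rule squeeze_zero[where K = "C * decay_mass"])
      fix t assume t: "t \<in> {0..T}"
      show "Hs_norm (- 1/2) (dist_diff (dist_of2 (\<psi> t) $ j) (dist_of2 (\<psi> u) $ j)) \<le> C * decay_mass * \<bar>t - u\<bar>"
        using Hs_norm_ift_diff[OF half_bounds(2) p_meas p_meas p_decay[OF t] p_decay[OF u] C[OF t u]]
        unfolding dist_of2_psi by (simp add: mult_ac)
    qed (rule Hs_norm_nonneg)
  qed
  then have "((\<lambda>t. sqrt (\<Sum>j\<in>(UNIV :: 2 set). (Hs_norm (- 1/2) (dist_diff (dist_of2 (\<psi> t) $ j) (dist_of2 (\<psi> u) $ j)))\<^sup>2)) \<longlongrightarrow> sqrt (\<Sum>j\<in>(UNIV :: 2 set). 0\<^sup>2)) (at u within {0..T})"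
    by (intro tendsto_real_sqrt tendsto_sum tendsto_power)
  then show "((\<lambda>t. Hs_norm2 (- 1/2) (dist_diff2 (dist_of2 (\<psi> t)) (dist_of2 (\<psi> u)))) \<longlongrightarrow> 0) (at u within {0..T})"
    unfolding Hs_norm2_def dist_diff2_def by simp
  show "((\<lambda>t. Hs_norm (1/2) (dist_diff (dist_of (\<lambda>x. of_real (\<phi> t x))) (dist_of (\<lambda>x. of_real (\<phi> u x))))) \<longlongrightarrow> 0) (at u within {0..T})"
  proof (rule squeeze_zero[where K = "CC * decay_mass"])
    fix t assume t: "t \<in> {0..T}"
    show "Hs_norm (1/2) (dist_diff (dist_of (\<lambda>x. of_real (\<phi> t x))) (dist_of (\<lambda>x. of_real (\<phi> u x)))) \<le> CC * decay_mass * \<bar>t - u\<bar>"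
      using Hs_norm_ift_diff[OF half_bounds(1) q_meas q_meas q_decay[OF t] q_decay[OF u] q_lip[OF t u]]
      unfolding dist\<phi> by (simp add: mult_ac)
  qed (rule Hs_norm_nonneg)
  show "((\<lambda>t. Hs_norm (- 1/2) (dist_diff (\<phi>t t) (\<phi>t u))) \<longlongrightarrow> 0) (at u within {0..T})"
  proof (rule squeeze_zero[where K = "CC * decay_mass"])
    fix t assume t: "t \<in> {0..T}"
    show "Hs_norm (- 1/2) (dist_diff (\<phi>t t) (\<phi>t u)) \<le> CC * decay_mass * \<bar>t - u\<bar>"
      using Hs_norm_ift_diff[OF half_bounds(2) qt_meas qt_meas qt_decay[OF t] qt_decay[OF u] qt_lip[OF t u]]
      unfolding \<phi>t_def by (simp add: mult_ac)
  qed (rule Hs_norm_nonneg)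
  show "((\<lambda>t. Hs_norm (- 1/2) (dist_diff (dist_scale (of_real (1 / (t - u)))
                 (dist_diff (dist_of (\<lambda>x. of_real (\<phi> t x))) (dist_of (\<lambda>x. of_real (\<phi> u x))))) (\<phi>t u))) \<longlongrightarrow> 0) (at u within {0..T})"
  proof (rule squeeze_zero[where K = "CC * decay_mass"])
    fix t assume t: "t \<in> {0..T}" and ne: "t \<noteq> u"
    have tr: "Hs_transform (- 1/2) (dist_diff (dist_scale (of_real (1 / (t - u)))
                 (dist_diff (dist_of (\<lambda>x. of_real (\<phi> t x))) (dist_of (\<lambda>x. of_real (\<phi> u x))))) (\<phi>t u))
        (\<lambda>\<xi>. of_real (1 / (t - u)) * (q t \<xi> - q u \<xi>) - qt u \<xi>)"
      by (intro Hs_transform_diff[OF half_bounds(2)] Hs_transform_scale q_transform qt_transform t u half_bounds(2))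
    have b: "norm (of_real (1 / (t - u)) * (q t \<xi> - q u \<xi>) - qt u \<xi>) \<le> (CC * \<bar>t - u\<bar>) * (1 / (1 + \<xi>\<^sup>2))" for \<xi>
    proof -
      have ne': "complex_of_real (t - u) \<noteq> 0" using ne by (simp only: of_real_eq_0_iff)
      have "of_real (1 / (t - u)) * (q t \<xi> - q u \<xi>) - qt u \<xi> = of_real (1 / (t - u)) * (q t \<xi> - q u \<xi> - of_real (t - u) * qt u \<xi>)"
        using ne' by (simp only: of_real_divide of_real_1) (simp add: field_simps)
      then have "norm (of_real (1 / (t - u)) * (q t \<xi> - q u \<xi>) - qt u \<xi>) = \<bar>1 / (t - u)\<bar> * norm (q t \<xi> - q u \<xi> - of_real (t - u) * qt u \<xi>)"
        by (simp only: norm_mult norm_of_real)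
      also have "\<dots> \<le> \<bar>1 / (t - u)\<bar> * (CC * \<bar>t - u\<bar>\<^sup>2 * e2 \<xi>)"
        by (intro mult_left_mono q_taylor t u) simp
      also have "\<dots> = (CC * \<bar>t - u\<bar>) * (1 / (1 + \<xi>\<^sup>2))"
      proof -
        define D where "D = \<bar>t - u\<bar>"
        have D: "D \<noteq> 0" "\<bar>1 / (t - u)\<bar> = 1 / D" using ne by (auto simp: D_def abs_divide)
        show ?thesis unfolding D(2) D_def[symmetric] using D(1) by (simp add: power2_eq_square)
      qed
      finally show ?thesis .
    qed
    show "Hs_norm (- 1/2) (dist_diff (dist_scale (of_real (1 / (t - u)))
                 (dist_diff (dist_of (\<lambda>x. of_real (\<phi> t x))) (dist_of (\<lambda>x. of_real (\<phi> u x))))) (\<phi>t u)) \<le> CC * decay_mass * \<bar>t - u\<bar>"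
      using Hs_norm_decay[OF half_bounds(2) tr b] by (simp add: mult_ac)
  qed (rule Hs_norm_nonneg)
qed

text \<open>The transforms are integrable, so \<open>\<phi>\<close> and \<open>\<psi>\<close> are
  bounded functions, and so are their products.\<close>

lemma regularity:
  assumes t: "t \<in> {0..T}"
  shows "tempered_fun (\<lambda>x. of_real (\<phi> t x))" "tempered_fun (\<lambda>x. \<psi> t x $ j)"
    "tempered_fun (\<lambda>x. dirac_source (\<phi> t) (\<psi> t) x $ j)" "tempered_fun (\<lambda>x. of_real ((norm (\<psi> t x))\<^sup>2))"
    "in_Hs2 (- 1/2) (dist_of2 (\<psi> t))" "in_Hs (1/2) (dist_of (\<lambda>x. of_real (\<phi> t x)))" "in_Hs (- 1/2) (\<phi>t t)"
proof -
  have fq: "(\<lambda>x. complex_of_real (\<phi> t x)) = ift (q t)" by (simp add: \<phi>_ift fun_eq_iff)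
  have fp: "(\<lambda>x. \<psi> t x $ j) = ift (p j t)" for j by (simp add: \<psi>_def fun_eq_iff)
  show "tempered_fun (\<lambda>x. of_real (\<phi> t x))"
    unfolding fq by (rule Hs_transform_ift(3)[OF half_bounds(1) q_meas q_decay[OF t]])
  show "tempered_fun (\<lambda>x. \<psi> t x $ j)"
    unfolding fp by (rule Hs_transform_ift(3)[OF half_bounds(1) p_meas p_decay[OF t]])
  have pm': "ift (p j t) \<in> borel_measurable borel" for j by (rule fourier_measurable(2)[OF p_meas])
  have qm': "ift (q t) \<in> borel_measurable borel" by (rule fourier_measurable(2)[OF q_meas])
  obtain Bq where Bq: "\<And>x. norm (ift (q t) x) \<le> Bq" using ift_bounded[OF q_bounded_integrable[OF t]] by blast
  have "\<forall>j. \<exists>B. \<forall>x. norm (ift (p j t) x) \<le> B" using ift_bounded[OF p_bounded_integrable[OF t]] by blast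
  then obtain Bp where Bp: "\<And>j x. norm (ift (p j t) x) \<le> Bp j" by metis
  have Bq0: "Bq \<ge> 0" using order_trans[OF norm_ge_zero Bq] .
  have ds: "(\<lambda>x. dirac_source (\<phi> t) (\<psi> t) x $ j) = (\<lambda>x. ift (q t) x * ift (p j t) x)"
    by (simp add: dirac_source_def \<phi>_ift \<psi>_def fun_eq_iff)
  show "tempered_fun (\<lambda>x. dirac_source (\<phi> t) (\<psi> t) x $ j)"
    unfolding ds
  proof (rule tempered_fun_bounded)
    show "(\<lambda>x. ift (q t) x * ift (p j t) x) \<in> borel_measurable borel" by (rule borel_measurable_times[OF qm' pm'])
    show "norm (ift (q t) x * ift (p j t) x) \<le> Bq * Bp j" for x
      unfolding norm_mult by (intro mult_mono Bq Bp Bq0) simp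
  qed
  have ns: "complex_of_real ((norm (\<psi> t x))\<^sup>2) = of_real ((norm (ift (p 1 t) x))\<^sup>2 + (norm (ift (p 2 t) x))\<^sup>2)" for x
    by (simp add: norm_vec_def L2_set_def sum_2 \<psi>_def)
  show "tempered_fun (\<lambda>x. of_real ((norm (\<psi> t x))\<^sup>2))"
    unfolding ns
  proof (rule tempered_fun_bounded)
    show "(\<lambda>x. complex_of_real ((norm (ift (p 1 t) x))\<^sup>2 + (norm (ift (p 2 t) x))\<^sup>2)) \<in> borel_measurable borel"
      using pm'[of 1] pm'[of 2] by measurable
    show "norm (complex_of_real ((norm (ift (p 1 t) x))\<^sup>2 + (norm (ift (p 2 t) x))\<^sup>2)) \<le> (Bp 1)\<^sup>2 + (Bp 2)\<^sup>2" for x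
      unfolding norm_of_real using Bp by (subst abs_of_nonneg) (auto intro!: add_mono power_mono)
  qed
  show "in_Hs2 (- 1/2) (dist_of2 (\<psi> t))"
    unfolding in_Hs2_def dist_of2_psi using Hs_transform_ift(2)[OF half_bounds(2) p_meas p_decay[OF t]] by simp
  show "in_Hs (1/2) (dist_of (\<lambda>x. of_real (\<phi> t x)))"
    unfolding fq by (rule Hs_transform_ift(2)[OF half_bounds(1) q_meas q_decay[OF t]])
  show "in_Hs (- 1/2) (\<phi>t t)"
    unfolding \<phi>t_def by (rule Hs_transform_ift(2)[OF half_bounds(2) qt_meas qt_decay[OF t]])
qed

lemma solution: "dkg_solution m M T \<psi> \<phi> \<phi>t"
  unfolding dkg_solution_def
  by (intro conjI ballI allI regularity limits dirac_duhamel kg_duhamel)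

end

section \<open>Expansion of the field for concentrated data\<close>

lemma cos_sin_lip: "\<bar>cos x - cos y\<bar> \<le> \<bar>x - y\<bar>" "\<bar>sin x - sin y\<bar> \<le> \<bar>x - (y::real)\<bar>"
proof -
  have "norm (cos x - cos y) \<le> 1 * norm (x - y)"
    by (rule field_differentiable_bound[OF convex_UNIV, where f' = "\<lambda>z. - sin z"]) (auto intro!: derivative_eq_intros)
  then show "\<bar>cos x - cos y\<bar> \<le> \<bar>x - y\<bar>" by simp
  have "norm (sin x - sin y) \<le> 1 * norm (x - y)"
    by (rule field_differentiable_bound[OF convex_UNIV, where f' = "\<lambda>z. cos z"]) (auto intro!: derivative_eq_intros)
  then show "\<bar>sin x - sin y\<bar> \<le> \<bar>x - y\<bar>" by simp
qed

lemma omega_diff: "0 \<le> omega m \<xi> - \<bar>\<xi>\<bar>" "omega m \<xi> - \<bar>\<xi>\<bar> \<le> \<bar>m\<bar>"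
proof -
  show "0 \<le> omega m \<xi> - \<bar>\<xi>\<bar>" using abs_le_omega(1)[of \<xi> m] by simp
  show "omega m \<xi> - \<bar>\<xi>\<bar> \<le> \<bar>m\<bar>" unfolding omega_def using sqrt_sum_squares_le_sum_abs[of m \<xi>] by simp
qed

text \<open>The mass changes the frequency by at most \<open>\<bar>m\<bar>\<close>, hence the phase
  by at most \<open>\<bar>t\<bar> * \<bar>m\<bar>\<close>, uniformly in
  \<open>\<xi>\<close>.\<close>

lemma kg_cos_massless: "\<bar>kg_cos m t \<xi> - cos (t * \<xi>)\<bar> \<le> \<bar>t\<bar> * \<bar>m\<bar>"
proof -
  have c: "cos (t * \<xi>) = cos (t * \<bar>\<xi>\<bar>)" by (cases "\<xi> \<ge> 0") auto
  have "\<bar>kg_cos m t \<xi> - cos (t * \<xi>)\<bar> \<le> \<bar>t * omega m \<xi> - t * \<bar>\<xi>\<bar>\<bar>"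
    unfolding c kg_cos_def by (rule cos_sin_lip)
  also have "\<dots> = \<bar>t\<bar> * \<bar>omega m \<xi> - \<bar>\<xi>\<bar>\<bar>" by (simp add: abs_mult flip: right_diff_distrib)
  also have "\<dots> \<le> \<bar>t\<bar> * \<bar>m\<bar>" using omega_diff[of m \<xi>] by (intro mult_left_mono) auto
  finally show ?thesis .
qed

text \<open>Two errors of size \<open>\<bar>t\<bar> * \<bar>m\<bar>\<close>: one from replacing
  \<open>\<xi> / omega m \<xi>\<close> by 1, where the sine provides the factor
  \<open>t * omega m \<xi>\<close> against the denominator, and one from the phase.\<close>

lemma kg_sin_massless_pos:
  assumes x: "\<xi> \<ge> 0"
  shows "\<bar>kg_sin m t \<xi> * \<xi> - sin (t * \<xi>)\<bar> \<le> 2 * (\<bar>t\<bar> * \<bar>m\<bar>)"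
proof (cases "omega m \<xi> = 0")
  case True
  then have "\<xi> = 0" using abs_le_omega(1)[of \<xi> m] by simp
  then show ?thesis by simp
next
  case False
  then have w: "omega m \<xi> > 0" using omega_nonneg[of m \<xi>] by simp
  define w where "w = omega m \<xi>"
  have w0: "w > 0" "\<xi> \<le> w" "w - \<xi> \<le> \<bar>m\<bar>" unfolding w_def using w omega_diff[of m \<xi>] x by auto
  have "kg_sin m t \<xi> * \<xi> - sin (t * w) = - (sin (t * w) * ((w - \<xi>) / w))"
    using w0 False by (simp add: kg_sin_def w_def field_simps)
  then have "\<bar>kg_sin m t \<xi> * \<xi> - sin (t * w)\<bar> = \<bar>sin (t * w)\<bar> * ((w - \<xi>) / w)"
    using w0 by (simp add: abs_mult)
  also have "\<dots> \<le> \<bar>t * w\<bar> * ((w - \<xi>) / w)" using w0 by (intro mult_right_mono abs_sin_x_le_abs_x) auto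
  also have "\<dots> = \<bar>t\<bar> * (w - \<xi>)" using w0 by (simp add: abs_mult)
  also have "\<dots> \<le> \<bar>t\<bar> * \<bar>m\<bar>" using w0 by (intro mult_left_mono) auto
  finally have 1: "\<bar>kg_sin m t \<xi> * \<xi> - sin (t * w)\<bar> \<le> \<bar>t\<bar> * \<bar>m\<bar>" .
  have "\<bar>sin (t * w) - sin (t * \<xi>)\<bar> \<le> \<bar>t * w - t * \<xi>\<bar>" by (rule cos_sin_lip)
  also have "\<dots> = \<bar>t\<bar> * (w - \<xi>)" using w0 by (simp add: abs_mult flip: right_diff_distrib)
  also have "\<dots> \<le> \<bar>t\<bar> * \<bar>m\<bar>" using w0 by (intro mult_left_mono) auto
  finally show ?thesis using 1 by linarith
qed

lemma kg_sin_massless: "\<bar>kg_sin m t \<xi> * \<xi> - sin (t * \<xi>)\<bar> \<le> 2 * (\<bar>t\<bar> * \<bar>m\<bar>)"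
proof (cases "\<xi> \<ge> 0")
  case False
  have "kg_sin m t (- \<xi>) = kg_sin m t \<xi>" by (simp add: kg_sin_def omega_def)
  then have "kg_sin m t (- \<xi>) * (- \<xi>) - sin (t * (- \<xi>)) = - (kg_sin m t \<xi> * \<xi> - sin (t * \<xi>))" by simp
  then show ?thesis using kg_sin_massless_pos[of "- \<xi>" m t] False by (simp only: abs_minus_cancel)
qed (rule kg_sin_massless_pos)

text \<open>The difference vanishes at time 0 and its derivative is the error of the cosines, so
  integration in time gives a second factor \<open>t\<close> and no negative power of
  \<open>\<xi>\<close>.\<close>

lemma kg_sin_wave:
  assumes t: "t \<ge> 0" and x: "\<xi> \<noteq> 0"
  shows "\<bar>kg_sin M t \<xi> - sin (t * \<xi>) / \<xi>\<bar> \<le> \<bar>M\<bar> * t\<^sup>2"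
proof -
  have "norm ((kg_sin M t \<xi> - sin (t * \<xi>) / \<xi>) - (kg_sin M 0 \<xi> - sin (0 * \<xi>) / \<xi>)) \<le> (\<bar>M\<bar> * t) * norm (t - 0)"
  proof (rule field_differentiable_bound[where S="{0..t}" and f' = "\<lambda>s. kg_cos M s \<xi> - cos (s * \<xi>)"])
    show "((\<lambda>t. kg_sin M t \<xi> - sin (t * \<xi>) / \<xi>) has_field_derivative kg_cos M z \<xi> - cos (z * \<xi>)) (at z within {0..t})" for z
      using x by (auto intro!: derivative_eq_intros has_field_derivative_at_within[OF kg_sin_deriv])
    fix z assume z: "z \<in> {0..t}"
    have "\<bar>z\<bar> * \<bar>M\<bar> \<le> t * \<bar>M\<bar>" using z by (intro mult_right_mono) auto
    then show "norm (kg_cos M z \<xi> - cos (z * \<xi>)) \<le> \<bar>M\<bar> * t"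
      using kg_cos_massless[of M z \<xi>] by (simp add: mult.commute)
  qed (use t in auto)
  then show ?thesis using t by (simp add: kg_sin_0 power2_eq_square)
qed

text \<open>\<open>bb\<close> is the part of the data that stays fixed as \<open>l\<close> grows, \<open>U\<close> and \<open>V\<close> are the profiles of a
  left-moving and a right-moving massless wave. What matters about \<open>K4\<close> is that it does not depend
  on \<open>l\<close>.\<close>

locale dkg_inf = dkg_sol +
  fixes bb :: "2 \<Rightarrow> real \<Rightarrow> complex" and U V :: "real \<Rightarrow> complex" and lb :: "real \<Rightarrow> real"
  assumes Um[measurable]: "U \<in> borel_measurable borel" and Vm[measurable]: "V \<in> borel_measurable borel"
    and bbm[measurable]: "\<And>k. bb k \<in> borel_measurable borel"
    and p0_eq: "\<And>k \<xi>. p0 k \<xi> = bb k \<xi> + (U \<xi> + spinor_sign k * V \<xi>) / 2"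
    and bbb: "\<And>k \<xi>. norm (bb k \<xi>) \<le> lb \<xi>" and lbs: "\<And>\<xi>. lb (- \<xi>) = lb \<xi>"
    and lbi: "integrable lborel (\<lambda>\<eta>. 4 * lb \<eta> * (1 + \<eta>\<^sup>2)\<^sup>2)"
    and Ub: "\<And>\<xi>. norm (U \<xi>) \<le> A0 * wt l \<xi>" and Vb: "\<And>\<xi>. norm (V \<xi>) \<le> A0 * wt l \<xi>"
begin

text \<open>Without mass the propagator is cos (t \<xi>) plus i sin (t \<xi>) times the exchange of
  the components, with eigenvectors (1, 1) and (1, -1). Hence the sum of the components evolves as
  \<open>U\<close> times exp (i t \<xi>), and their difference as \<open>V\<close> times the
  conjugate phase.\<close>

definition wave :: spinor where
  "wave k t \<xi> = (exp (\<i> * of_real (t * \<xi>)) * U \<xi> + spinor_sign k * (exp (- (\<i> * of_real (t * \<xi>))) * V \<xi>)) / 2"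

text \<open>\<open>Ke\<close> measures the remainder, with \<open>A * K1\<close> for the
  nonlinearity and \<open>4 * \<bar>m\<bar> * A0\<close> for the Dirac mass. \<open>K3\<close> adds
  the interaction with the background to give the error of the density, and \<open>K4\<close> adds
  the error of replacing the Klein-Gordon kernel by that of the wave equation.\<close>

definition "Ke = A * K1 + 4 * \<bar>m\<bar> * A0"
definition "Lb = (LINT \<eta>|lborel. 4 * lb \<eta> * (1 + \<eta>\<^sup>2)\<^sup>2)"
definition "K3 = 2 * \<kappa> * Ke * A + 32 * A * Lb"
definition "K4 = K3 + \<bar>M\<bar> * \<kappa> * A\<^sup>2"

lemma wave_joint_meas: "joint_meas wave"
  unfolding joint_meas_def wave_def by measurable

lemma wave_bound: "norm (wave k t \<xi>) \<le> A * wt l \<xi>"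
proof -
  have "norm (exp (\<i> * of_real (t * \<xi>)) * U \<xi> + spinor_sign k * (exp (- (\<i> * of_real (t * \<xi>))) * V \<xi>)) \<le> A0 * wt l \<xi> + A0 * wt l \<xi>"
    by (rule norm_triangle_mono) (use Ub[of \<xi>] Vb[of \<xi>] norm_exp_imaginary(1)[of "t * \<xi>"] norm_exp_imaginary(2)[of "t * \<xi>"] in \<open>simp_all only: norm_mult norm_spinor_sign mult_1\<close>)
  then have "norm (wave k t \<xi>) \<le> 1 * (A0 * wt l \<xi>)" unfolding wave_def norm_divide by simp
  also have "\<dots> \<le> 8 * (A0 * wt l \<xi>)" using A0_nonneg wt_nonneg by (intro mult_right_mono) auto
  finally show ?thesis by (simp add: A_def)
qed

lemma wave_adm: "admissible A wave"
  unfolding admissible_def using wave_joint_meas wave_bound by blast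

lemma exp_cos_sin: "exp (\<i> * of_real x) = of_real (cos x) + \<i> * of_real (sin x)"
  "exp (- (\<i> * of_real x)) = of_real (cos x) - \<i> * of_real (sin x)"
proof -
  show "exp (\<i> * of_real x) = of_real (cos x) + \<i> * of_real (sin x)"
    using cis_conv_exp[of x] by (simp add: complex_eq_iff)
  have "exp (\<i> * of_real (- x)) = of_real (cos (- x)) + \<i> * of_real (sin (- x))"
    unfolding cis_conv_exp[symmetric] by (simp add: complex_eq_iff)
  then show "exp (- (\<i> * of_real x)) = of_real (cos x) - \<i> * of_real (sin x)" by simp
qed

text \<open>In the proof \<open>c\<close>, \<open>x\<close> and \<open>y\<close> are the deviations
  of the entries of the propagator from the massless ones; each is of order
  \<open>\<bar>t\<bar> * \<bar>m\<bar>\<close>.\<close>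

lemma massless:
  "norm ((\<Sum>k\<in>UNIV. dirac_prop m t \<xi> $ j $ k * ((U \<xi> + spinor_sign k * V \<xi>) / 2)) - wave j t \<xi>) \<le> 4 * \<bar>m\<bar> * A0 * \<bar>t\<bar> * wt l \<xi>"
proof -
  define c where "c = complex_of_real (kg_cos m t \<xi> - cos (t * \<xi>))"
  define x where "x = complex_of_real (kg_sin m t \<xi> * \<xi> - sin (t * \<xi>))"
  define y where "y = complex_of_real (kg_sin m t \<xi> * m)"
  define h where "h = \<bar>t\<bar> * \<bar>m\<bar>"
  have h: "h \<ge> 0" by (simp add: h_def)
  have nb: "norm c \<le> h" "norm x \<le> 2 * h" "norm y \<le> h"
  proof -
    show "norm c \<le> h" "norm x \<le> 2 * h" unfolding c_def x_def h_def norm_of_real by (rule kg_cos_massless, rule kg_sin_massless)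
    show "norm y \<le> h" unfolding y_def h_def norm_of_real abs_mult by (intro mult_right_mono kg_sin_bound) simp
  qed
  define d1 d2 where "d1 = (U \<xi> + V \<xi>) / 2" and "d2 = (U \<xi> - V \<xi>) / 2"
  define a where "a = A0 * wt l \<xi>"
  have d: "norm d1 \<le> a" "norm d2 \<le> a"
    using norm_triangle_ineq[of "U \<xi>" "V \<xi>"] norm_triangle_ineq4[of "U \<xi>" "V \<xi>"] Ub[of \<xi>] Vb[of \<xi>]
    unfolding d1_def d2_def a_def by (simp_all add: norm_divide)
  have a0: "a \<ge> 0" using order_trans[OF norm_ge_zero d(1)] .
  have e: "(\<Sum>k\<in>UNIV. dirac_prop m t \<xi> $ 1 $ k * ((U \<xi> + spinor_sign k * V \<xi>) / 2)) - wave 1 t \<xi> = (c + \<i> * y) * d1 + \<i> * x * d2"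
    "(\<Sum>k\<in>UNIV. dirac_prop m t \<xi> $ 2 $ k * ((U \<xi> + spinor_sign k * V \<xi>) / 2)) - wave 2 t \<xi> = \<i> * x * d1 + (c - \<i> * y) * d2"
    unfolding sum_2 dirac_prop_entries wave_def exp_cos_sin c_def x_def y_def d1_def d2_def spinor_sign_def
    by (simp_all add: field_simps)
  have cy: "norm (c + \<i> * y) \<le> 2 * h" "norm (c - \<i> * y) \<le> 2 * h"
    using norm_triangle_ineq[of c "\<i> * y"] norm_triangle_ineq4[of c "\<i> * y"] nb by (simp_all add: norm_mult)
  have "norm ((c + \<i> * y) * d1 + \<i> * x * d2) \<le> (2 * h) * a + (2 * h) * a"
    by (rule norm_triangle_mono; unfold norm_mult norm_ii mult_1; intro mult_mono cy nb d) (use h a0 in auto)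
  moreover have "norm (\<i> * x * d1 + (c - \<i> * y) * d2) \<le> (2 * h) * a + (2 * h) * a"
    by (rule norm_triangle_mono; unfold norm_mult norm_ii mult_1; intro mult_mono cy nb d) (use h a0 in auto)
  ultimately have "norm ((\<Sum>k\<in>UNIV. dirac_prop m t \<xi> $ j $ k * ((U \<xi> + spinor_sign k * V \<xi>) / 2)) - wave j t \<xi>) \<le> (2 * h) * a + (2 * h) * a"
    using exhaust_2[of j] e by auto
  then show ?thesis unfolding h_def a_def by (simp add: mult_ac)
qed

definition "background j t \<xi> = (\<Sum>k\<in>UNIV. dirac_prop m t \<xi> $ j $ k * bb k \<xi>)"

lemma background_bound: "norm (background j t \<xi>) \<le> 4 * lb \<xi>"
proof -
  have "norm (background j t \<xi>) \<le> (\<Sum>k\<in>(UNIV :: 2 set). 2 * lb \<xi>)"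
    unfolding background_def by (rule sum_norm_le) (unfold norm_mult, intro mult_mono dirac_prop_bound bbb, auto)
  then show ?thesis by simp
qed

lemma background_meas: "background j t \<in> borel_measurable borel"
  unfolding background_def[abs_def] by measurable

text \<open>The remainder is of order \<open>T\<close>. The background is not small, but it is
  dominated by a fixed function of frequency, and convolution with it brings no factor
  \<open>l\<close>.\<close>

definition "remainder j t \<xi> = p j t \<xi> - wave j t \<xi> - background j t \<xi>"

lemma wave_meas: "wave j t \<in> borel_measurable borel" by (rule joint_meas_section[OF wave_joint_meas])

lemma remainder_meas: "remainder j t \<in> borel_measurable borel"
  unfolding remainder_def[abs_def] by (intro borel_measurable_diff p_meas wave_meas background_meas)

lemma remainder_bound:
  assumes t: "t \<in> {0..T}"
  shows "norm (remainder j t \<xi>) \<le> (T * Ke) * wt l \<xi>"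
proof -
  have pl: "free_spinor j t \<xi> = background j t \<xi> + (\<Sum>k\<in>UNIV. dirac_prop m t \<xi> $ j $ k * ((U \<xi> + spinor_sign k * V \<xi>) / 2))"
    unfolding free_spinor_def background_def p0_eq sum.distrib[symmetric] by (simp only: distrib_left)
  have "remainder j t \<xi> = (G p j t \<xi> - free_spinor j t \<xi>) + ((\<Sum>k\<in>UNIV. dirac_prop m t \<xi> $ j $ k * ((U \<xi> + spinor_sign k * V \<xi>) / 2)) - wave j t \<xi>)"
    unfolding remainder_def pG[OF t] pl by simp
  also have "norm \<dots> \<le> T * (A * K1) * wt l \<xi> + 4 * \<bar>m\<bar> * A0 * \<bar>t\<bar> * wt l \<xi>"
    by (rule norm_triangle_mono[OF G_plin[OF padm t] massless])
  also have "4 * \<bar>m\<bar> * A0 * \<bar>t\<bar> * wt l \<xi> \<le> 4 * \<bar>m\<bar> * A0 * T * wt l \<xi>"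
    using t A0_nonneg wt_nonneg by (intro mult_right_mono mult_left_mono) auto
  finally show ?thesis unfolding Ke_def by (simp add: algebra_simps)
qed

lemma Ke_nonneg: "Ke \<ge> 0" unfolding Ke_def using A_nonneg K1_nonneg A0_nonneg by simp

lemma lb_nonneg: "lb \<xi> \<ge> 0" using order_trans[OF norm_ge_zero bbb] .

lemma Lb_nonneg: "Lb \<ge> 0" unfolding Lb_def using lb_nonneg by (intro integral_nonneg_AE AE_I2) simp

lemma conv_bilinear_split:
  assumes "integrable lborel (\<lambda>\<eta>. f (\<xi> - \<eta>) * g \<eta>)" "integrable lborel (\<lambda>\<eta>. f' (\<xi> - \<eta>) * g' \<eta>)"
    and i1: "integrable lborel (\<lambda>\<eta>. f1 (\<xi> - \<eta>) * g \<eta>)" and i2: "integrable lborel (\<lambda>\<eta>. f2 (\<xi> - \<eta>) * g \<eta>)"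
    and i3: "integrable lborel (\<lambda>\<eta>. f' (\<xi> - \<eta>) * g1 \<eta>)" and i4: "integrable lborel (\<lambda>\<eta>. f' (\<xi> - \<eta>) * g2 \<eta>)"
    and f: "\<And>x. f x = f' x + f1 x + f2 x" and g: "\<And>x. g x = g' x + g1 x + g2 x"
  shows "conv f g \<xi> - conv f' g' \<xi> = (conv f1 g \<xi> + conv f2 g \<xi>) + (conv f' g1 \<xi> + conv f' g2 \<xi>)"
proof -
  have e: "f (\<xi> - \<eta>) * g \<eta> - f' (\<xi> - \<eta>) * g' \<eta> = (f1 (\<xi> - \<eta>) * g \<eta> + f2 (\<xi> - \<eta>) * g \<eta>) + (f' (\<xi> - \<eta>) * g1 \<eta> + f' (\<xi> - \<eta>) * g2 \<eta>)" for \<eta>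
    unfolding f g by (simp add: algebra_simps)
  have "conv f g \<xi> - conv f' g' \<xi> = (LINT \<eta>|lborel. f (\<xi> - \<eta>) * g \<eta> - f' (\<xi> - \<eta>) * g' \<eta>)"
    unfolding conv_def using assms(1,2) by simp
  then show ?thesis unfolding e conv_def using i1 i2 i3 i4 by simp
qed

text \<open>The term of the wave with itself may be as large as \<open>l\<close>, all others stay
  bounded: the remainder carries a \<open>T\<close> against the \<open>l\<close> of
  \<open>conv_bound\<close>, and the background is handled by \<open>conv_bound_low\<close>. Writing
  f = g + e + h, the difference is e f + h f + g e + g h, where each product keeps one undivided
  factor.\<close>

lemma conv_wave_error:
  assumes t: "t \<in> {0..T}"
  shows "norm (conv (cnj_reflect (p k t)) (p k t) \<xi> - conv (cnj_reflect (wave k t)) (wave k t) \<xi>) \<le> K3 * wt l \<xi>"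
proof -
  define f where "f = p k t"
  define g where "g = wave k t"
  define h where "h = background k t"
  define e where "e = remainder k t"
  have fm: "f \<in> borel_measurable borel" unfolding f_def by (rule p_meas)
  have gm: "g \<in> borel_measurable borel" unfolding g_def by (rule wave_meas)
  have hm: "h \<in> borel_measurable borel" unfolding h_def by (rule background_meas)
  have em: "e \<in> borel_measurable borel" unfolding e_def by (rule remainder_meas)
  have fb: "norm (f x) \<le> A * wt l x" for x unfolding f_def by (rule admissible_bound[OF padm t])
  have gb: "norm (g x) \<le> A * wt l x" for x unfolding g_def by (rule wave_bound)
  have hb: "norm (h x) \<le> 4 * lb x" for x unfolding h_def by (rule background_bound)
  have eb: "norm (e x) \<le> (T * Ke) * wt l x" for x unfolding e_def by (rule remainder_bound[OF t])
  have rhb: "norm (cnj_reflect h x) \<le> 4 * lb x" for x unfolding cnj_reflect_def using hb[of "- x"] lbs by simp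
  have fe: "f x = g x + e x + h x" for x unfolding f_def g_def h_def e_def remainder_def by simp
  have rfe: "cnj_reflect f x = cnj_reflect g x + cnj_reflect e x + cnj_reflect h x" for x unfolding cnj_reflect_def fe by simp
  note c1 = conv_bound[OF l0 cnj_reflect_measurable[OF em] fm cnj_reflect_bound[OF eb] fb, where \<xi>=\<xi>]
  note c2 = conv_bound_low[OF l1 fm cnj_reflect_measurable[OF hm] fb rhb lbi, where \<xi>=\<xi>]
  note c3 = conv_bound[OF l0 cnj_reflect_measurable[OF gm] em cnj_reflect_bound[OF gb] eb, where \<xi>=\<xi>]
  note c4 = conv_bound_low[OF l1 cnj_reflect_measurable[OF gm] hm cnj_reflect_bound[OF gb] hb lbi, where \<xi>=\<xi>]
  \<comment> \<open>\<open>conv_bound_low\<close> expects the weighted factor first; the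
    substitution of \<open>\<xi> - \<eta>\<close> for \<open>\<eta>\<close> restores the order used
    here.\<close>
  have c2i: "integrable lborel (\<lambda>\<eta>. cnj_reflect h (\<xi> - \<eta>) * f \<eta>)"
  proof -
    have i: "integrable lborel (\<lambda>\<eta>. f (\<xi> - (\<xi> + - 1 * \<eta>)) * cnj_reflect h (\<xi> + - 1 * \<eta>))"
      by (rule lborel_integrable_real_affine[OF c2(1)]) simp
    have eq: "f (\<xi> - (\<xi> + - 1 * \<eta>)) * cnj_reflect h (\<xi> + - 1 * \<eta>) = cnj_reflect h (\<xi> - \<eta>) * f \<eta>" for \<eta>
      by (simp add: mult.commute[of "f \<eta>"])
    show ?thesis using i unfolding eq .
  qed
  have sp: "conv (cnj_reflect f) f \<xi> - conv (cnj_reflect g) g \<xi> = (conv (cnj_reflect e) f \<xi> + conv (cnj_reflect h) f \<xi>) + (conv (cnj_reflect g) e \<xi> + conv (cnj_reflect g) h \<xi>)"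
    by (rule conv_bilinear_split[OF conv_bound(1)[OF l0 cnj_reflect_measurable[OF fm] fm cnj_reflect_bound[OF fb] fb]
          conv_bound(1)[OF l0 cnj_reflect_measurable[OF gm] gm cnj_reflect_bound[OF gb] gb] c1(1) c2i c3(1) c4(1) rfe fe])
  have b2: "norm (conv (cnj_reflect h) f \<xi>) \<le> 16 * A * Lb * wt l \<xi>"
    using c2(2) unfolding conv_commute[of f] Lb_def[symmetric] .
  have b4: "norm (conv (cnj_reflect g) h \<xi>) \<le> 16 * A * Lb * wt l \<xi>"
    using c4(2) unfolding Lb_def[symmetric] .
  have b1: "norm (conv (cnj_reflect e) f \<xi>) \<le> \<kappa> * Ke * A * wt l \<xi>"
  proof -
    have eq: "16 * wmass * l * (T * Ke) * A * wt l \<xi> = (T * l) * (\<kappa> * Ke * A * wt l \<xi>)" by (simp add: \<kappa>_def)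
    show ?thesis using c1(2) unfolding eq Tl mult_1 .
  qed
  have b3: "norm (conv (cnj_reflect g) e \<xi>) \<le> \<kappa> * Ke * A * wt l \<xi>"
  proof -
    have eq: "16 * wmass * l * A * (T * Ke) * wt l \<xi> = (T * l) * (\<kappa> * Ke * A * wt l \<xi>)" by (simp add: \<kappa>_def)
    show ?thesis using c3(2) unfolding eq Tl mult_1 .
  qed
  have "norm ((conv (cnj_reflect e) f \<xi> + conv (cnj_reflect h) f \<xi>) + (conv (cnj_reflect g) e \<xi> + conv (cnj_reflect g) h \<xi>)) \<le> (\<kappa> * Ke * A * wt l \<xi> + 16 * A * Lb * wt l \<xi>) + (\<kappa> * Ke * A * wt l \<xi> + 16 * A * Lb * wt l \<xi>)"
    by (rule norm_triangle_mono[OF norm_triangle_mono[OF b1 b2] norm_triangle_mono[OF b3 b4]])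
  moreover have "(\<kappa> * Ke * A * wt l \<xi> + 16 * A * Lb * wt l \<xi>) + (\<kappa> * Ke * A * wt l \<xi> + 16 * A * Lb * wt l \<xi>) = K3 * wt l \<xi>"
    unfolding K3_def by (simp add: algebra_simps)
  ultimately show ?thesis unfolding f_def[symmetric] g_def[symmetric] sp by simp
qed

lemma K3_nonneg: "K3 \<ge> 0" unfolding K3_def using kappa_nonneg Ke_nonneg A_nonneg Lb_nonneg by simp

lemma density_wave_error:
  assumes t: "t \<in> {0..T}"
  shows "norm (N t \<xi> - scalar_density wave wave t \<xi>) \<le> K3 * wt l \<xi>"
proof -
  define D where "D k = conv (cnj_reflect (p k t)) (p k t) \<xi> - conv (cnj_reflect (wave k t)) (wave k t) \<xi>" for k
  have "N t \<xi> - scalar_density wave wave t \<xi> = (\<Sum>k\<in>UNIV. spinor_sign k * D k) / (2 * of_real pi)"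
    unfolding scalar_density_def D_def by (simp add: sum_subtractf right_diff_distrib diff_divide_distrib)
  moreover have "norm (\<Sum>k\<in>(UNIV :: 2 set). spinor_sign k * D k) \<le> (\<Sum>k\<in>(UNIV :: 2 set). K3 * wt l \<xi>)"
    by (rule sum_norm_le) (simp add: norm_mult D_def conv_wave_error[OF t])
  ultimately have "norm (N t \<xi> - scalar_density wave wave t \<xi>) \<le> 2 * (K3 * wt l \<xi>) / (2 * pi)"
    using divide_right_mono[of "norm (\<Sum>k\<in>(UNIV :: 2 set). spinor_sign k * D k)" "2 * (K3 * wt l \<xi>)" "2 * pi"] by (simp add: norm_divide)
  also have "\<dots> \<le> K3 * wt l \<xi>"
    using pi_gt3 K3_nonneg wt_nonneg[of l \<xi>] mult_right_mono[of 1 pi "K3 * wt l \<xi>"] by (simp add: divide_le_eq mult.commute)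
  finally show ?thesis .
qed

definition "wave_response t \<xi> = (LINT s:{0..t}|lborel. of_real (sin ((t - s) * \<xi>) / \<xi>) * scalar_density wave wave s \<xi>)"

text \<open>Density and kernel are replaced in turn by those of the massless wave. Both errors of
  the integrand are of order \<open>T\<close>, the second because the additional power of
  \<open>T\<close> in \<open>kg_sin_wave\<close> meets the factor \<open>l\<close> of the density;
  the time integral adds another \<open>T\<close>. The main term is only of order
  \<open>T\<close>.\<close>

lemma field_expansion:
  assumes x: "\<xi> \<noteq> 0"
  shows "norm (q T \<xi> - free_field T \<xi> - wave_response T \<xi>) \<le> T\<^sup>2 * K4 * wt l \<xi>"
proof -
  have TT: "T \<in> {0..T}" using T0 by simp
  have sm: "(\<lambda>s. scalar_density wave wave s \<xi>) \<in> borel_measurable borel" by (rule scalar_density_measurable[OF wave_joint_meas wave_joint_meas]) auto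
  have sb: "norm (scalar_density wave wave s \<xi>) \<le> \<kappa> * l * A * A * wt l \<xi>" if "s \<in> {0..T}" for s by (rule scalar_density_adm[OF wave_adm wave_adm that])
  have s0: "0 \<le> \<kappa> * l * A * A * wt l \<xi>" using order_trans[OF norm_ge_zero sb[OF TT]] .
  have i2: "set_integrable lborel {0..T} (\<lambda>s. of_real (sin ((T - s) * \<xi>) / \<xi>) * scalar_density wave wave s \<xi>)"
  proof (rule set_lint_integrable)
    show "(\<lambda>s. of_real (sin ((T - s) * \<xi>) / \<xi>) * scalar_density wave wave s \<xi>) \<in> borel_measurable borel" using sm by measurable
    fix s assume s: "s \<in> {0..T}"
    have "\<bar>sin ((T - s) * \<xi>) / \<xi>\<bar> \<le> 1 / \<bar>\<xi>\<bar>" unfolding abs_divide by (intro divide_right_mono) auto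
    then show "norm (of_real (sin ((T - s) * \<xi>) / \<xi>) * scalar_density wave wave s \<xi>) \<le> 1 / \<bar>\<xi>\<bar> * (\<kappa> * l * A * A * wt l \<xi>)"
      unfolding norm_mult norm_of_real using sb[OF s] by (intro mult_mono) auto
  qed
  have "q T \<xi> - free_field T \<xi> - wave_response T \<xi> = (LINT s:{0..T}|lborel. of_real (kg_sin M (T - s) \<xi>) * N s \<xi> - of_real (sin ((T - s) * \<xi>) / \<xi>) * scalar_density wave wave s \<xi>)"
    unfolding set_integral_diff(2)[OF kg_src_integrable[OF padm padm TT] i2] Q_def wave_response_def kg_response_def by simp
  moreover have "norm (LINT s:{0..T}|lborel. of_real (kg_sin M (T - s) \<xi>) * N s \<xi> - of_real (sin ((T - s) * \<xi>) / \<xi>) * scalar_density wave wave s \<xi>) \<le> (T - 0) * (T * K4 * wt l \<xi>)"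
  proof (rule set_lint_bound)
    fix s assume s: "s \<in> {0..T}"
    have e: "of_real (kg_sin M (T - s) \<xi>) * N s \<xi> - of_real (sin ((T - s) * \<xi>) / \<xi>) * scalar_density wave wave s \<xi>
      = of_real (kg_sin M (T - s) \<xi>) * (N s \<xi> - scalar_density wave wave s \<xi>) + of_real (kg_sin M (T - s) \<xi> - sin ((T - s) * \<xi>) / \<xi>) * scalar_density wave wave s \<xi>"
      unfolding of_real_diff by (simp only: algebra_simps)
    have 1: "norm (of_real (kg_sin M (T - s) \<xi>) * (N s \<xi> - scalar_density wave wave s \<xi>)) \<le> T * (K3 * wt l \<xi>)"
      unfolding norm_mult norm_of_real using kg_sin_bound[of M "T - s" \<xi>] s T0 by (intro mult_mono density_wave_error) auto
    have "\<bar>kg_sin M (T - s) \<xi> - sin ((T - s) * \<xi>) / \<xi>\<bar> \<le> \<bar>M\<bar> * (T - s)\<^sup>2" using s by (intro kg_sin_wave x) auto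
    also have "\<dots> \<le> \<bar>M\<bar> * T\<^sup>2" using s by (intro mult_left_mono power_mono) auto
    finally have 2: "norm (of_real (kg_sin M (T - s) \<xi> - sin ((T - s) * \<xi>) / \<xi>) * scalar_density wave wave s \<xi>) \<le> (\<bar>M\<bar> * T\<^sup>2) * (\<kappa> * l * A * A * wt l \<xi>)"
      unfolding norm_mult norm_of_real using sb[OF s] by (intro mult_mono) auto
    have 3: "(\<bar>M\<bar> * T\<^sup>2) * (\<kappa> * l * A * A * wt l \<xi>) = (T * l) * (T * (\<bar>M\<bar> * \<kappa> * A\<^sup>2 * wt l \<xi>))" by (simp add: power2_eq_square)
    have 4: "T * (K3 * wt l \<xi>) + T * (\<bar>M\<bar> * \<kappa> * A\<^sup>2 * wt l \<xi>) = T * K4 * wt l \<xi>"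
      unfolding K4_def by (simp add: algebra_simps)
    show "norm (of_real (kg_sin M (T - s) \<xi>) * N s \<xi> - of_real (sin ((T - s) * \<xi>) / \<xi>) * scalar_density wave wave s \<xi>) \<le> T * K4 * wt l \<xi>"
      using norm_triangle_mono[OF 1 2] unfolding e 3 Tl mult_1 4 .
  next
    show "0 \<le> T * K4 * wt l \<xi>" unfolding K4_def using T0 K3_nonneg kappa_nonneg wt_nonneg by simp
  qed (use T0 in auto)
  ultimately show ?thesis by (simp add: power2_eq_square mult.assoc)
qed

end

section \<open>The resonant interaction\<close>

text \<open>The sine splits the integrand into exponentials with phases 2 s (\<eta> - \<xi>) and 2 s
  \<eta>, with elementary primitives. For large negative \<open>\<xi>\<close> the first has a large
  denominator and only the second matters.\<close>

lemma time_integral: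
  fixes T \<xi> \<eta> :: real
  assumes T: "T \<ge> 0" and n: "\<eta> \<noteq> 0" "\<eta> - \<xi> \<noteq> 0"
  shows "(LINT s:{0..T}|lborel. of_real (sin ((T - s) * \<xi>)) * exp (\<i> * of_real (s * (2 * \<eta> - \<xi>))))
    = - (exp (\<i> * of_real (T * \<xi>)) * (exp (\<i> * of_real (2 * T * (\<eta> - \<xi>))) - 1) / of_real (\<eta> - \<xi>)
        - exp (- (\<i> * of_real (T * \<xi>))) * (exp (\<i> * of_real (2 * T * \<eta>)) - 1) / of_real \<eta>) / 4"
proof -
  define X where "X = exp (\<i> * of_real (T * \<xi>))"
  define Y where "Y = exp (- (\<i> * of_real (T * \<xi>)))"
  define z where "z = complex_of_real \<eta>"
  define w where "w = complex_of_real (\<eta> - \<xi>)"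
  have zw: "z \<noteq> 0" "w \<noteq> 0" unfolding z_def w_def using n by (simp_all only: of_real_eq_0_iff not_False_eq_True)
  define F where "F s = - (X * exp (2 * \<i> * w * s) / w - Y * exp (2 * \<i> * z * s) / z) / 4" for s :: complex
  define f where "f s = (X * exp (2 * \<i> * w * s) - Y * exp (2 * \<i> * z * s)) / (2 * \<i>)" for s :: complex
  have d: "(F has_field_derivative f s) (at s)" for s
  proof -
    have "(F has_field_derivative - (X * (exp (2 * \<i> * w * s) * (2 * \<i> * w)) / w - Y * (exp (2 * \<i> * z * s) * (2 * \<i> * z)) / z) / 4) (at s)"
      unfolding F_def[abs_def] by (auto intro!: derivative_eq_intros)
    also have "- (X * (exp (2 * \<i> * w * s) * (2 * \<i> * w)) / w - Y * (exp (2 * \<i> * z * s) * (2 * \<i> * z)) / z) / 4 = f s"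
      using zw by (simp add: f_def field_simps)
    finally show ?thesis .
  qed
  have v: "((\<lambda>s. F (of_real s)) has_vector_derivative f (of_real s)) (at s within {0..T})" for s :: real
    by (rule has_vector_derivative_at_within[OF has_vector_derivative_real_field[OF d]])
  have c: "continuous_on {0..T} (\<lambda>s. f (of_real s))"
    unfolding f_def by (intro continuous_intros) auto
  have I: "(LINT s:{0..T}|lborel. f (of_real s)) = F (of_real T) - F (of_real 0)"
    unfolding set_lebesgue_integral_def
    by (rule integral_FTC_Icc[OF T v c])
  have e: "of_real (sin ((T - s) * \<xi>)) * exp (\<i> * of_real (s * (2 * \<eta> - \<xi>))) = f (of_real s)" for s
  proof -
    have "complex_of_real (sin ((T - s) * \<xi>)) = (exp (\<i> * of_real ((T - s) * \<xi>)) - exp (- (\<i> * of_real ((T - s) * \<xi>)))) / (2 * \<i>)"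
      unfolding sin_of_real[symmetric] sin_exp_eq ..
    then have "of_real (sin ((T - s) * \<xi>)) * exp (\<i> * of_real (s * (2 * \<eta> - \<xi>))) = (exp (\<i> * of_real ((T - s) * \<xi>)) * exp (\<i> * of_real (s * (2 * \<eta> - \<xi>))) - exp (- (\<i> * of_real ((T - s) * \<xi>))) * exp (\<i> * of_real (s * (2 * \<eta> - \<xi>)))) / (2 * \<i>)"
      by (simp add: left_diff_distrib)
    also have "exp (\<i> * of_real ((T - s) * \<xi>)) * exp (\<i> * of_real (s * (2 * \<eta> - \<xi>))) = X * exp (2 * \<i> * w * of_real s)"
      unfolding X_def w_def exp_add[symmetric] by (rule arg_cong[of _ _ exp]) (simp add: algebra_simps)
    also have "exp (- (\<i> * of_real ((T - s) * \<xi>))) * exp (\<i> * of_real (s * (2 * \<eta> - \<xi>))) = Y * exp (2 * \<i> * z * of_real s)"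
      unfolding Y_def z_def exp_add[symmetric] by (rule arg_cong[of _ _ exp]) (simp add: algebra_simps)
    finally show ?thesis by (simp add: f_def)
  qed
  have ew: "exp (\<i> * of_real (2 * T * (\<eta> - \<xi>))) = exp (2 * \<i> * w * of_real T)" "exp (\<i> * of_real (2 * T * \<eta>)) = exp (2 * \<i> * z * of_real T)"
    unfolding w_def z_def by (rule arg_cong[of _ _ exp], simp)+
  show ?thesis
    unfolding e I ew X_def[symmetric] Y_def[symmetric] w_def[symmetric] z_def[symmetric] F_def by (simp add: field_simps zw)
qed

text \<open>The factor \<open>- exp (\<i> * of_real (T * \<xi>))\<close> removes the phase of the
  second term, whose real part becomes a nonnegative multiple of (sin (T \<eta>))^2 / \<eta>. The
  first term is only estimated, by 2 / (\<eta> - \<xi>).\<close>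

lemma time_integral_Re:
  fixes T \<xi> \<eta> :: real
  assumes T: "T \<ge> 0" and n: "\<eta> > 0" "\<eta> - \<xi> > 0"
  shows "Re (- exp (\<i> * of_real (T * \<xi>)) * (LINT s:{0..T}|lborel. of_real (sin ((T - s) * \<xi>)) * exp (\<i> * of_real (s * (2 * \<eta> - \<xi>)))))
    \<ge> ((sin (T * \<eta>))\<^sup>2 / \<eta> - 1 / (\<eta> - \<xi>)) / 2"
proof -
  define X where "X = exp (\<i> * of_real (T * \<xi>))"
  define Y where "Y = exp (- (\<i> * of_real (T * \<xi>)))"
  define P where "P = exp (\<i> * of_real (2 * T * (\<eta> - \<xi>))) - 1"
  define Z where "Z = exp (\<i> * of_real (2 * T * \<eta>)) - 1"
  have XY: "X * Y = 1" unfolding X_def Y_def exp_add[symmetric] by simp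
  have nX: "norm X = 1" unfolding X_def by (rule norm_exp_imaginary)
  have nP: "norm P \<le> 2"
  proof -
    have "norm P \<le> norm (exp (\<i> * of_real (2 * T * (\<eta> - \<xi>)))) + norm (1::complex)" unfolding P_def by (rule norm_triangle_ineq4)
    then show ?thesis unfolding norm_exp_imaginary norm_one by simp
  qed
  have RZ: "Re Z = - 2 * (sin (T * \<eta>))\<^sup>2"
  proof -
    have "Re Z = cos (2 * (T * \<eta>)) - 1" unfolding Z_def cis_conv_exp[symmetric] by (simp add: mult.assoc)
    then show ?thesis unfolding cos_double_sin by simp
  qed
  have ring: "(s / e - 1 / w) / 2 = (- 2 / w - (- 2 * s) / e) / 4" for s e w :: real
    by (simp add: diff_divide_distrib)
  have I: "(LINT s:{0..T}|lborel. of_real (sin ((T - s) * \<xi>)) * exp (\<i> * of_real (s * (2 * \<eta> - \<xi>)))) = - (X * P / of_real (\<eta> - \<xi>) - Y * Z / of_real \<eta>) / 4"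
    unfolding X_def Y_def P_def Z_def by (rule time_integral) (use T n in auto)
  have "- X * (- (X * P / of_real (\<eta> - \<xi>) - Y * Z / of_real \<eta>) / 4) = (X * X * P / of_real (\<eta> - \<xi>) - (X * Y) * Z / of_real \<eta>) / 4"
    by (simp add: field_simps)
  then have r: "Re (- X * (- (X * P / of_real (\<eta> - \<xi>) - Y * Z / of_real \<eta>) / 4)) = (Re (X * X * P) / (\<eta> - \<xi>) - Re Z / \<eta>) / 4"
    unfolding XY mult_1 by (simp only: Re_divide_numeral minus_complex.sel Re_divide_of_real)
  have "\<bar>Re (X * X * P)\<bar> \<le> norm (X * X * P)" by (rule abs_Re_le_cmod)
  also have "\<dots> \<le> 2" using nP by (simp add: norm_mult nX)
  finally have "- 2 \<le> Re (X * X * P)" by simp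
  then have m: "- 2 / (\<eta> - \<xi>) \<le> Re (X * X * P) / (\<eta> - \<xi>)" using n by (intro divide_right_mono) auto
  have "((sin (T * \<eta>))\<^sup>2 / \<eta> - 1 / (\<eta> - \<xi>)) / 2 = (- 2 / (\<eta> - \<xi>) - (- 2 * (sin (T * \<eta>))\<^sup>2) / \<eta>) / 4"
    by (rule ring)
  also have "\<dots> \<le> (Re (X * X * P) / (\<eta> - \<xi>) - Re Z / \<eta>) / 4"
    unfolding RZ by (intro divide_right_mono diff_right_mono m) simp
  finally show ?thesis unfolding I X_def[symmetric] r .
qed

text \<open>This is the square of the \<open>H\<^sup>s\<close> norm, \<open>s = - 1/2\<close>, of the profile \<open>(sin y)\<^sup>2\<close> on \<open>{1..R}\<close>, up to the
  difference between \<open>\<langle>y\<rangle>\<close> and \<open>y\<close>; it grows like \<open>3/8 * ln R\<close>.\<close>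

definition profile_mass :: "real \<Rightarrow> real" where
  "profile_mass R = (LINT y|lborel. indicat_real {1..R} y * ((sin y) ^ 4 / y))"

text \<open>The condition \<open>N0 \<ge> 2 * R\<close> separates the two profiles and keeps the
  window of output frequencies long. The second condition on \<open>N0\<close> makes the estimated
  part of the time integral at most half of the main part.\<close>

locale dkg_prof = dkg_inf +
  fixes a b R N0 :: real
  assumes ab: "a > 0" "b > 0" and R1: "R \<ge> 1" and N0: "N0 \<ge> 2 * R" "N0 * profile_mass R \<ge> 2 * R"
    and U_eq: "\<And>\<xi>. U \<xi> = of_real (a * (sin (T * \<xi>))\<^sup>2 * indicator {1..R} (T * \<xi>))"
    and V_eq: "\<And>\<xi>. V \<xi> = of_real (b * indicator {N0..2 * N0} (T * \<xi>))"
begin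

definition "u \<xi> = a * (sin (T * \<xi>))\<^sup>2 * indicat_real {1..R} (T * \<xi>)"

lemma U_u: "U \<xi> = of_real (u \<xi>)" unfolding U_eq u_def ..

lemma u_meas[measurable]: "u \<in> borel_measurable borel" unfolding u_def[abs_def] by measurable

lemma u_nonneg: "u \<xi> \<ge> 0" unfolding u_def using ab by (simp add: indicator_def)

lemma ind_integrable: "integrable lborel (indicat_real {1..R})"
  by (rule integrable_real_indicator) (auto simp: emeasure_lborel_Icc_eq)

lemma u_scaled: "u (0 + l * y) = a * (sin y)\<^sup>2 * indicat_real {1..R} y"
  unfolding u_def using Tl(1) by (simp flip: mult.assoc)

lemma u_integrable: "integrable lborel u" "(LINT \<eta>|lborel. u \<eta>) \<le> l * (a * R)"
proof -
  have i: "integrable lborel (\<lambda>y. a * (sin y)\<^sup>2 * indicat_real {1..R} y)"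
  proof (rule Bochner_Integration.integrable_bound[OF integrable_mult_right[OF ind_integrable, of a]])
    show "AE y in lborel. norm (a * (sin y)\<^sup>2 * indicat_real {1..R} y) \<le> norm (a * indicat_real {1..R} y)"
      using ab by (intro AE_I2) (auto simp: indicator_def abs_mult power_le_one_iff abs_square_le_1 intro!: mult_left_le)
  qed measurable
  then show "integrable lborel u"
    unfolding u_scaled[symmetric] using l0 by (subst (asm) lborel_integrable_real_affine_iff) auto
  have "(LINT \<eta>|lborel. u \<eta>) = \<bar>l\<bar> *\<^sub>R (LINT y|lborel. u (0 + l * y))"
    by (rule lborel_integral_real_affine) (use l0 in simp)
  also have "\<dots> = l * (LINT y|lborel. a * (sin y)\<^sup>2 * indicat_real {1..R} y)" unfolding u_scaled using l0 by simp
  also have "(LINT y|lborel. a * (sin y)\<^sup>2 * indicat_real {1..R} y) \<le> (LINT y|lborel. a * indicat_real {1..R} y)"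
    by (rule integral_mono[OF i integrable_mult_right[OF ind_integrable, of a]])
      (use ab in \<open>auto simp: indicator_def abs_square_le_1\<close>)
  also have "(LINT y|lborel. a * indicat_real {1..R} y) = a * (R - 1)" using R1 by simp
  also have "\<dots> \<le> a * R" using ab by simp
  finally show "(LINT \<eta>|lborel. u \<eta>) \<le> l * (a * R)" using l0 by simp
qed

text \<open>The coupling of the left-moving profile to the resonant kernel. The measure d\<eta> /
  \<eta> is scale invariant, so \<open>l\<close> drops out.\<close>

lemma u_mass: "integrable lborel (\<lambda>\<eta>. u \<eta> * ((sin (T * \<eta>))\<^sup>2 / \<eta>))" "(LINT \<eta>|lborel. u \<eta> * ((sin (T * \<eta>))\<^sup>2 / \<eta>)) = a * profile_mass R"
proof -
  define g where "g \<eta> = u \<eta> * ((sin (T * \<eta>))\<^sup>2 / \<eta>)" for \<eta>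
  have gm[measurable]: "g \<in> borel_measurable borel" unfolding g_def[abs_def] by measurable
  have gs: "g (0 + l * y) = a / l * (indicat_real {1..R} y * ((sin y) ^ 4 / y))" for y
  proof -
    have Ty: "T * (0 + l * y) = y" using Tl(1) by (simp flip: mult.assoc)
    show ?thesis unfolding g_def u_scaled Ty by (simp add: power4_eq_xxxx power2_eq_square)
  qed
  have "integrable lborel g"
  proof (rule Bochner_Integration.integrable_bound[OF u_integrable(1)])
    show "g \<in> borel_measurable lborel" by measurable
    show "AE \<eta> in lborel. norm (g \<eta>) \<le> norm (u \<eta>)"
    proof (intro AE_I2)
      fix \<eta>
      show "norm (g \<eta>) \<le> norm (u \<eta>)"
      proof (cases "T * \<eta> \<in> {1..R}")
        case True
        then have "1 \<le> T * \<eta>" by simp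
        moreover have "0 < \<eta>"
        proof -
          have "0 < T * \<eta>" using \<open>1 \<le> T * \<eta>\<close> by linarith
          then show ?thesis using T0 by (simp add: zero_less_mult_iff)
        qed
        moreover from this have "T * \<eta> \<le> 1 * \<eta>" using T0 by (intro mult_right_mono) auto
        ultimately have e: "\<eta> \<ge> 1" by simp
        have "(sin (T * \<eta>))\<^sup>2 / \<eta> \<le> 1 / 1" using e by (intro frac_le) (auto simp: abs_square_le_1)
        then have "u \<eta> * ((sin (T * \<eta>))\<^sup>2 / \<eta>) \<le> u \<eta> * 1" by (intro mult_left_mono u_nonneg) simp
        moreover have "0 \<le> u \<eta> * ((sin (T * \<eta>))\<^sup>2 / \<eta>)" using u_nonneg[of \<eta>] e by simp
        ultimately show ?thesis unfolding g_def using u_nonneg[of \<eta>] by simp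
      next
        case False
        then show ?thesis by (simp add: g_def u_def)
      qed
    qed
  qed
  then show "integrable lborel (\<lambda>\<eta>. u \<eta> * ((sin (T * \<eta>))\<^sup>2 / \<eta>))" unfolding g_def .
  have "(LINT \<eta>|lborel. g \<eta>) = \<bar>l\<bar> *\<^sub>R (LINT y|lborel. g (0 + l * y))"
    by (rule lborel_integral_real_affine) (use l0 in simp)
  also have "\<dots> = a * profile_mass R" unfolding gs integral_mult_right_zero profile_mass_def using l0 by simp
  finally show "(LINT \<eta>|lborel. u \<eta> * ((sin (T * \<eta>))\<^sup>2 / \<eta>)) = a * profile_mass R" unfolding g_def .
qed

text \<open>On this window of negative frequencies, only the product of \<open>U\<close> at \<open>\<eta>\<close> and \<open>cnj V\<close> at \<open>\<eta> - \<xi>\<close>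
  survives in the quadratic term.\<close>

context
  fixes \<xi> :: real
  assumes x: "N0 \<le> - (T * \<xi>)" "- (T * \<xi>) \<le> 2 * N0 - R"
begin

text \<open>Taking the difference of the components, as gamma0 does, cancels the products of
  \<open>P\<close> with itself and of \<open>W\<close> with itself. Of the two mixed products, one
  vanishes because \<open>T * (\<eta> - \<xi>)\<close> exceeds the support of \<open>U\<close>; in
  the other the cutoff of \<open>V\<close> equals 1 wherever \<open>U\<close> is nonzero.\<close>

lemma wave_product:
  "cnj_reflect (wave 1 s) (\<xi> - \<eta>) * wave 1 s \<eta> - cnj_reflect (wave 2 s) (\<xi> - \<eta>) * wave 2 s \<eta> = of_real (b / 2) * (exp (\<i> * of_real (s * (2 * \<eta> - \<xi>))) * U \<eta>)"
proof -
  define P where "P \<eta> = exp (\<i> * of_real (s * \<eta>)) * U \<eta>" for \<eta>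
  define W where "W \<eta> = exp (- (\<i> * of_real (s * \<eta>))) * V \<eta>" for \<eta>
  have d: "wave 1 s \<eta> = (P \<eta> + W \<eta>) / 2" "wave 2 s \<eta> = (P \<eta> - W \<eta>) / 2" for \<eta>
    unfolding wave_def P_def W_def spinor_sign_def by simp_all
  have 1: "cnj (P (\<eta> - \<xi>)) * W \<eta> = 0"
  proof (cases "T * \<eta> \<in> {N0..2 * N0}")
    case True
    then have "T * (\<eta> - \<xi>) \<ge> 2 * N0" using x by (simp add: right_diff_distrib)
    then have "T * (\<eta> - \<xi>) \<notin> {1..R}" using N0 R1 by auto
    then show ?thesis by (simp add: P_def U_eq)
  next
    case False
    then show ?thesis by (simp add: W_def V_eq)
  qed
  have 2: "cnj (W (\<eta> - \<xi>)) * P \<eta> = of_real b * (exp (\<i> * of_real (s * (2 * \<eta> - \<xi>))) * U \<eta>)"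
  proof (cases "T * \<eta> \<in> {1..R}")
    case True
    then have "T * (\<eta> - \<xi>) \<in> {N0..2 * N0}" using x by (simp add: right_diff_distrib)
    then have "cnj (W (\<eta> - \<xi>)) = of_real b * exp (\<i> * of_real (s * (\<eta> - \<xi>)))"
      by (simp add: W_def V_eq exp_cnj)
    moreover have "exp (\<i> * of_real (s * (\<eta> - \<xi>))) * exp (\<i> * of_real (s * \<eta>)) = exp (\<i> * of_real (s * (2 * \<eta> - \<xi>)))"
      unfolding exp_add[symmetric] by (rule arg_cong[of _ _ exp]) (simp add: algebra_simps)
    ultimately show ?thesis unfolding P_def by (metis mult.assoc)
  next
    case False
    then show ?thesis by (simp add: P_def U_eq)
  qed
  have "cnj_reflect (wave 1 s) (\<xi> - \<eta>) * wave 1 s \<eta> - cnj_reflect (wave 2 s) (\<xi> - \<eta>) * wave 2 s \<eta> = (cnj (P (\<eta> - \<xi>)) * W \<eta> + cnj (W (\<eta> - \<xi>)) * P \<eta>) / 2"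
    unfolding cnj_reflect_def d by (simp add: field_simps)
  then show ?thesis unfolding 1 2 by simp
qed

lemma density_formula: "scalar_density wave wave s \<xi> = of_real (b / (4 * pi)) * (LINT \<eta>|lborel. exp (\<i> * of_real (s * (2 * \<eta> - \<xi>))) * U \<eta>)"
proof -
  have i: "integrable lborel (\<lambda>\<eta>. cnj_reflect (wave k s) (\<xi> - \<eta>) * wave k s \<eta>)" for k
    by (rule conv_bound(1)[OF l0 cnj_reflect_measurable[OF wave_meas] wave_meas cnj_reflect_bound[OF wave_bound] wave_bound])
  have "scalar_density wave wave s \<xi> = (conv (cnj_reflect (wave 1 s)) (wave 1 s) \<xi> - conv (cnj_reflect (wave 2 s)) (wave 2 s) \<xi>) / (2 * of_real pi)"
    unfolding scalar_density_def sum_2 spinor_sign_def by simp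
  also have "conv (cnj_reflect (wave 1 s)) (wave 1 s) \<xi> - conv (cnj_reflect (wave 2 s)) (wave 2 s) \<xi> = (LINT \<eta>|lborel. of_real (b / 2) * (exp (\<i> * of_real (s * (2 * \<eta> - \<xi>))) * U \<eta>))"
    unfolding conv_def wave_product[symmetric] by (rule Bochner_Integration.integral_diff[OF i i, symmetric])
  finally show ?thesis unfolding integral_mult_right_zero by simp
qed

text \<open>After the exchange of integrals the integrand in \<open>\<eta>\<close>, turned by one
  common phase, has a real part that is bounded below pointwise, so different \<open>\<eta>\<close>
  do not cancel beyond the error already counted. The constant collects
  \<open>b / (4 * pi * \<bar>\<xi>\<bar>)\<close> with
  \<open>\<bar>\<xi>\<bar> \<le> 2 * N0 / T\<close> and the surviving
  \<open>a * profile_mass R / 4\<close>.\<close>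

lemma wave_response_lower: "norm (wave_response T \<xi>) \<ge> a * b * profile_mass R / (32 * pi * N0) * T"
proof -
  have TN: "N0 > 0" using N0 R1 by simp
  have Tx: "T * \<xi> < 0" using x TN by simp
  then have xneg: "\<xi> < 0" using T0 by (simp add: mult_less_0_iff)
  define I where "I \<eta> = (LINT s:{0..T}|lborel. of_real (sin ((T - s) * \<xi>)) * exp (\<i> * of_real (s * (2 * \<eta> - \<xi>))))" for \<eta>
  have Ui: "integrable lborel U" unfolding U_u[abs_def] using u_integrable(1) by simp
  have gb: "norm (complex_of_real (sin ((T - s) * \<xi>)) * exp (\<i> * of_real (s * (2 * \<eta> - \<xi>)))) \<le> 1" for s \<eta>
    unfolding norm_mult norm_exp_imaginary norm_of_real by simp
  have gm: "(\<lambda>(\<eta>, s). complex_of_real (sin ((T - s) * \<xi>)) * exp (\<i> * of_real (s * (2 * \<eta> - \<xi>)))) \<in> borel_measurable (borel \<Otimes>\<^sub>M borel)"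
    unfolding case_prod_beta' by measurable
  have F: "(LINT s:{0..T}|lborel. (LINT \<eta>|lborel. (of_real (sin ((T - s) * \<xi>)) * exp (\<i> * of_real (s * (2 * \<eta> - \<xi>)))) * U \<eta>)) = (LINT \<eta>|lborel. I \<eta> * U \<eta>)"
    unfolding I_def by (rule Fubini_time(2)[OF gm gb zero_le_one Ui])
  have Iint: "integrable lborel (\<lambda>\<eta>. I \<eta> * U \<eta>)"
  proof (rule bounded_times_integrable[OF _ _ Ui])
    show "I \<in> borel_measurable borel"
    proof -
      have Ieq: "I = (\<lambda>\<eta>. LINT s|lborel. (if 0 \<le> s \<and> s \<le> T then of_real (sin ((T - s) * \<xi>)) * exp (\<i> * of_real (s * (2 * \<eta> - \<xi>))) else 0))"
        unfolding I_def set_lebesgue_integral_def by (intro ext Bochner_Integration.integral_cong) (auto simp: indicator_def)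
      show ?thesis unfolding Ieq by measurable
    qed
    show "norm (I \<eta>) \<le> (T - 0) * 1" for \<eta> unfolding I_def using T0 by (intro set_lint_bound gb) auto
  qed
  have "wave_response T \<xi> = (LINT s:{0..T}|lborel. of_real (b / (4 * pi * \<xi>)) * (LINT \<eta>|lborel. (of_real (sin ((T - s) * \<xi>)) * exp (\<i> * of_real (s * (2 * \<eta> - \<xi>)))) * U \<eta>))"
  proof -
    have eq: "(LINT \<eta>|lborel. (of_real (sin ((T - s) * \<xi>)) * exp (\<i> * of_real (s * (2 * \<eta> - \<xi>)))) * U \<eta>) = of_real (sin ((T - s) * \<xi>)) * (LINT \<eta>|lborel. exp (\<i> * of_real (s * (2 * \<eta> - \<xi>))) * U \<eta>)" for s
      by (simp only: mult.assoc integral_mult_right_zero)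
    show ?thesis unfolding wave_response_def density_formula eq
      by (intro set_lebesgue_integral_cong allI impI) (simp_all add: mult_ac)
  qed
  also have "\<dots> = of_real (b / (4 * pi * \<xi>)) * (LINT \<eta>|lborel. I \<eta> * U \<eta>)"
    unfolding set_integral_mult_right F ..
  finally have R: "norm (wave_response T \<xi>) = b / (4 * pi * \<bar>\<xi>\<bar>) * norm (LINT \<eta>|lborel. I \<eta> * U \<eta>)"
    using ab by (simp add: norm_mult norm_divide abs_mult)
  \<comment> \<open>This phase has modulus 1 and does not depend on \<open>\<eta>\<close>, so it can
    be put inside the integral at no cost.\<close>
  define X where "X = - exp (\<i> * of_real (T * \<xi>))"
  have nX: "norm X = 1" unfolding X_def norm_minus_cancel by (rule norm_exp_imaginary)
  have i1: "integrable lborel (\<lambda>\<eta>. u \<eta> * ((sin (T * \<eta>))\<^sup>2 / \<eta>) / 2)" by (rule integrable_divide_zero, rule u_mass(1))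
  have i2: "integrable lborel (\<lambda>\<eta>. u \<eta> * (T / N0) / 2)" by (rule integrable_divide_zero, rule integrable_mult_left, rule u_integrable)
  have "a * profile_mass R / 4 \<le> (LINT \<eta>|lborel. u \<eta> * ((sin (T * \<eta>))\<^sup>2 / \<eta>) / 2 - u \<eta> * (T / N0) / 2)"
  proof -
    define Y where "Y = (LINT \<eta>|lborel. u \<eta>) * (T / N0)"
    have "(LINT \<eta>|lborel. u \<eta> * ((sin (T * \<eta>))\<^sup>2 / \<eta>) / 2 - u \<eta> * (T / N0) / 2) = a * profile_mass R / 2 - Y / 2"
      unfolding Bochner_Integration.integral_diff[OF i1 i2] integral_divide_zero integral_mult_left_zero u_mass(2) Y_def ..
    moreover have "Y \<le> (l * (a * R)) * (T / N0)"
      unfolding Y_def using u_integrable(2) T0 TN by (intro mult_right_mono) auto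
    moreover have "(l * (a * R)) * (T / N0) = (T * l) * (a * R / N0)" by simp
    moreover have "a * R / N0 \<le> a * profile_mass R / 2"
    proof -
      have "R / N0 \<le> profile_mass R / 2" using N0(2) TN by (simp add: field_simps)
      then have "a * (R / N0) \<le> a * (profile_mass R / 2)" using ab by (intro mult_left_mono) auto
      then show ?thesis by simp
    qed
    ultimately show ?thesis unfolding Tl mult_1 by linarith
  qed
  also have "\<dots> \<le> (LINT \<eta>|lborel. Re (X * (I \<eta> * U \<eta>)))"
  proof (rule integral_mono)
    show "integrable lborel (\<lambda>\<eta>. u \<eta> * ((sin (T * \<eta>))\<^sup>2 / \<eta>) / 2 - u \<eta> * (T / N0) / 2)"
      by (rule Bochner_Integration.integrable_diff[OF i1 i2])
    show "integrable lborel (\<lambda>\<eta>. Re (X * (I \<eta> * U \<eta>)))" using Iint by (intro integrable_Re integrable_mult_right)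
    fix \<eta>
    show "u \<eta> * ((sin (T * \<eta>))\<^sup>2 / \<eta>) / 2 - u \<eta> * (T / N0) / 2 \<le> Re (X * (I \<eta> * U \<eta>))"
    proof (cases "T * \<eta> \<in> {1..R}")
      case False
      then show ?thesis by (simp add: u_def U_eq)
    next
      case True
      then have "0 < T * \<eta>" by simp
      then have e: "\<eta> > 0" using T0 by (simp add: zero_less_mult_iff)
      have ex: "\<eta> - \<xi> > 0" using e xneg by simp
      have "T * (\<eta> - \<xi>) \<ge> N0" using x e T0 True by (simp add: right_diff_distrib)
      then have "1 / (\<eta> - \<xi>) \<le> T / N0" using TN ex by (simp add: field_simps)
      then have "((sin (T * \<eta>))\<^sup>2 / \<eta> - T / N0) / 2 \<le> ((sin (T * \<eta>))\<^sup>2 / \<eta> - 1 / (\<eta> - \<xi>)) / 2" by (intro divide_right_mono diff_left_mono) auto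
      also have "\<dots> \<le> Re (X * I \<eta>)" unfolding X_def I_def by (rule time_integral_Re) (use T0 e ex in auto)
      finally have "u \<eta> * (((sin (T * \<eta>))\<^sup>2 / \<eta> - T / N0) / 2) \<le> u \<eta> * Re (X * I \<eta>)"
        by (intro mult_left_mono u_nonneg)
      also have "\<dots> = Re (X * (I \<eta> * U \<eta>))" unfolding U_u by (simp add: algebra_simps)
      finally have fin: "u \<eta> * (((sin (T * \<eta>))\<^sup>2 / \<eta> - T / N0) / 2) \<le> Re (X * (I \<eta> * U \<eta>))" .
      have "u \<eta> * c / 2 - u \<eta> * d / 2 = u \<eta> * ((c - d) / 2)" for c d by (simp add: right_diff_distrib diff_divide_distrib)
      then show ?thesis using fin by (simp only:)
    qed
  qed
  also have "\<dots> = Re (X * (LINT \<eta>|lborel. I \<eta> * U \<eta>))"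
    unfolding integral_mult_right_zero[symmetric] using Iint by (intro integral_Re integrable_mult_right)
  also have "\<dots> \<le> norm (X * (LINT \<eta>|lborel. I \<eta> * U \<eta>))" by (rule complex_Re_le_cmod)
  also have "\<dots> = norm (LINT \<eta>|lborel. I \<eta> * U \<eta>)" by (simp add: norm_mult nX)
  finally have lower: "a * profile_mass R / 4 \<le> norm (LINT \<eta>|lborel. I \<eta> * U \<eta>)" .
  have "profile_mass R * N0 > 0" using N0 R1 by (simp add: mult.commute)
  then have mu: "profile_mass R > 0" using TN by (simp add: zero_less_mult_iff)
  have "T * \<bar>\<xi>\<bar> \<le> 2 * N0" using x R1 xneg by simp
  then have "T / (2 * N0) \<le> 1 / \<bar>\<xi>\<bar>" using xneg TN by (simp add: field_simps)
  then have "b / (4 * pi) * (T / (2 * N0)) * (a * profile_mass R / 4) \<le> b / (4 * pi) * (1 / \<bar>\<xi>\<bar>) * norm (LINT \<eta>|lborel. I \<eta> * U \<eta>)"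
    using lower ab mu T0 TN by (intro mult_mono mult_left_mono) auto
  moreover have "b / (4 * pi) * (T / (2 * N0)) * (a * profile_mass R / 4) = a * b * profile_mass R / (32 * pi * N0) * T"
    by (simp add: mult_ac)
  moreover have "b / (4 * pi) * (1 / \<bar>\<xi>\<bar>) = b / (4 * pi * \<bar>\<xi>\<bar>)" by simp
  ultimately show ?thesis unfolding R by simp
qed

end

end

section \<open>Divergence of the profile mass\<close>

lemma sin4_period: "(LINT y:{real k * pi..real (Suc k) * pi}|lborel. (sin y) ^ 4) = 3 * pi / 8"
proof -
  define F where "F y = 3 * y / 8 - sin (2 * y) / 4 + sin (4 * y) / 32" for y :: real
  have d: "(F has_vector_derivative (sin y) ^ 4) (at y within S)" for y S
  proof -
    have "(F has_real_derivative 3 / 8 - cos (2 * y) / 2 + cos (4 * y) / 8) (at y within S)"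
      unfolding F_def[abs_def] by (auto intro!: derivative_eq_intros)
    also have "3 / 8 - cos (2 * y) / 2 + cos (4 * y) / 8 = (sin y) ^ 4"
    proof -
      have c2: "cos (2 * y) = 1 - 2 * (sin y)\<^sup>2" by (rule cos_double_sin)
      have c4: "cos (4 * y) = 2 * (1 - 2 * (sin y)\<^sup>2)\<^sup>2 - 1" using cos_double_cos[of "2 * y"] unfolding c2 by simp
      show ?thesis unfolding c2 c4 by (simp add: power2_eq_square power4_eq_xxxx field_simps)
    qed
    finally show ?thesis by (simp add: has_real_derivative_iff_has_vector_derivative)
  qed
  have "(LINT y:{real k * pi..real (Suc k) * pi}|lborel. (sin y) ^ 4) = F (real (Suc k) * pi) - F (real k * pi)"
    unfolding set_lebesgue_integral_def
    by (rule integral_FTC_Icc[OF _ d]) (auto intro!: continuous_intros)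
  also have "\<dots> = 3 * pi / 8"
  proof -
    have s: "sin (2 * (real j * pi)) = 0" "sin (4 * (real j * pi)) = 0" for j
      using sin_npi[of "2 * j"] sin_npi[of "4 * j"] by (simp_all add: mult.assoc)
    show ?thesis unfolding F_def s by (simp add: algebra_simps)
  qed
  finally show ?thesis .
qed

lemma prof_integrable: "R \<ge> 1 \<Longrightarrow> set_integrable lborel {1..R} (\<lambda>y::real. (sin y) ^ 4 / y)"
  by (rule borel_integrable_atLeastAtMost') (auto intro!: continuous_intros)

text \<open>On this period 1 / y is at least 1 / ((k + 1) pi), and (sin y)^4 has the integral 3 pi /
  8.\<close>

lemma profile_mass_step: "profile_mass (real (Suc k) * pi) \<ge> profile_mass (real k * pi) + 3 / 8 / real (Suc k)" if k: "k \<ge> 1" for k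
proof -
  have pi1: "1 \<le> real k * pi" using k pi_gt3 mult_mono[of 1 "real k" 1 pi] by simp
  have kk: "real k * pi \<le> real (Suc k) * pi" by (intro mult_right_mono) auto
  let ?f = "\<lambda>y::real. (sin y) ^ 4 / y"
  have g: "indicat_real {1..\<alpha>} y *\<^sub>R c + indicat_real {\<alpha>..\<beta>} y *\<^sub>R c = indicat_real {1..\<beta>} y *\<^sub>R c" if "y \<noteq> \<alpha>" "1 \<le> \<alpha>" "\<alpha> \<le> \<beta>" for \<alpha> \<beta> y c :: real
    using that by (auto simp: indicator_def)
  have i: "set_integrable lborel {1..real (Suc k) * pi} ?f" using pi1 kk by (intro prof_integrable) linarith
  have i1: "set_integrable lborel {1..real k * pi} ?f" using pi1 by (intro prof_integrable)
  have i2: "set_integrable lborel {real k * pi..real (Suc k) * pi} ?f"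
    by (rule set_integrable_subset[OF i]) (use pi1 in auto)
  have i3: "set_integrable lborel {real k * pi..real (Suc k) * pi} (\<lambda>y. (sin y) ^ 4 / (real (Suc k) * pi))"
    by (rule borel_integrable_atLeastAtMost') (auto intro!: continuous_intros)
  have "3 / 8 / real (Suc k) = (LINT y:{real k * pi..real (Suc k) * pi}|lborel. (sin y) ^ 4) / (real (Suc k) * pi)"
    unfolding sin4_period by simp
  also have "\<dots> = (LINT y:{real k * pi..real (Suc k) * pi}|lborel. (sin y) ^ 4 / (real (Suc k) * pi))"
    by (rule set_integral_divide_zero[symmetric])
  also have "\<dots> \<le> (LINT y:{real k * pi..real (Suc k) * pi}|lborel. ?f y)"
  proof (rule set_integral_mono[OF i3 i2])
    fix y assume y: "y \<in> {real k * pi..real (Suc k) * pi}"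
    then have "0 < y" using pi1 by simp
    then show "(sin y) ^ 4 / (real (Suc k) * pi) \<le> ?f y" using y by (intro divide_left_mono) auto
  qed
  finally have a: "3 / 8 / real (Suc k) \<le> (LINT y:{real k * pi..real (Suc k) * pi}|lborel. ?f y)" .
  have "(LINT y|lborel. indicat_real {1..real k * pi} y *\<^sub>R ?f y) + (LINT y|lborel. indicat_real {real k * pi..real (Suc k) * pi} y *\<^sub>R ?f y)
     = (LINT y|lborel. indicat_real {1..real k * pi} y *\<^sub>R ?f y + indicat_real {real k * pi..real (Suc k) * pi} y *\<^sub>R ?f y)"
    using i1 i2 unfolding set_integrable_def by simp
  also have "\<dots> = (LINT y|lborel. indicat_real {1..real (Suc k) * pi} y *\<^sub>R ?f y)"
  proof (rule integral_cong_AE)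
    have "AE y in lborel. y \<noteq> real k * pi" by (rule AE_lborel_singleton)
    then show "AE y in lborel. indicat_real {1..real k * pi} y *\<^sub>R ?f y + indicat_real {real k * pi..real (Suc k) * pi} y *\<^sub>R ?f y = indicat_real {1..real (Suc k) * pi} y *\<^sub>R ?f y"
      by eventually_elim (rule g[OF _ pi1 kk])
  qed measurable
  finally have b: "profile_mass (real k * pi) + (LINT y:{real k * pi..real (Suc k) * pi}|lborel. ?f y) = profile_mass (real (Suc k) * pi)"
    unfolding profile_mass_def set_lebesgue_integral_def by simp
  show ?thesis using a b by linarith
qed

text \<open>Comparison with the harmonic series. The induction starts at R = pi with the trivial
  bound 0, which accounts for the 1 subtracted from the harmonic number.\<close>

lemma profile_mass_unbounded: "\<exists>R\<ge>1. profile_mass R \<ge> K"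
proof -
  have nn: "profile_mass R \<ge> 0" for R unfolding profile_mass_def
    by (intro integral_nonneg_AE AE_I2) (auto simp: indicator_def)
  have h: "profile_mass (real (Suc n) * pi) \<ge> 3 / 8 * (harm (Suc n) - 1)" for n
  proof (induction n)
    case 0
    have "harm (Suc 0) = (1 :: real)" by (simp add: harm_Suc harm_expand(1))
    then show ?case using nn[of "real (Suc 0) * pi"] by (simp only: diff_self mult_zero_right)
  next
    case (Suc n)
    have ring: "3 / 8 * (h + 1 / r - 1) = 3 / 8 * (h - 1) + 3 / 8 / r" for h r :: real by (simp add: algebra_simps diff_divide_distrib)
    have "harm (Suc (Suc n)) = harm (Suc n) + 1 / real (Suc (Suc n))" by (subst harm_Suc) (simp only: inverse_eq_divide)
    then have "3 / 8 * (harm (Suc (Suc n)) - 1) = 3 / 8 * (harm (Suc n) - 1) + 3 / 8 / real (Suc (Suc n))"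
      by (simp only: ring)
    then show ?case using Suc profile_mass_step[of "Suc n"] by linarith
  qed
  obtain n :: nat where n: "real n \<ge> exp (8 / 3 * K + 1)" using real_arch_simple by blast
  have "exp (8 / 3 * K + 1) \<le> real (Suc n) + 1" using n by simp
  then have "8 / 3 * K + 1 \<le> ln (real (Suc n) + 1)"
    using ln_ge_iff[of "real (Suc n) + 1" "8 / 3 * K + 1"] by linarith
  also have "\<dots> \<le> harm (Suc n)" by (rule ln_le_harm)
  finally have "3 / 8 * (harm (Suc n) - 1) \<ge> K" by simp
  moreover have "1 \<le> real (Suc n) * pi" using pi_gt3 mult_mono[of 1 "real (Suc n)" 1 pi] by simp
  ultimately show ?thesis using h[of n] by (intro exI[of _ "real (Suc n) * pi"]) linarith
qed

section \<open>Sizes of the perturbation and of the field at the final time\<close>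

context dkg_prof
begin

lemma mass_pos: "profile_mass R > 0" "N0 > 0"
proof -
  show n: "N0 > 0" using N0 R1 by simp
  have "profile_mass R * N0 > 0" using N0 R1 by (simp add: mult.commute)
  then show "profile_mass R > 0" using n by (simp add: zero_less_mult_iff)
qed

text \<open>On the support the weight is at most 1 / \<xi>, and the square of \<open>u\<close> is
  \<open>u\<close> times \<open>a * (sin (T * \<xi>))\<^sup>2\<close>. The squared norm is thereby
  bounded by the integral that also governs the interaction.\<close>

lemma U_norm: "integrable lborel (\<lambda>\<xi>. japanese \<xi> powr (2 * (- 1/2)) * (norm (U \<xi>))\<^sup>2)"
  "(LINT \<xi>|lborel. japanese \<xi> powr (2 * (- 1/2)) * (norm (U \<xi>))\<^sup>2) \<le> a\<^sup>2 * profile_mass R"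
proof -
  let ?g = "\<lambda>\<eta>. a * (u \<eta> * ((sin (T * \<eta>))\<^sup>2 / \<eta>))"
  have gi: "integrable lborel ?g" using u_mass(1) by (rule integrable_mult_right)
  have b: "japanese \<xi> powr (2 * (- 1/2)) * (norm (U \<xi>))\<^sup>2 \<le> ?g \<xi>" for \<xi>
  proof (cases "T * \<xi> \<in> {1..R}")
    case False
    then show ?thesis by (simp add: U_eq u_def)
  next
    case True
    then have "0 < T * \<xi>" by simp
    then have x: "\<xi> > 0" using T0 by (simp add: zero_less_mult_iff)
    have "\<xi> \<le> japanese \<xi>" unfolding japanese_def by (simp add: real_le_rsqrt)
    then have "inverse (japanese \<xi>) \<le> inverse \<xi>" using x by (intro le_imp_inverse_le) auto
    moreover have "japanese \<xi> powr (2 * (- 1/2)) = inverse (japanese \<xi>)"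
      using japanese_ge_1[of \<xi>] by (simp add: powr_minus)
    ultimately have "japanese \<xi> powr (2 * (- 1/2)) * (norm (U \<xi>))\<^sup>2 \<le> inverse \<xi> * (u \<xi>)\<^sup>2"
      unfolding U_u by (simp add: mult_right_mono)
    also have "\<dots> = ?g \<xi>" using True by (simp add: u_def power2_eq_square divide_inverse mult_ac)
    finally show ?thesis .
  qed
  show i: "integrable lborel (\<lambda>\<xi>. japanese \<xi> powr (2 * (- 1/2)) * (norm (U \<xi>))\<^sup>2)"
  proof (rule Bochner_Integration.integrable_bound[OF gi])
    show "(\<lambda>\<xi>. japanese \<xi> powr (2 * (- 1/2)) * (norm (U \<xi>))\<^sup>2) \<in> borel_measurable lborel" by measurable
    show "AE \<xi> in lborel. norm (japanese \<xi> powr (2 * (- 1/2)) * (norm (U \<xi>))\<^sup>2) \<le> norm (?g \<xi>)"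
      using b by (intro AE_I2, unfold real_norm_def, subst abs_of_nonneg, simp) (rule order_trans[OF b abs_ge_self])
  qed
  have "(LINT \<xi>|lborel. japanese \<xi> powr (2 * (- 1/2)) * (norm (U \<xi>))\<^sup>2) \<le> integral\<^sup>L lborel ?g"
    by (rule integral_mono[OF i gi b])
  also have "\<dots> = a\<^sup>2 * profile_mass R" unfolding integral_mult_right_zero u_mass(2) by (simp add: power2_eq_square)
  finally show "(LINT \<xi>|lborel. japanese \<xi> powr (2 * (- 1/2)) * (norm (U \<xi>))\<^sup>2) \<le> a\<^sup>2 * profile_mass R" .
qed

text \<open>The support has length \<open>l * N0\<close> and the weight there is at most
  \<open>1 / (l * N0)\<close>; the two cancel.\<close>

lemma V_norm: "integrable lborel (\<lambda>\<xi>. japanese \<xi> powr (2 * (- 1/2)) * (norm (V \<xi>))\<^sup>2)"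
  "(LINT \<xi>|lborel. japanese \<xi> powr (2 * (- 1/2)) * (norm (V \<xi>))\<^sup>2) \<le> b\<^sup>2"
proof -
  let ?g = "\<lambda>\<eta>. b\<^sup>2 / (l * N0) * indicat_real {l * N0..l * (2 * N0)} \<eta>"
  have gi: "integrable lborel ?g" by (intro integrable_mult_right integrable_real_indicator) (auto simp: emeasure_lborel_Icc_eq)
  have b: "japanese \<xi> powr (2 * (- 1/2)) * (norm (V \<xi>))\<^sup>2 \<le> ?g \<xi>" for \<xi>
  proof (cases "T * \<xi> \<in> {N0..2 * N0}")
    case False
    then have "V \<xi> = 0" by (simp add: V_eq)
    moreover have "0 \<le> ?g \<xi>" using l0 mass_pos by (intro mult_nonneg_nonneg divide_nonneg_nonneg) auto
    ultimately show ?thesis by (simp only: norm_zero power_zero_numeral mult_zero_right)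
  next
    case True
    have e: "l * (T * \<xi>) = \<xi>" using Tl(2) by (simp flip: mult.assoc)
    have "l * N0 \<le> l * (T * \<xi>)" "l * (T * \<xi>) \<le> l * (2 * N0)" using True l0 by (auto intro!: mult_left_mono)
    then have x: "l * N0 \<le> \<xi>" "\<xi> \<le> l * (2 * N0)" unfolding e by simp_all
    have lN: "l * N0 > 0" using l0 mass_pos by simp
    have "\<xi> \<le> japanese \<xi>" unfolding japanese_def by (simp add: real_le_rsqrt)
    then have "inverse (japanese \<xi>) \<le> inverse (l * N0)" using x lN by (intro le_imp_inverse_le) auto
    moreover have "japanese \<xi> powr (2 * (- 1/2)) = inverse (japanese \<xi>)"
      using japanese_ge_1[of \<xi>] by (simp add: powr_minus)
    moreover have "norm (V \<xi>) = b" using True ab by (simp add: V_eq)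
    ultimately have "japanese \<xi> powr (2 * (- 1/2)) * (norm (V \<xi>))\<^sup>2 \<le> inverse (l * N0) * b\<^sup>2"
      by (simp only:) (intro mult_right_mono; simp)
    moreover have "?g \<xi> = inverse (l * N0) * b\<^sup>2" using x by (simp add: divide_inverse)
    ultimately show ?thesis by (simp only:)
  qed
  show i: "integrable lborel (\<lambda>\<xi>. japanese \<xi> powr (2 * (- 1/2)) * (norm (V \<xi>))\<^sup>2)"
  proof (rule Bochner_Integration.integrable_bound[OF gi])
    show "(\<lambda>\<xi>. japanese \<xi> powr (2 * (- 1/2)) * (norm (V \<xi>))\<^sup>2) \<in> borel_measurable lborel" by measurable
    show "AE \<xi> in lborel. norm (japanese \<xi> powr (2 * (- 1/2)) * (norm (V \<xi>))\<^sup>2) \<le> norm (?g \<xi>)"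
      using b by (intro AE_I2, unfold real_norm_def, subst abs_of_nonneg, simp) (rule order_trans[OF b abs_ge_self])
  qed
  have "(LINT \<xi>|lborel. japanese \<xi> powr (2 * (- 1/2)) * (norm (V \<xi>))\<^sup>2) \<le> integral\<^sup>L lborel ?g"
    by (rule integral_mono[OF i gi b])
  also have "\<dots> = b\<^sup>2 / (l * N0) * (l * N0)" unfolding integral_mult_right_zero using l0 mass_pos by simp
  also have "\<dots> = b\<^sup>2" using l0 mass_pos by simp
  finally show "(LINT \<xi>|lborel. japanese \<xi> powr (2 * (- 1/2)) * (norm (V \<xi>))\<^sup>2) \<le> b\<^sup>2" .
qed

text \<open>On the window the free field vanishes by \<open>supp\<close>, and by the bound on
  \<open>T * K4\<close> at least half of the resonant response survives all errors. There the field
  is of size \<open>T\<close>, while the weight and the length of the window are each of size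
  \<open>l\<close>, so the result does not depend on \<open>l\<close>.\<close>

lemma inflation:
  assumes supp: "\<And>\<xi>. \<bar>\<xi>\<bar> \<ge> l * N0 \<Longrightarrow> q0 \<xi> = 0 \<and> q1 \<xi> = 0"
    and K: "T * K4 \<le> a * b * profile_mass R / (32 * pi * N0) / 2"
  shows "Hs_norm (1/2) (dist_of (\<lambda>x. of_real (\<phi> T x))) \<ge> a * b * profile_mass R / (128 * pi)"
proof -
  define c0 where "c0 = a * b * profile_mass R / (32 * pi * N0)"
  have c0: "c0 > 0" unfolding c0_def using ab mass_pos by simp
  have TT: "T \<in> {0..T}" using T0 by simp
  have NR: "N0 \<ge> 2 * R" "R \<ge> 1" using N0 R1 by auto
  \<comment> \<open>The window of \<open>wave_response_lower\<close>, rescaled to the original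
    frequencies.\<close>
  define E where "E = {- (l * (2 * N0 - R))..- (l * N0)}"
  have le: "- (l * (2 * N0 - R)) \<le> - (l * N0)" using l0 NR by (simp add: mult_left_mono)
  have qb: "norm (q T \<xi>) \<ge> c0 * T / 2" if "\<xi> \<in> E" for \<xi>
  proof -
    have e: "T * (l * z) = z" for z using Tl(1) by (simp flip: mult.assoc)
    have xE: "l * N0 \<le> - \<xi>" "- \<xi> \<le> l * (2 * N0 - R)" using that unfolding E_def by auto
    have "T * (l * N0) \<le> T * (- \<xi>)" "T * (- \<xi>) \<le> T * (l * (2 * N0 - R))"
      by (rule mult_left_mono[OF xE(1) less_imp_le[OF T0(1)]], rule mult_left_mono[OF xE(2) less_imp_le[OF T0(1)]])
    then have x: "N0 \<le> - (T * \<xi>)" "- (T * \<xi>) \<le> 2 * N0 - R" unfolding e by simp_all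
    have neg: "\<xi> \<noteq> 0" using x mass_pos by auto
    have "l * N0 \<le> \<bar>\<xi>\<bar>" using that unfolding E_def by auto
    then have ql: "free_field T \<xi> = 0" using supp[of \<xi>] unfolding free_field_def by simp
    have "norm (q T \<xi> - wave_response T \<xi>) \<le> T\<^sup>2 * K4 * wt l \<xi>" using field_expansion[OF neg] unfolding ql by simp
    also have "\<dots> \<le> T\<^sup>2 * K4 * 1"
      using K3_nonneg kappa_nonneg by (intro mult_left_mono wt_le_1) (simp add: K4_def)
    also have "\<dots> = T * (T * K4)" by (simp add: power2_eq_square)
    also have "\<dots> \<le> T * (c0 / 2)" using K T0 unfolding c0_def by (intro mult_left_mono) auto
    finally have 1: "norm (q T \<xi> - wave_response T \<xi>) \<le> c0 * T / 2" by (simp add: mult.commute)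
    have 2: "c0 * T \<le> norm (wave_response T \<xi>)" unfolding c0_def by (rule wave_response_lower[OF x])
    have "norm (wave_response T \<xi>) \<le> norm (q T \<xi> - wave_response T \<xi>) + norm (q T \<xi>)"
      using norm_triangle_ineq4[of "q T \<xi>" "q T \<xi> - wave_response T \<xi>"] by simp
    then show ?thesis using 1 2 by linarith
  qed
  let ?h = "\<lambda>\<xi>. japanese \<xi> powr (2 * (1/2)) * (norm (q T \<xi>))\<^sup>2"
  let ?g = "\<lambda>\<xi>. l * N0 * (c0 * T / 2)\<^sup>2 * indicat_real E \<xi>"
  have gi: "integrable lborel ?g" unfolding E_def by (intro integrable_mult_right integrable_real_indicator) (auto simp: emeasure_lborel_Icc_eq)
  have hi: "integrable lborel ?h" by (rule weighted_decay(1)[OF half_bounds(1) q_meas q_decay[OF TT]])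
  have gh: "?g \<xi> \<le> ?h \<xi>" for \<xi>
  proof (cases "\<xi> \<in> E")
    case True
    have "l * N0 \<le> \<bar>\<xi>\<bar>" using True unfolding E_def by auto
    also have "\<bar>\<xi>\<bar> \<le> japanese \<xi>" unfolding japanese_def by (simp add: real_le_rsqrt)
    also have "japanese \<xi> = japanese \<xi> powr (2 * (1/2))" using japanese_ge_1[of \<xi>] by simp
    finally have "l * N0 * (c0 * T / 2)\<^sup>2 \<le> ?h \<xi>"
      using c0 T0 l0 mass_pos by (intro mult_mono power_mono qb True) auto
    then show ?thesis using True by simp
  qed simp
  have "integral\<^sup>L lborel ?g = l * N0 * (c0 * T / 2)\<^sup>2 * (l * (N0 - R))"
    unfolding integral_mult_right_zero E_def using le by (simp add: algebra_simps)
  also have "\<dots> = (T * l)\<^sup>2 * (N0 * (N0 - R) * c0\<^sup>2 / 4)" by (simp add: power2_eq_square)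
  also have "\<dots> = N0 * (N0 - R) * c0\<^sup>2 / 4" unfolding Tl by simp
  \<comment> \<open>From \<open>N0 \<ge> 2 * R\<close> even N0 / 2 would do in place of
    \<open>N0 - R\<close>; a quarter makes the bound a perfect square.\<close>
  also have "\<dots> \<ge> N0 * (N0 / 4) * c0\<^sup>2 / 4"
    using NR mass_pos by (intro divide_right_mono mult_right_mono mult_left_mono) auto
  finally have "(N0 * c0 / 4)\<^sup>2 \<le> integral\<^sup>L lborel ?g" by (simp add: power2_eq_square mult_ac)
  also have "\<dots> \<le> integral\<^sup>L lborel ?h" by (rule integral_mono[OF gi hi gh])
  finally have "sqrt ((N0 * c0 / 4)\<^sup>2) \<le> sqrt (integral\<^sup>L lborel ?h)" by (rule real_sqrt_le_mono)
  then have "N0 * c0 / 4 \<le> Hs_norm (1/2) (dist_of (\<lambda>x. of_real (\<phi> T x)))"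
    unfolding Hs_norm_eq[OF half_bounds(1) q_transform[OF TT half_bounds(1)]] using c0 mass_pos by simp
  moreover have "N0 * c0 / 4 = a * b * profile_mass R / (128 * pi)" unfolding c0_def using mass_pos by simp
  ultimately show ?thesis by simp
qed

end

section \<open>Approximation of the data\<close>

lemma Hs_transform_cong_AE:
  assumes g: "Hs_transform s T g" and m: "g' \<in> borel_measurable lborel" and ae: "AE \<xi> in lborel. g \<xi> = g' \<xi>"
  shows "Hs_transform s T g'"
  unfolding Hs_transform_def
proof (intro conjI allI impI m)
  have gm: "g \<in> borel_measurable lborel" by (rule Hs_transform_measurable[OF g])
  have gi: "integrable lborel (\<lambda>\<xi>. japanese \<xi> powr (2 * s) * (norm (g \<xi>))\<^sup>2)" using g by (simp add: Hs_transform_def)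
  show "integrable lborel (\<lambda>\<xi>. japanese \<xi> powr (2 * s) * (norm (g' \<xi>))\<^sup>2)"
  proof (rule integrable_cong_AE_imp[OF gi])
    show "(\<lambda>\<xi>. japanese \<xi> powr (2 * s) * (norm (g' \<xi>))\<^sup>2) \<in> borel_measurable lborel" using m by measurable
    show "AE \<xi> in lborel. japanese \<xi> powr (2 * s) * (norm (g \<xi>))\<^sup>2 = japanese \<xi> powr (2 * s) * (norm (g' \<xi>))\<^sup>2"
      using ae by eventually_elim simp
  qed
  fix f assume f: "schwartz f"
  have fm: "f \<in> borel_measurable lborel" using schwartz_measurable[OF f] by simp
  have "dist_fourier T f = dist_of g f" using g f by (simp add: Hs_transform_def)
  also have "\<dots> = dist_of g' f"
    unfolding dist_of_def
  proof (rule Bochner_Integration.integral_cong_AE)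
    show "(\<lambda>x. g x * f x) \<in> borel_measurable lborel" "(\<lambda>x. g' x * f x) \<in> borel_measurable lborel"
      using gm m fm by measurable
    show "AE x in lborel. g x * f x = g' x * f x" using ae by eventually_elim simp
  qed
  finally show "dist_fourier T f = dist_of g' f" .
qed

text \<open>Truncation in frequency and in height gives a bounded transform of compact support. Both
  conditions depend only on absolute values, so Hermitian symmetry is preserved.\<close>

definition cut :: "(real \<Rightarrow> complex) \<Rightarrow> nat \<Rightarrow> real \<Rightarrow> complex" where
  "cut g n \<xi> = (if \<bar>\<xi>\<bar> \<le> real n \<and> norm (g \<xi>) \<le> real n then g \<xi> else 0)"

text \<open>At each frequency the error is bounded by \<open>g\<close> itself and vanishes from some
  \<open>n\<close> on, so dominated convergence applies.\<close>

lemma cut_approx: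
  fixes g :: "real \<Rightarrow> complex"
  assumes gm: "g \<in> borel_measurable borel"
    and gi: "integrable lborel (\<lambda>\<xi>. japanese \<xi> powr (2 * s) * (norm (g \<xi>))\<^sup>2)" and e: "e > 0"
  shows "\<exists>n. (LINT \<xi>|lborel. japanese \<xi> powr (2 * s) * (norm (cut g n \<xi> - g \<xi>))\<^sup>2) \<le> e"
proof -
  define d where "d n \<xi> = japanese \<xi> powr (2 * s) * (norm (cut g n \<xi> - g \<xi>))\<^sup>2" for n \<xi>
  have cm: "cut g n \<in> borel_measurable borel" for n unfolding cut_def[abs_def] using gm by measurable
  have dm: "d n \<in> borel_measurable lborel" for n unfolding d_def[abs_def] using cm[of n] gm by measurable
  have le: "norm (cut g n \<xi> - g \<xi>) \<le> norm (g \<xi>)" for n \<xi> by (simp add: cut_def)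
  have db: "norm (d n \<xi>) \<le> japanese \<xi> powr (2 * s) * (norm (g \<xi>))\<^sup>2" for n \<xi>
  proof -
    have "0 \<le> d n \<xi>" unfolding d_def by simp
    moreover have "d n \<xi> \<le> japanese \<xi> powr (2 * s) * (norm (g \<xi>))\<^sup>2"
      unfolding d_def by (intro mult_left_mono power_mono le norm_ge_zero powr_ge_zero)
    ultimately show ?thesis by simp
  qed
  have dl: "(\<lambda>n. d n \<xi>) \<longlonglongrightarrow> 0" for \<xi>
  proof (rule tendsto_eventually)
    obtain N where N: "\<bar>\<xi>\<bar> + norm (g \<xi>) \<le> real N" using real_arch_simple[of "\<bar>\<xi>\<bar> + norm (g \<xi>)"] by (elim exE)
    have "d n \<xi> = 0" if "n \<ge> N" for n
    proof -
      have nN: "real N \<le> real n" using that by simp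
      have "\<bar>\<xi>\<bar> \<le> real n" using N nN norm_ge_zero[of "g \<xi>"] by linarith
      moreover have "norm (g \<xi>) \<le> real n" using N nN abs_ge_zero[of \<xi>] by linarith
      ultimately show ?thesis by (simp add: cut_def d_def)
    qed
    then show "eventually (\<lambda>n. d n \<xi> = 0) sequentially" by (rule eventually_sequentiallyI)
  qed
  have "(\<lambda>n. integral\<^sup>L lborel (d n)) \<longlonglongrightarrow> integral\<^sup>L lborel (\<lambda>\<xi>::real. 0::real)"
  proof (rule integral_dominated_convergence)
    show "(\<lambda>\<xi>::real. 0::real) \<in> borel_measurable lborel" by simp
    show "d n \<in> borel_measurable lborel" for n by (rule dm)
    show "integrable lborel (\<lambda>\<xi>. japanese \<xi> powr (2 * s) * (norm (g \<xi>))\<^sup>2)" by (rule gi)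
    show "AE \<xi> in lborel. (\<lambda>n. d n \<xi>) \<longlonglongrightarrow> 0" using dl by (intro AE_I2)
    show "AE \<xi> in lborel. norm (d n \<xi>) \<le> japanese \<xi> powr (2 * s) * (norm (g \<xi>))\<^sup>2" for n using db by (intro AE_I2)
  qed
  then have "(\<lambda>n. integral\<^sup>L lborel (d n)) \<longlonglongrightarrow> 0" unfolding Bochner_Integration.integral_zero .
  then have "\<forall>\<^sub>F n in sequentially. integral\<^sup>L lborel (d n) < e" using e by (rule order_tendstoD(2))
  then obtain n where "integral\<^sup>L lborel (d n) < e" unfolding eventually_sequentially by (meson order_refl)
  then have "integral\<^sup>L lborel (d n) \<le> e" by (rule less_imp_le)
  then show ?thesis unfolding d_def[abs_def] by (rule exI)
qed

text \<open>One parameter bounds both height and support, so that finitely many truncations share a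
  common \<rho>.\<close>

definition band_limited :: "real \<Rightarrow> (real \<Rightarrow> complex) \<Rightarrow> bool" where
  "band_limited \<rho> h \<longleftrightarrow> h \<in> borel_measurable borel \<and> (\<forall>\<xi>. norm (h \<xi>) \<le> \<rho> * indicator {-\<rho>..\<rho>} \<xi>)"

lemma band_limited_mono:
  assumes "band_limited \<rho> h" "0 \<le> \<rho>" "\<rho> \<le> \<rho>'"
  shows "band_limited \<rho>' h"
proof -
  have "\<rho> * indicator {-\<rho>..\<rho>} \<xi> \<le> \<rho>' * indicator {-\<rho>'..\<rho>'} \<xi>" for \<xi>
    using assms by (auto simp: indicator_def)
  then show ?thesis using assms(1) unfolding band_limited_def by (meson order_trans)
qed

lemma band_limited_cut: "g \<in> borel_measurable borel \<Longrightarrow> band_limited (real n) (cut g n)"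
proof -
  assume [measurable]: "g \<in> borel_measurable borel"
  have "cut g n \<in> borel_measurable borel" unfolding cut_def[abs_def] by measurable
  then show ?thesis unfolding band_limited_def by (auto simp: cut_def indicator_def)
qed

lemma band_limited_approx:
  assumes "in_Hs s T" and e: "e > 0"
  shows "\<exists>g h \<rho>. Hs_transform s T g \<and> \<rho> \<ge> 0 \<and> band_limited \<rho> h \<and> (LINT \<xi>|lborel. japanese \<xi> powr (2 * s) * (norm (h \<xi> - g \<xi>))\<^sup>2) \<le> e"
proof -
  obtain g where g: "Hs_transform s T g" using assms by (auto simp: in_Hs_def)
  have gm: "g \<in> borel_measurable borel" using Hs_transform_measurable[OF g] by simp
  have gi: "integrable lborel (\<lambda>\<xi>. japanese \<xi> powr (2 * s) * (norm (g \<xi>))\<^sup>2)" using g by (simp add: Hs_transform_def)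
  obtain n where "(LINT \<xi>|lborel. japanese \<xi> powr (2 * s) * (norm (cut g n \<xi> - g \<xi>))\<^sup>2) \<le> e"
    using cut_approx[OF gm gi e] by blast
  then show ?thesis using g band_limited_cut[OF gm, of n] by (intro exI[of _ g] exI[of _ "cut g n"] exI[of _ "real n"]) simp
qed

text \<open>The transform of a real-valued distribution is Hermitian only almost everywhere, whereas
  \<open>dkg_sol\<close> needs the symmetry at every point. The symmetrised \<open>k\<close> agrees
  with \<open>g\<close> almost everywhere and is Hermitian throughout.\<close>

lemma band_limited_approx_real:
  assumes s: "\<bar>s\<bar> \<le> 1/2" and T: "in_Hs s T" and r: "real_valued T" and e: "e > 0"
  shows "\<exists>g h \<rho>. Hs_transform s T g \<and> \<rho> \<ge> 0 \<and> band_limited \<rho> h \<and> (\<forall>\<xi>. h (- \<xi>) = cnj (h \<xi>)) \<and> (LINT \<xi>|lborel. japanese \<xi> powr (2 * s) * (norm (h \<xi> - g \<xi>))\<^sup>2) \<le> e"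
proof -
  obtain g where g: "Hs_transform s T g" and t: "tempered T" using T by (auto simp: in_Hs_def)
  have gm[measurable]: "g \<in> borel_measurable borel" using Hs_transform_measurable[OF g] by simp
  define k where "k \<xi> = (g \<xi> + cnj (g (- \<xi>))) / 2" for \<xi>
  have km: "k \<in> borel_measurable borel" unfolding k_def[abs_def] by measurable
  have ae: "AE \<xi> in lborel. g \<xi> = k \<xi>"
    using Hs_transform_real[OF s t r g] by eventually_elim (simp add: k_def)
  have kt: "Hs_transform s T k" by (rule Hs_transform_cong_AE[OF g _ ae]) (use km in simp)
  have ki: "integrable lborel (\<lambda>\<xi>. japanese \<xi> powr (2 * s) * (norm (k \<xi>))\<^sup>2)" using kt by (simp add: Hs_transform_def)
  have ks: "k (- \<xi>) = cnj (k \<xi>)" for \<xi> by (simp add: k_def add.commute)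
  obtain n where n: "(LINT \<xi>|lborel. japanese \<xi> powr (2 * s) * (norm (cut k n \<xi> - k \<xi>))\<^sup>2) \<le> e"
    using cut_approx[OF km ki e] by blast
  have "cut k n (- \<xi>) = cnj (cut k n \<xi>)" for \<xi> by (simp add: cut_def ks)
  then show ?thesis using kt band_limited_cut[OF km, of n] n by (intro exI[of _ k] exI[of _ "cut k n"] exI[of _ "real n"]) simp
qed

lemma band_limited_weight_integrable:
  assumes "\<rho> \<ge> 0"
  shows "integrable lborel (\<lambda>\<eta>. c * (\<rho> * indicator {-\<rho>..\<rho>} \<eta>) * (1 + \<eta>\<^sup>2)\<^sup>2 :: real)"
proof -
  have "set_integrable lborel {-\<rho>..\<rho>} (\<lambda>\<eta>. c * \<rho> * (1 + \<eta>\<^sup>2)\<^sup>2)"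
    by (rule borel_integrable_atLeastAtMost') (intro continuous_intros)
  then show ?thesis unfolding set_integrable_def by (simp add: mult_ac)
qed

lemma band_limited_sum_integrable:
  assumes h: "band_limited \<rho> h" and k: "band_limited \<rho> k" and r: "\<rho> \<ge> 0"
  shows "integrable lborel (\<lambda>\<eta>. (norm (h \<eta>) + norm (k \<eta>)) * (1 + \<eta>\<^sup>2)\<^sup>2)"
proof (rule Bochner_Integration.integrable_bound[OF band_limited_weight_integrable[OF r, of 2]])
  have hm: "h \<in> borel_measurable borel" and km: "k \<in> borel_measurable borel" using h k unfolding band_limited_def by simp_all
  show "(\<lambda>\<eta>. (norm (h \<eta>) + norm (k \<eta>)) * (1 + \<eta>\<^sup>2)\<^sup>2) \<in> borel_measurable lborel"
    using hm km by measurable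
  show "AE \<eta> in lborel. norm ((norm (h \<eta>) + norm (k \<eta>)) * (1 + \<eta>\<^sup>2)\<^sup>2) \<le> norm (2 * (\<rho> * indicator {-\<rho>..\<rho>} \<eta>) * (1 + \<eta>\<^sup>2)\<^sup>2)"
  proof (intro AE_I2)
    fix \<eta> :: real
    have 1: "norm (h \<eta>) + norm (k \<eta>) \<le> 2 * (\<rho> * indicator {-\<rho>..\<rho>} \<eta>)"
      using h k unfolding band_limited_def by (metis add_mono mult_2)
    then have "(norm (h \<eta>) + norm (k \<eta>)) * (1 + \<eta>\<^sup>2)\<^sup>2 \<le> 2 * (\<rho> * indicator {-\<rho>..\<rho>} \<eta>) * (1 + \<eta>\<^sup>2)\<^sup>2"
      by (intro mult_right_mono) auto
    then show "norm ((norm (h \<eta>) + norm (k \<eta>)) * (1 + \<eta>\<^sup>2)\<^sup>2) \<le> norm (2 * (\<rho> * indicator {-\<rho>..\<rho>} \<eta>) * (1 + \<eta>\<^sup>2)\<^sup>2)"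
      unfolding real_norm_def by (subst abs_of_nonneg) (auto intro: order_trans[OF _ abs_ge_self])
  qed
qed

lemma band_limited_decay:
  assumes h: "band_limited \<rho> h" and k: "band_limited \<rho> k" and r: "\<rho> \<ge> 0"
  shows "(1 + \<xi>\<^sup>2) * (norm (h \<xi>) + norm (k \<xi>)) \<le> (2 * \<rho> * (1 + \<rho>\<^sup>2)\<^sup>2) * e2 \<xi>"
proof -
  have p: "0 < 1 + \<xi>\<^sup>2" by (rule one_plus_sq_pos)
  have 1: "norm (h \<xi>) + norm (k \<xi>) \<le> 2 * (\<rho> * indicator {-\<rho>..\<rho>} \<xi>)"
    using h k unfolding band_limited_def by (metis add_mono mult_2)
  have "(norm (h \<xi>) + norm (k \<xi>)) * (1 + \<xi>\<^sup>2)\<^sup>2 \<le> 2 * \<rho> * (1 + \<rho>\<^sup>2)\<^sup>2"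
  proof (cases "\<xi> \<in> {-\<rho>..\<rho>}")
    case True
    then have "\<bar>\<xi>\<bar> \<le> \<bar>\<rho>\<bar>" using r by auto
    then have "\<xi>\<^sup>2 \<le> \<rho>\<^sup>2" by (simp add: abs_le_square_iff)
    then have "(1 + \<xi>\<^sup>2)\<^sup>2 \<le> (1 + \<rho>\<^sup>2)\<^sup>2" by (intro power_mono) auto
    then show ?thesis using 1 True r by (intro mult_mono) auto
  next
    case False
    then have "norm (h \<xi>) + norm (k \<xi>) \<le> 0" using 1 by simp
    then have "norm (h \<xi>) + norm (k \<xi>) = 0" using norm_ge_zero[of "h \<xi>"] norm_ge_zero[of "k \<xi>"] by linarith
    then show ?thesis using r by simp
  qed
  then have "(1 + \<xi>\<^sup>2) * (norm (h \<xi>) + norm (k \<xi>)) * (1 + \<xi>\<^sup>2) \<le> 2 * \<rho> * (1 + \<rho>\<^sup>2)\<^sup>2"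
    by (simp add: power2_eq_square mult_ac)
  then show ?thesis using p by (simp add: field_simps)
qed

text \<open>Once \<open>l\<close> exceeds the band the weight is at least 1/4 there, so the
  truncated data lie in the weighted class with a constant free of \<open>l\<close>.\<close>

lemma band_limited_wt:
  assumes h: "band_limited \<rho> h" and r: "0 \<le> \<rho>" "\<rho> \<le> l" and l: "l > 0"
  shows "norm (h \<xi>) \<le> 4 * \<rho> * wt l \<xi>"
proof (cases "\<xi> \<in> {-\<rho>..\<rho>}")
  case True
  then have "\<bar>\<xi> / l\<bar> \<le> 1" using r l by (auto simp: divide_le_eq)
  then have "(\<xi> / l)\<^sup>2 \<le> 1" by (simp only: abs_square_le_1)
  then have "(1 + (\<xi> / l)\<^sup>2)\<^sup>2 \<le> (1 + 1)\<^sup>2" by (intro power_mono) auto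
  moreover have "0 < (1 + (\<xi> / l)\<^sup>2)\<^sup>2" by (intro zero_less_power one_plus_sq_pos)
  ultimately have "1 \<le> 4 * wt l \<xi>" unfolding wt_def by (simp add: field_simps)
  then have "\<rho> * 1 \<le> \<rho> * (4 * wt l \<xi>)" using r by (intro mult_left_mono)
  moreover have "norm (h \<xi>) \<le> \<rho> * 1" using h True unfolding band_limited_def by (metis indicator_simps(1))
  ultimately show ?thesis by simp
next
  case False
  then have "norm (h \<xi>) \<le> 0" using h unfolding band_limited_def by (metis indicator_simps(2) mult_zero_right)
  also have "0 \<le> 4 * \<rho> * wt l \<xi>" using r wt_nonneg by simp
  finally show ?thesis .
qed

lemma wt_support:
  assumes l: "l > 0" and x: "\<bar>1 / l * \<xi>\<bar> \<le> c"
  shows "1 \<le> (1 + c\<^sup>2)\<^sup>2 * wt l \<xi>"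
proof -
  have "(\<xi> / l)\<^sup>2 = \<bar>1 / l * \<xi>\<bar>\<^sup>2" unfolding power2_abs by simp
  then have "(\<xi> / l)\<^sup>2 \<le> c\<^sup>2" using power_mono[OF x abs_ge_zero, of 2] by (simp only:)
  then have "(1 + (\<xi> / l)\<^sup>2)\<^sup>2 \<le> (1 + c\<^sup>2)\<^sup>2" by (intro power_mono) auto
  moreover have "0 < (1 + (\<xi> / l)\<^sup>2)\<^sup>2" by (intro zero_less_power one_plus_sq_pos)
  ultimately show ?thesis unfolding wt_def by (simp add: field_simps)
qed

text \<open>A pointwise inequality between squares stands in for the triangle inequality of the
  weighted norm; three terms, each with a factor 3, give 9.\<close>

lemma weighted_triangle3:
  fixes f g h k :: "real \<Rightarrow> complex"
  assumes fi: "integrable lborel (\<lambda>\<xi>. w \<xi> * (norm (f \<xi>))\<^sup>2)"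
    and gi: "integrable lborel (\<lambda>\<xi>. w \<xi> * (norm (g \<xi>))\<^sup>2)" and hi: "integrable lborel (\<lambda>\<xi>. w \<xi> * (norm (h \<xi>))\<^sup>2)" and ki: "integrable lborel (\<lambda>\<xi>. w \<xi> * (norm (k \<xi>))\<^sup>2)"
    and w: "\<And>\<xi>. w \<xi> \<ge> (0::real)" and le: "\<And>\<xi>. norm (f \<xi>) \<le> norm (g \<xi>) + norm (h \<xi>) / 2 + norm (k \<xi>) / 2"
    and b: "(LINT \<xi>|lborel. w \<xi> * (norm (g \<xi>))\<^sup>2) \<le> c" "(LINT \<xi>|lborel. w \<xi> * (norm (h \<xi>))\<^sup>2) \<le> c" "(LINT \<xi>|lborel. w \<xi> * (norm (k \<xi>))\<^sup>2) \<le> c"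
  shows "(LINT \<xi>|lborel. w \<xi> * (norm (f \<xi>))\<^sup>2) \<le> 9 * c"
proof -
  have sq: "(x + y / 2 + z / 2)\<^sup>2 \<le> 3 * (x\<^sup>2 + y\<^sup>2 + z\<^sup>2)" for x y z :: real
  proof -
    have "3 * (x\<^sup>2 + y\<^sup>2 + z\<^sup>2) - (x + y / 2 + z / 2)\<^sup>2 = (x - y)\<^sup>2 / 2 + (x - z)\<^sup>2 / 2 + (y - z)\<^sup>2 / 4 + x\<^sup>2 + 2 * y\<^sup>2 + 2 * z\<^sup>2"
      by (simp add: power2_eq_square field_simps)
    also have "\<dots> \<ge> 0" by (intro add_nonneg_nonneg) simp_all
    finally show ?thesis by simp
  qed
  have "(LINT \<xi>|lborel. w \<xi> * (norm (f \<xi>))\<^sup>2) \<le> (LINT \<xi>|lborel. 3 * (w \<xi> * (norm (g \<xi>))\<^sup>2 + w \<xi> * (norm (h \<xi>))\<^sup>2 + w \<xi> * (norm (k \<xi>))\<^sup>2))"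
  proof (rule integral_mono[OF fi])
    show "integrable lborel (\<lambda>\<xi>. 3 * (w \<xi> * (norm (g \<xi>))\<^sup>2 + w \<xi> * (norm (h \<xi>))\<^sup>2 + w \<xi> * (norm (k \<xi>))\<^sup>2))"
      by (intro integrable_mult_right Bochner_Integration.integrable_add gi hi ki)
    fix \<xi>
    have "(norm (f \<xi>))\<^sup>2 \<le> (norm (g \<xi>) + norm (h \<xi>) / 2 + norm (k \<xi>) / 2)\<^sup>2" by (intro power_mono le) simp
    also have "\<dots> \<le> 3 * ((norm (g \<xi>))\<^sup>2 + (norm (h \<xi>))\<^sup>2 + (norm (k \<xi>))\<^sup>2)" by (rule sq)
    finally have "w \<xi> * (norm (f \<xi>))\<^sup>2 \<le> w \<xi> * (3 * ((norm (g \<xi>))\<^sup>2 + (norm (h \<xi>))\<^sup>2 + (norm (k \<xi>))\<^sup>2))" by (intro mult_left_mono w)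
    then show "w \<xi> * (norm (f \<xi>))\<^sup>2 \<le> 3 * (w \<xi> * (norm (g \<xi>))\<^sup>2 + w \<xi> * (norm (h \<xi>))\<^sup>2 + w \<xi> * (norm (k \<xi>))\<^sup>2)"
      by (simp add: algebra_simps)
  qed
  also have "\<dots> = 3 * ((LINT \<xi>|lborel. w \<xi> * (norm (g \<xi>))\<^sup>2) + (LINT \<xi>|lborel. w \<xi> * (norm (h \<xi>))\<^sup>2) + (LINT \<xi>|lborel. w \<xi> * (norm (k \<xi>))\<^sup>2))"
    unfolding integral_mult_right_zero
      Bochner_Integration.integral_add[OF Bochner_Integration.integrable_add[OF gi hi] ki] Bochner_Integration.integral_add[OF gi hi] ..
  also have "\<dots> \<le> 9 * c" using add_mono[OF add_mono[OF b(1) b(2)] b(3)] by simp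
  finally show ?thesis .
qed

section \<open>Choice of the parameters and conclusion\<close>

lemma profile_choice:
  assumes e: "e > 0" and \<epsilon>: "\<epsilon> > 0"
  shows "\<exists>R a b N0. R \<ge> 1 \<and> a > 0 \<and> b > 0 \<and> N0 \<ge> 2 * R \<and> N0 * profile_mass R \<ge> 2 * R \<and>
    a\<^sup>2 * profile_mass R \<le> e\<^sup>2 \<and> b\<^sup>2 \<le> e\<^sup>2 \<and> a * b * profile_mass R / (128 * pi) > inverse \<epsilon>"
proof -
  \<comment> \<open>Chosen so that \<open>e\<^sup>2 * (K - 1) / (128 * pi)\<close> equals
    \<open>inverse \<epsilon>\<close>; the additional 1 makes the final inequality strict.\<close>
  define K where "K = 128 * pi / (e\<^sup>2 * \<epsilon>) + 1"
  have K: "K > 1" unfolding K_def using e \<epsilon> by simp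
  obtain R where R: "R \<ge> 1" "profile_mass R \<ge> K\<^sup>2" using profile_mass_unbounded by blast
  define \<mu> where "\<mu> = profile_mass R"
  have s: "sqrt \<mu> \<ge> K" unfolding \<mu>_def by (rule real_le_rsqrt[OF R(2)])
  have sp: "sqrt \<mu> > 0" using s K by linarith
  then have mp: "\<mu> > 0" by simp
  have sq: "sqrt \<mu> * sqrt \<mu> = \<mu>" using mp by simp
  have "(e / sqrt \<mu>)\<^sup>2 * \<mu> = e\<^sup>2" using mp by (simp add: power_divide)
  moreover have "2 * R \<le> 2 * R + 2 * R / \<mu>" using R mp by simp
  moreover have "2 * R \<le> (2 * R + 2 * R / \<mu>) * \<mu>" using R mp by (simp add: distrib_right)
  moreover have "inverse \<epsilon> < e / sqrt \<mu> * e * \<mu> / (128 * pi)"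
  proof -
    have i: "inverse \<epsilon> = e\<^sup>2 * (K - 1) / (128 * pi)" unfolding K_def using e \<epsilon> by (simp add: field_simps)
    have "e\<^sup>2 * (K - 1) < e\<^sup>2 * sqrt \<mu>" using s e by (intro mult_strict_left_mono) auto
    also have "e\<^sup>2 * sqrt \<mu> = e / sqrt \<mu> * e * (sqrt \<mu> * sqrt \<mu>)"
    proof -
      have "e\<^sup>2 * z = e / z * e * (z * z)" if "z > 0" for z using that by (simp add: power2_eq_square)
      then show ?thesis using sp .
    qed
    also have "\<dots> = e / sqrt \<mu> * e * \<mu>" unfolding sq ..
    finally show ?thesis unfolding i by (intro divide_strict_right_mono) auto
  qed
  moreover have "e / sqrt \<mu> > 0" using e sp by simp
  \<comment> \<open>The witness for \<open>N0\<close> is the sum of the two lower bounds imposed on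
    it.\<close>
  ultimately show ?thesis using R e unfolding \<mu>_def
    by (intro exI[of _ R] exI[of _ "e / sqrt (profile_mass R)"] exI[of _ e] exI[of _ "2 * R + 2 * R / profile_mass R"] conjI) simp_all
qed

text \<open>Assembles the construction for data already truncated at \<rho>. All constants are named
  before \<open>l\<close>, and none of them involves it; \<open>l\<close> is then taken large
  against each, so there is no circularity.\<close>

lemma inflating_solution:
  fixes \<beta> :: "2 \<Rightarrow> real \<Rightarrow> complex"
  assumes e: "e > 0" and \<epsilon>: "\<epsilon> > 0" and \<rho>: "\<rho> \<ge> 0" and \<beta>: "\<And>k. band_limited \<rho> (\<beta> k)" and h0: "band_limited \<rho> q0" and h1: "band_limited \<rho> q1"
    and s0: "\<And>\<xi>. q0 (- \<xi>) = cnj (q0 \<xi>)" and s1: "\<And>\<xi>. q1 (- \<xi>) = cnj (q1 \<xi>)"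
  shows "\<exists>\<psi> \<phi> \<phi>t T U V. 0 < T \<and> T < \<epsilon> \<and> dkg_solution m M T \<psi> \<phi> \<phi>t \<and>
    (\<forall>j. Hs_transform (- 1/2) (dist_of2 (\<psi> 0) $ j) (\<lambda>\<xi>. \<beta> j \<xi> + (U \<xi> + spinor_sign j * V \<xi>) / 2)) \<and>
    Hs_transform (1/2) (dist_of (\<lambda>x. of_real (\<phi> 0 x))) q0 \<and> Hs_transform (- 1/2) (\<phi>t 0) q1 \<and>
    integrable lborel (\<lambda>\<xi>. japanese \<xi> powr (2 * (- 1/2)) * (norm (U \<xi>))\<^sup>2) \<and>
    (LINT \<xi>|lborel. japanese \<xi> powr (2 * (- 1/2)) * (norm (U \<xi>))\<^sup>2) \<le> e\<^sup>2 \<and>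
    integrable lborel (\<lambda>\<xi>. japanese \<xi> powr (2 * (- 1/2)) * (norm (V \<xi>))\<^sup>2) \<and>
    (LINT \<xi>|lborel. japanese \<xi> powr (2 * (- 1/2)) * (norm (V \<xi>))\<^sup>2) \<le> e\<^sup>2 \<and>
    Hs_norm (1/2) (dist_of (\<lambda>x. of_real (\<phi> T x))) > inverse \<epsilon>"
proof -
  obtain R a b N0 where R1: "R \<ge> 1" and ab: "a > 0" "b > 0" and N0: "N0 \<ge> 2 * R" "N0 * profile_mass R \<ge> 2 * R"
    and ae: "a\<^sup>2 * profile_mass R \<le> e\<^sup>2" and background: "b\<^sup>2 \<le> e\<^sup>2" and big: "a * b * profile_mass R / (128 * pi) > inverse \<epsilon>"
    using profile_choice[OF e \<epsilon>] by blast
  have N02: "N0 \<ge> 2" using N0 R1 by linarith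
  \<comment> \<open>The profiles live where \<open>\<bar>\<xi>\<bar> \<le> 2 * N0 * l\<close>; on
    that set the weight is bounded below independently of \<open>l\<close>. The term
    \<open>4 * \<rho>\<close> comes from \<open>band_limited_wt\<close>.\<close>
  define A0 where "A0 = (a + b) * (1 + (2 * N0)\<^sup>2)\<^sup>2 + 4 * \<rho>"
  define lb where "lb \<xi> = \<rho> * indicat_real {-\<rho>..\<rho>} \<xi>" for \<xi>
  define A where "A = 8 * A0"
  define \<kappa> where "\<kappa> = 16 * wmass"
  define L where "L = (LINT \<eta>|lborel. (norm (q0 \<eta>) + norm (q1 \<eta>)) * (1 + \<eta>\<^sup>2)\<^sup>2)"
  define K4 where "K4 = 2 * \<kappa> * (A * (16 * L + \<kappa>\<^sup>2 * A\<^sup>2) + 4 * \<bar>m\<bar> * A0) * A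
    + 32 * A * (LINT \<eta>|lborel. 4 * lb \<eta> * (1 + \<eta>\<^sup>2)\<^sup>2) + \<bar>M\<bar> * \<kappa> * A\<^sup>2"
  define c0 where "c0 = a * b * profile_mass R / (32 * pi * N0)"
  define S where "S = 16 * L + 3 * \<kappa>\<^sup>2 * A\<^sup>2"
  \<comment> \<open>The summands ensure, in this order, \<open>\<rho> < l\<close>, the smallness
    needed for the contraction, an expansion error below half of the main term, and
    \<open>1 / l < \<epsilon>\<close>.\<close>
  define l where "l = 1 + \<rho> + \<bar>2 * S\<bar> + \<bar>2 * K4 / c0\<bar> + 2 / \<epsilon>"
  have e0: "2 / \<epsilon> > 0" using \<epsilon> by simp
  have l: "l \<ge> 1" "l > 0" "\<rho> \<le> l" "\<rho> < l" "2 * S \<le> l" "2 * K4 / c0 \<le> l" "2 / \<epsilon> \<le> l"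
    unfolding l_def using \<rho> e0 by linarith+
  define U where "U \<xi> = complex_of_real (a * (sin (1 / l * \<xi>))\<^sup>2 * indicator {1..R} (1 / l * \<xi>))" for \<xi>
  define V where "V \<xi> = complex_of_real (b * indicator {N0..2 * N0} (1 / l * \<xi>))" for \<xi>
  define p0 where "p0 k \<xi> = \<beta> k \<xi> + (U \<xi> + spinor_sign k * V \<xi>) / 2" for k \<xi>
  have Um: "U \<in> borel_measurable borel" unfolding U_def[abs_def] by measurable
  have Vm: "V \<in> borel_measurable borel" unfolding V_def[abs_def] by measurable
  have \<beta>m: "\<beta> k \<in> borel_measurable borel" for k using \<beta>[of k] by (simp add: band_limited_def)
  have p0m: "p0 k \<in> borel_measurable borel" for k unfolding p0_def[abs_def] using Um Vm \<beta>m[of k] by measurable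
  have q0m: "q0 \<in> borel_measurable borel" and q1m: "q1 \<in> borel_measurable borel" using h0 h1 by (simp_all add: band_limited_def)
  define D where "D = (1 + (2 * N0)\<^sup>2)\<^sup>2"
  have Dn: "D \<ge> 0" unfolding D_def by simp
  have A0D: "A0 = (a + b) * D + 4 * \<rho>" unfolding A0_def D_def ..
  have Ub': "norm (U \<xi>) \<le> a * (D * wt l \<xi>)" for \<xi>
  proof (cases "1 / l * \<xi> \<in> {1..R}")
    case True
    then have "\<bar>1 / l * \<xi>\<bar> \<le> 2 * N0" using N0 R1 by (simp only: atLeastAtMost_iff) linarith
    then have "1 \<le> D * wt l \<xi>" unfolding D_def by (rule wt_support[OF l(2)])
    then have "a * 1 \<le> a * (D * wt l \<xi>)" using ab by (intro mult_left_mono) auto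
    moreover have "norm (U \<xi>) \<le> a * 1"
    proof -
      have "norm (U \<xi>) = a * (sin (1 / l * \<xi>))\<^sup>2" unfolding U_def norm_of_real using True ab by simp
      then show ?thesis using ab by (simp add: abs_square_le_1)
    qed
    ultimately show ?thesis by linarith
  next
    case False
    then have "U \<xi> = 0" unfolding U_def by simp
    then show ?thesis using ab Dn wt_nonneg[of l \<xi>] by simp
  qed
  have Vb': "norm (V \<xi>) \<le> b * (D * wt l \<xi>)" for \<xi>
  proof (cases "1 / l * \<xi> \<in> {N0..2 * N0}")
    case True
    then have "\<bar>1 / l * \<xi>\<bar> \<le> 2 * N0" using N02 by (simp only: atLeastAtMost_iff) linarith
    then have "1 \<le> D * wt l \<xi>" unfolding D_def by (rule wt_support[OF l(2)])
    then have "b * 1 \<le> b * (D * wt l \<xi>)" using ab by (intro mult_left_mono) auto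
    moreover have "norm (V \<xi>) = b" unfolding V_def using True ab by simp
    ultimately show ?thesis by linarith
  next
    case False
    then have "V \<xi> = 0" unfolding V_def by simp
    then show ?thesis using ab Dn wt_nonneg[of l \<xi>] by simp
  qed
  have nn: "0 \<le> a * (D * wt l \<xi>)" "0 \<le> b * (D * wt l \<xi>)" "0 \<le> 4 * \<rho> * wt l \<xi>" for \<xi>
    using ab Dn wt_nonneg[of l \<xi>] \<rho> by simp_all
  have split: "A0 * wt l \<xi> = a * (D * wt l \<xi>) + b * (D * wt l \<xi>) + 4 * \<rho> * wt l \<xi>" for \<xi>
    unfolding A0D by (simp add: algebra_simps)
  have Ub: "norm (U \<xi>) \<le> A0 * wt l \<xi>" and Vb: "norm (V \<xi>) \<le> A0 * wt l \<xi>" for \<xi>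
    using Ub'[of \<xi>] Vb'[of \<xi>] nn[of \<xi>] unfolding split by linarith+
  have nsg: "norm (spinor_sign k * z) = norm z" for k z by (simp add: spinor_sign_def)
  have p0b: "norm (p0 k \<xi>) \<le> A0 * wt l \<xi>" for k \<xi>
  proof -
    have "norm (p0 k \<xi>) \<le> norm (\<beta> k \<xi>) + norm ((U \<xi> + spinor_sign k * V \<xi>) / 2)" unfolding p0_def by (rule norm_triangle_ineq)
    moreover have "norm ((U \<xi> + spinor_sign k * V \<xi>) / 2) = norm (U \<xi> + spinor_sign k * V \<xi>) / 2" by (simp add: norm_divide)
    moreover have "norm (U \<xi> + spinor_sign k * V \<xi>) \<le> norm (U \<xi>) + norm (V \<xi>)" using norm_triangle_ineq[of "U \<xi>" "spinor_sign k * V \<xi>"] unfolding nsg .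
    moreover have "norm (\<beta> k \<xi>) \<le> 4 * \<rho> * wt l \<xi>" by (rule band_limited_wt[OF \<beta> \<rho> l(3) l(2)])
    ultimately show ?thesis using Ub'[of \<xi>] Vb'[of \<xi>] nn[of \<xi>] unfolding split by linarith
  qed
  have Li: "integrable lborel (\<lambda>\<eta>. (norm (q0 \<eta>) + norm (q1 \<eta>)) * (1 + \<eta>\<^sup>2)\<^sup>2)" by (rule band_limited_sum_integrable[OF h0 h1 \<rho>])
  have small: "S / l \<le> 1/2" using l by (simp add: divide_le_eq)
  interpret D: dkg_data m M l A0 p0 q0 q1
    using l(1) p0m q0m q1m p0b Li small[unfolded S_def L_def \<kappa>_def A_def] by (rule dkg_data.intro)
  obtain p where pa: "D.admissible D.A p" and pG: "\<And>j t \<xi>. t \<in> {0..D.T} \<Longrightarrow> p j t \<xi> = D.G p j t \<xi>"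
    using D.fixed_point by blast
  interpret S: dkg_sol m M l A0 p0 q0 q1 p "2 * \<rho> * (1 + \<rho>\<^sup>2)\<^sup>2"
    by (rule dkg_sol.intro[OF D.dkg_data_axioms dkg_sol_axioms.intro[OF pa pG band_limited_decay[OF h0 h1 \<rho>] s0 s1]])
  have \<beta>b: "norm (\<beta> k \<xi>) \<le> lb \<xi>" for k \<xi> using \<beta>[of k] unfolding band_limited_def lb_def by blast
  have lbs: "lb (- \<xi>) = lb \<xi>" for \<xi> unfolding lb_def by (auto simp: indicator_def)
  have lbi: "integrable lborel (\<lambda>\<eta>. 4 * lb \<eta> * (1 + \<eta>\<^sup>2)\<^sup>2)" unfolding lb_def by (rule band_limited_weight_integrable[OF \<rho>])
  interpret I: dkg_inf m M l A0 p0 q0 q1 p "2 * \<rho> * (1 + \<rho>\<^sup>2)\<^sup>2" \<beta> U V lb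
    by (rule dkg_inf.intro[OF S.dkg_sol_axioms dkg_inf_axioms.intro[OF Um Vm \<beta>m p0_def \<beta>b lbs lbi Ub Vb]])
  have DT: "D.T = 1 / l" by (rule D.T_def)
  interpret P: dkg_prof m M l A0 p0 q0 q1 p "2 * \<rho> * (1 + \<rho>\<^sup>2)\<^sup>2" \<beta> U V lb a b R N0
    by (rule dkg_prof.intro[OF I.dkg_inf_axioms dkg_prof_axioms.intro[OF ab R1 N0]]) (simp_all only: DT U_def V_def)
  have c0: "c0 > 0" unfolding c0_def using ab P.mass_pos by simp
  \<comment> \<open>The constant of the locale, which is instantiated with \<open>l\<close>,
    coincides with the one fixed before \<open>l\<close> was chosen.\<close>
  have K4: "I.K4 = K4"
    unfolding I.K4_def I.K3_def I.Ke_def I.Lb_def D.K1_def D.L_def D.\<kappa>_def D.A_def K4_def A_def \<kappa>_def L_def ..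
  have TK: "D.T * I.K4 \<le> c0 / 2"
  proof -
    have "2 * K4 \<le> l * c0" using l(6) c0 by (simp add: divide_le_eq)
    then show ?thesis unfolding K4 DT using l(2) by (simp add: divide_le_eq mult.commute)
  qed
  \<comment> \<open>The observed frequencies start at \<open>l * N0\<close>, beyond the band of the
    data because \<open>\<rho> < l\<close> and \<open>N0 \<ge> 1\<close>.\<close>
  have supp: "q0 \<xi> = 0 \<and> q1 \<xi> = 0" if "\<bar>\<xi>\<bar> \<ge> l * N0" for \<xi>
  proof -
    have "l * 1 \<le> l * N0" by (rule mult_left_mono) (use N02 l(2) in auto)
    then have "\<rho> < \<bar>\<xi>\<bar>" using that l(4) by linarith
    then have "\<xi> \<notin> {-\<rho>..\<rho>}" by auto
    then have "\<rho> * indicator {-\<rho>..\<rho>} \<xi> = 0" by simp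
    then have "norm (q0 \<xi>) \<le> 0" "norm (q1 \<xi>) \<le> 0" using h0 h1 unfolding band_limited_def by metis+
    then show ?thesis by simp
  qed
  have inf: "a * b * profile_mass R / (128 * pi) \<le> Hs_norm (1/2) (dist_of (\<lambda>x. of_real (S.\<phi> D.T x)))"
    by (rule P.inflation[OF supp TK[unfolded c0_def]])
  have z: "0 \<in> {0..D.T}" using D.T0 by simp
  have "D.T < \<epsilon>"
  proof -
    have "1 / \<epsilon> < 2 / \<epsilon>" using \<epsilon> by (simp add: divide_strict_right_mono)
    then have "1 / \<epsilon> < l" using l(7) by linarith
    then show ?thesis unfolding DT using \<epsilon> l(2) by (simp add: field_simps)
  qed
  moreover have "\<forall>j. Hs_transform (- 1/2) (dist_of2 (S.\<psi> 0) $ j) (\<lambda>\<xi>. \<beta> j \<xi> + (U \<xi> + spinor_sign j * V \<xi>) / 2)"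
    using S.p_transform[OF z half_bounds(2)] unfolding S.initial(1)[abs_def] p0_def[abs_def] by (rule allI)
  moreover have "Hs_transform (1/2) (dist_of (\<lambda>x. of_real (S.\<phi> 0 x))) q0"
    using S.q_transform[OF z half_bounds(1)] unfolding S.initial(2)[abs_def] .
  moreover have "Hs_transform (- 1/2) (S.\<phi>t 0) q1"
    using S.qt_transform[OF z half_bounds(2)] unfolding S.initial(3)[abs_def] .
  ultimately show ?thesis
    using D.T0(1) S.solution P.U_norm(1) order_trans[OF P.U_norm(2) ae] P.V_norm(1) order_trans[OF P.V_norm(2) background] order_less_le_trans[OF big inf]
    by (intro exI[of _ S.\<psi>] exI[of _ S.\<phi>] exI[of _ S.\<phi>t] exI[of _ D.T] exI[of _ U] exI[of _ V] conjI) assumption+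
qed

lemma band_limited_weighted:
  assumes "\<bar>s\<bar> \<le> 1/2" and h: "band_limited \<rho> h" and r: "\<rho> \<ge> 0"
  shows "integrable lborel (\<lambda>\<xi>. japanese \<xi> powr (2 * s) * (norm (h \<xi>))\<^sup>2)"
proof (rule weighted_decay(1)[OF assms(1)])
  show "h \<in> borel_measurable borel" using h by (simp add: band_limited_def)
  fix \<xi>
  have "norm (h \<xi>) \<le> 1 * (norm (h \<xi>) + norm (h \<xi>))" by simp
  also have "\<dots> \<le> (1 + \<xi>\<^sup>2) * (norm (h \<xi>) + norm (h \<xi>))" by (intro mult_right_mono) auto
  also have "\<dots> \<le> (2 * \<rho> * (1 + \<rho>\<^sup>2)\<^sup>2) * e2 \<xi>" by (rule band_limited_decay[OF h h r])
  finally show "norm (h \<xi>) \<le> (2 * \<rho> * (1 + \<rho>\<^sup>2)\<^sup>2) * (1 / (1 + \<xi>\<^sup>2))" .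
qed

lemma Hs_norm_diff_le:
  assumes s: "\<bar>s\<bar> \<le> 1/2" and h: "Hs_transform s S h" and g: "Hs_transform s T g" and e: "e \<ge> 0"
    and le: "(LINT \<xi>|lborel. japanese \<xi> powr (2 * s) * (norm (h \<xi> - g \<xi>))\<^sup>2) \<le> e\<^sup>2"
  shows "Hs_norm s (dist_diff S T) \<le> e"
proof -
  have "Hs_norm s (dist_diff S T) = sqrt (LINT \<xi>|lborel. japanese \<xi> powr (2 * s) * (norm (h \<xi> - g \<xi>))\<^sup>2)"
    by (rule Hs_norm_eq[OF s Hs_transform_diff[OF s h g]])
  also have "\<dots> \<le> sqrt (e\<^sup>2)" by (rule real_sqrt_le_mono[OF le])
  finally show ?thesis using e by simp
qed

theorem theorem1p1:
  fixes m M \<epsilon> :: real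
    and \<psi>\<^sub>0 :: "dist ^ 2" and \<phi>\<^sub>0 \<phi>\<^sub>1 :: dist
  assumes "m \<ge> 0" and "M \<ge> 0"
    and "in_Hs2 (- 1/2) \<psi>\<^sub>0"
    and "in_Hs (1/2) \<phi>\<^sub>0" and "real_valued \<phi>\<^sub>0"
    and "in_Hs (- 1/2) \<phi>\<^sub>1" and "real_valued \<phi>\<^sub>1"
    and "\<epsilon> > 0"
  shows "\<exists>(\<psi> :: real \<Rightarrow> real \<Rightarrow> complex ^ 2) (\<phi> :: real \<Rightarrow> real \<Rightarrow> real) (\<phi>t :: real \<Rightarrow> dist) T t\<^sub>\<epsilon>.
    t\<^sub>\<epsilon> \<in> {0<..<\<epsilon>} \<and> t\<^sub>\<epsilon> \<le> T \<and> dkg_solution m M T \<psi> \<phi> \<phi>t \<and>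
    Hs_norm2 (- 1/2) (dist_diff2 (dist_of2 (\<psi> 0)) \<psi>\<^sub>0)
      + Hs_norm (1/2) (dist_diff (dist_of (\<lambda>x. of_real (\<phi> 0 x))) \<phi>\<^sub>0)
      + Hs_norm (- 1/2) (dist_diff (\<phi>t 0) \<phi>\<^sub>1) < \<epsilon> \<and>
    Hs_norm (1/2) (dist_of (\<lambda>x. of_real (\<phi> t\<^sub>\<epsilon> x))) > inverse \<epsilon>"
proof -
  \<comment> \<open>The spinor part of the distance will be at most \<open>5 * e\<close> and each
    field part at most \<open>e\<close>; the total 7 e is strictly below 8 e.\<close>
  define e where "e = \<epsilon> / 8"
  have e: "e > 0" "e\<^sup>2 > 0" "e \<ge> 0" using \<open>\<epsilon> > 0\<close> by (simp_all add: e_def)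
  have h: "\<bar>1/2\<bar> \<le> (1/2::real)" "\<bar>- 1/2\<bar> \<le> (1/2::real)" by simp_all
  have "\<forall>j. \<exists>g h \<rho>. Hs_transform (- 1/2) (\<psi>\<^sub>0 $ j) g \<and> \<rho> \<ge> 0 \<and> band_limited \<rho> h \<and> (LINT \<xi>|lborel. japanese \<xi> powr (2 * (- 1/2)) * (norm (h \<xi> - g \<xi>))\<^sup>2) \<le> e\<^sup>2"
    using assms(3) e(2) unfolding in_Hs2_def by (intro allI band_limited_approx) simp_all
  then obtain g \<beta> r where d: "\<forall>j. Hs_transform (- 1/2) (\<psi>\<^sub>0 $ j) (g j) \<and> r j \<ge> 0 \<and> band_limited (r j) (\<beta> j) \<and> (LINT \<xi>|lborel. japanese \<xi> powr (2 * (- 1/2)) * (norm (\<beta> j \<xi> - g j \<xi>))\<^sup>2) \<le> e\<^sup>2"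
    by (elim choice[THEN exE]) (rule that)
  have g: "Hs_transform (- 1/2) (\<psi>\<^sub>0 $ j) (g j)" and r: "r j \<ge> 0" and \<beta>: "band_limited (r j) (\<beta> j)"
    and gb: "(LINT \<xi>|lborel. japanese \<xi> powr (2 * (- 1/2)) * (norm (\<beta> j \<xi> - g j \<xi>))\<^sup>2) \<le> e\<^sup>2" for j
    using d by simp_all
  obtain g0 q0 r0 where g0: "Hs_transform (1/2) \<phi>\<^sub>0 g0" and r0: "r0 \<ge> 0" and q0: "band_limited r0 q0" "\<And>\<xi>. q0 (- \<xi>) = cnj (q0 \<xi>)"
    and b0: "(LINT \<xi>|lborel. japanese \<xi> powr (2 * (1/2)) * (norm (q0 \<xi> - g0 \<xi>))\<^sup>2) \<le> e\<^sup>2"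
    using band_limited_approx_real[OF h(1) assms(4,5) e(2)] by (elim exE conjE) (rule that; (assumption | erule spec))
  obtain g1 q1 r1 where g1: "Hs_transform (- 1/2) \<phi>\<^sub>1 g1" and r1: "r1 \<ge> 0" and q1: "band_limited r1 q1" "\<And>\<xi>. q1 (- \<xi>) = cnj (q1 \<xi>)"
    and b1: "(LINT \<xi>|lborel. japanese \<xi> powr (2 * (- 1/2)) * (norm (q1 \<xi> - g1 \<xi>))\<^sup>2) \<le> e\<^sup>2"
    using band_limited_approx_real[OF h(2) assms(6,7) e(2)] by (elim exE conjE) (rule that; (assumption | erule spec))
  \<comment> \<open>A common band for the two spinor components and the two field data.\<close>
  define \<rho> where "\<rho> = r 1 + r 2 + r0 + r1"
  have \<rho>: "\<rho> \<ge> 0" unfolding \<rho>_def using r[of 1] r[of 2] r0 r1 by linarith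
  have rj: "r j \<le> \<rho>" for j unfolding \<rho>_def using exhaust_2[of j] r[of 1] r[of 2] r0 r1 by auto
  have lows: "band_limited \<rho> (\<beta> j)" "band_limited \<rho> q0" "band_limited \<rho> q1" for j
  proof -
    show "band_limited \<rho> (\<beta> j)" by (rule band_limited_mono[OF \<beta> r rj])
    show "band_limited \<rho> q0" by (rule band_limited_mono[OF q0(1) r0]) (use r[of 1] r[of 2] r1 in \<open>simp add: \<rho>_def\<close>)
    show "band_limited \<rho> q1" by (rule band_limited_mono[OF q1(1) r1]) (use r[of 1] r[of 2] r0 in \<open>simp add: \<rho>_def\<close>)
  qed
  obtain \<psi> \<phi> \<phi>t T U V where T: "0 < T" "T < \<epsilon>" and sol: "dkg_solution m M T \<psi> \<phi> \<phi>t"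
    and tp: "\<And>j. Hs_transform (- 1/2) (dist_of2 (\<psi> 0) $ j) (\<lambda>\<xi>. \<beta> j \<xi> + (U \<xi> + spinor_sign j * V \<xi>) / 2)"
    and t0: "Hs_transform (1/2) (dist_of (\<lambda>x. of_real (\<phi> 0 x))) q0" and t1: "Hs_transform (- 1/2) (\<phi>t 0) q1"
    and Ui: "integrable lborel (\<lambda>\<xi>. japanese \<xi> powr (2 * (- 1/2)) * (norm (U \<xi>))\<^sup>2)"
    and Ub: "(LINT \<xi>|lborel. japanese \<xi> powr (2 * (- 1/2)) * (norm (U \<xi>))\<^sup>2) \<le> e\<^sup>2"
    and Vi: "integrable lborel (\<lambda>\<xi>. japanese \<xi> powr (2 * (- 1/2)) * (norm (V \<xi>))\<^sup>2)"
    and Vb: "(LINT \<xi>|lborel. japanese \<xi> powr (2 * (- 1/2)) * (norm (V \<xi>))\<^sup>2) \<le> e\<^sup>2"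
    and big: "Hs_norm (1/2) (dist_of (\<lambda>x. of_real (\<phi> T x))) > inverse \<epsilon>"
    using inflating_solution[where m = m and M = M and \<beta> = \<beta>, OF e(1) \<open>\<epsilon> > 0\<close> \<rho> lows q0(2) q1(2)] by (elim exE conjE) (rule that; (assumption | erule spec))
  have n1: "Hs_norm (- 1/2) (dist_diff2 (dist_of2 (\<psi> 0)) \<psi>\<^sub>0 $ j) \<le> 3 * e" for j
  proof -
    let ?f = "\<lambda>\<xi>. \<beta> j \<xi> + (U \<xi> + spinor_sign j * V \<xi>) / 2 - g j \<xi>"
    have fi: "integrable lborel (\<lambda>\<xi>. japanese \<xi> powr (2 * (- 1/2)) * (norm (?f \<xi>))\<^sup>2)"
      using Hs_transform_diff[OF h(2) tp[of j] g[of j]] unfolding Hs_transform_def by (elim conjE)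
    have bi: "integrable lborel (\<lambda>\<xi>. japanese \<xi> powr (2 * (- 1/2)) * (norm (\<beta> j \<xi> - g j \<xi>))\<^sup>2)"
    proof (rule weighted_diff_integrable)
      show "integrable lborel (\<lambda>\<xi>. japanese \<xi> powr (2 * (- 1/2)) * (norm (\<beta> j \<xi>))\<^sup>2)" by (rule band_limited_weighted[OF h(2) lows(1) \<rho>])
      show "integrable lborel (\<lambda>\<xi>. japanese \<xi> powr (2 * (- 1/2)) * (norm (g j \<xi>))\<^sup>2)"
        using g[of j] unfolding Hs_transform_def by (elim conjE)
      show "g j \<in> borel_measurable lborel" by (rule Hs_transform_measurable[OF g])
      show "\<beta> j \<in> borel_measurable lborel" using \<beta>[of j] by (simp add: band_limited_def)
    qed
    have le: "norm (?f \<xi>) \<le> norm (\<beta> j \<xi> - g j \<xi>) + norm (U \<xi>) / 2 + norm (V \<xi>) / 2" for \<xi>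
    proof -
      have n: "norm (spinor_sign j * V \<xi>) = norm (V \<xi>)" by (simp add: spinor_sign_def)
      have "?f \<xi> = (\<beta> j \<xi> - g j \<xi>) + (U \<xi> + spinor_sign j * V \<xi>) / 2" by (simp add: algebra_simps)
      then have "norm (?f \<xi>) \<le> norm (\<beta> j \<xi> - g j \<xi>) + norm ((U \<xi> + spinor_sign j * V \<xi>) / 2)" by (simp only: norm_triangle_ineq)
      moreover have "norm ((U \<xi> + spinor_sign j * V \<xi>) / 2) = norm (U \<xi> + spinor_sign j * V \<xi>) / 2" by (simp add: norm_divide)
      moreover have "norm (U \<xi> + spinor_sign j * V \<xi>) \<le> norm (U \<xi>) + norm (V \<xi>)" using norm_triangle_ineq[of "U \<xi>" "spinor_sign j * V \<xi>"] unfolding n .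
      ultimately show ?thesis by linarith
    qed
    have "(LINT \<xi>|lborel. japanese \<xi> powr (2 * (- 1/2)) * (norm (?f \<xi>))\<^sup>2) \<le> 9 * e\<^sup>2"
      by (rule weighted_triangle3[OF fi bi Ui Vi powr_ge_zero le gb Ub Vb])
    then have "(LINT \<xi>|lborel. japanese \<xi> powr (2 * (- 1/2)) * (norm (?f \<xi>))\<^sup>2) \<le> (3 * e)\<^sup>2" by (simp add: power_mult_distrib)
    then show ?thesis unfolding dist_diff2_def vec_lambda_beta
      by (intro Hs_norm_diff_le[OF h(2) tp g]) (use e(3) in simp)
  qed
  have "Hs_norm2 (- 1/2) (dist_diff2 (dist_of2 (\<psi> 0)) \<psi>\<^sub>0) \<le> 5 * e"
  proof -
    have "(Hs_norm (- 1/2) (dist_diff2 (dist_of2 (\<psi> 0)) \<psi>\<^sub>0 $ j))\<^sup>2 \<le> (3 * e)\<^sup>2" for j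
      by (intro power_mono n1 Hs_norm_nonneg)
    then have "(\<Sum>j\<in>UNIV. (Hs_norm (- 1/2) (dist_diff2 (dist_of2 (\<psi> 0)) \<psi>\<^sub>0 $ j))\<^sup>2) \<le> (3 * e)\<^sup>2 + (3 * e)\<^sup>2"
      unfolding sum_2 by (intro add_mono)
    \<comment> \<open>Two components of size 3 e each, and 18 is less than 25.\<close>
    also have "\<dots> \<le> (5 * e)\<^sup>2" using e by (simp add: power_mult_distrib)
    finally show ?thesis unfolding Hs_norm2_def using e by (intro real_le_lsqrt) auto
  qed
  moreover have "Hs_norm (1/2) (dist_diff (dist_of (\<lambda>x. of_real (\<phi> 0 x))) \<phi>\<^sub>0) \<le> e"
    by (rule Hs_norm_diff_le[OF h(1) t0 g0 e(3) b0])
  moreover have "Hs_norm (- 1/2) (dist_diff (\<phi>t 0) \<phi>\<^sub>1) \<le> e"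
    by (rule Hs_norm_diff_le[OF h(2) t1 g1 e(3) b1])
  moreover have "8 * e = \<epsilon>" by (simp add: e_def)
  ultimately have "Hs_norm2 (- 1/2) (dist_diff2 (dist_of2 (\<psi> 0)) \<psi>\<^sub>0)
      + Hs_norm (1/2) (dist_diff (dist_of (\<lambda>x. of_real (\<phi> 0 x))) \<phi>\<^sub>0)
      + Hs_norm (- 1/2) (dist_diff (\<phi>t 0) \<phi>\<^sub>1) < \<epsilon>" using e(1) by linarith
  \<comment> \<open>The endpoint \<open>T\<close> of the interval of existence also serves as the
    time of inflation.\<close>
  then show ?thesis using T sol big
    by (intro exI[of _ \<psi>] exI[of _ \<phi>] exI[of _ \<phi>t] exI[of _ T] conjI) (simp_all only: greaterThanLessThan_iff order_refl simp_thms)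
qed

end
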